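(* Let $N\ge 1$, $1\le m\le N$, $A\in\mathbb R^{N\times N}$, $B\in\mathbb R^{N\times m}$. Assume that $A$ is diagonalizable over $\mathbb R$ and that $(A,B)$ satisfies the Kalman rank condition with Kalman index $K$. Then the system $y_t+Ay_x=B\chi_{\mathcal O}u$ is exactly controllable in $\mathcal Y_K^+$ in the following sense. (i) Global case. Let $\mathcal O=\mathbb R$. There exists a constant $\widetilde C_*>0$, independent of $T$, such that for every $T>0$ and all real-valued $y_0,y_d\in\mathcal Y_K^+$ there exists $u\in L^2((0,T)\times\mathbb R;\mathbb R^m)$ such that the corresponding solution with $y(0,\cdot)=y_0$ satisfies $y(T,\cdot)=y_d$ and $$\|u\|_{L^2((0,T)\times\mathbb R;\mathbb R^m)}^2\le\widetilde C_*\max\{T^{-1},T^{-(2K+1)}\}\,\|y_d-S(T)y_0\|_{\mathcal Y_K^+}^2 .$$ (ii) Localized case. Assume in addition that $0\notin\sigma(A)$ and that $\mathcal O$ satisfies the bounded-gap condition (BG). Let $p=\#\sigma(A)$ and $T_1>T_{\rm geom}$. Then there exists a constant $\widetilde C_{\mathcal O,T_1}>0$ such that, for every $T\in(T_{\rm geom},T_1]$ and all real-valued $y_0,y_d\in\mathcal Y_K^+$, there exists $u\in L^2((0,T)\times\mathcal O;\mathbb R^m)$ such that the corresponding solution with $y(0,\cdot)=y_0$ satisfies $y(T,\cdot)=y_d$ and $$\|u\|_{L^2((0,T)\times\mathcal O;\mathbb R^m)}^2\le\frac{\widetilde C_{\mathcal O,T_1}}{(T-T_{\rm geom})^{2p-1}}\,\|y_d-S(T)y_0\|_{\mathcal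 Y_K^+}^2 .$$
   Context: Fourier convention: $\widehat f(\xi)=\int_{\mathbb R}f(x)e^{-ix\xi}\,dx$. Kalman rank condition with Kalman index $K$: $K\ge0$ is the smallest integer such that $\operatorname{rank}(B,AB,\dots,A^KB)=N$. Kalman layers: $\mathcal K_k=\operatorname{Ran}(B,AB,\dots,A^kB)\subset\mathbb R^N$, $\mathcal K_{-1}=\{0\}$, $\mathcal V_k=\mathcal K_k\cap\mathcal K_{k-1}^\perp$ for $k=0,\dots,K$ (orthogonality for the Euclidean inner product), so $\mathbb R^N=\bigoplus_{k=0}^K\mathcal V_k$; $\Pi_k$ is the orthogonal projector onto $\mathcal V_k$, extended complex-linearly to $\mathbb C^N$. Weights: $\rho_k(\xi)=\min\{|\xi|^{2k},1\}$. The space $\mathcal Y_K^-$ is the Hilbert completion of $\mathcal S(\mathbb R;\mathbb C^N)$ for the norm $\|q\|_{\mathcal Y_K^-}^2=\sum_{k=0}^K\int_{\mathbb R}\rho_k(\xi)|\Pi_k\widehat q(\xi)|^2\,d\xi$. Its dual with respect to the $L^2$-Fourier pairing is $\mathcal Y_K^+$, i.e. the space of $y\in L^2(\mathbb R;\mathbb C^N)$ with $\|y\|_{\mathcal Y_K^+}^2=\sum_{k=0}^K\int_{\mathbb R}\rho_k(\xi)^{-1}|\Pi_k\widehat y(\xi)|^2\,d\xi<\infty$ (the value of $\rho_k^{-1}$ at $\xi=0$ is irrelevant). Controlled system: $y_t+Ay_x=B\chi_{\mathcal O}u$ in $(0,T)\times\mathbb R$, $y(0,\cdot)=y_0$, with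 $\chi_{\mathcal O}$ the indicator function of $\mathcal O$. Solutions are understood by transposition: $\langle y(T),q_T\rangle=\langle y_0,q(0)\rangle+\int_0^T\int_{\mathcal O}u\cdot B^\top q\,dx\,dt$ for all adjoint solutions $q$ of $q_t+A^\top q_x=0$, $q(T)=q_T\in\mathcal Y_K^-$ (duality between $\mathcal Y_K^+$ and $\mathcal Y_K^-$). $S(T)$ is the free evolution: $\widehat{S(T)y_0}(\xi)=e^{-iT\xi A}\widehat y_0(\xi)$. Bounded-gap condition (BG): $\mathcal O=\bigcup_{n\in\mathbb Z}(a_n,b_n)$ with $a_n<b_n<a_{n+1}$ for all $n\in\mathbb Z$, $\ell_{\mathcal O}:=\inf_n(b_n-a_n)>0$ and $G_{\mathcal O}:=\sup_n(a_{n+1}-b_n)<\infty$. Geometric time (when $0\notin\sigma(A)$): $T_{\rm geom}:=G_{\mathcal O}/\lambda_*$ with $\lambda_*:=\min_{\lambda\in\sigma(A)}|\lambda|>0$. *)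

theory Defs
  imports "HOL-Analysis.Analysis"
begin

section \<open>Linear algebra\<close>

(* The power operation of the type class instance for vec is the componentwise one, so matrix powers
   and the matrix exponential are defined here. *)
primrec mat_pow :: "'a::comm_semiring_1^'n^'n \<Rightarrow> nat \<Rightarrow> 'a^'n^'n" where
  "mat_pow M 0 = mat 1"
| "mat_pow M (Suc k) = M ** mat_pow M k"

definition mat_exp :: "complex^'n^'n \<Rightarrow> complex^'n^'n" where
  "mat_exp M = (\<Sum>k. mat_pow M k /\<^sub>R fact k)"

definition cvec :: "real^'n \<Rightarrow> complex^'n" where
  "cvec v = (\<chi> i. complex_of_real (v $ i))"

abbreviation cmat :: "real^'n^'m \<Rightarrow> complex^'n^'m" where
  "cmat \<equiv> map_matrix complex_of_real"

definition diagonalizable_over_real :: "real^'n^'n \<Rightarrow> bool" where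
  "diagonalizable_over_real A \<longleftrightarrow>
     (\<exists>P D :: real^'n^'n. invertible P \<and> (\<forall>i j. i \<noteq> j \<longrightarrow> D $ i $ j = 0) \<and> A = P ** D ** matrix_inv P)"

definition mat_spectrum :: "real^'n^'n \<Rightarrow> complex set" where
  "mat_spectrum A = {z. \<exists>v. v \<noteq> 0 \<and> cmat A *v v = z *s v}"

text \<open>The range of the block matrix \<open>(B, AB, ..., A^k B)\<close>, whose argument is the family of
  blocks \<open>v 0, ..., v k\<close>.\<close>

definition kalman_range :: "real^'n^'n \<Rightarrow> real^'m^'n \<Rightarrow> nat \<Rightarrow> (real^'n) set" where
  "kalman_range A B k = range (\<lambda>v :: nat \<Rightarrow> real^'m. \<Sum>j\<le>k. (mat_pow A j ** B) *v v j)"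

definition kalman_index :: "real^'n^'n \<Rightarrow> real^'m^'n \<Rightarrow> nat \<Rightarrow> bool" where
  "kalman_index A B K \<longleftrightarrow>
     dim (kalman_range A B K) = CARD('n) \<and>
     (\<forall>k<K. dim (kalman_range A B k) \<noteq> CARD('n))"

definition kalman_layer :: "real^'n^'n \<Rightarrow> real^'m^'n \<Rightarrow> nat \<Rightarrow> (real^'n) set" where
  "kalman_layer A B k =
     kalman_range A B k \<inter> (if k = 0 then {0} else kalman_range A B (k - 1))\<^sup>\<bottom>"

definition orth_proj :: "(real^'n) set \<Rightarrow> real^'n \<Rightarrow> real^'n" where
  "orth_proj V x = (THE p. p \<in> V \<and> x - p \<in> V\<^sup>\<bottom>)"

text \<open>The projector onto the \<open>k\<close>-th layer, extended complex-linearly.\<close>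

definition layer_proj :: "real^'n^'n \<Rightarrow> real^'m^'n \<Rightarrow> nat \<Rightarrow> complex^'n \<Rightarrow> complex^'n" where
  "layer_proj A B k z =
     cvec (orth_proj (kalman_layer A B k) (\<chi> i. Re (z $ i))) +
     \<i> *s cvec (orth_proj (kalman_layer A B k) (\<chi> i. Im (z $ i)))"

section \<open>Fourier transform\<close>

definition L2_normsq :: "'a::euclidean_space set \<Rightarrow> ('a \<Rightarrow> 'b::euclidean_space) \<Rightarrow> ennreal" where
  "L2_normsq S f = (\<integral>\<^sup>+x. ennreal ((norm (f x))\<^sup>2) * indicator S x \<partial>lborel)"

definition L2_on :: "'a::euclidean_space set \<Rightarrow> ('a \<Rightarrow> 'b::euclidean_space) set" where
  "L2_on S = {f. set_borel_measurable lborel S f \<and> L2_normsq S f < \<infinity>}"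

definition fourier :: "(real \<Rightarrow> complex^'n) \<Rightarrow> real \<Rightarrow> complex^'n" where
  "fourier f \<xi> = (LINT x|lborel. exp (- \<i> * of_real (x * \<xi>)) *s f x)"

text \<open>For square-integrable functions the transform is the \<open>L\<^sup>2\<close> limit of the transforms of the
  truncations; it is determined almost everywhere.\<close>

definition is_fourier_L2 :: "(real \<Rightarrow> complex^'n) \<Rightarrow> (real \<Rightarrow> complex^'n) \<Rightarrow> bool" where
  "is_fourier_L2 f g \<longleftrightarrow>
     f \<in> L2_on UNIV \<and> g \<in> L2_on UNIV \<and>
     ((\<lambda>R. L2_normsq UNIV (\<lambda>\<xi>. g \<xi> - fourier (\<lambda>x. indicator {-R..R} x *\<^sub>R f x) \<xi>))
        \<longlongrightarrow> 0) at_top"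

definition fourier_L2 :: "(real \<Rightarrow> complex^'n) \<Rightarrow> real \<Rightarrow> complex^'n" where
  "fourier_L2 f = (SOME g. is_fourier_L2 f g)"

definition schwartz :: "(real \<Rightarrow> complex^'n) \<Rightarrow> bool" where
  "schwartz f \<longleftrightarrow>
     (\<exists>D :: nat \<Rightarrow> real \<Rightarrow> complex^'n.
        D 0 = f \<and>
        (\<forall>k x. (D k has_vector_derivative D (Suc k) x) (at x)) \<and>
        (\<forall>j k. bounded (range (\<lambda>x. x ^ j *\<^sub>R D k x))))"

section \<open>The weighted spaces\<close>

definition weight :: "nat \<Rightarrow> real \<Rightarrow> real" where
  "weight k \<xi> = min (\<bar>\<xi>\<bar> ^ (2 * k)) 1"

text \<open>The squared norm of \<open>\<Y>\<^sub>K\<^sup>-\<close>, as a function of the Fourier transform.\<close>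

definition Yminus_normsq_hat ::
    "real^'n^'n \<Rightarrow> real^'m^'n \<Rightarrow> nat \<Rightarrow> (real \<Rightarrow> complex^'n) \<Rightarrow> ennreal" where
  "Yminus_normsq_hat A B K g =
     (\<Sum>k\<le>K. \<integral>\<^sup>+\<xi>. ennreal (weight k \<xi> * (norm (layer_proj A B k (g \<xi>)))\<^sup>2) \<partial>lborel)"

text \<open>Since \<open>weight k\<close> vanishes at \<open>0\<close> for \<open>k > 0\<close>, elements of the completion \<open>\<Y>\<^sub>K\<^sup>-\<close> of the
  Schwartz space need not be tempered distributions. The completion is therefore realised on the
  Fourier side: the Fourier transform embeds the Schwartz space isometrically into a weighted
  \<open>L\<^sup>2\<close> space, which is complete, and \<open>\<Y>\<^sub>K\<^sup>-\<close> is the closure of the image. A member \<open>g\<close> of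
  \<open>Yminus_hat A B K\<close> is thus the Fourier transform of an element of \<open>\<Y>\<^sub>K\<^sup>-\<close>.\<close>

definition Yminus_hat ::
    "real^'n^'n \<Rightarrow> real^'m^'n \<Rightarrow> nat \<Rightarrow> (real \<Rightarrow> complex^'n) set" where
  "Yminus_hat A B K =
     {g \<in> borel_measurable lborel.
        \<exists>q :: nat \<Rightarrow> real \<Rightarrow> complex^'n. (\<forall>j. schwartz (q j)) \<and>
          (\<lambda>j. Yminus_normsq_hat A B K (\<lambda>\<xi>. fourier (q j) \<xi> - g \<xi>)) \<longlonglongrightarrow> 0}"

definition Yplus_normsq ::
    "real^'n^'n \<Rightarrow> real^'m^'n \<Rightarrow> nat \<Rightarrow> (real \<Rightarrow> complex^'n) \<Rightarrow> ennreal" where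
  "Yplus_normsq A B K y =
     (\<Sum>k\<le>K. \<integral>\<^sup>+\<xi>. ennreal ((norm (layer_proj A B k (fourier_L2 y \<xi>)))\<^sup>2 / weight k \<xi>) \<partial>lborel)"

definition Yplus ::
    "real^'n^'n \<Rightarrow> real^'m^'n \<Rightarrow> nat \<Rightarrow> (real \<Rightarrow> complex^'n) set" where
  "Yplus A B K = {y \<in> L2_on UNIV. Yplus_normsq A B K y < \<infinity>}"

text \<open>The \<open>L\<^sup>2\<close> pairing \<open>\<langle>y, q\<rangle>\<close>, conjugate-linear in \<open>q\<close>, where \<open>g\<close> is the Fourier transform of
  \<open>q\<close>. The factor makes it equal to \<open>\<integral> y \<cdot> cnj q dx\<close> (Parseval).\<close>

definition pairing :: "(real \<Rightarrow> complex^'n) \<Rightarrow> (real \<Rightarrow> complex^'n) \<Rightarrow> complex" where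
  "pairing y g =
     (LINT \<xi>|lborel. (\<Sum>i\<in>UNIV. fourier_L2 y \<xi> $ i * cnj (g \<xi> $ i))) / of_real (2 * pi)"

section \<open>The controlled system\<close>

definition free_evolution ::
    "real^'n^'n \<Rightarrow> real \<Rightarrow> (real \<Rightarrow> complex^'n) \<Rightarrow> real \<Rightarrow> complex^'n" where
  "free_evolution A T y0 =
     (SOME z. is_fourier_L2 z
        (\<lambda>\<xi>. mat_exp (map_matrix (\<lambda>a. - \<i> * of_real (T * \<xi> * a)) A) *v fourier_L2 y0 \<xi>))"

text \<open>The equation \<open>q\<^sub>t + A\<^sup>T q\<^sub>x = 0\<close> on \<open>[0, t]\<close> with final state \<open>q(t) = q\<^sub>t\<close>, after Fourier
  transformation in \<open>x\<close>; \<open>qh s\<close> and \<open>g\<close> are the Fourier transforms of \<open>q(s)\<close> and of \<open>q\<^sub>t\<close>.\<close>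

definition adjoint_solution_hat ::
    "real^'n^'n \<Rightarrow> real \<Rightarrow> (real \<Rightarrow> complex^'n) \<Rightarrow> (real \<Rightarrow> real \<Rightarrow> complex^'n) \<Rightarrow> bool" where
  "adjoint_solution_hat A t g qh \<longleftrightarrow>
     qh t = g \<and>
     (\<forall>\<xi>. \<forall>s\<in>{0..t}.
        ((\<lambda>s. qh s \<xi>) has_vector_derivative
           (- \<i> * of_real \<xi>) *s (cmat (transpose A) *v qh s \<xi>)) (at s within {0..t}))"

text \<open>\<open>w\<close> is the function \<open>B\<^sup>T q \<in> L\<^sup>2((0, t) \<times> \<real>)\<close>. It is square-integrable even though \<open>q(s)\<close>
  itself need not be a function of \<open>x\<close>, and it is determined almost everywhere.\<close>

definition adjoint_observation ::
    "real^'m^'n \<Rightarrow> real \<Rightarrow> (real \<Rightarrow> real \<Rightarrow> complex^'n) \<Rightarrow> (real \<times> real \<Rightarrow> complex^'m) \<Rightarrow> bool" where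
  "adjoint_observation B t qh w \<longleftrightarrow>
     w \<in> L2_on ({0<..<t} \<times> UNIV) \<and>
     (AE s in lborel. s \<in> {0<..<t} \<longrightarrow>
        is_fourier_L2 (\<lambda>x. w (s, x)) (\<lambda>\<xi>. cmat (transpose B) *v qh s \<xi>))"

text \<open>\<open>y :: [0, T] \<rightarrow> \<Y>\<^sub>K\<^sup>+\<close> is the solution by transposition of \<open>y\<^sub>t + A y\<^sub>x = B \<chi>\<^sub>\<omega> u\<close>,
  \<open>y(0) = y0\<close>: the duality identity holds at every time \<open>t \<le> T\<close>, for all adjoint solutions on
  \<open>[0, t]\<close> with final state in \<open>\<Y>\<^sub>K\<^sup>-\<close>.\<close>

definition transposition_solution ::
    "real^'n^'n \<Rightarrow> real^'m^'n \<Rightarrow> nat \<Rightarrow> real set \<Rightarrow> real \<Rightarrow> (real \<times> real \<Rightarrow> real^'m) \<Rightarrow>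
     (real \<Rightarrow> complex^'n) \<Rightarrow> (real \<Rightarrow> real \<Rightarrow> complex^'n) \<Rightarrow> bool" where
  "transposition_solution A B K \<omega> T u y0 y \<longleftrightarrow>
     (AE x in lborel. y 0 x = y0 x) \<and>
     (\<forall>t\<in>{0..T}.
        y t \<in> Yplus A B K \<and>
        (\<forall>g\<in>Yminus_hat A B K. \<forall>qh. adjoint_solution_hat A t g qh \<longrightarrow>
           (\<exists>w. adjoint_observation B t qh w \<and>
              pairing (y t) g =
                pairing y0 (qh 0) +
                (LINT z:{0<..<t} \<times> \<omega>|lborel. (\<Sum>i\<in>UNIV. of_real (u z $ i) * cnj (w z $ i))))))"

definition steers ::
    "real^'n^'n \<Rightarrow> real^'m^'n \<Rightarrow> nat \<Rightarrow> real set \<Rightarrow> real \<Rightarrow> (real \<times> real \<Rightarrow> real^'m) \<Rightarrow>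
     (real \<Rightarrow> complex^'n) \<Rightarrow> (real \<Rightarrow> complex^'n) \<Rightarrow> bool" where
  "steers A B K \<omega> T u y0 yd \<longleftrightarrow>
     (\<exists>y. transposition_solution A B K \<omega> T u y0 y \<and> (AE x in lborel. y T x = yd x))"

section \<open>The control region\<close>

definition bounded_gap :: "(int \<Rightarrow> real) \<Rightarrow> (int \<Rightarrow> real) \<Rightarrow> real set \<Rightarrow> bool" where
  "bounded_gap a b \<omega> \<longleftrightarrow>
     \<omega> = (\<Union>n. {a n<..<b n}) \<and>
     (\<forall>n. a n < b n \<and> b n < a (n + 1)) \<and>
     (INF n. b n - a n) > 0 \<and>
     bdd_above (range (\<lambda>n. a (n + 1) - b n))"

definition gap :: "(int \<Rightarrow> real) \<Rightarrow> (int \<Rightarrow> real) \<Rightarrow> real" where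
  "gap a b = (SUP n. a (n + 1) - b n)"

definition geometric_time :: "real^'n^'n \<Rightarrow> (int \<Rightarrow> real) \<Rightarrow> (int \<Rightarrow> real) \<Rightarrow> real" where
  "geometric_time A a b = gap a b / Min (cmod ` mat_spectrum A)"

end

theory Submission
  imports Defs "HOL-Probability.Probability"
begin

text \<open>
After Fourier transformation in \<open>x\<close> the adjoint equation becomes a linear system of ordinary differential
equations for each frequency \<open>\<xi>\<close>, solved by \<open>q(s, \<xi>) = exp (i (t - s) \<xi> A\<^sup>T) g(\<xi>)\<close>. By duality, steering
with a bound on the cost amounts to an observability inequality: the energy of \<open>B\<^sup>T q\<close> on
\<open>(0, T) \<times> \<omega>\<close> controls the \<open>\<Y>\<^sub>K\<^sup>-\<close> norm of the final datum.

\<^bold>\<open>One frequency.\<close> Let \<open>D\<^sub>\<mu>\<close> multiply the \<open>k\<close>-th Kalman layer by \<open>\<mu>\<^sup>k\<close>. During unit time,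
\<open>B\<^sup>T exp (i s \<tau> A\<^sup>T) z\<close> controls \<open>D\<^sub>\<mu> z\<close> with \<open>\<mu> = min \<bar>\<tau>\<bar> 1\<close>, uniformly in \<open>\<tau>\<close> (\<open>mode_observability\<close>). For small
\<open>\<tau>\<close> the observation is close to a polynomial in \<open>s\<close> whose coefficients \<open>\<tau>\<^sup>r B\<^sup>T (A\<^sup>T)\<^sup>r z\<close>, \<open>r \<le> k\<close>,
determine the \<open>k\<close>-th layer of \<open>\<tau>\<^sup>k z\<close>, by the Kalman condition; large \<open>\<tau>\<close> reduce to small ones on short time
windows. Rescaling time produces the factor \<open>min T (T\<^bsup>2K+1\<^esup>)\<close>, and integration over \<open>\<xi>\<close> gives the
global inequality.

\<^bold>\<open>Localized observation.\<close> \<open>B\<^sup>T q\<close> is a superposition of waves that travel with the eigenvalues of \<open>A\<close>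
as speeds. Moving along the speed \<open>m\<close> for a time \<open>\<eta>\<close> and subtracting annihilates the wave of speed \<open>m\<close> and multiplies
the amplitude of the wave of speed \<open>l\<close> by \<open>exp (- i \<eta> \<xi> (l - m)) - 1\<close>, which is bounded below on average over \<open>\<eta> < \<epsilon>\<close>
as long as \<open>\<xi>\<close> stays away from \<open>0\<close> (\<open>wave_elimination\<close>). The one wave that remains after \<open>p - 1\<close> such steps sweeps
across the control region, as there is enough time for it to cross a gap. With \<open>\<epsilon>\<close>
proportional to \<open>\<theta> = T - T\<^sub>g\<^sub>e\<^sub>o\<^sub>m\<close> every step costs a factor \<open>\<theta>\<^sup>-\<^sup>2\<close>, the final sweep a factor \<open>\<theta>\<^sup>-\<^sup>1\<close>. Low
frequencies need no time at all: a function with small frequencies hardly changes over the length of a gap, so that it cannot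
hide outside the control region (\<open>low_frequency_observability\<close>).

\<^bold>\<open>Duality.\<close> Sending a final datum to the state that its own observation generates as a control is a strongly monotone
Lipschitz operator between the weighted spaces, hence onto; the constant in the observability inequality bounds the cost
(\<open>control_exists\<close>). Real data are
steered by the real part of the control. Parseval's identity turns the resulting formula on the Fourier side into the
identity that defines solutions by transposition (\<open>input_map_duality\<close>, \<open>steers_of_input_map\<close>).

The \<open>L\<^sup>2\<close> theory of the Fourier transform, including partial transforms of functions on the plane, rests on Gaussian
regularisation and on the uniqueness of characteristic functions of probability measures.
\<close>

section \<open>Square-integrable functions\<close>

text \<open>Integrals without a measure are taken with respect to the Lebesgue measure.\<close>

abbreviation nn_integral_lborel :: "('a::euclidean_space \<Rightarrow> ennreal) \<Rightarrow> ennreal" (binder "\<integral>\<^sup>+" 10) where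
 "nn_integral_lborel f \<equiv> nn_integral lborel f"

abbreviation integral_lborel :: "('a::euclidean_space \<Rightarrow> 'b::{banach, second_countable_topology}) \<Rightarrow> 'b" (binder "LINT " 10) where
 "integral_lborel f \<equiv> integral\<^sup>L lborel f"

text \<open>Membership in \<open>L\<^sup>2\<close> with a Borel measurable representative. Finite norms as real numbers permit subtraction,
which the extended values of \<open>L2_normsq\<close> do not.\<close>

definition sqint :: "('a::euclidean_space \<Rightarrow> 'b::euclidean_space) \<Rightarrow> bool" where
 "sqint f \<longleftrightarrow> f \<in> borel_measurable borel \<and> integrable lborel (\<lambda>x. (norm (f x))\<^sup>2)"

definition l2norm :: "('a::euclidean_space \<Rightarrow> 'b::euclidean_space) \<Rightarrow> real" where
 "l2norm f = sqrt (LINT x. (norm (f x))\<^sup>2)"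

lemma sqint_measurable [measurable_dest]: "sqint f \<Longrightarrow> f \<in> borel_measurable borel"
 by (simp add: sqint_def)

lemma sqint_integrable: "sqint f \<Longrightarrow> integrable lborel (\<lambda>x. (norm (f x))\<^sup>2)"
 by (simp add: sqint_def)

lemma l2norm_nonneg [simp]: "0 \<le> l2norm f"
 by (simp add: l2norm_def)

lemma l2norm_sq: "(l2norm f)\<^sup>2 = (LINT x. (norm (f x))\<^sup>2)"
 by (simp add: l2norm_def)

lemma L2_normsq_UNIV: "L2_normsq UNIV f = (\<integral>\<^sup>+x. ennreal ((norm (f x))\<^sup>2))"
 by (simp add: L2_normsq_def)

lemma sqint_iff_nn:
 "sqint f \<longleftrightarrow> f \<in> borel_measurable borel \<and> (\<integral>\<^sup>+x. ennreal ((norm (f x))\<^sup>2)) < \<infinity>"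
 unfolding sqint_def by (auto simp: integrable_iff_bounded)

lemma sqint_iff_L2_on: "sqint f \<longleftrightarrow> f \<in> L2_on UNIV"
 unfolding sqint_iff_nn L2_on_def set_borel_measurable_def by (simp add: L2_normsq_UNIV)

lemma L2_normsq_eq_l2norm: "sqint f \<Longrightarrow> L2_normsq UNIV f = ennreal ((l2norm f)\<^sup>2)"
 unfolding L2_normsq_UNIV l2norm_sq sqint_def by (intro nn_integral_eq_integral) auto

lemma sqint_bound:
 assumes g: "sqint g" and f[measurable]: "f \<in> borel_measurable borel"
  and le: "AE x in lborel. norm (f x) \<le> C * norm (g x)"
 shows "sqint f" "C \<ge> 0 \<Longrightarrow> l2norm f \<le> C * l2norm g"
proof -
 have i: "integrable lborel (\<lambda>x. C\<^sup>2 * (norm (g x))\<^sup>2)"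
  using g by (simp add: sqint_def)
 have ae: "AE x in lborel. (norm (f x))\<^sup>2 \<le> C\<^sup>2 * (norm (g x))\<^sup>2"
  using le by eventually_elim (metis norm_ge_zero power_mono power_mult_distrib)
 have i2: "integrable lborel (\<lambda>x. (norm (f x))\<^sup>2)"
  by (rule Bochner_Integration.integrable_bound[OF i]) (use ae in auto)
 then show "sqint f" by (simp add: sqint_def)
 assume C: "C \<ge> 0"
 have "(l2norm f)\<^sup>2 \<le> (C * l2norm g)\<^sup>2"
  unfolding power_mult_distrib l2norm_sq
  using integral_mono_AE[OF i2 i ae] by simp
 then show "l2norm f \<le> C * l2norm g"
  using C by (meson l2norm_nonneg mult_nonneg_nonneg power2_le_imp_le)
qed

lemma sqint_cong_AE:
 assumes "sqint f" "g \<in> borel_measurable borel" "AE x in lborel. f x = g x"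
 shows "sqint g"
 by (rule sqint_bound(1)[OF assms(1,2), of 1]) (use assms(3) in auto)

lemma l2norm_cong_AE:
 assumes [measurable]: "f \<in> borel_measurable borel" "g \<in> borel_measurable borel"
  and "AE x in lborel. f x = g x"
 shows "l2norm f = l2norm g"
 unfolding l2norm_def by (rule arg_cong[where f=sqrt], rule integral_cong_AE) (use assms(3) in auto)

lemma sqint_zero [simp]: "sqint (\<lambda>x. 0)" by (simp add: sqint_def)

lemma sqint_scaleR: "sqint f \<Longrightarrow> sqint (\<lambda>x. c *\<^sub>R f x)"
 by (rule sqint_bound(1)[of f _ "\<bar>c\<bar>"]) auto

lemma l2norm_scaleR: "l2norm (\<lambda>x. c *\<^sub>R f x) = \<bar>c\<bar> * l2norm f"
 by (simp add: l2norm_def power_mult_distrib real_sqrt_mult)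

lemma sqint_minus: "sqint f \<Longrightarrow> sqint (\<lambda>x. - f x)"
 using sqint_scaleR[of f "-1"] by simp

lemma l2norm_diff_swap: "l2norm (\<lambda>x. f x - g x) = l2norm (\<lambda>x. g x - f x)"
 by (simp add: l2norm_def norm_minus_commute)

lemma norm_add_sq_le: "(norm (a + b))\<^sup>2 \<le> 2 * (norm a)\<^sup>2 + 2 * (norm (b::'a::real_normed_vector))\<^sup>2"
proof -
 have "(norm (a + b))\<^sup>2 \<le> (norm a + norm b)\<^sup>2" by (intro power_mono norm_triangle_ineq) auto
 also have "\<dots> \<le> 2 * (norm a)\<^sup>2 + 2 * (norm b)\<^sup>2"
  using sum_squares_bound[of "norm a" "norm b"] by (simp add: power2_sum)
 finally show ?thesis .
qed

lemma sqint_add: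
 assumes f: "sqint f" and g: "sqint g"
 shows "sqint (\<lambda>x. f x + g x)"
proof -
 have [measurable]: "f \<in> borel_measurable borel" "g \<in> borel_measurable borel"
  using f g by (auto simp: sqint_def)
 have "integrable lborel (\<lambda>x. (norm (f x + g x))\<^sup>2)"
  by (rule Bochner_Integration.integrable_bound[where f="\<lambda>x. 2 * (norm (f x))\<^sup>2 + 2 * (norm (g x))\<^sup>2"])
   (use f g norm_add_sq_le in \<open>auto simp: sqint_def\<close>)
 then show ?thesis by (simp add: sqint_def)
qed

lemma sqint_diff: "sqint f \<Longrightarrow> sqint g \<Longrightarrow> sqint (\<lambda>x. f x - g x)"
 using sqint_add[OF _ sqint_minus, of f g] by simp

lemma sqint_norm_mult_integrable:
 assumes f: "sqint f" and g: "sqint g"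
 shows "integrable lborel (\<lambda>x. norm (f x) * norm (g x))"
proof -
 have [measurable]: "f \<in> borel_measurable borel" "g \<in> borel_measurable borel"
  using f g by (auto simp: sqint_def)
 have le: "norm (f x) * norm (g x) \<le> (norm (f x))\<^sup>2 + (norm (g x))\<^sup>2" for x
  using sum_squares_bound[of "norm (f x)" "norm (g x)"]
   mult_nonneg_nonneg[OF norm_ge_zero norm_ge_zero, of "f x" "g x"]
  by linarith
 show ?thesis
  by (rule Bochner_Integration.integrable_bound[where f="\<lambda>x. (norm (f x))\<^sup>2 + (norm (g x))\<^sup>2"])
   (use f g le in \<open>auto simp: sqint_def\<close>)
qed

lemma l2_Cauchy_Schwarz:
 assumes f: "sqint f" and g: "sqint g"
 shows "(LINT x. norm (f x) * norm (g x)) \<le> l2norm f * l2norm g"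
proof -
 note m [measurable] = sqint_measurable[OF f] sqint_measurable[OF g]
 have "(\<integral>\<^sup>+x. ennreal (norm (f x)) * ennreal (norm (g x)))\<^sup>2
   \<le> (\<integral>\<^sup>+x. (ennreal (norm (f x)))\<^sup>2) * (\<integral>\<^sup>+x. (ennreal (norm (g x)))\<^sup>2)"
  by (rule Cauchy_Schwarz_nn_integral) auto
 then have "(\<integral>\<^sup>+x. ennreal (norm (f x) * norm (g x)))\<^sup>2
   \<le> (\<integral>\<^sup>+x. ennreal ((norm (f x))\<^sup>2)) * (\<integral>\<^sup>+x. ennreal ((norm (g x))\<^sup>2))"
  by (simp add: ennreal_mult ennreal_power)
 then have "ennreal ((LINT x. norm (f x) * norm (g x))\<^sup>2) \<le> ennreal ((l2norm f)\<^sup>2 * (l2norm g)\<^sup>2)"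
  using f g L2_normsq_eq_l2norm[OF f] L2_normsq_eq_l2norm[OF g]
  by (subst (asm) nn_integral_eq_integral[OF sqint_norm_mult_integrable[OF f g]])
   (simp_all add: L2_normsq_UNIV ennreal_mult ennreal_power)
 then have "(LINT x. norm (f x) * norm (g x))\<^sup>2 \<le> (l2norm f * l2norm g)\<^sup>2"
  by (simp add: power_mult_distrib)
 then show ?thesis by (meson l2norm_nonneg mult_nonneg_nonneg power2_le_imp_le)
qed

lemma l2norm_triangle:
 assumes f: "sqint f" and g: "sqint g"
 shows "l2norm (\<lambda>x. f x + g x) \<le> l2norm f + l2norm g"
proof -
 note m [measurable] = sqint_measurable[OF f] sqint_measurable[OF g]
 note i = sqint_norm_mult_integrable[OF f g] sqint_integrable[OF f] sqint_integrable[OF g]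
 have "(l2norm (\<lambda>x. f x + g x))\<^sup>2 \<le> (LINT x. (norm (f x))\<^sup>2 + 2 * (norm (f x) * norm (g x)) + (norm (g x))\<^sup>2)"
  unfolding l2norm_sq
 proof (rule integral_mono)
  show "integrable lborel (\<lambda>x. (norm (f x + g x))\<^sup>2)" using sqint_add[OF f g] by (simp add: sqint_def)
  show "integrable lborel (\<lambda>x. (norm (f x))\<^sup>2 + 2 * (norm (f x) * norm (g x)) + (norm (g x))\<^sup>2)"
   using i by simp
  fix x
  have "(norm (f x + g x))\<^sup>2 \<le> (norm (f x) + norm (g x))\<^sup>2"
   by (intro power_mono norm_triangle_ineq) auto
  then show "(norm (f x + g x))\<^sup>2 \<le> (norm (f x))\<^sup>2 + 2 * (norm (f x) * norm (g x)) + (norm (g x))\<^sup>2"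
   by (simp add: power2_sum)
 qed
 also have "\<dots> = (l2norm f)\<^sup>2 + 2 * (LINT x. norm (f x) * norm (g x)) + (l2norm g)\<^sup>2"
  using i by (simp add: l2norm_sq)
 also have "\<dots> \<le> (l2norm f + l2norm g)\<^sup>2"
  using l2_Cauchy_Schwarz[OF f g] by (simp add: power2_sum)
 finally show ?thesis by (rule power2_le_imp_le) simp
qed

lemma l2norm_triangle_diff:
 assumes "sqint f" "sqint g" "sqint h"
 shows "l2norm (\<lambda>x. f x - h x) \<le> l2norm (\<lambda>x. f x - g x) + l2norm (\<lambda>x. g x - h x)"
 using l2norm_triangle[OF sqint_diff[OF assms(1,2)] sqint_diff[OF assms(2,3)]] by simp

lemma l2norm_eq_0_iff:
 assumes f: "sqint f" shows "l2norm f = 0 \<longleftrightarrow> (AE x in lborel. f x = 0)"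
 using integral_nonneg_eq_0_iff_AE[OF sqint_integrable[OF f]] by (simp add: l2norm_def)

text \<open>A subsequence with geometrically small increments converges almost everywhere, because its increments are
summable at almost every point.\<close>

lemma l2_complete:
 fixes f :: "nat \<Rightarrow> 'a::euclidean_space \<Rightarrow> 'b::euclidean_space"
 assumes f: "\<And>n. sqint (f n)"
  and C: "\<And>e. e > 0 \<Longrightarrow> \<exists>N. \<forall>m\<ge>N. \<forall>n\<ge>N. l2norm (\<lambda>x. f m x - f n x) < e"
 shows "\<exists>g r. sqint g \<and> (\<lambda>n. l2norm (\<lambda>x. f n x - g x)) \<longlonglongrightarrow> 0 \<and> strict_mono r \<and>
   (AE x in lborel. (\<lambda>n. f (r n) x) \<longlonglongrightarrow> g x)"
proof -
 note m [measurable] = sqint_measurable[OF f]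
 have "\<exists>N. \<forall>m\<ge>N. \<forall>n\<ge>N. l2norm (\<lambda>x. f m x - f n x) < (1/2)^k" for k
  by (rule C) simp
 then obtain N where N: "\<And>k m n. m \<ge> N k \<Longrightarrow> n \<ge> N k \<Longrightarrow> l2norm (\<lambda>x. f m x - f n x) < (1/2)^k"
  by metis
 define r where "r = rec_nat (N 0) (\<lambda>k r. max (Suc r) (N (Suc k)))"
 have rS: "r (Suc k) = max (Suc (r k)) (N (Suc k))" for k by (simp add: r_def)
 have mono: "strict_mono r" by (rule strict_monoI_Suc) (simp add: rS)
 have rN: "r k \<ge> N k" for k by (cases k) (simp_all add: r_def)
 define D where "D k x = f (r (Suc k)) x - f (r k) x" for k x
 have D[measurable]: "D k \<in> borel_measurable borel" for k unfolding D_def by measurable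
 have Dsq: "sqint (D k)" for k unfolding D_def by (intro sqint_diff f)
 have Dn: "l2norm (D k) < (1/2)^k" for k
  unfolding D_def using N[of k "r (Suc k)" "r k"] rN[of k] strict_monoD[OF mono, of k "Suc k"] by simp
 have "(\<integral>\<^sup>+x. (\<Sum>k. ennreal (2^k * (norm (D k x))\<^sup>2))) = (\<Sum>k. \<integral>\<^sup>+x. ennreal (2^k * (norm (D k x))\<^sup>2))"
  by (rule nn_integral_suminf) simp
 also have "\<dots> \<le> (\<Sum>k. ennreal ((1/2)^k))"
 proof (rule suminf_le)
  fix k
  have "(\<integral>\<^sup>+x. ennreal (2^k * (norm (D k x))\<^sup>2)) = 2^k * ennreal ((l2norm (D k))\<^sup>2)"
   unfolding L2_normsq_eq_l2norm[OF Dsq, symmetric] L2_normsq_UNIV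
   by (simp add: ennreal_mult nn_integral_cmult ennreal_power[symmetric])
  also have "\<dots> = ennreal (2^k * (l2norm (D k))\<^sup>2)" by (simp add: ennreal_mult ennreal_power[symmetric])
  also have "\<dots> \<le> ennreal (2^k * ((1/2)^k)\<^sup>2)"
   using Dn[of k] by (intro ennreal_leI mult_left_mono power_mono) auto
  also have "2^k * ((1/2)^k)\<^sup>2 = ((1/2)^k :: real)" by (simp add: power2_eq_square power_divide)
  finally show "(\<integral>\<^sup>+x. ennreal (2^k * (norm (D k x))\<^sup>2)) \<le> ennreal ((1/2)^k)" .
 qed auto
 also have "\<dots> < \<infinity>" by (subst suminf_ennreal2) (auto intro!: summable_geometric)
 finally have "AE x in lborel. (\<Sum>k. ennreal (2^k * (norm (D k x))\<^sup>2)) \<noteq> \<infinity>"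
  by (intro nn_integral_noteq_infinite) (auto simp: less_top)
 then have conv: "AE x in lborel. convergent (\<lambda>k. f (r k) x)"
 proof eventually_elim
  case (elim x)
  then have s: "summable (\<lambda>k. 2^k * (norm (D k x))\<^sup>2)"
   by (intro summable_suminf_not_top) auto
  have "(\<lambda>k. 2^k * (norm (D k x))\<^sup>2) \<longlonglongrightarrow> 0" by (rule summable_LIMSEQ_zero[OF s])
  then have "Bseq (\<lambda>k. 2^k * (norm (D k x))\<^sup>2)" using convergentI convergent_imp_Bseq by blast
  then obtain M where M: "M > 0" "\<And>k. norm (2^k * (norm (D k x))\<^sup>2) \<le> M" by (auto simp: Bseq_def)
  have b: "norm (D k x) \<le> sqrt M * (sqrt (1/2))^k" for k
  proof (rule power2_le_imp_le)
   have "(norm (D k x))\<^sup>2 \<le> M * (1/2)^k" using M(2)[of k] by (simp add: field_simps power_divide)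
   also have "\<dots> = (sqrt M * (sqrt (1/2))^k)\<^sup>2"
   proof -
    have "((sqrt (1/2))^k)\<^sup>2 = ((sqrt (1/2))\<^sup>2)^k" by (metis power_mult mult.commute)
    then show ?thesis using M(1) by (simp only: power_mult_distrib) simp
   qed
   finally show "(norm (D k x))\<^sup>2 \<le> (sqrt M * (sqrt (1/2))^k)\<^sup>2" .
  qed (use M(1) in auto)
  have "summable (\<lambda>k. D k x)"
   by (rule summable_comparison_test'[where g="\<lambda>k. sqrt M * (sqrt (1/2))^k", OF _ b])
    (intro summable_mult summable_geometric, simp add: real_sqrt_divide)
  then have "convergent (\<lambda>n. \<Sum>k<n. D k x)" by (simp add: summable_iff_convergent)
  moreover have "(\<Sum>k<n. D k x) = f (r n) x - f (r 0) x" for n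
   unfolding D_def by (rule sum_lessThan_telescope)
  ultimately have "convergent (\<lambda>n. f (r n) x - f (r 0) x)" by simp
  then show "convergent (\<lambda>k. f (r k) x)" by (simp add: convergent_diff_const_right_iff)
 qed
 define g where "g x = lim (\<lambda>k. f (r k) x)" for x
 have gm[measurable]: "g \<in> borel_measurable borel"
  unfolding g_def by (rule borel_measurable_lim_metric) measurable
 have lim: "AE x in lborel. (\<lambda>k. f (r k) x) \<longlonglongrightarrow> g x"
  using conv by eventually_elim (simp add: g_def convergent_LIMSEQ_iff)
 have fat: "(\<integral>\<^sup>+x. ennreal ((norm (f n x - g x))\<^sup>2)) \<le> ennreal (((1/2)^k)\<^sup>2)" if n: "n \<ge> N k" for n k
 proof -
  have "(\<integral>\<^sup>+x. ennreal ((norm (f n x - g x))\<^sup>2)) = (\<integral>\<^sup>+x. liminf (\<lambda>j. ennreal ((norm (f n x - f (r j) x))\<^sup>2)))"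
  proof (rule nn_integral_cong_AE)
   show "AE x in lborel. ennreal ((norm (f n x - g x))\<^sup>2) = liminf (\<lambda>j. ennreal ((norm (f n x - f (r j) x))\<^sup>2))"
    using lim
   proof eventually_elim
    case (elim x)
    have "(\<lambda>j. ennreal ((norm (f n x - f (r j) x))\<^sup>2)) \<longlonglongrightarrow> ennreal ((norm (f n x - g x))\<^sup>2)"
     by (intro tendsto_intros elim)
    from lim_imp_Liminf[OF _ this] show ?case by simp
   qed
  qed
  also have "\<dots> \<le> liminf (\<lambda>j. \<integral>\<^sup>+x. ennreal ((norm (f n x - f (r j) x))\<^sup>2))"
   by (rule nn_integral_liminf) simp
  also have "\<dots> \<le> liminf (\<lambda>j. ennreal (((1/2)^k)\<^sup>2))"
  proof (rule Liminf_mono)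
   have "\<forall>\<^sub>F j in sequentially. j \<ge> k" by (rule eventually_ge_at_top)
   then show "\<forall>\<^sub>F j in sequentially. (\<integral>\<^sup>+x. ennreal ((norm (f n x - f (r j) x))\<^sup>2)) \<le> ennreal (((1/2)^k)\<^sup>2)"
   proof eventually_elim
    case (elim j)
    have "r j \<ge> N k" using rN[of k] strict_mono_mono[OF mono] elim by (meson monoD order_trans)
    then have "l2norm (\<lambda>x. f n x - f (r j) x) \<le> (1/2)^k" using N[of k n "r j"] n by simp
    then show ?case
     unfolding L2_normsq_UNIV[symmetric] L2_normsq_eq_l2norm[OF sqint_diff[OF f f]]
     by (intro ennreal_leI power_mono) auto
   qed
  qed
  also have "\<dots> = ennreal (((1/2)^k)\<^sup>2)" by (simp add: Liminf_const)
  finally show ?thesis .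
 qed
 have dsq: "sqint (\<lambda>x. f n x - g x)" if "n \<ge> N 0" for n
  unfolding sqint_iff_nn using fat[OF that] by (auto simp: top_unique less_top[symmetric])
 have gsq: "sqint g"
  using sqint_diff[OF f[of "N 0"] dsq[of "N 0"]] by simp
 have le: "l2norm (\<lambda>x. f n x - g x) \<le> (1/2)^k" if "n \<ge> N k" for n k
 proof -
  have "ennreal ((l2norm (\<lambda>x. f n x - g x))\<^sup>2) \<le> ennreal (((1/2)^k)\<^sup>2)"
   using fat[OF that] L2_normsq_eq_l2norm[OF sqint_diff[OF f[of n] gsq]] by (simp add: L2_normsq_UNIV)
  then have "(l2norm (\<lambda>x. f n x - g x))\<^sup>2 \<le> ((1/2)^k)\<^sup>2" by (simp add: ennreal_le_iff)
  then show ?thesis by (rule power2_le_imp_le) simp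
 qed
 have "(\<lambda>n. l2norm (\<lambda>x. f n x - g x)) \<longlonglongrightarrow> 0"
 proof (rule LIMSEQ_I)
  fix e :: real assume "e > 0"
  then obtain k where k: "(1/2)^k < e" using real_arch_pow_inv[of e "1/2"] by auto
  show "\<exists>no. \<forall>n\<ge>no. norm (l2norm (\<lambda>x. f n x - g x) - 0) < e"
   using le k by (intro exI[of _ "N k"]) (fastforce intro: le_less_trans)
 qed
 then show ?thesis using gsq mono lim by blast
qed

lemma l2_limit_unique_AE:
 assumes f: "\<And>n. sqint (f n)" and g: "sqint g"
  and lim: "(\<lambda>n. l2norm (\<lambda>x. f n x - g x)) \<longlonglongrightarrow> 0"
  and r: "strict_mono (r::nat\<Rightarrow>nat)" and ae: "AE x in lborel. (\<lambda>n. f (r n) x) \<longlonglongrightarrow> h x"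
 shows "AE x in lborel. h x = g x"
proof -
 let ?f = "\<lambda>n. f (r n)"
 have lim': "(\<lambda>n. l2norm (\<lambda>x. ?f n x - g x)) \<longlonglongrightarrow> 0"
  using LIMSEQ_subseq_LIMSEQ[OF lim r] by (simp add: o_def)
 have "\<exists>k s. sqint k \<and> (\<lambda>n. l2norm (\<lambda>x. ?f n x - k x)) \<longlonglongrightarrow> 0 \<and> strict_mono s \<and>
   (AE x in lborel. (\<lambda>n. ?f (s n) x) \<longlonglongrightarrow> k x)"
 proof (rule l2_complete[OF f])
  fix e :: real assume "e > 0"
  then obtain N where N: "\<And>n. n \<ge> N \<Longrightarrow> l2norm (\<lambda>x. ?f n x - g x) < e/2"
   using LIMSEQ_D[OF lim', of "e/2"] by auto
  show "\<exists>N. \<forall>m\<ge>N. \<forall>n\<ge>N. l2norm (\<lambda>x. ?f m x - ?f n x) < e"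
  proof (intro exI allI impI)
   fix m n assume "m \<ge> N" "n \<ge> N"
   then show "l2norm (\<lambda>x. ?f m x - ?f n x) < e"
    using N[of m] N[of n] l2norm_triangle_diff[OF f[of "r m"] g f[of "r n"]] l2norm_diff_swap[of g "?f n"] by simp
  qed
 qed
 then obtain k s where k: "sqint k" "(\<lambda>n. l2norm (\<lambda>x. ?f n x - k x)) \<longlonglongrightarrow> 0" "strict_mono s"
   "AE x in lborel. (\<lambda>n. ?f (s n) x) \<longlonglongrightarrow> k x" by blast
 have "l2norm (\<lambda>x. g x - k x) \<le> 0"
 proof (rule LIMSEQ_le_const)
  show "(\<lambda>n. l2norm (\<lambda>x. ?f n x - g x) + l2norm (\<lambda>x. ?f n x - k x)) \<longlonglongrightarrow> 0"
   using tendsto_add[OF lim' k(2)] by simp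
  show "\<exists>N. \<forall>n\<ge>N. l2norm (\<lambda>x. g x - k x) \<le> l2norm (\<lambda>x. ?f n x - g x) + l2norm (\<lambda>x. ?f n x - k x)"
   using l2norm_triangle_diff[OF g f[of "r _"] k(1)] l2norm_diff_swap[of g] by auto
 qed
 then have "l2norm (\<lambda>x. g x - k x) = 0" using l2norm_nonneg[of "\<lambda>x. g x - k x"] by linarith
 then have gk: "AE x in lborel. g x = k x" using l2norm_eq_0_iff[OF sqint_diff[OF g k(1)]] by simp
 show ?thesis using gk k(4) ae
 proof eventually_elim
  case (elim x)
  have "(\<lambda>n. ?f (s n) x) \<longlonglongrightarrow> h x" using LIMSEQ_subseq_LIMSEQ[OF elim(3) k(3)] by (simp add: o_def)
  then show ?case using elim LIMSEQ_unique by metis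
 qed
qed

section \<open>The Fourier transform\<close>

definition fourier1 :: "(real \<Rightarrow> complex) \<Rightarrow> real \<Rightarrow> complex" where
 "fourier1 f \<xi> = (LINT x. cis (- (x * \<xi>)) * f x)"

lemma cis_measurable [measurable]: "cis \<in> borel_measurable borel"
 by (intro borel_measurable_continuous_onI continuous_intros)

lemma cnj_measurable [measurable]: "cnj \<in> borel_measurable borel"
 by (intro borel_measurable_continuous_onI continuous_intros)

lemma integral_norm_bound_ennreal': "ennreal (norm (LINT x|M. f x)) \<le> (\<integral>\<^sup>+x. ennreal (norm (f x)) \<partial>M)"
 by (cases "integrable M f") (auto simp: integral_norm_bound_ennreal not_integrable_integral_eq)

lemma integrable_unimodular_mult:
 assumes f: "integrable M (f :: 'a \<Rightarrow> complex)" and k: "k \<in> borel_measurable M" "\<And>x. norm (k x) \<le> 1"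
 shows "integrable M (\<lambda>x. k x * f x)"
proof (rule Bochner_Integration.integrable_bound[OF f])
 show "(\<lambda>x. k x * f x) \<in> borel_measurable M" using k(1) borel_measurable_integrable[OF f] by measurable
 show "AE x in M. norm (k x * f x) \<le> norm (f x)"
  using k(2) by (auto simp: norm_mult intro!: mult_left_le_one_le)
qed

lemma integrable_cis_mult [simp]:
 "integrable lborel (f :: real \<Rightarrow> complex) \<Longrightarrow> integrable lborel (\<lambda>x. cis (- (x * \<xi>)) * f x)"
 by (rule integrable_unimodular_mult) auto

lemma borel_measurable_fourier1 [measurable]:
 assumes [measurable]: "f \<in> borel_measurable borel"
 shows "fourier1 f \<in> borel_measurable borel"
 unfolding fourier1_def by measurable

lemma integrable_kernel:
 fixes f g :: "real \<Rightarrow> complex"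
 assumes f: "integrable lborel f" and g: "integrable lborel g"
  and k[measurable]: "case_prod k \<in> borel_measurable (borel \<Otimes>\<^sub>M borel)" and k1: "\<And>x y. norm (k x y) \<le> (1::real)"
 shows "integrable (lborel \<Otimes>\<^sub>M lborel) (\<lambda>(x,y). k x y * f x * g y)"
proof -
 note [measurable] = borel_measurable_integrable[OF f] borel_measurable_integrable[OF g]
 have m: "(\<lambda>(x,y). k x y * f x * g y) \<in> borel_measurable (lborel \<Otimes>\<^sub>M lborel)" by measurable
 show ?thesis
 proof (rule integrableI_bounded[OF m])
  have "(\<integral>\<^sup>+z. ennreal (norm (case z of (x,y) \<Rightarrow> k x y * f x * g y)) \<partial>(lborel \<Otimes>\<^sub>M lborel))
    \<le> (\<integral>\<^sup>+z. ennreal (norm (f (fst z))) * ennreal (norm (g (snd z))) \<partial>(lborel \<Otimes>\<^sub>M lborel))"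
   using k1 by (intro nn_integral_mono) (auto simp: norm_mult ennreal_mult[symmetric] mult.assoc
     intro!: ennreal_leI mult_left_le_one_le)
  also have "\<dots> = (\<integral>\<^sup>+x. \<integral>\<^sup>+y. ennreal (norm (f x)) * ennreal (norm (g y)))"
   by (subst lborel.nn_integral_fst[symmetric]) auto
  also have "\<dots> = (\<integral>\<^sup>+x. ennreal (norm (f x))) * (\<integral>\<^sup>+y. ennreal (norm (g y)))"
   by (simp add: nn_integral_cmult nn_integral_multc)
  also have "\<dots> < \<infinity>"
   using f g by (simp add: integrable_iff_bounded ennreal_mult_less_top)
  finally show "(\<integral>\<^sup>+z. ennreal (norm (case z of (x,y) \<Rightarrow> k x y * f x * g y)) \<partial>(lborel \<Otimes>\<^sub>M lborel)) < \<infinity>" .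
 qed
qed

lemma kernel_swap:
 fixes f g :: "real \<Rightarrow> complex"
 assumes "integrable lborel f" "integrable lborel g"
  and "case_prod k \<in> borel_measurable (borel \<Otimes>\<^sub>M borel)" "\<And>x y. norm (k x y) \<le> (1::real)"
 shows "(LINT y. LINT x. k x y * f x * g y) = (LINT x. LINT y. k x y * f x * g y)"
 using lborel_pair.Fubini_integral[OF integrable_kernel[OF assms]] by simp

lemma fourier1_multiplication:
 assumes f: "integrable lborel f" and g: "integrable lborel g"
 shows "(LINT y. fourier1 f y * g y) = (LINT x. f x * fourier1 g x)"
proof -
 have "(LINT y. fourier1 f y * g y) = (LINT y. LINT x. cis (- (x * y)) * f x * g y)"
  unfolding fourier1_def using f by (simp add: integral_mult_left_zero)
 also have "\<dots> = (LINT x. LINT y. cis (- (x * y)) * f x * g y)"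
  by (rule kernel_swap[OF f g]) auto
 also have "\<dots> = (LINT x. f x * fourier1 g x)"
  unfolding fourier1_def integral_mult_right_zero[symmetric]
  by (simp add: mult_ac)
 finally show ?thesis .
qed

lemma norm_fourier1_le: "norm (fourier1 f \<xi>) \<le> (LINT x. norm (f x))"
 unfolding fourier1_def using integral_norm_bound[of lborel "\<lambda>x. cis (- (x * \<xi>)) * f x"] by (simp add: norm_mult)

subsection \<open>Gaussians\<close>

lemma gaussian_integrable:
 assumes s: "(s::real) > 0" shows "integrable lborel (\<lambda>x. exp (- (s * x - a)\<^sup>2 / 2))"
proof -
 have "integrable lborel (\<lambda>x. exp (- x\<^sup>2 / 2) :: real)"
 proof -
  have "integrable lborel (\<lambda>x. sqrt (2 * pi) * std_normal_density x)" by simp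
  then show ?thesis by (simp add: std_normal_density_def)
 qed
 then have "integrable lborel (\<lambda>x. exp (- (- a + s * x)\<^sup>2 / 2))"
  using lborel_integrable_real_affine_iff[of s "\<lambda>x. exp (- x\<^sup>2 / 2) :: real" "- a"] s by simp
 then show ?thesis by (simp add: algebra_simps)
qed

lemma gaussian_fourier_std: "(LINT x. cis (t * x) * complex_of_real (exp (- x\<^sup>2 / 2))) = of_real (sqrt (2 * pi) * exp (- t\<^sup>2 / 2))"
proof -
 have "char std_normal_distribution t = (LINT x. std_normal_density x *\<^sub>R iexp (t * x))"
  unfolding char_def by (subst integral_density) auto
 also have "\<dots> = (LINT x. of_real (1 / sqrt (2 * pi)) * (cis (t * x) * complex_of_real (exp (- x\<^sup>2 / 2))))"
  by (rule Bochner_Integration.integral_cong) (simp_all add: std_normal_density_def cis_conv_exp scaleR_conv_of_real)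
 also have "\<dots> = of_real (1 / sqrt (2 * pi)) * (LINT x. cis (t * x) * complex_of_real (exp (- x\<^sup>2 / 2)))"
  by simp
 finally show ?thesis
  unfolding char_std_normal_distribution by (simp add: field_simps)
qed

lemma gaussian_fourier:
 fixes s t :: real
 assumes s: "s > 0"
 shows "(LINT x. cis (t * x) * complex_of_real (exp (- (s * x)\<^sup>2 / 2))) = of_real (sqrt (2 * pi) / s * exp (- (t / s)\<^sup>2 / 2))"
proof -
 have "of_real (sqrt (2 * pi) * exp (- (t / s)\<^sup>2 / 2)) = (LINT x. cis (t / s * x) * complex_of_real (exp (- x\<^sup>2 / 2)))"
  by (rule gaussian_fourier_std[symmetric])
 also have "\<dots> = s *\<^sub>R (LINT x. cis (t / s * (0 + s * x)) * complex_of_real (exp (- (0 + s * x)\<^sup>2 / 2)))"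
  using s by (subst lborel_integral_real_affine[of s _ 0]) auto
 also have "\<dots> = of_real s * (LINT x. cis (t * x) * complex_of_real (exp (- (s * x)\<^sup>2 / 2)))"
  using s by (simp add: scaleR_conv_of_real)
 finally show ?thesis using s by (simp add: field_simps)
qed

lemma gaussian_total:
 assumes s: "s > 0"
 shows "(\<integral>\<^sup>+x. ennreal (sqrt (2 * pi) / s * exp (- ((x - a) / s)\<^sup>2 / 2))) = ennreal (2 * pi)"
proof -
 have i: "integrable lborel (\<lambda>x. sqrt (2 * pi) / s * exp (- ((x - a) / s)\<^sup>2 / 2))"
  using gaussian_integrable[of "1 / s" "a / s"] s by (simp add: diff_divide_distrib)
 have "(\<integral>\<^sup>+x. ennreal (sqrt (2 * pi) / s * exp (- ((x - a) / s)\<^sup>2 / 2)))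
   = ennreal (LINT x. sqrt (2 * pi) / s * exp (- ((x - a) / s)\<^sup>2 / 2))"
  using s by (intro nn_integral_eq_integral i) auto
 also have "(LINT x. sqrt (2 * pi) / s * exp (- ((x - a) / s)\<^sup>2 / 2)) = \<bar>s\<bar> *\<^sub>R (LINT x. sqrt (2 * pi) / s * exp (- ((a + s * x - a) / s)\<^sup>2 / 2))"
  by (rule lborel_integral_real_affine) (use s in auto)
 also have "\<dots> = (LINT x. sqrt (2 * pi) * exp (- x\<^sup>2 / 2))"
  using s by simp
 also have "\<dots> = (LINT x. (2 * pi) * std_normal_density x)"
  by (rule Bochner_Integration.integral_cong) (simp_all add: std_normal_density_def field_simps)
 also have "\<dots> = 2 * pi" using prob_space.prob_space[OF prob_space_normal_density[of 1 0]] by simp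
 finally show ?thesis .
qed

subsection \<open>The Plancherel bound\<close>

text \<open>The Gaussian makes the double integral that arises from the square of the transform absolutely convergent and turns it into
an integral of \<open>f(x) cnj (f(y)) \<kappa>(x - y)\<close> with a positive kernel of total mass \<open>2 \<pi>\<close>. Splitting the product by
\<open>2 a b \<le> a\<^sup>2 + b\<^sup>2\<close> finishes the estimate.\<close>

lemma fourier1_smoothed_energy:
 assumes f: "integrable lborel f" "sqint f" and s: "s > 0"
 shows "(\<integral>\<^sup>+\<xi>. ennreal ((norm (fourier1 f \<xi>))\<^sup>2 * exp (- (s * \<xi>)\<^sup>2 / 2)))
     \<le> ennreal (2 * pi) * (\<integral>\<^sup>+x. ennreal ((norm (f x))\<^sup>2))"
proof -
 note [measurable] = sqint_measurable[OF f(2)]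
 define g where "g \<xi> = complex_of_real (exp (- (s * \<xi>)\<^sup>2 / 2))" for \<xi>
 define \<kappa> where "\<kappa> t = sqrt (2 * pi) / s * exp (- (t / s)\<^sup>2 / 2)" for t
 have \<kappa>0: "\<kappa> t \<ge> 0" for t using s by (simp add: \<kappa>_def)
 have [measurable]: "g \<in> borel_measurable borel" "\<kappa> \<in> borel_measurable borel"
  unfolding g_def \<kappa>_def by measurable
 have gi: "integrable lborel g"
  unfolding g_def using gaussian_integrable[OF s, of 0] by (intro integrable_of_real) simp
 have cf: "integrable lborel (\<lambda>x. cnj (f x))" using f(1) by simp
 define B where "B = (LINT x. norm (f x))"
 have B0: "B \<ge> 0" by (simp add: B_def)
 have Gi: "integrable lborel (\<lambda>\<xi>. cnj (fourier1 f \<xi>) * g \<xi>)"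
 proof (rule Bochner_Integration.integrable_bound)
  show "integrable lborel (\<lambda>\<xi>. of_real B * g \<xi>)" using gi by simp
  show "AE \<xi> in lborel. norm (cnj (fourier1 f \<xi>) * g \<xi>) \<le> norm (of_real B * g \<xi>)"
   using norm_fourier1_le[of f] B0 by (auto simp: norm_mult B_def intro!: mult_right_mono)
 qed measurable
 have Gh: "fourier1 (\<lambda>\<xi>. cnj (fourier1 f \<xi>) * g \<xi>) x = (LINT y. cnj (f y) * of_real (\<kappa> (x - y)))" for x
 proof -
  have "fourier1 (\<lambda>\<xi>. cnj (fourier1 f \<xi>) * g \<xi>) x
    = (LINT \<xi>. LINT y. cis (- (\<xi> * x)) * cis (y * \<xi>) * cnj (f y) * g \<xi>)"
  proof -
   have "cnj (fourier1 f \<xi>) = (LINT y. cis (y * \<xi>) * cnj (f y))" for \<xi>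
    unfolding fourier1_def Bochner_Integration.integral_cnj[symmetric] by (simp add: cis_cnj del: Bochner_Integration.integral_cnj)
   moreover have "(LINT y. cis (- (\<xi> * x)) * cis (y * \<xi>) * cnj (f y) * g \<xi>)
     = cis (- (\<xi> * x)) * ((LINT y. cis (y * \<xi>) * cnj (f y)) * g \<xi>)" for \<xi>
   proof -
    have "(LINT y. cis (- (\<xi> * x)) * cis (y * \<xi>) * cnj (f y) * g \<xi>)
      = (LINT y. cis (- (\<xi> * x)) * (cis (y * \<xi>) * cnj (f y) * g \<xi>))"
     by (simp only: mult.assoc)
    also have "\<dots> = cis (- (\<xi> * x)) * (LINT y. cis (y * \<xi>) * cnj (f y) * g \<xi>)"
     by (rule integral_mult_right_zero)
    finally show ?thesis by (simp only: integral_mult_left_zero)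
   qed
   ultimately show ?thesis unfolding fourier1_def[of _ x] by (simp only:)
  qed
  also have "\<dots> = (LINT y. LINT \<xi>. cis (- (\<xi> * x)) * cis (y * \<xi>) * cnj (f y) * g \<xi>)"
   by (rule kernel_swap[OF cf gi]) (auto simp: norm_mult)
  also have "\<dots> = (LINT y. cnj (f y) * (LINT \<xi>. cis ((y - x) * \<xi>) * g \<xi>))"
   unfolding integral_mult_right_zero[symmetric]
   by (intro Bochner_Integration.integral_cong refl) (simp add: cis_mult algebra_simps)
  also have "\<dots> = (LINT y. cnj (f y) * of_real (\<kappa> (x - y)))"
   unfolding g_def gaussian_fourier[OF s] \<kappa>_def by (simp add: power_divide power2_commute)
  finally show ?thesis .
 qed
 have \<kappa>tot: "(\<integral>\<^sup>+x. ennreal (\<kappa> (x - y))) = ennreal (2 * pi)"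
   "(\<integral>\<^sup>+x. ennreal (\<kappa> (y - x))) = ennreal (2 * pi)" for y
  using gaussian_total[OF s, of y] unfolding \<kappa>_def by (simp_all add: power_divide power2_commute[of y])
 have "(\<integral>\<^sup>+\<xi>. ennreal ((norm (fourier1 f \<xi>))\<^sup>2 * exp (- (s * \<xi>)\<^sup>2 / 2)))
   = (\<integral>\<^sup>+\<xi>. ennreal (norm (fourier1 f \<xi> * (cnj (fourier1 f \<xi>) * g \<xi>))))"
  by (intro nn_integral_cong) (simp add: norm_mult g_def power2_eq_square)
 also have "\<dots> = ennreal (LINT \<xi>. norm (fourier1 f \<xi> * (cnj (fourier1 f \<xi>) * g \<xi>)))"
 proof (intro nn_integral_eq_integral integrable_norm)
  show "integrable lborel (\<lambda>\<xi>. fourier1 f \<xi> * (cnj (fourier1 f \<xi>) * g \<xi>))"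
  proof (rule Bochner_Integration.integrable_bound)
   show "integrable lborel (\<lambda>\<xi>. of_real B * (cnj (fourier1 f \<xi>) * g \<xi>))" using Gi by simp
   show "AE \<xi> in lborel. norm (fourier1 f \<xi> * (cnj (fourier1 f \<xi>) * g \<xi>)) \<le> norm (of_real B * (cnj (fourier1 f \<xi>) * g \<xi>))"
    using norm_fourier1_le[of f] B0 by (auto simp: norm_mult B_def intro!: mult_right_mono)
  qed measurable
 qed auto
 also have "(LINT \<xi>. norm (fourier1 f \<xi> * (cnj (fourier1 f \<xi>) * g \<xi>)))
   = norm (LINT \<xi>. fourier1 f \<xi> * (cnj (fourier1 f \<xi>) * g \<xi>))"
 proof -
  have e: "fourier1 f \<xi> * (cnj (fourier1 f \<xi>) * g \<xi>) = of_real (norm (fourier1 f \<xi> * (cnj (fourier1 f \<xi>) * g \<xi>)))" for \<xi>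
   unfolding mult.assoc[symmetric] complex_norm_square[symmetric]
   by (simp add: g_def norm_mult norm_power)
  have "(LINT \<xi>. fourier1 f \<xi> * (cnj (fourier1 f \<xi>) * g \<xi>))
    = (LINT \<xi>. complex_of_real (norm (fourier1 f \<xi> * (cnj (fourier1 f \<xi>) * g \<xi>))))"
   by (rule Bochner_Integration.integral_cong[OF refl]) (rule e)
  also have "\<dots> = of_real (LINT \<xi>. norm (fourier1 f \<xi> * (cnj (fourier1 f \<xi>) * g \<xi>)))"
   by (rule integral_complex_of_real)
  finally show ?thesis by simp
 qed
 also have "\<dots> = norm (LINT x. f x * (LINT y. cnj (f y) * of_real (\<kappa> (x - y))))"
  unfolding fourier1_multiplication[OF f(1) Gi] Gh ..
 also have "ennreal \<dots> \<le> (\<integral>\<^sup>+x. ennreal (norm (f x * (LINT y. cnj (f y) * of_real (\<kappa> (x - y))))))"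
  by (rule integral_norm_bound_ennreal')
 also have "\<dots> \<le> (\<integral>\<^sup>+x. \<integral>\<^sup>+y. ennreal (norm (f x) * norm (f y) * \<kappa> (x - y)))"
 proof (intro nn_integral_mono)
  fix x
  have "ennreal (norm (f x * (LINT y. cnj (f y) * of_real (\<kappa> (x - y)))))
    = ennreal (norm (f x)) * ennreal (norm (LINT y. cnj (f y) * of_real (\<kappa> (x - y))))"
   by (simp add: norm_mult ennreal_mult)
  also have "\<dots> \<le> ennreal (norm (f x)) * (\<integral>\<^sup>+y. ennreal (norm (cnj (f y) * of_real (\<kappa> (x - y)))))"
   by (intro mult_left_mono integral_norm_bound_ennreal') auto
  also have "\<dots> = (\<integral>\<^sup>+y. ennreal (norm (f x) * norm (f y) * \<kappa> (x - y)))"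
   by (subst nn_integral_cmult[symmetric]) (auto simp: norm_mult ennreal_mult \<kappa>0 mult_ac)
  finally show "ennreal (norm (f x * (LINT y. cnj (f y) * of_real (\<kappa> (x - y)))))
    \<le> (\<integral>\<^sup>+y. ennreal (norm (f x) * norm (f y) * \<kappa> (x - y)))" .
 qed
 also have "\<dots> \<le> (\<integral>\<^sup>+x. \<integral>\<^sup>+y. ennreal (1/2 * (norm (f x))\<^sup>2) * ennreal (\<kappa> (x - y)) + ennreal (1/2 * (norm (f y))\<^sup>2) * ennreal (\<kappa> (x - y)))"
 proof (intro nn_integral_mono)
  fix x y
  have "norm (f x) * norm (f y) * \<kappa> (x - y) \<le> (1/2 * (norm (f x))\<^sup>2 + 1/2 * (norm (f y))\<^sup>2) * \<kappa> (x - y)"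
   using sum_squares_bound[of "norm (f x)" "norm (f y)"] by (intro mult_right_mono \<kappa>0) simp
  also have "\<dots> = 1/2 * (norm (f x))\<^sup>2 * \<kappa> (x - y) + 1/2 * (norm (f y))\<^sup>2 * \<kappa> (x - y)"
   by (rule distrib_right)
  finally show "ennreal (norm (f x) * norm (f y) * \<kappa> (x - y)) \<le> ennreal (1/2 * (norm (f x))\<^sup>2) * ennreal (\<kappa> (x - y)) + ennreal (1/2 * (norm (f y))\<^sup>2) * ennreal (\<kappa> (x - y))"
   using \<kappa>0 by (subst (1 2) ennreal_mult[symmetric]) (auto simp: ennreal_plus[symmetric] intro!: ennreal_leI simp del: ennreal_plus)
 qed
 also have "\<dots> = (\<integral>\<^sup>+x. \<integral>\<^sup>+y. ennreal (1/2 * (norm (f x))\<^sup>2) * ennreal (\<kappa> (x - y)))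
   + (\<integral>\<^sup>+x. \<integral>\<^sup>+y. ennreal (1/2 * (norm (f y))\<^sup>2) * ennreal (\<kappa> (x - y)))"
  by (simp add: nn_integral_add)
 also have "(\<integral>\<^sup>+x. \<integral>\<^sup>+y. ennreal (1/2 * (norm (f y))\<^sup>2) * ennreal (\<kappa> (x - y)))
   = (\<integral>\<^sup>+y. \<integral>\<^sup>+x. ennreal (1/2 * (norm (f y))\<^sup>2) * ennreal (\<kappa> (x - y)))"
  by (rule lborel_pair.Fubini') measurable
 also have "(\<integral>\<^sup>+x. \<integral>\<^sup>+y. ennreal (1/2 * (norm (f x))\<^sup>2) * ennreal (\<kappa> (x - y))) + \<dots>
   = ennreal (2 * pi) * (\<integral>\<^sup>+x. ennreal (1/2 * (norm (f x))\<^sup>2)) + ennreal (2 * pi) * (\<integral>\<^sup>+x. ennreal (1/2 * (norm (f x))\<^sup>2))"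
  by (simp add: nn_integral_cmult \<kappa>tot nn_integral_multc mult.commute)
 also have "\<dots> = ennreal (2 * pi) * (\<integral>\<^sup>+x. ennreal (1/2 * (norm (f x))\<^sup>2) + ennreal (1/2 * (norm (f x))\<^sup>2))"
  by (simp add: nn_integral_add distrib_left)
 also have "(\<integral>\<^sup>+x. ennreal (1/2 * (norm (f x))\<^sup>2) + ennreal (1/2 * (norm (f x))\<^sup>2)) = (\<integral>\<^sup>+x. ennreal ((norm (f x))\<^sup>2))"
  by (intro nn_integral_cong) (simp add: ennreal_plus[symmetric] del: ennreal_plus)
 finally show ?thesis .
qed

text \<open>Fatou's lemma, as the Gaussian factor tends to \<open>1\<close>.\<close>

lemma fourier1_bounded:
 assumes f: "integrable lborel f" "sqint f"
 shows "sqint (fourier1 f)" "l2norm (fourier1 f) \<le> sqrt (2 * pi) * l2norm f"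
proof -
 note m[measurable] = sqint_measurable[OF f(2)]
 have "(\<integral>\<^sup>+\<xi>. ennreal ((norm (fourier1 f \<xi>))\<^sup>2))
   = (\<integral>\<^sup>+\<xi>. liminf (\<lambda>n. ennreal ((norm (fourier1 f \<xi>))\<^sup>2 * exp (- (1 / real (Suc n) * \<xi>)\<^sup>2 / 2))))"
 proof (intro nn_integral_cong)
  fix \<xi> :: real
  have "(\<lambda>n. ennreal ((norm (fourier1 f \<xi>))\<^sup>2 * exp (- (1 / real (Suc n) * \<xi>)\<^sup>2 / 2)))
    \<longlonglongrightarrow> ennreal ((norm (fourier1 f \<xi>))\<^sup>2 * exp (- (0 * \<xi>)\<^sup>2 / 2))"
   by (intro tendsto_intros LIMSEQ_inverse_real_of_nat[unfolded inverse_eq_divide]) simp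
  from lim_imp_Liminf[OF _ this]
  show "ennreal ((norm (fourier1 f \<xi>))\<^sup>2) = liminf (\<lambda>n. ennreal ((norm (fourier1 f \<xi>))\<^sup>2 * exp (- (1 / real (Suc n) * \<xi>)\<^sup>2 / 2)))"
   by simp
 qed
 also have "\<dots> \<le> liminf (\<lambda>n. \<integral>\<^sup>+\<xi>. ennreal ((norm (fourier1 f \<xi>))\<^sup>2 * exp (- (1 / real (Suc n) * \<xi>)\<^sup>2 / 2)))"
  by (rule nn_integral_liminf) simp
 also have "\<dots> \<le> liminf (\<lambda>n::nat. ennreal (2 * pi) * (\<integral>\<^sup>+x. ennreal ((norm (f x))\<^sup>2)))"
  by (intro Liminf_mono always_eventually allI fourier1_smoothed_energy f) simp
 also have "\<dots> = ennreal (2 * pi) * (\<integral>\<^sup>+x. ennreal ((norm (f x))\<^sup>2))"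
  by (simp add: Liminf_const)
 also have "\<dots> = ennreal (2 * pi * (l2norm f)\<^sup>2)"
  using L2_normsq_eq_l2norm[OF f(2)] by (simp add: L2_normsq_UNIV ennreal_mult)
 finally have le: "(\<integral>\<^sup>+\<xi>. ennreal ((norm (fourier1 f \<xi>))\<^sup>2)) \<le> ennreal (2 * pi * (l2norm f)\<^sup>2)" .
 then show s: "sqint (fourier1 f)"
  unfolding sqint_iff_nn by (auto simp: top_unique less_top[symmetric])
 have "(l2norm (fourier1 f))\<^sup>2 \<le> 2 * pi * (l2norm f)\<^sup>2"
  using le L2_normsq_eq_l2norm[OF s] by (simp add: L2_normsq_UNIV)
 also have "\<dots> = (sqrt (2 * pi) * l2norm f)\<^sup>2" by (simp add: power_mult_distrib)
 finally show "l2norm (fourier1 f) \<le> sqrt (2 * pi) * l2norm f"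
  by (rule power2_le_imp_le) simp
qed

subsection \<open>Injectivity on integrable functions\<close>

text \<open>The positive and the negative part of \<open>h\<close> have equal mass. Normalised to probability densities they have
the same characteristic function, hence they agree.\<close>

lemma real_integrable_zero_fourier:
 fixes h :: "real \<Rightarrow> real"
 assumes h: "integrable lborel h" and z: "\<And>t. (LINT x. cis (t * x) * of_real (h x)) = 0"
 shows "AE x in lborel. h x = 0"
proof -
 note [measurable] = borel_measurable_integrable[OF h]
 define p n where "p x = max (h x) 0" and "n x = max (- h x) 0" for x
 have [measurable]: "p \<in> borel_measurable borel" "n \<in> borel_measurable borel" unfolding p_def n_def by measurable
 have pi: "integrable lborel p" and ni: "integrable lborel n"
  unfolding p_def n_def using h by (auto intro: integrable_max)
 have hpn: "h x = p x - n x" for x by (simp add: p_def n_def)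
 have ci: "integrable lborel (\<lambda>x. cis (t * x) * complex_of_real (q x))" if "integrable lborel q" for q t
  by (rule integrable_unimodular_mult) (use that in auto)
 have eq: "(LINT x. cis (t * x) * of_real (p x)) = (LINT x. cis (t * x) * of_real (n x))" for t
  using z[of t] ci[OF pi] ci[OF ni] by (simp add: hpn right_diff_distrib)
 define m where "m = (LINT x. p x)"
 have m': "(LINT x. n x) = m"
  using eq[of 0] by (simp add: m_def)
 have m0: "m \<ge> 0" unfolding m_def by (intro Bochner_Integration.integral_nonneg) (simp add: p_def)
 show ?thesis
 proof (cases "m = 0")
  case True
  have nn: "AE x in lborel. 0 \<le> p x" "AE x in lborel. 0 \<le> n x" by (simp_all add: p_def n_def)
  have "AE x in lborel. p x = 0" "AE x in lborel. n x = 0"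
   using integral_nonneg_eq_0_iff_AE[OF pi nn(1)] integral_nonneg_eq_0_iff_AE[OF ni nn(2)] True m'
   by (simp_all add: m_def)
  then show ?thesis by eventually_elim (simp add: hpn)
 next
  case False
  then have m: "m > 0" using m0 by simp
  have rd: "real_distribution (density lborel (\<lambda>x. ennreal (q x / m)))"
   and ch: "char (density lborel (\<lambda>x. ennreal (q x / m))) = (\<lambda>t. (LINT x. cis (t * x) * of_real (q x)) / of_real m)"
   if q: "integrable lborel q" "\<And>x. q x \<ge> 0" "(LINT x. q x) = m" for q
  proof -
   note [measurable] = borel_measurable_integrable[OF q(1)]
   have "(\<integral>\<^sup>+x. ennreal (q x / m)) = ennreal (LINT x. q x / m)"
    using q m by (intro nn_integral_eq_integral) auto
   also have "\<dots> = 1" using q m by simp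
   finally have "prob_space (density lborel (\<lambda>x. ennreal (q x / m)))"
    by (intro prob_spaceI) (simp add: emeasure_density)
   then show "real_distribution (density lborel (\<lambda>x. ennreal (q x / m)))"
    by (simp add: real_distribution_def real_distribution_axioms_def)
   show "char (density lborel (\<lambda>x. ennreal (q x / m))) = (\<lambda>t. (LINT x. cis (t * x) * of_real (q x)) / of_real m)"
   proof
    fix t
    have "char (density lborel (\<lambda>x. ennreal (q x / m))) t = (LINT x. (q x / m) *\<^sub>R iexp (t * x))"
     unfolding char_def using q m by (subst integral_density) auto
    also have "\<dots> = (LINT x. (cis (t * x) * of_real (q x)) / of_real m)"
     by (rule Bochner_Integration.integral_cong) (simp_all add: cis_conv_exp scaleR_conv_of_real)
    finally show "char (density lborel (\<lambda>x. ennreal (q x / m))) t = (LINT x. cis (t * x) * of_real (q x)) / of_real m"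
     by simp
   qed
  qed
  have p0: "p x \<ge> 0" and n0: "n x \<ge> 0" for x by (simp_all add: p_def n_def)
  have "density lborel (\<lambda>x. ennreal (p x / m)) = density lborel (\<lambda>x. ennreal (n x / m))"
   using rd[OF pi p0 m_def[symmetric]] rd[OF ni n0 m'] ch[OF pi p0 m_def[symmetric]] ch[OF ni n0 m']
   by (intro Levy_uniqueness) (simp_all add: eq)
  then have "AE x in lborel. ennreal (p x / m) = ennreal (n x / m)"
   by (intro sigma_finite_measure.density_unique[OF sigma_finite_lborel]) auto
  then show ?thesis
   by eventually_elim (use m p0 n0 in \<open>simp add: hpn\<close>)
 qed
qed

lemma integrable_zero_fourier:
 fixes h :: "real \<Rightarrow> complex"
 assumes h: "integrable lborel h" and z: "\<And>t. (LINT x. cis (t * x) * h x) = 0"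
 shows "AE x in lborel. h x = 0"
proof -
 have ci: "integrable lborel (\<lambda>x. cis (t * x) * q x)" if "integrable lborel q" for q t
  by (rule integrable_unimodular_mult) (use that in auto)
 have hc: "integrable lborel (\<lambda>x. cnj (h x))" using h by simp
 have z': "(LINT x. cis (t * x) * cnj (h x)) = 0" for t
 proof -
  have "(LINT x. cis (t * x) * cnj (h x)) = (LINT x. cnj (cis (- t * x) * h x))"
   by (simp add: cis_cnj)
  also have "\<dots> = cnj (LINT x. cis (- t * x) * h x)"
   by (rule Bochner_Integration.integral_cnj)
  finally show ?thesis by (simp only: z) simp
 qed
 have "(LINT x. cis (t * x) * of_real (Re (h x))) = 0" for t
 proof -
  have "(LINT x. cis (t * x) * of_real (Re (h x))) = (LINT x. (1/2) * (cis (t * x) * h x + cis (t * x) * cnj (h x)))"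
   by (intro Bochner_Integration.integral_cong refl)
    (simp add: distrib_left[symmetric] complex_add_cnj)
  also have "\<dots> = 0" using ci[OF h, of t] ci[OF hc, of t] z[of t] z'[of t] by simp
  finally show ?thesis .
 qed
 then have 1: "AE x in lborel. Re (h x) = 0"
  using h by (intro real_integrable_zero_fourier) auto
 have "(LINT x. cis (t * x) * of_real (Im (h x))) = 0" for t
 proof -
  have "(LINT x. cis (t * x) * of_real (Im (h x))) = (LINT x. (- \<i>/2) * (cis (t * x) * h x - cis (t * x) * cnj (h x)))"
   by (intro Bochner_Integration.integral_cong refl)
    (simp add: right_diff_distrib[symmetric] complex_diff_cnj complex_eq_iff)
  also have "\<dots> = 0" using ci[OF h, of t] ci[OF hc, of t] z[of t] z'[of t] by simp
  finally show ?thesis .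
 qed
 then have 2: "AE x in lborel. Im (h x) = 0"
  using h by (intro real_integrable_zero_fourier) auto
 show ?thesis using 1 2 by eventually_elim (simp add: complex_eq_iff)
qed

subsection \<open>The transform of square-integrable functions\<close>

definition trunc :: "real \<Rightarrow> (real \<Rightarrow> complex) \<Rightarrow> real \<Rightarrow> complex" where
 "trunc R f x = indicator {-R..R} x *\<^sub>R f x"

text \<open>The scalar counterpart of \<open>is_fourier_L2\<close>.\<close>

definition isf :: "(real \<Rightarrow> complex) \<Rightarrow> (real \<Rightarrow> complex) \<Rightarrow> bool" where
 "isf f g \<longleftrightarrow> sqint f \<and> sqint g \<and> ((\<lambda>R. l2norm (\<lambda>\<xi>. g \<xi> - fourier1 (trunc R f) \<xi>)) \<longlongrightarrow> 0) at_top"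

lemma trunc_measurable [measurable]: "f \<in> borel_measurable borel \<Longrightarrow> trunc R f \<in> borel_measurable borel"
 unfolding trunc_def by measurable

lemma sqint_trunc: "sqint f \<Longrightarrow> sqint (trunc R f)"
 by (rule sqint_bound(1)[of f _ 1]) (auto simp: trunc_def split: split_indicator)

lemma integrable_trunc: assumes f: "sqint f" shows "integrable lborel (trunc R f)"
proof -
 note [measurable] = sqint_measurable[OF f]
 have "sqint (\<lambda>x. indicator {-R..R} x :: real)"
 proof -
  have "(norm (indicator {-R..R} x :: real))\<^sup>2 = indicator {-R..R} x" for x by (simp split: split_indicator)
  then show ?thesis unfolding sqint_def by (simp add: integrable_real_indicator emeasure_lborel_Icc_eq)
 qed
 from sqint_norm_mult_integrable[OF this f]
 show ?thesis
  by (rule Bochner_Integration.integrable_bound) (auto simp: trunc_def)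
qed

lemma trunc_tendsto: assumes f: "sqint f"
 shows "((\<lambda>R. l2norm (\<lambda>x. f x - trunc R f x)) \<longlongrightarrow> 0) at_top"
proof -
 note [measurable] = sqint_measurable[OF f] sqint_measurable[OF sqint_trunc[OF f]]
 have "((\<lambda>R. LINT x. (norm (f x - trunc R f x))\<^sup>2) \<longlongrightarrow> integral\<^sup>L lborel (\<lambda>x::real. 0::real)) at_top"
 proof (rule tendsto_at_topI_sequentially)
  fix X :: "nat \<Rightarrow> real" assume X: "filterlim X at_top sequentially"
  show "(\<lambda>n. LINT x. (norm (f x - trunc (X n) f x))\<^sup>2) \<longlonglongrightarrow> integral\<^sup>L lborel (\<lambda>x::real. 0::real)"
  proof (rule integral_dominated_convergence[where w="\<lambda>x. (norm (f x))\<^sup>2"])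
   show "integrable lborel (\<lambda>x. (norm (f x))\<^sup>2)" using f by (simp add: sqint_def)
   show "AE x in lborel. norm ((norm (f x - trunc (X n) f x))\<^sup>2) \<le> (norm (f x))\<^sup>2" for n
    by (intro AE_I2) (auto simp: trunc_def split: split_indicator)
   show "AE x in lborel. (\<lambda>n. (norm (f x - trunc (X n) f x))\<^sup>2) \<longlonglongrightarrow> 0"
   proof (rule AE_I2)
    fix x
    have "\<forall>\<^sub>F n in sequentially. \<bar>x\<bar> \<le> X n"
     using X by (simp add: filterlim_at_top)
    then have "\<forall>\<^sub>F n in sequentially. (norm (f x - trunc (X n) f x))\<^sup>2 = 0"
     by eventually_elim (auto simp: trunc_def indicator_def)
    then show "(\<lambda>n. (norm (f x - trunc (X n) f x))\<^sup>2) \<longlonglongrightarrow> 0" by (rule tendsto_eventually)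
   qed
  qed auto
 qed
 then have "((\<lambda>R. sqrt (LINT x. (norm (f x - trunc R f x))\<^sup>2)) \<longlongrightarrow> sqrt 0) at_top"
  by (intro tendsto_real_sqrt) simp
 then show ?thesis by (simp add: l2norm_def)
qed

lemma fourier1_diff:
 assumes "integrable lborel f" "integrable lborel g"
 shows "fourier1 (\<lambda>x. f x - g x) \<xi> = fourier1 f \<xi> - fourier1 g \<xi>"
 unfolding fourier1_def using assms by (simp add: right_diff_distrib)

lemma fourier1_diff_l2:
 assumes f: "integrable lborel f" "sqint f" and g: "integrable lborel g" "sqint g"
 shows "l2norm (\<lambda>\<xi>. fourier1 f \<xi> - fourier1 g \<xi>) \<le> sqrt (2 * pi) * l2norm (\<lambda>x. f x - g x)"
proof -
 have "fourier1 (\<lambda>x. f x - g x) = (\<lambda>\<xi>. fourier1 f \<xi> - fourier1 g \<xi>)"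
  by (rule ext, rule fourier1_diff[OF f(1) g(1)])
 then show ?thesis using fourier1_bounded(2)[of "\<lambda>x. f x - g x"] f g by (simp add: sqint_diff)
qed

lemma isf_fourier1:
 assumes f: "integrable lborel f" "sqint f"
 shows "isf f (fourier1 f)"
 unfolding isf_def
proof (intro conjI f fourier1_bounded)
 have "((\<lambda>R. sqrt (2 * pi) * l2norm (\<lambda>x. f x - trunc R f x)) \<longlongrightarrow> sqrt (2 * pi) * 0) at_top"
  by (intro tendsto_intros trunc_tendsto f)
 then have "((\<lambda>R. sqrt (2 * pi) * l2norm (\<lambda>x. f x - trunc R f x)) \<longlongrightarrow> 0) at_top" by simp
 then show "((\<lambda>R. l2norm (\<lambda>\<xi>. fourier1 f \<xi> - fourier1 (trunc R f) \<xi>)) \<longlongrightarrow> 0) at_top"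
  by (rule tendsto_0_le[where K=1])
   (use fourier1_diff_l2[OF f integrable_trunc sqint_trunc, OF f(2) f(2)] in auto)
qed

lemma isf_exists:
 assumes f: "sqint f" shows "\<exists>g. isf f g"
proof -
 let ?F = "\<lambda>R. fourier1 (trunc R f)"
 note b = fourier1_bounded[OF integrable_trunc[OF f] sqint_trunc[OF f]]
 have d: "l2norm (\<lambda>\<xi>. ?F R \<xi> - ?F S \<xi>) \<le> sqrt (2 * pi) * (l2norm (\<lambda>x. f x - trunc R f x) + l2norm (\<lambda>x. f x - trunc S f x))" for R S
 proof -
  have "l2norm (\<lambda>\<xi>. ?F R \<xi> - ?F S \<xi>) \<le> sqrt (2 * pi) * l2norm (\<lambda>x. trunc R f x - trunc S f x)"
   by (intro fourier1_diff_l2 integrable_trunc sqint_trunc f)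
  also have "l2norm (\<lambda>x. trunc R f x - trunc S f x) \<le> l2norm (\<lambda>x. trunc R f x - f x) + l2norm (\<lambda>x. f x - trunc S f x)"
   by (intro l2norm_triangle_diff sqint_trunc f)
  finally show ?thesis by (simp add: l2norm_diff_swap[of f])
 qed
 have tail: "\<exists>N::real. \<forall>R\<ge>N. sqrt (2 * pi) * l2norm (\<lambda>x. f x - trunc R f x) < e" if "e > 0" for e
 proof -
  have "((\<lambda>R. sqrt (2 * pi) * l2norm (\<lambda>x. f x - trunc R f x)) \<longlongrightarrow> sqrt (2 * pi) * 0) at_top"
   by (intro tendsto_intros trunc_tendsto f)
  from order_tendstoD(2)[OF this, of e] that show ?thesis by (simp add: eventually_at_top_linorder)
 qed
 have "\<exists>g r. sqint g \<and> (\<lambda>n. l2norm (\<lambda>x. ?F (real n) x - g x)) \<longlonglongrightarrow> 0 \<and> strict_mono r \<and>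
   (AE x in lborel. (\<lambda>n. ?F (real (r n)) x) \<longlonglongrightarrow> g x)"
 proof (rule l2_complete)
  show "sqint (?F (real n))" for n by (rule b)
  fix e :: real assume "e > 0"
  then obtain N where N: "\<And>R. R \<ge> N \<Longrightarrow> sqrt (2 * pi) * l2norm (\<lambda>x. f x - trunc R f x) < e/2"
   using tail[of "e/2"] by auto
  obtain M :: nat where M: "N \<le> M" using real_arch_simple by blast
  show "\<exists>N. \<forall>m\<ge>N. \<forall>n\<ge>N. l2norm (\<lambda>x. ?F (real m) x - ?F (real n) x) < e"
  proof (intro exI[of _ M] allI impI)
   fix m n assume "M \<le> m" "M \<le> n"
   then show "l2norm (\<lambda>x. ?F (real m) x - ?F (real n) x) < e"
    using N[of m] N[of n] M d[of m n] by (simp add: distrib_left)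
  qed
 qed
 then obtain g where g: "sqint g" "(\<lambda>n. l2norm (\<lambda>x. ?F (real n) x - g x)) \<longlonglongrightarrow> 0" by blast
 have "((\<lambda>R. l2norm (\<lambda>\<xi>. g \<xi> - ?F R \<xi>)) \<longlongrightarrow> 0) at_top"
 proof (rule tendstoI)
  fix e :: real assume e: "e > 0"
  then obtain N where N: "\<And>R. R \<ge> N \<Longrightarrow> sqrt (2 * pi) * l2norm (\<lambda>x. f x - trunc R f x) < e/3"
   using tail[of "e/3"] by auto
  obtain M :: nat where M: "N \<le> M" using real_arch_simple by blast
  obtain L where L: "\<And>n. n \<ge> L \<Longrightarrow> l2norm (\<lambda>x. ?F (real n) x - g x) < e/3"
   using LIMSEQ_D[OF g(2), of "e/3"] e by auto
  let ?n = "max L M"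
  show "\<forall>\<^sub>F R in at_top. dist (l2norm (\<lambda>\<xi>. g \<xi> - ?F R \<xi>)) 0 < e"
   using eventually_ge_at_top[of N]
  proof eventually_elim
   case (elim R)
   have "l2norm (\<lambda>\<xi>. g \<xi> - ?F R \<xi>) \<le> l2norm (\<lambda>\<xi>. g \<xi> - ?F (real ?n) \<xi>) + l2norm (\<lambda>\<xi>. ?F (real ?n) \<xi> - ?F R \<xi>)"
    by (intro l2norm_triangle_diff g b)
   also have "\<dots> < e"
    using L[of ?n] N[of ?n] N[OF elim] M d[of ?n R] l2norm_diff_swap[of g "?F (real ?n)"]
    by (simp only: distrib_left of_nat_max) linarith
   finally show ?case by simp
  qed
 qed
 then show ?thesis using f g(1) unfolding isf_def by blast
qed

lemma isf_cong_AE: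
 assumes fg: "isf f g" and f': "f' \<in> borel_measurable borel" "AE x in lborel. f x = f' x"
  and g': "g' \<in> borel_measurable borel" "AE x in lborel. g x = g' x"
 shows "isf f' g'"
proof -
 have s: "sqint f" "sqint g" using fg by (auto simp: isf_def)
 note [measurable] = sqint_measurable[OF s(1)] sqint_measurable[OF s(2)] f'(1) g'(1)
 have t: "fourier1 (trunc R f') = fourier1 (trunc R f)" for R
  unfolding fourier1_def trunc_def using f'(2) by (intro ext integral_cong_AE) auto
 have [measurable]: "trunc R f \<in> borel_measurable borel" for R unfolding trunc_def by measurable
 have "l2norm (\<lambda>\<xi>. g' \<xi> - fourier1 (trunc R f') \<xi>) = l2norm (\<lambda>\<xi>. g \<xi> - fourier1 (trunc R f) \<xi>)" for R
  unfolding t using g'(2) by (intro l2norm_cong_AE) auto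
 then show ?thesis using fg sqint_cong_AE[OF s(1) f'] sqint_cong_AE[OF s(2) g'] by (simp add: isf_def)
qed

lemma isf_unique:
 assumes "isf f g" "isf f g'" shows "AE x in lborel. g x = g' x"
proof -
 have f: "sqint f" and g: "sqint g" and g': "sqint g'" using assms by (auto simp: isf_def)
 note b = fourier1_bounded[OF integrable_trunc[OF f] sqint_trunc[OF f]]
 have "((\<lambda>R. l2norm (\<lambda>\<xi>. g \<xi> - fourier1 (trunc R f) \<xi>) + l2norm (\<lambda>\<xi>. g' \<xi> - fourier1 (trunc R f) \<xi>)) \<longlongrightarrow> 0 + 0) at_top"
  using assms by (intro tendsto_add) (auto simp: isf_def)
 then have "l2norm (\<lambda>\<xi>. g \<xi> - g' \<xi>) \<le> 0 + 0"
 proof (rule tendsto_lowerbound)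
  show "\<forall>\<^sub>F R in at_top. l2norm (\<lambda>\<xi>. g \<xi> - g' \<xi>) \<le> l2norm (\<lambda>\<xi>. g \<xi> - fourier1 (trunc R f) \<xi>) + l2norm (\<lambda>\<xi>. g' \<xi> - fourier1 (trunc R f) \<xi>)"
   using l2norm_triangle_diff[OF g b(1) g'] l2norm_diff_swap[of g'] by (intro always_eventually) auto
 qed simp
 then have "l2norm (\<lambda>\<xi>. g \<xi> - g' \<xi>) = 0" using l2norm_nonneg[of "\<lambda>\<xi>. g \<xi> - g' \<xi>"] by linarith
 then show ?thesis using l2norm_eq_0_iff[OF sqint_diff[OF g g']] by simp
qed

lemma sqint_mult_integrable:
 fixes f g :: "real \<Rightarrow> complex"
 assumes f: "sqint f" and g: "sqint g"
 shows "integrable lborel (\<lambda>x. f x * g x)"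
proof -
 note [measurable] = sqint_measurable[OF f] sqint_measurable[OF g]
 show ?thesis
  by (rule Bochner_Integration.integrable_bound[OF sqint_norm_mult_integrable[OF f g]]) (auto simp: norm_mult)
qed

lemma sqint_mult_integral_bound:
 fixes f g :: "real \<Rightarrow> complex"
 assumes f: "sqint f" and g: "sqint g"
 shows "norm (LINT x. f x * g x) \<le> l2norm f * l2norm g"
 using integral_norm_bound[of lborel "\<lambda>x. f x * g x"] l2_Cauchy_Schwarz[OF f g] by (simp add: norm_mult)

lemma isf_multiplication:
 assumes fg: "isf f g" and p: "integrable lborel p" "sqint p"
 shows "(LINT x. g x * p x) = (LINT x. f x * fourier1 p x)"
proof -
 have f: "sqint f" and g: "sqint g" using fg by (auto simp: isf_def)
 note b = fourier1_bounded[OF integrable_trunc[OF f] sqint_trunc[OF f]]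
 note bp = fourier1_bounded[OF p]
 let ?d = "(LINT x. g x * p x) - (LINT x. f x * fourier1 p x)"
 have "((\<lambda>R. l2norm (\<lambda>\<xi>. g \<xi> - fourier1 (trunc R f) \<xi>) * l2norm p + l2norm (\<lambda>x. f x - trunc R f x) * l2norm (fourier1 p)) \<longlongrightarrow> 0 * l2norm p + 0 * l2norm (fourier1 p)) at_top"
  using fg by (intro tendsto_intros trunc_tendsto f) (auto simp: isf_def)
 then have "norm ?d \<le> 0 * l2norm p + 0 * l2norm (fourier1 p)"
 proof (rule tendsto_lowerbound)
  have "norm ?d \<le> l2norm (\<lambda>\<xi>. g \<xi> - fourier1 (trunc R f) \<xi>) * l2norm p + l2norm (\<lambda>x. f x - trunc R f x) * l2norm (fourier1 p)" for R
  proof -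
   have d: "?d = (LINT x. (g x - fourier1 (trunc R f) x) * p x) - (LINT x. (f x - trunc R f x) * fourier1 p x)"
    using fourier1_multiplication[OF integrable_trunc[OF f] p(1), of R] sqint_mult_integrable[OF g p(2)]
     sqint_mult_integrable[OF b(1) p(2)] sqint_mult_integrable[OF f bp(1)] sqint_mult_integrable[OF sqint_trunc[OF f] bp(1)]
    by (simp add: left_diff_distrib)
   have "norm ?d \<le> norm (LINT x. (g x - fourier1 (trunc R f) x) * p x) + norm (LINT x. (f x - trunc R f x) * fourier1 p x)"
    unfolding d by (rule norm_triangle_ineq4)
   also have "\<dots> \<le> l2norm (\<lambda>\<xi>. g \<xi> - fourier1 (trunc R f) \<xi>) * l2norm p + l2norm (\<lambda>x. f x - trunc R f x) * l2norm (fourier1 p)"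
    by (intro add_mono sqint_mult_integral_bound sqint_diff g b p f sqint_trunc bp)
   finally show ?thesis .
  qed
  then show "\<forall>\<^sub>F R in at_top. norm ?d \<le> l2norm (\<lambda>\<xi>. g \<xi> - fourier1 (trunc R f) \<xi>) * l2norm p + l2norm (\<lambda>x. f x - trunc R f x) * l2norm (fourier1 p)"
   by (intro always_eventually) auto
 qed simp
 then show ?thesis by simp
qed

subsection \<open>Inversion and Parseval\<close>

text \<open>Modulated Gaussians and their transforms \<open>gmh\<close>. They serve as test functions: they are total in \<open>L\<^sup>2\<close>,
and integrable together with their transforms.\<close>

definition gm :: "real \<Rightarrow> real \<Rightarrow> complex" where
 "gm a x = cis (a * x) * of_real (exp (- x\<^sup>2 / 2))"

definition gmh :: "real \<Rightarrow> real \<Rightarrow> complex" where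
 "gmh a \<xi> = of_real (sqrt (2 * pi) * exp (- (\<xi> - a)\<^sup>2 / 2))"

lemma gmh_measurable [measurable]: "gmh a \<in> borel_measurable borel"
 unfolding gmh_def[abs_def] by measurable

lemma gm_int: "integrable lborel (gm a)" "integrable lborel (gmh a)"
proof -
 have "integrable lborel (\<lambda>x. cis (a * x) * complex_of_real (exp (- (1 * x - 0)\<^sup>2 / 2)))"
  using gaussian_integrable[of 1 0] by (intro integrable_unimodular_mult integrable_of_real) auto
 then show "integrable lborel (gm a)" by (simp add: gm_def[abs_def])
 have "integrable lborel (\<lambda>x. complex_of_real (sqrt (2 * pi) * exp (- (1 * x - a)\<^sup>2 / 2)))"
  using gaussian_integrable[of 1 a] by (intro integrable_of_real) simp
 then show "integrable lborel (gmh a)" by (simp add: gmh_def[abs_def])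
qed

lemma sqint_bounded_integrable:
 assumes f: "integrable lborel f" and b: "\<And>x. norm (f x) \<le> C"
 shows "sqint f"
proof -
 note [measurable] = borel_measurable_integrable[OF f]
 have C: "C \<ge> 0" using b[of undefined] norm_ge_zero order_trans by blast
 have "integrable lborel (\<lambda>x. (norm (f x))\<^sup>2)"
 proof (rule Bochner_Integration.integrable_bound)
  show "integrable lborel (\<lambda>x. C * norm (f x))" using f by simp
  show "AE x in lborel. norm ((norm (f x))\<^sup>2) \<le> norm (C * norm (f x))"
   using b C by (auto simp: power2_eq_square intro!: mult_right_mono)
 qed simp
 then show ?thesis by (simp add: sqint_def)
qed

lemma gm_sq: "sqint (gm a)" "sqint (gmh a)"
proof -
 show "sqint (gm a)" by (rule sqint_bounded_integrable[OF gm_int(1), of _ 1]) (simp add: gm_def norm_mult)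
 show "sqint (gmh a)" by (rule sqint_bounded_integrable[OF gm_int(2), of _ "sqrt (2 * pi)"])
  (simp add: gmh_def norm_mult)
qed

lemma fourier_gm: "fourier1 (gm a) = gmh a"
proof
 fix \<xi>
 have "fourier1 (gm a) \<xi> = (LINT x. cis ((a - \<xi>) * x) * complex_of_real (exp (- x\<^sup>2 / 2)))"
  unfolding fourier1_def gm_def mult.assoc[symmetric] cis_mult
  by (intro Bochner_Integration.integral_cong refl) (simp add: algebra_simps)
 then show "fourier1 (gm a) \<xi> = gmh a \<xi>"
  by (simp only: gaussian_fourier_std gmh_def power2_commute)
qed

lemma fourier_gmh: "fourier1 (gmh a) x = 2 * pi * gm a (- x)"
proof -
 have "fourier1 (gmh a) x = (LINT \<xi>. of_real (sqrt (2 * pi)) * (cis (- (\<xi> * x)) * complex_of_real (exp (- (\<xi> - a)\<^sup>2 / 2))))"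
  unfolding fourier1_def gmh_def by (simp add: mult_ac)
 also have "\<dots> = \<bar>1\<bar> *\<^sub>R (LINT \<xi>. of_real (sqrt (2 * pi)) * (cis (- ((a + 1 * \<xi>) * x)) * complex_of_real (exp (- (a + 1 * \<xi> - a)\<^sup>2 / 2))))"
  by (rule lborel_integral_real_affine) simp
 also have "\<dots> = (LINT \<xi>. (of_real (sqrt (2 * pi)) * cis (- (a * x))) * (cis ((- x) * \<xi>) * complex_of_real (exp (- \<xi>\<^sup>2 / 2))))"
 proof -
  have "cis (- ((a + 1 * \<xi>) * x)) = cis (- (a * x)) * cis ((- x) * \<xi>)" for \<xi>
   by (simp add: cis_mult algebra_simps)
  then show ?thesis by (simp only:) (simp add: mult_ac)
 qed
 also have "\<dots> = (of_real (sqrt (2 * pi)) * cis (- (a * x))) * (LINT \<xi>. (cis ((- x) * \<xi>) * complex_of_real (exp (- \<xi>\<^sup>2 / 2))))"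
  by (rule integral_mult_right_zero)
 also have "\<dots> = of_real (sqrt (2 * pi) * sqrt (2 * pi)) * gm a (- x)"
  unfolding gaussian_fourier_std gm_def by (simp only: of_real_mult) simp
 finally show ?thesis by simp
qed

lemma gm_minus: "gm a (- x) = gm (- a) x" "gmh a (- x) = gmh (- a) x" "cnj (gm a x) = gm (- a) x" "cnj (gmh a x) = gmh a x"
proof -
 have "(- x - a)\<^sup>2 = (x - - a)\<^sup>2" by (simp add: power2_eq_square algebra_simps)
 then show "gmh a (- x) = gmh (- a) x" unfolding gmh_def by simp
qed (simp_all add: gm_def gmh_def cis_cnj)

lemma isf_gm: "isf f g \<Longrightarrow> (LINT x. g x * gm a x) = (LINT x. f x * gmh a x)"
 using isf_multiplication[OF _ gm_int(1) gm_sq(1)] by (simp add: fourier_gm)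

text \<open>A Gaussian factor makes a square-integrable function integrable, so that the vanishing integrals are its Fourier
transform.\<close>

lemma gm_total:
 assumes d: "sqint d" and z: "\<And>a. (LINT x. d x * gm a x) = 0"
 shows "AE x in lborel. d x = 0"
proof -
 have "AE x in lborel. d x * complex_of_real (exp (- x\<^sup>2 / 2)) = 0"
 proof (rule integrable_zero_fourier)
  show "integrable lborel (\<lambda>x. d x * complex_of_real (exp (- x\<^sup>2 / 2)))"
   using sqint_mult_integrable[OF d gm_sq(1)[of 0]] by (simp add: gm_def)
  show "(LINT x. cis (t * x) * (d x * complex_of_real (exp (- x\<^sup>2 / 2)))) = 0" for t
   using z[of t] by (simp add: gm_def mult_ac)
 qed
 then show ?thesis by simp
qed

text \<open>Testing against a total family determines the transform. This avoids the limit of truncations in all that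
follows.\<close>

lemma isf_of_weak:
 assumes f: "sqint f" and g: "sqint g"
  and w: "\<And>a. (LINT x. g x * gm a x) = (LINT x. f x * gmh a x)"
 shows "isf f g"
proof -
 obtain g' where g': "isf f g'" using isf_exists[OF f] by blast
 then have s: "sqint g'" by (simp add: isf_def)
 have "AE x in lborel. g' x - g x = 0"
 proof (rule gm_total)
  show "sqint (\<lambda>x. g' x - g x)" by (intro sqint_diff s g)
  show "(LINT x. (g' x - g x) * gm a x) = 0" for a
   using isf_gm[OF g', of a] w[of a] sqint_mult_integrable[OF s gm_sq(1)[of a]] sqint_mult_integrable[OF g gm_sq(1)[of a]]
   by (simp add: left_diff_distrib)
 qed
 then show ?thesis
  by (intro isf_cong_AE[OF g']) (use f g in \<open>auto simp: sqint_def\<close>)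
qed

lemma lborel_integral_reflect: "(LINT x. (f (- x) :: complex)) = (LINT x. f (x::real))"
 using lborel_integral_real_affine[of "-1" f 0] by simp

lemma sqint_reflect: assumes f: "sqint (f :: real \<Rightarrow> 'b::euclidean_space)" shows "sqint (\<lambda>x. f (- x))"
proof -
 have "integrable lborel (\<lambda>x. (norm (f (0 + (-1) * x)))\<^sup>2)"
  using f by (subst lborel_integrable_real_affine_iff) (auto simp: sqint_def)
 moreover have [measurable]: "f \<in> borel_measurable borel" using f by (simp add: sqint_def)
 ultimately show ?thesis by (simp add: sqint_def)
qed

lemma sqint_translate: assumes f: "sqint (f :: real \<Rightarrow> 'b::euclidean_space)" shows "sqint (\<lambda>x. f (x + c))"
proof -
 have "integrable lborel (\<lambda>x. (norm (f (c + 1 * x)))\<^sup>2)"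
  using f by (subst lborel_integrable_real_affine_iff) (auto simp: sqint_def)
 moreover have [measurable]: "f \<in> borel_measurable borel" using f by (simp add: sqint_def)
 ultimately show ?thesis by (simp add: sqint_def add.commute)
qed

lemma isf_inverse_exists:
 assumes g: "sqint g" shows "\<exists>f. isf f g"
proof -
 obtain k where k: "isf g k" using isf_exists[OF g] by blast
 then have ks: "sqint k" by (simp add: isf_def)
 define f where "f x = (1 / (2 * pi)) *\<^sub>R k (- x)" for x
 have fs: "sqint f" unfolding f_def by (intro sqint_scaleR sqint_reflect ks)
 have "isf f g"
 proof (rule isf_of_weak[OF fs g])
  fix a
  have "(LINT x. f x * gmh a x) = (LINT x. (1 / (2 * pi)) *\<^sub>R ((\<lambda>x. k x * gmh (- a) x) (- x)))"
   by (intro Bochner_Integration.integral_cong refl) (simp add: f_def gm_minus)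
  also have "\<dots> = (1 / (2 * pi)) *\<^sub>R (LINT x. k x * gmh (- a) x)"
   unfolding integral_scaleR_right using lborel_integral_reflect[of "\<lambda>x. k x * gmh (- a) x"] by simp
  also have "(LINT x. k x * gmh (- a) x) = (LINT x. g x * fourier1 (gmh (- a)) x)"
   by (rule isf_multiplication[OF k gm_int(2) gm_sq(2)])
  also have "\<dots> = (LINT x. (2 * pi) *\<^sub>R (g x * gm a x))"
   by (intro Bochner_Integration.integral_cong refl) (simp add: fourier_gmh gm_minus scaleR_conv_of_real)
  finally show "(LINT x. g x * gm a x) = (LINT x. f x * gmh a x)" by simp
 qed
 then show ?thesis by blast
qed

lemma isf_inversion:
 assumes fg: "isf f g" shows "isf g (\<lambda>x. (2 * pi) *\<^sub>R f (- x))"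
proof (rule isf_of_weak)
 show f: "sqint g" using fg by (simp add: isf_def)
 have fs: "sqint f" using fg by (simp add: isf_def)
 show "sqint (\<lambda>x. (2 * pi) *\<^sub>R f (- x))" by (intro sqint_scaleR sqint_reflect fs)
 fix a
 have "(LINT x. (2 * pi) *\<^sub>R f (- x) * gm a x) = (LINT x. (2 * pi) *\<^sub>R ((\<lambda>x. f x * gm (- a) x) (- x)))"
  by (intro Bochner_Integration.integral_cong refl) (simp add: gm_minus)
 also have "\<dots> = (2 * pi) *\<^sub>R (LINT x. f x * gm (- a) x)"
  unfolding integral_scaleR_right using lborel_integral_reflect[of "\<lambda>x. f x * gm (- a) x"] by simp
 also have "\<dots> = (LINT x. f x * fourier1 (gmh a) x)"
  unfolding integral_scaleR_right[symmetric]
  by (intro Bochner_Integration.integral_cong refl) (simp add: fourier_gmh gm_minus scaleR_conv_of_real)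
 also have "\<dots> = (LINT x. g x * gmh a x)"
  by (rule isf_multiplication[OF fg gm_int(2) gm_sq(2), symmetric])
 finally show "(LINT x. (2 * pi) *\<^sub>R f (- x) * gm a x) = (LINT x. g x * gmh a x)" .
qed

lemma isf_conj:
 assumes fg: "isf f g" shows "isf (\<lambda>x. cnj (f x)) (\<lambda>\<xi>. cnj (g (- \<xi>)))"
proof (rule isf_of_weak)
 have f: "sqint f" and g: "sqint g" using fg by (auto simp: isf_def)
 note [measurable] = sqint_measurable[OF f] sqint_measurable[OF g]
 show "sqint (\<lambda>x. cnj (f x))" by (rule sqint_bound(1)[OF f, of _ 1]) auto
 show "sqint (\<lambda>\<xi>. cnj (g (- \<xi>)))" by (rule sqint_bound(1)[OF sqint_reflect[OF g], of _ 1]) auto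
 fix a
 have "(LINT x. cnj (g (- x)) * gm a x) = (LINT x. cnj ((\<lambda>x. g x * gm a x) (- x)))"
  by (intro Bochner_Integration.integral_cong refl) (simp add: gm_minus)
 also have "\<dots> = cnj (LINT x. f x * gmh a x)"
  unfolding Bochner_Integration.integral_cnj isf_gm[OF fg, symmetric]
  using lborel_integral_reflect[of "\<lambda>x. g x * gm a x"] by simp
 also have "\<dots> = (LINT x. cnj (f x) * gmh a x)"
  unfolding Bochner_Integration.integral_cnj[symmetric] by (simp add: gm_minus del: Bochner_Integration.integral_cnj)
 finally show "(LINT x. cnj (g (- x)) * gm a x) = (LINT x. cnj (f x) * gmh a x)" .
qed

lemma isf_translate:
 assumes fg: "isf f g" shows "isf (\<lambda>x. f (x + c)) (\<lambda>\<xi>. cis (c * \<xi>) * g \<xi>)"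
proof (rule isf_of_weak)
 have f: "sqint f" and g: "sqint g" using fg by (auto simp: isf_def)
 note [measurable] = sqint_measurable[OF f] sqint_measurable[OF g]
 show "sqint (\<lambda>x. f (x + c))" by (rule sqint_translate[OF f])
 show "sqint (\<lambda>\<xi>. cis (c * \<xi>) * g \<xi>)" by (rule sqint_bound(1)[OF g, of _ 1]) (auto simp: norm_mult)
 fix a
 have "(LINT x. cis (c * x) * g x * gm a x) = (LINT x. g x * gm (a + c) x)"
 proof -
  have "cis ((a + c) * x) = cis (c * x) * cis (a * x)" for x by (simp add: cis_mult algebra_simps)
  then show ?thesis by (intro Bochner_Integration.integral_cong refl) (simp only: gm_def mult_ac)
 qed
 also have "\<dots> = (LINT x. f x * gmh (a + c) x)" by (rule isf_gm[OF fg])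
 also have "\<dots> = \<bar>1\<bar> *\<^sub>R (LINT x. f (c + 1 * x) * gmh (a + c) (c + 1 * x))"
  by (rule lborel_integral_real_affine) simp
 also have "\<dots> = (LINT x. f (x + c) * gmh a x)"
  by (simp add: gmh_def add.commute)
 finally show "(LINT x. cis (c * x) * g x * gm a x) = (LINT x. f (x + c) * gmh a x)" .
qed

lemma isf_add:
 assumes a: "isf f g" "isf f' g'" shows "isf (\<lambda>x. f x + f' x) (\<lambda>x. g x + g' x)"
proof (rule isf_of_weak)
 have s: "sqint f" "sqint g" "sqint f'" "sqint g'" using a by (auto simp: isf_def)
 show "sqint (\<lambda>x. f x + f' x)" "sqint (\<lambda>x. g x + g' x)" by (intro sqint_add s)+
 show "(LINT x. (g x + g' x) * gm b x) = (LINT x. (f x + f' x) * gmh b x)" for b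
  using isf_gm[OF a(1), of b] isf_gm[OF a(2), of b] sqint_mult_integrable[OF s(2) gm_sq(1)[of b]] sqint_mult_integrable[OF s(4) gm_sq(1)[of b]]
   sqint_mult_integrable[OF s(1) gm_sq(2)[of b]] sqint_mult_integrable[OF s(3) gm_sq(2)[of b]]
  by (simp add: distrib_right)
qed

lemma sqint_cmult: "sqint f \<Longrightarrow> sqint (\<lambda>x. (c::complex) * f x)"
 by (rule sqint_bound(1)[of f _ "norm c"]) (auto simp: norm_mult)

lemma isf_cmult:
 assumes a: "isf f g" shows "isf (\<lambda>x. c * f x) (\<lambda>x. c * g x)"
proof (rule isf_of_weak)
 have s: "sqint f" "sqint g" using a by (auto simp: isf_def)
 show "sqint (\<lambda>x. c * f x)" "sqint (\<lambda>x. c * g x)" by (intro sqint_cmult s)+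
 show "(LINT x. c * g x * gm b x) = (LINT x. c * f x * gmh b x)" for b
  using isf_gm[OF a(1), of b] by (simp add: mult.assoc)
qed

lemma isf_diff: "isf f g \<Longrightarrow> isf f' g' \<Longrightarrow> isf (\<lambda>x. f x - f' x) (\<lambda>x. g x - g' x)"
 using isf_add[OF _ isf_cmult[of f' g' "-1"], of f g] by simp

lemma isf_multiplication_L2:
 assumes fg: "isf f g" and pq: "isf p q"
 shows "(LINT x. g x * p x) = (LINT x. f x * q x)"
proof -
 have f: "sqint f" and g: "sqint g" and p: "sqint p" and q: "sqint q" using fg pq by (auto simp: isf_def)
 note b = fourier1_bounded[OF integrable_trunc[OF p] sqint_trunc[OF p]]
 let ?d = "(LINT x. g x * p x) - (LINT x. f x * q x)"
 have "((\<lambda>R. l2norm g * l2norm (\<lambda>\<xi>. p \<xi> - trunc R p \<xi>) + l2norm f * l2norm (\<lambda>x. q x - fourier1 (trunc R p) x)) \<longlongrightarrow> l2norm g * 0 + l2norm f * 0) at_top"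
  using pq by (intro tendsto_intros trunc_tendsto p) (auto simp: isf_def)
 then have "norm ?d \<le> l2norm g * 0 + l2norm f * 0"
 proof (rule tendsto_lowerbound)
  have "norm ?d \<le> l2norm g * l2norm (\<lambda>\<xi>. p \<xi> - trunc R p \<xi>) + l2norm f * l2norm (\<lambda>x. q x - fourier1 (trunc R p) x)" for R
  proof -
   have d: "?d = (LINT x. g x * (p x - trunc R p x)) - (LINT x. f x * (q x - fourier1 (trunc R p) x))"
    using isf_multiplication[OF fg integrable_trunc[OF p, of R] sqint_trunc[OF p]] sqint_mult_integrable[OF g p]
     sqint_mult_integrable[OF f b(1)] sqint_mult_integrable[OF f q] sqint_mult_integrable[OF g sqint_trunc[OF p]]
    by (simp add: right_diff_distrib)
   have "norm ?d \<le> norm (LINT x. g x * (p x - trunc R p x)) + norm (LINT x. f x * (q x - fourier1 (trunc R p) x))"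
    unfolding d by (rule norm_triangle_ineq4)
   also have "\<dots> \<le> l2norm g * l2norm (\<lambda>\<xi>. p \<xi> - trunc R p \<xi>) + l2norm f * l2norm (\<lambda>x. q x - fourier1 (trunc R p) x)"
    by (intro add_mono sqint_mult_integral_bound sqint_diff g b p f sqint_trunc q)
   finally show ?thesis .
  qed
  then show "\<forall>\<^sub>F R in at_top. norm ?d \<le> l2norm g * l2norm (\<lambda>\<xi>. p \<xi> - trunc R p \<xi>) + l2norm f * l2norm (\<lambda>x. q x - fourier1 (trunc R p) x)"
   by (intro always_eventually) auto
 qed simp
 then show ?thesis by simp
qed

lemma isf_Parseval:
 assumes a: "isf f g" "isf f' g'"
 shows "(LINT x. g x * cnj (g' x)) = 2 * pi * (LINT x. f x * cnj (f' x))"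
proof -
 have "isf (\<lambda>x. cnj (g' x)) (\<lambda>\<xi>. cnj ((2 * pi) *\<^sub>R f' (- (- \<xi>))))"
  by (rule isf_conj[OF isf_inversion[OF a(2)]])
 from isf_multiplication_L2[OF a(1) this]
 have "(LINT x. g x * cnj (g' x)) = (LINT x. (2 * pi) *\<^sub>R (f x * cnj (f' x)))" by simp
 then show ?thesis unfolding integral_scaleR_right by (simp add: scaleR_conv_of_real)
qed

lemma isf_l2norm:
 assumes a: "isf f g" shows "(l2norm g)\<^sup>2 = 2 * pi * (l2norm f)\<^sup>2"
proof -
 have e: "(LINT x. h x * cnj (h x)) = of_real ((l2norm h)\<^sup>2)" for h :: "real \<Rightarrow> complex"
  unfolding l2norm_sq complex_norm_square[symmetric] integral_complex_of_real[symmetric] by simp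
 have "complex_of_real ((l2norm g)\<^sup>2) = complex_of_real (2 * pi * (l2norm f)\<^sup>2)"
  using isf_Parseval[OF a a] by (simp add: e)
 then show ?thesis by (simp only: of_real_eq_iff)
qed

lemma isf_injective:
 assumes "isf f g" "isf f' g" shows "AE x in lborel. f x = f' x"
proof -
 have s: "sqint f" "sqint f'" using assms by (auto simp: isf_def)
 have "isf (\<lambda>x. f x - f' x) (\<lambda>x. g x - g x)" by (rule isf_diff[OF assms])
 from isf_l2norm[OF this] have "l2norm (\<lambda>x. f x - f' x) = 0" by (simp add: l2norm_def)
 then show ?thesis using l2norm_eq_0_iff[OF sqint_diff[OF s]] by simp
qed

subsection \<open>The transform in one of two variables\<close>

lemma borel_R2: "f \<in> borel_measurable borel \<Longrightarrow> f \<in> borel_measurable ((borel :: 'a::second_countable_topology measure) \<Otimes>\<^sub>M (borel :: 'b::second_countable_topology measure))"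
 by (simp add: borel_prod)

lemma nn_integral_R2:
 assumes f: "f \<in> borel_measurable borel"
 shows "(\<integral>\<^sup>+z. f z \<partial>(lborel :: (real \<times> real) measure)) = (\<integral>\<^sup>+s. \<integral>\<^sup>+x. f (s, x))"
proof -
 note [measurable] = borel_R2[OF f]
 show ?thesis unfolding lborel_prod[symmetric] by (subst lborel.nn_integral_fst[symmetric]) measurable
qed

lemma AE_R2:
 "AE z in (lborel :: (real \<times> real) measure). P z \<Longrightarrow> AE s in lborel. AE x in lborel. P (s, x)"
 unfolding lborel_prod[symmetric] by (rule lborel_pair.AE_pair)

lemma section_measurable [measurable]:
 "f \<in> borel_measurable borel \<Longrightarrow> (\<lambda>x. f (s, x)) \<in> borel_measurable (borel :: real measure)" for s :: real
 by (rule measurable_compose[of "\<lambda>x. (s,x)"]) (auto intro!: borel_measurable_continuous_onI continuous_intros)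

lemma sqint_section:
 fixes f :: "real \<times> real \<Rightarrow> 'b::euclidean_space"
 assumes f: "sqint f" shows "AE s in lborel. sqint (\<lambda>x. f (s, x))"
proof -
 note [measurable] = sqint_measurable[OF f] borel_R2[OF sqint_measurable[OF f]]
 have "(\<integral>\<^sup>+s. \<integral>\<^sup>+x. ennreal ((norm (f (s, x)))\<^sup>2)) < \<infinity>"
  using f by (simp add: sqint_iff_nn nn_integral_R2)
 moreover have m: "(\<lambda>s. \<integral>\<^sup>+x. ennreal ((norm (f (s, x)))\<^sup>2)) \<in> borel_measurable lborel"
  by measurable
 ultimately have "AE s in lborel. (\<integral>\<^sup>+x. ennreal ((norm (f (s, x)))\<^sup>2)) \<noteq> \<infinity>"
  by (intro nn_integral_noteq_infinite) auto
 then show ?thesis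
  by eventually_elim (auto simp: sqint_iff_nn less_top[symmetric])
qed

lemma sqint_sections_bound:
 fixes f :: "real \<times> real \<Rightarrow> 'b::euclidean_space" and g :: "real \<times> real \<Rightarrow> 'c::euclidean_space"
 assumes g: "sqint g" and f: "f \<in> borel_measurable borel" and C: "C \<ge> 0"
  and le: "AE s in lborel. sqint (\<lambda>x. g (s, x)) \<longrightarrow> sqint (\<lambda>x. f (s, x)) \<and> l2norm (\<lambda>x. f (s, x)) \<le> C * l2norm (\<lambda>x. g (s, x))"
 shows "sqint f" "l2norm f \<le> C * l2norm g"
proof -
 note [measurable] = sqint_measurable[OF g] f borel_R2[OF sqint_measurable[OF g]] borel_R2[OF f]
 have "(\<integral>\<^sup>+z. ennreal ((norm (f z))\<^sup>2)) = (\<integral>\<^sup>+s. \<integral>\<^sup>+x. ennreal ((norm (f (s, x)))\<^sup>2))"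
  by (rule nn_integral_R2) simp
 also have "\<dots> \<le> (\<integral>\<^sup>+s. ennreal (C\<^sup>2) * (\<integral>\<^sup>+x. ennreal ((norm (g (s, x)))\<^sup>2)))"
 proof (rule nn_integral_mono_AE)
  show "AE s in lborel. (\<integral>\<^sup>+x. ennreal ((norm (f (s, x)))\<^sup>2)) \<le> ennreal (C\<^sup>2) * (\<integral>\<^sup>+x. ennreal ((norm (g (s, x)))\<^sup>2))"
   using le sqint_section[OF g]
  proof eventually_elim
   case (elim s)
   then have s: "sqint (\<lambda>x. f (s, x))" "sqint (\<lambda>x. g (s, x))" by auto
   have "(l2norm (\<lambda>x. f (s, x)))\<^sup>2 \<le> C\<^sup>2 * (l2norm (\<lambda>x. g (s, x)))\<^sup>2"
    using elim C by (metis l2norm_nonneg power_mono power_mult_distrib)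
   then show ?case
    using L2_normsq_eq_l2norm[OF s(1)] L2_normsq_eq_l2norm[OF s(2)]
    by (simp add: L2_normsq_UNIV ennreal_mult[symmetric])
  qed
 qed
 also have "\<dots> = ennreal (C\<^sup>2) * (\<integral>\<^sup>+s. (\<integral>\<^sup>+x. ennreal ((norm (g (s, x)))\<^sup>2)))"
  by (rule nn_integral_cmult) measurable
 also have "(\<integral>\<^sup>+s. (\<integral>\<^sup>+x. ennreal ((norm (g (s, x)))\<^sup>2))) = (\<integral>\<^sup>+z. ennreal ((norm (g z))\<^sup>2))"
  by (rule nn_integral_R2[symmetric]) simp
 also have "\<dots> = ennreal ((l2norm g)\<^sup>2)" using L2_normsq_eq_l2norm[OF g] by (simp add: L2_normsq_UNIV)
 finally have le: "(\<integral>\<^sup>+z. ennreal ((norm (f z))\<^sup>2)) \<le> ennreal ((C * l2norm g)\<^sup>2)"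
  by (simp add: ennreal_mult power_mult_distrib)
 then show s: "sqint f" unfolding sqint_iff_nn by (auto simp: top_unique less_top[symmetric])
 have "(l2norm f)\<^sup>2 \<le> (C * l2norm g)\<^sup>2"
  using le L2_normsq_eq_l2norm[OF s] by (simp add: L2_normsq_UNIV)
 then show "l2norm f \<le> C * l2norm g"
  by (rule power2_le_imp_le) (use C in auto)
qed

text \<open>The transforms of the truncated sections depend measurably on both variables, and the Plancherel bound on every
section makes them a Cauchy sequence in \<open>L\<^sup>2\<close> of the plane.\<close>

lemma isf_partial:
 fixes f :: "real \<times> real \<Rightarrow> complex"
 assumes f: "sqint f"
 shows "\<exists>g. sqint g \<and> (AE s in lborel. isf (\<lambda>x. f (s, x)) (\<lambda>\<xi>. g (s, \<xi>)))"
proof -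
 note [measurable] = sqint_measurable[OF f] borel_R2[OF sqint_measurable[OF f]]
 define t where "t n z = indicator {- real n..real n} (snd z) *\<^sub>R f z" for n z
 define F where "F n z = fourier1 (trunc (real n) (\<lambda>x. f (fst z, x))) (snd z)" for n z
 have Fm[measurable]: "F n \<in> borel_measurable borel" for n
  unfolding F_def fourier1_def trunc_def borel_prod[symmetric] by measurable
 have tm[measurable]: "t n \<in> borel_measurable borel" for n
  unfolding t_def borel_prod[symmetric] by measurable
 have ts: "sqint (t n)" for n
  by (rule sqint_bound(1)[OF f tm, where C=1]) (auto simp: t_def split: split_indicator)
 have tsec: "(\<lambda>x. t n (s, x)) = trunc (real n) (\<lambda>x. f (s, x))" for n s
  by (simp add: t_def trunc_def fun_eq_iff)
 have sec: "AE s in lborel. sqint (\<lambda>x. f (s, x))" by (rule sqint_section[OF f])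
 have Fs: "sqint (F n)" for n
 proof (rule sqint_sections_bound(1)[OF ts[of n] Fm, of "sqrt (2 * pi)"])
  show "AE s in lborel. sqint (\<lambda>x. t n (s, x)) \<longrightarrow> sqint (\<lambda>x. F n (s, x)) \<and> l2norm (\<lambda>x. F n (s, x)) \<le> sqrt (2 * pi) * l2norm (\<lambda>x. t n (s, x))"
   using sec by eventually_elim (use fourier1_bounded[OF integrable_trunc sqint_trunc] in \<open>simp add: F_def tsec\<close>)
 qed simp
 have Fd: "l2norm (\<lambda>z. F m z - F n z) \<le> sqrt (2 * pi) * l2norm (\<lambda>z. t m z - t n z)" for m n
 proof (rule sqint_sections_bound(2)[OF sqint_diff[OF ts[of m] ts[of n]]])
  show "AE s in lborel. sqint (\<lambda>x. t m (s, x) - t n (s, x)) \<longrightarrow> sqint (\<lambda>x. F m (s, x) - F n (s, x)) \<and> l2norm (\<lambda>x. F m (s, x) - F n (s, x)) \<le> sqrt (2 * pi) * l2norm (\<lambda>x. t m (s, x) - t n (s, x))"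
   using sec
  proof eventually_elim
   case (elim s)
   note i = integrable_trunc[OF elim] sqint_trunc[OF elim]
   show ?case
    using fourier1_diff_l2[OF i[of "real m"] i[of "real n"]] sqint_diff[OF fourier1_bounded(1)[OF i[of "real m"]] fourier1_bounded(1)[OF i[of "real n"]]]
    by (simp add: F_def fun_cong[OF tsec])
  qed
 qed auto
 have tl: "(\<lambda>n. l2norm (\<lambda>z. f z - t n z)) \<longlonglongrightarrow> 0"
 proof -
  have "(\<lambda>n. LINT z. (norm (f z - t n z))\<^sup>2) \<longlonglongrightarrow> integral\<^sup>L lborel (\<lambda>z::real\<times>real. 0::real)"
  proof (rule integral_dominated_convergence[where w="\<lambda>z. (norm (f z))\<^sup>2"])
   show "integrable lborel (\<lambda>x. (norm (f x))\<^sup>2)" using f by (simp add: sqint_def)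
   show "AE z in lborel. norm ((norm (f z - t n z))\<^sup>2) \<le> (norm (f z))\<^sup>2" for n
    by (intro AE_I2) (auto simp: t_def split: split_indicator)
   show "AE z in lborel. (\<lambda>n. (norm (f z - t n z))\<^sup>2) \<longlonglongrightarrow> 0"
   proof (rule AE_I2)
    fix z :: "real \<times> real"
    obtain N :: nat where N: "\<bar>snd z\<bar> \<le> N" using real_arch_simple by blast
    have "\<forall>\<^sub>F n in sequentially. (norm (f z - t n z))\<^sup>2 = 0"
     using eventually_ge_at_top[of N] by eventually_elim (use N in \<open>auto simp: t_def indicator_def\<close>)
    then show "(\<lambda>n. (norm (f z - t n z))\<^sup>2) \<longlonglongrightarrow> 0" by (rule tendsto_eventually)
   qed
  qed auto
  then have "(\<lambda>n. sqrt (LINT z. (norm (f z - t n z))\<^sup>2)) \<longlonglongrightarrow> sqrt 0"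
   by (intro tendsto_real_sqrt) simp
  then show ?thesis by (simp add: l2norm_def)
 qed
 have "\<exists>g r. sqint g \<and> (\<lambda>n. l2norm (\<lambda>x. F n x - g x)) \<longlonglongrightarrow> 0 \<and> strict_mono r \<and>
   (AE x in lborel. (\<lambda>n. F (r n) x) \<longlonglongrightarrow> g x)"
 proof (rule l2_complete[OF Fs])
  fix e :: real assume "e > 0"
  then have "e / (2 * sqrt (2 * pi)) > 0" by simp
  then obtain N where N: "\<And>n. n \<ge> N \<Longrightarrow> l2norm (\<lambda>z. f z - t n z) < e / (2 * sqrt (2 * pi))"
   using LIMSEQ_D[OF tl] by fastforce
  show "\<exists>N. \<forall>m\<ge>N. \<forall>n\<ge>N. l2norm (\<lambda>x. F m x - F n x) < e"
  proof (intro exI allI impI)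
   fix m n assume mn: "N \<le> m" "N \<le> n"
   have "l2norm (\<lambda>x. t m x - t n x) \<le> l2norm (\<lambda>x. t m x - f x) + l2norm (\<lambda>x. f x - t n x)"
    by (intro l2norm_triangle_diff ts f)
   also have "\<dots> < e / (2 * sqrt (2 * pi)) + e / (2 * sqrt (2 * pi))"
    using N[OF mn(1)] N[OF mn(2)] l2norm_diff_swap[of "t m" f] by linarith
   also have "\<dots> = e / sqrt (2 * pi)" by (simp add: field_simps)
   finally have "sqrt (2 * pi) * l2norm (\<lambda>x. t m x - t n x) < e" by (simp add: field_simps)
   then show "l2norm (\<lambda>x. F m x - F n x) < e" using Fd[of m n] by linarith
  qed
 qed
 then obtain g r where g: "sqint g" and r: "strict_mono r" and ae: "AE z in lborel. (\<lambda>n. F (r n) z) \<longlonglongrightarrow> g z"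
  by blast
 note [measurable] = sqint_measurable[OF g]
 have "AE s in lborel. isf (\<lambda>x. f (s, x)) (\<lambda>\<xi>. g (s, \<xi>))"
  using AE_R2[OF ae] sec
 proof eventually_elim
  case (elim s)
  obtain h where h: "isf (\<lambda>x. f (s, x)) h" using isf_exists[OF elim(2)] by blast
  then have hs: "sqint h" by (simp add: isf_def)
  note b = fourier1_bounded(1)[OF integrable_trunc[OF elim(2)] sqint_trunc[OF elim(2)]]
  have lim: "(\<lambda>n. l2norm (\<lambda>x. F n (s, x) - h x)) \<longlonglongrightarrow> 0"
  proof -
   have "((\<lambda>R. l2norm (\<lambda>\<xi>. h \<xi> - fourier1 (trunc R (\<lambda>x. f (s, x))) \<xi>)) \<longlongrightarrow> 0) at_top"
    using h by (simp add: isf_def)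
   from filterlim_compose[OF this filterlim_real_sequentially] show ?thesis
    by (simp add: F_def l2norm_diff_swap[of h])
  qed
  have "AE x in lborel. g (s, x) = h x"
   by (rule l2_limit_unique_AE[OF _ hs lim r elim(1)]) (simp add: F_def b)
  then show ?case
   by (intro isf_cong_AE[OF h]) (auto intro!: sqint_measurable[OF elim(2)])
 qed
 then show ?thesis using g by blast
qed

lemma AE_lborel_affine:
 fixes P :: "real \<Rightarrow> bool"
 assumes c: "c \<noteq> 0" and P: "AE x in lborel. P x"
 shows "AE x in lborel. P (t + c * x)"
proof -
 obtain N where N: "{x \<in> space lborel. \<not> P x} \<subseteq> N" "emeasure lborel N = 0" "N \<in> sets lborel"
  using AE_E[OF P] by blast
 have "AE x in lborel. x \<notin> N" using N by (intro AE_not_in) (auto simp: null_sets_def)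
 moreover have "Measurable.pred borel (\<lambda>x. x \<notin> N)" using N(3) by simp
 ultimately have "AE x in lborel. t + c * x \<notin> N" by (intro AE_borel_affine[OF c])
 then show ?thesis by eventually_elim (use N(1) in auto)
qed

lemma isf_partial_inverse:
 fixes g :: "real \<times> real \<Rightarrow> complex"
 assumes g: "sqint g"
 shows "\<exists>f. sqint f \<and> (AE s in lborel. isf (\<lambda>x. f (s, x)) (\<lambda>\<xi>. g (s, \<xi>)))"
proof -
 obtain k where k: "sqint k" "AE s in lborel. isf (\<lambda>x. g (s, x)) (\<lambda>\<xi>. k (s, \<xi>))"
  using isf_partial[OF g] by blast
 note [measurable] = sqint_measurable[OF k(1)] sqint_measurable[OF g] borel_R2[OF sqint_measurable[OF k(1)]]
 define f where "f z = (1 / (2 * pi)) *\<^sub>R k (fst z, - snd z)" for z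
 have [measurable]: "f \<in> borel_measurable borel" unfolding f_def borel_prod[symmetric] by measurable
 have fs: "sqint f"
 proof (rule sqint_sections_bound(1)[OF k(1), of _ "1 / (2 * pi)"], goal_cases)
  case 3
  have "l2norm (\<lambda>x. f (s, x)) = 1 / (2 * pi) * l2norm (\<lambda>x. k (s, x))" for s
  proof -
   have "(LINT x. (norm (k (s, - x)))\<^sup>2) = (LINT x. (norm (k (s, x)))\<^sup>2)"
    using lborel_integral_real_affine[of "-1" "\<lambda>x. (norm (k (s, x)))\<^sup>2" 0] by simp
   then have "l2norm (\<lambda>x. k (s, - x)) = l2norm (\<lambda>x. k (s, x))" by (simp add: l2norm_def)
   then show ?thesis unfolding f_def by (simp add: l2norm_scaleR)
  qed
  then show ?case by (auto simp: f_def intro!: sqint_scaleR sqint_reflect)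
 qed auto
 have "AE s in lborel. isf (\<lambda>x. f (s, x)) (\<lambda>\<xi>. g (s, \<xi>))"
  using k(2)
 proof eventually_elim
  case (elim s)
  then have "sqint (\<lambda>\<xi>. g (s, \<xi>))" by (simp add: isf_def)
  from isf_inverse_exists[OF this] obtain h where h: "isf h (\<lambda>\<xi>. g (s, \<xi>))" by blast
  have hs: "sqint h" using h by (simp add: isf_def)
  note [measurable] = sqint_measurable[OF hs]
  have "AE x in lborel. k (s, x) = (2 * pi) *\<^sub>R h (- x)"
   by (rule isf_unique[OF elim isf_inversion[OF h]])
  then have ae: "AE x in lborel. k (s, x) = (2 * pi) *\<^sub>R h (- x)" .
  have "AE x in lborel. k (s, 0 + (-1) * x) = (2 * pi) *\<^sub>R h (- (0 + (-1) * x))"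
   by (rule AE_lborel_affine[OF _ ae]) simp
  then have "AE x in lborel. k (s, - x) = (2 * pi) *\<^sub>R h x" by simp
  then have hf: "AE x in lborel. h x = f (s, x)"
   by eventually_elim (simp add: f_def)
  have gm: "(\<lambda>\<xi>. g (s, \<xi>)) \<in> borel_measurable borel" and fm: "(\<lambda>x. f (s, x)) \<in> borel_measurable borel"
   by measurable
  show ?case by (rule isf_cong_AE[OF h fm hf gm]) simp
 qed
 then show ?thesis using fs by blast
qed

subsection \<open>Vector-valued functions\<close>

lemma norm_vec_sq: "(norm x)\<^sup>2 = (\<Sum>i\<in>UNIV. (norm (x $ i))\<^sup>2)"
 for x :: "'a::real_normed_vector ^ 'n"
 by (simp add: norm_vec_def L2_set_def sum_nonneg)

lemma bounded_linear_axis': "bounded_linear (axis i :: 'a::euclidean_space \<Rightarrow> 'a^'n)"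
proof (rule linear_conv_bounded_linear[THEN iffD1])
 show "linear (axis i :: 'a \<Rightarrow> 'a^'n)"
  by (rule linearI) (auto simp: axis_def vec_eq_iff)
qed

lemma vec_axis_sum: "x = (\<Sum>i\<in>UNIV. axis i (x $ i))" for x :: "'a::comm_monoid_add^'n"
 by (simp add: vec_eq_iff axis_def)

lemma measurable_vec_iff:
 fixes f :: "'b \<Rightarrow> ('a::euclidean_space)^'n"
 shows "f \<in> borel_measurable M \<longleftrightarrow> (\<forall>i. (\<lambda>x. f x $ i) \<in> borel_measurable M)"
proof
 assume f: "f \<in> borel_measurable M"
 show "\<forall>i. (\<lambda>x. f x $ i) \<in> borel_measurable M"
  by (intro allI borel_measurable_continuous_on[OF _ f]) (intro continuous_intros)
next
 assume f: "\<forall>i. (\<lambda>x. f x $ i) \<in> borel_measurable M"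
 have "(\<lambda>x. \<Sum>i\<in>UNIV. axis i (f x $ i)) \<in> borel_measurable M"
 proof (rule borel_measurable_sum)
  fix i
  show "(\<lambda>x. (axis i (f x $ i) :: 'a^'n)) \<in> borel_measurable M"
   by (rule borel_measurable_continuous_on[of "axis i"])
    (use f in \<open>auto intro!: linear_continuous_on bounded_linear_axis'\<close>)
 qed
 moreover have "f = (\<lambda>x. \<Sum>i\<in>UNIV. axis i (f x $ i))" by (rule ext) (rule vec_axis_sum)
 ultimately show "f \<in> borel_measurable M" by metis
qed

lemma measurable_vec_nth [measurable (raw)]:
 fixes f :: "'b \<Rightarrow> ('a::euclidean_space)^'n"
 shows "f \<in> borel_measurable M \<Longrightarrow> (\<lambda>x. f x $ i) \<in> borel_measurable M"
 using measurable_vec_iff by blast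

lemma integrable_vec_iff:
 fixes f :: "'b \<Rightarrow> ('a::euclidean_space)^'n"
 shows "integrable M f \<longleftrightarrow> (\<forall>i. integrable M (\<lambda>x. f x $ i))"
proof
 assume f: "integrable M f"
 show "\<forall>i. integrable M (\<lambda>x. f x $ i)"
  by (intro allI integrable_bounded_linear[OF bounded_linear_vec_nth f])
next
 assume f: "\<forall>i. integrable M (\<lambda>x. f x $ i)"
 have "integrable M (\<lambda>x. \<Sum>i\<in>UNIV. axis i (f x $ i))"
  by (intro Bochner_Integration.integrable_sum integrable_bounded_linear[OF bounded_linear_axis']) (use f in auto)
 moreover have "f = (\<lambda>x. \<Sum>i\<in>UNIV. axis i (f x $ i))" by (rule ext) (rule vec_axis_sum)
 ultimately show "integrable M f" by metis
qed

lemma integral_vec_nth: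
 fixes f :: "'b \<Rightarrow> ('a::euclidean_space)^'n"
 assumes "integrable M f" shows "integral\<^sup>L M f $ i = (LINT x|M. f x $ i)"
 by (rule integral_bounded_linear[OF bounded_linear_vec_nth assms, symmetric])

lemma L2_normsq_vec:
 fixes f :: "'b::euclidean_space \<Rightarrow> ('a::euclidean_space)^'n"
 assumes "f \<in> borel_measurable borel"
 shows "L2_normsq UNIV f = (\<Sum>i\<in>UNIV. L2_normsq UNIV (\<lambda>x. f x $ i))"
proof -
 note [measurable] = assms
 have "L2_normsq UNIV f = (\<integral>\<^sup>+x. (\<Sum>i\<in>UNIV. ennreal ((norm (f x $ i))\<^sup>2)))"
  unfolding L2_normsq_UNIV norm_vec_sq by (simp add: sum_ennreal)
 also have "\<dots> = (\<Sum>i\<in>UNIV. L2_normsq UNIV (\<lambda>x. f x $ i))"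
  unfolding L2_normsq_UNIV by (rule nn_integral_sum) measurable
 finally show ?thesis .
qed

lemma sqint_vec_iff:
 fixes f :: "'b::euclidean_space \<Rightarrow> ('a::euclidean_space)^'n"
 shows "sqint f \<longleftrightarrow> (\<forall>i. sqint (\<lambda>x. f x $ i))"
proof (cases "f \<in> borel_measurable borel")
 case True
 then show ?thesis
  using L2_normsq_vec[OF True] True
  by (auto simp: sqint_iff_nn L2_normsq_UNIV[symmetric] measurable_vec_iff)
next
 case False
 then show ?thesis by (auto simp: sqint_def measurable_vec_iff)
qed

lemma ennreal_sq_tendsto_0: "(\<And>x. f x \<ge> 0) \<Longrightarrow> ((\<lambda>x. ennreal ((f x)\<^sup>2)) \<longlongrightarrow> 0) F \<longleftrightarrow> (f \<longlongrightarrow> (0::real)) F"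
proof -
 assume f: "\<And>x. f x \<ge> 0"
 have "((\<lambda>x. ennreal ((f x)\<^sup>2)) \<longlongrightarrow> 0) F \<longleftrightarrow> ((\<lambda>x. (f x)\<^sup>2) \<longlongrightarrow> 0) F"
  using tendsto_ennreal_iff[of "\<lambda>x. (f x)\<^sup>2" F 0] by simp
 also have "\<dots> \<longleftrightarrow> (f \<longlongrightarrow> 0) F"
 proof
  assume "((\<lambda>x. (f x)\<^sup>2) \<longlongrightarrow> 0) F"
  from tendsto_real_sqrt[OF this] show "(f \<longlongrightarrow> 0) F" using f by simp
 next
  assume "(f \<longlongrightarrow> 0) F"
  from tendsto_power[OF this, of 2] show "((\<lambda>x. (f x)\<^sup>2) \<longlongrightarrow> 0) F" by simp
 qed
 finally show ?thesis .
qed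

lemma fourier_component:
 fixes f :: "real \<Rightarrow> complex^'n"
 assumes "integrable lborel f"
 shows "fourier f \<xi> $ i = fourier1 (\<lambda>x. f x $ i) \<xi>"
proof -
 have e: "exp (- \<i> * of_real (x * \<xi>)) = cis (- (x * \<xi>))" for x
  by (simp add: cis_conv_exp)
 have "integrable lborel (\<lambda>x. exp (- \<i> * of_real (x * \<xi>)) *s f x)"
  unfolding integrable_vec_iff e using assms by (auto simp: integrable_vec_iff)
 then show ?thesis unfolding fourier_def fourier1_def e by (subst integral_vec_nth) auto
qed

lemma FT_iff:
 fixes f g :: "real \<Rightarrow> complex^'n"
 shows "is_fourier_L2 f g \<longleftrightarrow> (\<forall>i. isf (\<lambda>x. f x $ i) (\<lambda>\<xi>. g \<xi> $ i))"
proof (cases "sqint f \<and> sqint g")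
 case True
 then have f: "sqint f" and g: "sqint g" by auto
 have fi: "sqint (\<lambda>x. f x $ i)" and gi: "sqint (\<lambda>x. g x $ i)" for i
  using f g by (auto simp: sqint_vec_iff)
 let ?t = "\<lambda>R x. indicator {-R..R} x *\<^sub>R f x"
 have ti: "(\<lambda>x. ?t R x $ i) = trunc R (\<lambda>x. f x $ i)" for R i
  by (simp add: trunc_def fun_eq_iff)
 have tint: "integrable lborel (?t R)" for R
  unfolding integrable_vec_iff ti using integrable_trunc[OF fi] by blast
 let ?D = "\<lambda>R i \<xi>. g \<xi> $ i - fourier1 (trunc R (\<lambda>x. f x $ i)) \<xi>"
 have Dc: "(g \<xi> - fourier (?t R) \<xi>) $ i = ?D R i \<xi>" for R i \<xi>
  using fourier_component[OF tint, of R \<xi> i] unfolding ti by simp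
 have Ds: "sqint (?D R i)" for R i
  by (intro sqint_diff gi fourier1_bounded integrable_trunc sqint_trunc fi)
 have "sqint (\<lambda>\<xi>. g \<xi> - fourier (?t R) \<xi>)" for R
  unfolding sqint_vec_iff Dc using Ds by blast
 then have "L2_normsq UNIV (\<lambda>\<xi>. g \<xi> - fourier (?t R) \<xi>) = (\<Sum>i\<in>UNIV. ennreal ((l2norm (?D R i))\<^sup>2))" for R
  by (subst L2_normsq_vec) (auto simp: sqint_def Dc L2_normsq_eq_l2norm[OF Ds] simp del: vector_minus_component)
 then have "is_fourier_L2 f g \<longleftrightarrow> ((\<lambda>R. \<Sum>i\<in>UNIV. ennreal ((l2norm (?D R i))\<^sup>2)) \<longlongrightarrow> 0) at_top"
  using f g by (simp add: is_fourier_L2_def sqint_iff_L2_on)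
 also have "\<dots> \<longleftrightarrow> (\<forall>i. ((\<lambda>R. ennreal ((l2norm (?D R i))\<^sup>2)) \<longlongrightarrow> 0) at_top)"
 proof
  assume a: "((\<lambda>R. \<Sum>i\<in>UNIV. ennreal ((l2norm (?D R i))\<^sup>2)) \<longlongrightarrow> 0) at_top"
  show "\<forall>i. ((\<lambda>R. ennreal ((l2norm (?D R i))\<^sup>2)) \<longlongrightarrow> 0) at_top"
  proof
   fix i
   show "((\<lambda>R. ennreal ((l2norm (?D R i))\<^sup>2)) \<longlongrightarrow> 0) at_top"
    by (rule tendsto_sandwich[OF _ _ tendsto_const a]) (auto intro!: always_eventually member_le_sum simp del: sum_ennreal)
  qed
 next
  assume a: "\<forall>i. ((\<lambda>R. ennreal ((l2norm (?D R i))\<^sup>2)) \<longlongrightarrow> 0) at_top"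
  have "((\<lambda>R. \<Sum>i\<in>UNIV. ennreal ((l2norm (?D R i))\<^sup>2)) \<longlongrightarrow> (\<Sum>i\<in>(UNIV::'n set). 0)) at_top"
   by (rule tendsto_sum) (use a in blast)
  then show "((\<lambda>R. \<Sum>i\<in>UNIV. ennreal ((l2norm (?D R i))\<^sup>2)) \<longlongrightarrow> 0) at_top" by (simp del: sum_ennreal)
 qed
 also have "\<dots> \<longleftrightarrow> (\<forall>i. isf (\<lambda>x. f x $ i) (\<lambda>\<xi>. g \<xi> $ i))"
  by (subst ennreal_sq_tendsto_0) (auto simp: isf_def fi gi)
 finally show ?thesis .
next
 case False
 have "\<not> is_fourier_L2 f g" using False by (auto simp: is_fourier_L2_def sqint_iff_L2_on)
 moreover have "\<not> (\<forall>i. isf (\<lambda>x. f x $ i) (\<lambda>\<xi>. g \<xi> $ i))" using False by (auto simp: isf_def sqint_vec_iff)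
 ultimately show ?thesis by blast
qed

lemma FT_sqint: "is_fourier_L2 f g \<Longrightarrow> sqint f" "is_fourier_L2 f g \<Longrightarrow> sqint g"
 by (simp_all add: is_fourier_L2_def sqint_iff_L2_on)

lemma FT_exists:
 fixes f :: "real \<Rightarrow> complex^'n"
 assumes "sqint f" shows "\<exists>g. is_fourier_L2 f g"
proof -
 have "\<forall>i. \<exists>g. isf (\<lambda>x. f x $ i) g" using assms isf_exists by (auto simp: sqint_vec_iff)
 then obtain g where "\<And>i. isf (\<lambda>x. f x $ i) (g i)" by metis
 then have "is_fourier_L2 f (\<lambda>\<xi>. \<chi> i. g i \<xi>)" by (simp add: FT_iff)
 then show ?thesis by blast
qed

lemma FT_fourier_L2:
 assumes "sqint f" shows "is_fourier_L2 f (fourier_L2 f)"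
 unfolding fourier_L2_def using FT_exists[OF assms] by (rule someI_ex)

lemma FT_inverse_exists:
 fixes g :: "real \<Rightarrow> complex^'n"
 assumes "sqint g" shows "\<exists>f. is_fourier_L2 f g"
proof -
 have "\<forall>i. \<exists>f. isf f (\<lambda>x. g x $ i)" using assms isf_inverse_exists by (auto simp: sqint_vec_iff)
 then obtain f where "\<And>i. isf (f i) (\<lambda>x. g x $ i)" by metis
 then have "is_fourier_L2 (\<lambda>\<xi>. \<chi> i. f i \<xi>) g" by (simp add: FT_iff)
 then show ?thesis by blast
qed

lemma AE_vec_eqI: "(\<And>i. AE x in M. f x $ i = g x $ i) \<Longrightarrow> AE x in M. f x = (g x :: 'a^'n)"
 unfolding vec_eq_iff by (rule eventually_all_finite)

lemma FT_unique: "is_fourier_L2 f g \<Longrightarrow> is_fourier_L2 f g' \<Longrightarrow> AE x in lborel. g x = g' x"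
 by (intro AE_vec_eqI) (auto simp: FT_iff intro: isf_unique)

lemma FT_injective: "is_fourier_L2 f g \<Longrightarrow> is_fourier_L2 f' g \<Longrightarrow> AE x in lborel. f x = f' x"
 by (intro AE_vec_eqI) (auto simp: FT_iff intro: isf_injective)

lemma FT_cong_AE:
 assumes fg: "is_fourier_L2 f g" and f': "f' \<in> borel_measurable borel" "AE x in lborel. f x = f' x"
  and g': "g' \<in> borel_measurable borel" "AE x in lborel. g x = g' x"
 shows "is_fourier_L2 f' g'"
 unfolding FT_iff
proof
 fix i
 have f'i: "AE x in lborel. f x $ i = f' x $ i" using f'(2) by eventually_elim simp
 have g'i: "AE x in lborel. g x $ i = g' x $ i" using g'(2) by eventually_elim simp
 show "isf (\<lambda>x. f' x $ i) (\<lambda>\<xi>. g' \<xi> $ i)"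
  by (rule isf_cong_AE[OF _ _ f'i _ g'i]) (use fg f'(1) g'(1) in \<open>auto simp: FT_iff measurable_vec_iff\<close>)
qed

lemma FT_add: "is_fourier_L2 f g \<Longrightarrow> is_fourier_L2 f' g' \<Longrightarrow> is_fourier_L2 (\<lambda>x. f x + f' x) (\<lambda>\<xi>. g \<xi> + g' \<xi>)"
 by (auto simp: FT_iff intro: isf_add)

lemma FT_diff: "is_fourier_L2 f g \<Longrightarrow> is_fourier_L2 f' g' \<Longrightarrow> is_fourier_L2 (\<lambda>x. f x - f' x) (\<lambda>\<xi>. g \<xi> - g' \<xi>)"
 by (auto simp: FT_iff intro: isf_diff)

lemma FT_cmult: "is_fourier_L2 f g \<Longrightarrow> is_fourier_L2 (\<lambda>x. c *s f x) (\<lambda>\<xi>. c *s g \<xi>)"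
 by (auto simp: FT_iff intro: isf_cmult)

lemma FT_translate: "is_fourier_L2 f g \<Longrightarrow> is_fourier_L2 (\<lambda>x. f (x + c)) (\<lambda>\<xi>. cis (c * \<xi>) *s g \<xi>)"
 by (auto simp: FT_iff intro: isf_translate)

definition vcnj :: "complex^'n \<Rightarrow> complex^'n" where
 "vcnj v = (\<chi> i. cnj (v $ i))"

lemma vcnj_nth [simp]: "vcnj v $ i = cnj (v $ i)" by (simp add: vcnj_def)

lemma FT_conj: "is_fourier_L2 f g \<Longrightarrow> is_fourier_L2 (\<lambda>x. vcnj (f x)) (\<lambda>\<xi>. vcnj (g (- \<xi>)))"
 by (auto simp: FT_iff intro: isf_conj)

lemma FT_Plancherel:
 fixes f g :: "real \<Rightarrow> complex^'n"
 assumes fg: "is_fourier_L2 f g"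
 shows "L2_normsq UNIV g = ennreal (2 * pi) * L2_normsq UNIV f"
proof -
 have i: "isf (\<lambda>x. f x $ i) (\<lambda>\<xi>. g \<xi> $ i)" for i using fg by (simp add: FT_iff)
 then have fi: "sqint (\<lambda>x. f x $ i)" and gi: "sqint (\<lambda>x. g x $ i)" for i by (auto simp: isf_def)
 note s = FT_sqint[OF fg]
 have "L2_normsq UNIV g = (\<Sum>i\<in>UNIV. ennreal (2 * pi) * L2_normsq UNIV (\<lambda>x. f x $ i))"
  using s L2_normsq_vec[of g] by (simp add: sqint_def L2_normsq_eq_l2norm[OF gi] L2_normsq_eq_l2norm[OF fi] isf_l2norm[OF i] ennreal_mult del: sum_ennreal)
 also have "\<dots> = ennreal (2 * pi) * L2_normsq UNIV f"
  using s L2_normsq_vec[of f] by (simp add: sqint_def sum_distrib_left del: sum_ennreal)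
 finally show ?thesis .
qed

definition herm :: "complex^'n \<Rightarrow> complex^'n \<Rightarrow> complex" where
 "herm v w = (\<Sum>i\<in>UNIV. v $ i * cnj (w $ i))"

lemma herm_integrable:
 assumes "sqint f" "sqint g" shows "integrable lborel (\<lambda>x. herm (f x) (g x))"
 unfolding herm_def
proof (intro Bochner_Integration.integrable_sum)
 fix i
 have f: "sqint (\<lambda>x. f x $ i)" and g: "sqint (\<lambda>x. g x $ i)" using assms by (auto simp: sqint_vec_iff)
 note [measurable] = sqint_measurable[OF f] sqint_measurable[OF g]
 show "integrable lborel (\<lambda>x. f x $ i * cnj (g x $ i))"
  by (rule Bochner_Integration.integrable_bound[OF sqint_norm_mult_integrable[OF f g]]) (auto simp: norm_mult)
qed

lemma FT_Parseval:
 assumes a: "is_fourier_L2 f g" "is_fourier_L2 f' g'"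
 shows "(LINT \<xi>. herm (g \<xi>) (g' \<xi>)) = 2 * pi * (LINT x. herm (f x) (f' x))"
proof -
 have i: "isf (\<lambda>x. f x $ i) (\<lambda>\<xi>. g \<xi> $ i)" "isf (\<lambda>x. f' x $ i) (\<lambda>\<xi>. g' \<xi> $ i)" for i using a by (auto simp: FT_iff)
 have int: "integrable lborel (\<lambda>x. u x $ i * cnj (v x $ i))" if "sqint u" "sqint v"
  for i and u v :: "real \<Rightarrow> complex^'a"
 proof -
  have uv: "sqint (\<lambda>x. u x $ i)" "sqint (\<lambda>x. cnj (v x $ i))"
  proof -
   show "sqint (\<lambda>x. u x $ i)" using that(1) by (simp add: sqint_vec_iff)
   have vi: "sqint (\<lambda>x. v x $ i)" using that(2) by (simp add: sqint_vec_iff)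
   note [measurable] = sqint_measurable[OF vi]
   show "sqint (\<lambda>x. cnj (v x $ i))" by (rule sqint_bound(1)[OF vi, of _ 1]) simp_all
  qed
  show ?thesis by (rule sqint_mult_integrable[OF uv])
 qed
 note s = FT_sqint[OF a(1)] FT_sqint[OF a(2)]
 have "(LINT \<xi>. herm (g \<xi>) (g' \<xi>)) = (\<Sum>j\<in>UNIV. LINT \<xi>. g \<xi> $ j * cnj (g' \<xi> $ j))"
  unfolding herm_def by (rule Bochner_Integration.integral_sum) (rule int[OF s(2) s(4)])
 also have "\<dots> = (\<Sum>j\<in>UNIV. 2 * pi * (LINT \<xi>. f \<xi> $ j * cnj (f' \<xi> $ j)))"
  by (intro sum.cong refl isf_Parseval i)
 also have "\<dots> = 2 * pi * (\<Sum>j\<in>UNIV. LINT \<xi>. f \<xi> $ j * cnj (f' \<xi> $ j))"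
  by (rule sum_distrib_left[symmetric])
 also have "(\<Sum>j\<in>UNIV. LINT \<xi>. f \<xi> $ j * cnj (f' \<xi> $ j)) = (LINT x. herm (f x) (f' x))"
  unfolding herm_def by (rule Bochner_Integration.integral_sum[symmetric]) (rule int[OF s(1) s(3)])
 finally show ?thesis .
qed

lemma FT_partial:
 fixes f :: "real \<times> real \<Rightarrow> complex^'n"
 assumes "sqint f"
 shows "\<exists>g. sqint g \<and> (AE s in lborel. is_fourier_L2 (\<lambda>x. f (s, x)) (\<lambda>\<xi>. g (s, \<xi>)))"
proof -
 have "\<forall>i. \<exists>g. sqint g \<and> (AE s in lborel. isf (\<lambda>x. f (s, x) $ i) (\<lambda>\<xi>. g (s, \<xi>)))"
  using assms isf_partial by (auto simp: sqint_vec_iff)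
 from choice[OF this] obtain g
  where g: "\<And>i. sqint (g i)" "\<And>i. AE s in lborel. isf (\<lambda>x. f (s, x) $ i) (\<lambda>\<xi>. g i (s, \<xi>))"
  by blast
 have "AE s in lborel. \<forall>i. isf (\<lambda>x. f (s, x) $ i) (\<lambda>\<xi>. g i (s, \<xi>))"
  by (rule eventually_all_finite) (rule g(2))
 then show ?thesis
  by (intro exI[of _ "\<lambda>z. \<chi> i. g i z"]) (auto simp: FT_iff sqint_vec_iff g)
qed

lemma FT_partial_inverse:
 fixes g :: "real \<times> real \<Rightarrow> complex^'n"
 assumes "sqint g"
 shows "\<exists>f. sqint f \<and> (AE s in lborel. is_fourier_L2 (\<lambda>x. f (s, x)) (\<lambda>\<xi>. g (s, \<xi>)))"
proof -
 have "\<forall>i. \<exists>f. sqint f \<and> (AE s in lborel. isf (\<lambda>x. f (s, x)) (\<lambda>\<xi>. g (s, \<xi>) $ i))"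
  using assms isf_partial_inverse by (auto simp: sqint_vec_iff)
 from choice[OF this] obtain f
  where f: "\<And>i. sqint (f i)" "\<And>i. AE s in lborel. isf (\<lambda>x. f i (s, x)) (\<lambda>\<xi>. g (s, \<xi>) $ i)"
  by blast
 have "AE s in lborel. \<forall>i. isf (\<lambda>x. f i (s, x)) (\<lambda>\<xi>. g (s, \<xi>) $ i)"
  by (rule eventually_all_finite) (rule f(2))
 then show ?thesis
  by (intro exI[of _ "\<lambda>z. \<chi> i. f i z"]) (auto simp: FT_iff sqint_vec_iff f)
qed

lemma FT_fourier:
 fixes f :: "real \<Rightarrow> complex^'n"
 assumes "integrable lborel f" "sqint f"
 shows "is_fourier_L2 f (fourier f)"
 unfolding FT_iff fourier_component[OF assms(1)]
 using assms isf_fourier1 by (auto simp: sqint_vec_iff integrable_vec_iff)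

section \<open>Linear algebra\<close>

subsection \<open>Spectral projectors\<close>

lemma matrix_mult_sum_left: "finite I \<Longrightarrow> (\<Sum>i\<in>I. M i) ** (N :: 'a::comm_ring_1^'k^'n) = (\<Sum>i\<in>I. M i ** N)"
 by (induction I rule: finite_induct) (auto simp: matrix_matrix_mult_def vec_eq_iff distrib_right sum.distrib)

lemma matrix_mult_sum_right: "finite I \<Longrightarrow> (N :: 'a::comm_ring_1^'n^'k) ** (\<Sum>i\<in>I. M i) = (\<Sum>i\<in>I. N ** M i)"
 by (induction I rule: finite_induct) (auto simp: matrix_add_ldistrib)

definition diagm :: "('n \<Rightarrow> real) \<Rightarrow> real^'n^'n" where
 "diagm d = (\<chi> i j. if i = j then d i else 0)"

lemma diagm_mult: "diagm d ** diagm e = diagm (\<lambda>i. d i * e i)"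
 by (simp add: diagm_def matrix_matrix_mult_def vec_eq_iff if_distrib[of "\<lambda>x. x * _"] if_distrib[of "\<lambda>x. _ * x"] cong: if_cong)

lemma diagm_one: "diagm (\<lambda>i. 1) = mat 1"
 by (simp add: diagm_def mat_def)

lemma diagm_sum: "finite I \<Longrightarrow> (\<Sum>i\<in>I. diagm (d i)) = diagm (\<lambda>k. \<Sum>i\<in>I. d i k)"
 by (simp add: diagm_def vec_eq_iff)

lemma diagm_scale: "c *\<^sub>R diagm d = diagm (\<lambda>k. c * d k)"
 by (simp add: diagm_def vec_eq_iff)

lemma matrix_scaleR_left: "(c *\<^sub>R M) ** N = c *\<^sub>R (M ** (N :: real^'k^'n))"
 by (simp add: matrix_matrix_mult_def vec_eq_iff sum_distrib_left mult.assoc)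

lemma matrix_scaleR_right: "M ** (c *\<^sub>R N) = c *\<^sub>R (M ** (N :: real^'k^'n))"
 by (simp add: matrix_matrix_mult_def vec_eq_iff sum_distrib_left mult_ac)

text \<open>In a basis of eigenvectors \<open>Q l\<close> selects the coordinates that belong to the eigenvalue \<open>l\<close>.\<close>

lemma diagonalizable_spectral_projectors:
 fixes A :: "real^'n^'n"
 assumes "diagonalizable_over_real A"
 obtains \<Lambda> :: "real set" and Q :: "real \<Rightarrow> real^'n^'n" where
  "finite \<Lambda>" "\<Lambda> \<noteq> {}" "\<And>r. mat_pow A r = (\<Sum>l\<in>\<Lambda>. l ^ r *\<^sub>R Q l)"
  "\<And>l m. l \<in> \<Lambda> \<Longrightarrow> m \<in> \<Lambda> \<Longrightarrow> Q l ** Q m = (if l = m then Q l else 0)"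
  "\<And>l. l \<in> \<Lambda> \<Longrightarrow> Q l \<noteq> 0"
proof -
 obtain P D :: "real^'n^'n" where P: "invertible P" and D: "\<And>i j. i \<noteq> j \<Longrightarrow> D $ i $ j = 0"
  and A: "A = P ** D ** matrix_inv P" using assms unfolding diagonalizable_over_real_def by blast
 define R where "R = matrix_inv P"
 have PR: "P ** R = mat 1" and RP: "R ** P = mat 1"
  using someI_ex[OF P[unfolded invertible_def]] by (auto simp: R_def matrix_inv_def)
 define d where "d i = D $ i $ i" for i
 have Dd: "D = diagm d" using D by (auto simp: diagm_def d_def vec_eq_iff)
 define c where "c e = P ** diagm e ** R" for e
 have cc: "c e ** c f = c (\<lambda>i. e i * f i)" for e f
 proof -
  have "c e ** c f = P ** diagm e ** (R ** P) ** diagm f ** R"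
   unfolding c_def by (simp only: matrix_mul_assoc)
  also have "\<dots> = P ** (diagm e ** diagm f) ** R" unfolding RP by (simp add: matrix_mul_assoc)
  finally show ?thesis by (simp add: diagm_mult c_def)
 qed
 have c1: "c (\<lambda>i. 1) = mat 1" unfolding c_def diagm_one by (simp add: PR)
 have Ac: "A = c d" by (simp add: A Dd c_def R_def)
 have pow: "mat_pow A r = c (\<lambda>i. d i ^ r)" for r
  by (induction r) (simp_all add: c1 Ac cc)
 define Q where "Q l = c (\<lambda>i. if d i = l then 1 else 0)" for l
 define \<Lambda> where "\<Lambda> = range d"
 have fin: "finite \<Lambda>" by (simp add: \<Lambda>_def)
 show thesis
 proof
  show "finite \<Lambda>" "\<Lambda> \<noteq> {}" by (simp_all add: \<Lambda>_def)
  show "mat_pow A r = (\<Sum>l\<in>\<Lambda>. l ^ r *\<^sub>R Q l)" for r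
  proof -
   have "(\<Sum>l\<in>\<Lambda>. l ^ r *\<^sub>R Q l) = (\<Sum>l\<in>\<Lambda>. P ** diagm (\<lambda>i. l ^ r * (if d i = l then 1 else 0)) ** R)"
    by (simp add: Q_def c_def diagm_scale[symmetric] matrix_scaleR_left matrix_scaleR_right)
   also have "\<dots> = P ** (\<Sum>l\<in>\<Lambda>. diagm (\<lambda>i. l ^ r * (if d i = l then 1 else 0))) ** R"
    by (simp add: matrix_mult_sum_left[OF fin] matrix_mult_sum_right[OF fin])
   also have "\<dots> = P ** diagm (\<lambda>i. d i ^ r) ** R"
    unfolding diagm_sum[OF fin]
    by (rule arg_cong[where f="\<lambda>e. P ** diagm e ** R"])
     (use fin in \<open>auto simp: \<Lambda>_def fun_eq_iff if_distrib[of "\<lambda>x. _ * x"] sum.delta cong: if_cong\<close>)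
   finally show ?thesis by (simp add: pow c_def)
  qed
  show "Q l ** Q m = (if l = m then Q l else 0)" if "l \<in> \<Lambda>" "m \<in> \<Lambda>" for l m
  proof (cases "l = m")
   case True then show ?thesis by (simp add: Q_def cc if_distrib[of "\<lambda>x. x * _"] cong: if_cong)
  next
   case False
   then have "(\<lambda>i. (if d i = l then 1 else 0) * (if d i = m then 1 else 0)) = (\<lambda>i. 0::real)" by auto
   moreover have "c (\<lambda>i. 0) = 0" by (simp add: c_def diagm_def matrix_matrix_mult_def vec_eq_iff)
   ultimately show ?thesis using False by (simp add: Q_def cc)
  qed
  show "Q l \<noteq> 0" if lL: "l \<in> \<Lambda>" for l
  proof
   assume "Q l = 0"
   then have "R ** Q l ** P = 0" by (simp add: matrix_matrix_mult_def vec_eq_iff)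
   moreover have "R ** Q l ** P = (R ** P) ** diagm (\<lambda>i. if d i = l then 1 else 0) ** (R ** P)"
    unfolding Q_def c_def by (simp only: matrix_mul_assoc)
   ultimately have z: "diagm (\<lambda>i. if d i = l then 1 else 0) = 0" by (simp add: RP)
   obtain i where "d i = l" using lL by (auto simp: \<Lambda>_def)
   then have "diagm (\<lambda>i. if d i = l then 1 else 0) $ i $ i = 1" by (simp add: diagm_def)
   then show False using z by simp
  qed
 qed
qed

lemma cmat_mult: "cmat (M ** N) = cmat M ** cmat N"
 by (simp add: map_matrix_def matrix_matrix_mult_def vec_eq_iff)

lemma cmat_add: "cmat (M + N) = cmat M + cmat N"
 by (simp add: map_matrix_def vec_eq_iff)

lemma cmat_zero: "cmat 0 = 0" by (simp add: map_matrix_def vec_eq_iff)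

lemma cmat_one: "cmat (mat 1) = mat 1" by (simp add: map_matrix_def mat_def vec_eq_iff)

lemma cmat_sum: "cmat (\<Sum>i\<in>I. M i) = (\<Sum>i\<in>I. cmat (M i))"
 by (induction I rule: infinite_finite_induct) (simp_all add: cmat_add cmat_zero)

lemma cmat_scale: "cmat (c *\<^sub>R M) *v z = complex_of_real c *s (cmat M *v z)"
 by (simp add: map_matrix_def matrix_vector_mult_def vec_eq_iff sum_distrib_left mult.assoc)

lemma matrix_vector_sum_left: "(\<Sum>i\<in>I. M i) *v z = (\<Sum>i\<in>I. M i *v (z :: 'a::comm_ring_1^'n))"
 by (induction I rule: infinite_finite_induct) (simp_all add: matrix_vector_mult_add_rdistrib)

lemma matrix_vector_sum_right: "M *v (\<Sum>i\<in>I. z i) = (\<Sum>i\<in>I. M *v (z i :: 'a::comm_ring_1^'n))"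
 by (induction I rule: infinite_finite_induct) (simp_all add: matrix_vector_right_distrib)

lemma mv_scale: "M *v (c *s z) = c *s (M *v (z :: 'a::comm_ring_1^'n))"
 by (simp add: matrix_vector_mult_def vec_eq_iff sum_distrib_left mult_ac)

lemma mv_scaleR: "M *v (c *\<^sub>R z) = c *\<^sub>R (M *v (z :: complex^'n))"
 by (simp add: matrix_vector_mult_def vec_eq_iff scaleR_sum_right)

lemma spectrum_from_projectors:
 fixes A :: "real^'n^'n"
 assumes fin: "finite \<Lambda>" and pow: "\<And>r. mat_pow A r = (\<Sum>l\<in>\<Lambda>. l ^ r *\<^sub>R Q l)"
  and Q: "\<And>l m. l \<in> \<Lambda> \<Longrightarrow> m \<in> \<Lambda> \<Longrightarrow> Q l ** Q m = (if l = m then Q l else 0)"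
  and Q0: "\<And>l. l \<in> \<Lambda> \<Longrightarrow> Q l \<noteq> 0"
 shows "mat_spectrum A = complex_of_real ` \<Lambda>"
proof -
 have A: "A = (\<Sum>l\<in>\<Lambda>. l *\<^sub>R Q l)" using pow[of 1] by simp
 have one: "mat 1 = (\<Sum>l\<in>\<Lambda>. Q l)" using pow[of 0] by simp
 have AQ: "A ** Q l = l *\<^sub>R Q l" "Q l ** A = l *\<^sub>R Q l" if "l \<in> \<Lambda>" for l
  using that fin by (simp_all add: A matrix_mult_sum_left matrix_mult_sum_right matrix_scaleR_left matrix_scaleR_right Q
    if_distrib[of "\<lambda>x. _ *\<^sub>R x"] cong: if_cong sum.cong)
 show ?thesis
 proof (intro set_eqI iffI)
  fix z assume "z \<in> mat_spectrum A"
  then obtain v where v: "v \<noteq> 0" "cmat A *v v = z *s v" by (auto simp: mat_spectrum_def)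
  have "v = cmat (mat 1) *v v" by (simp add: cmat_one)
  also have "\<dots> = (\<Sum>l\<in>\<Lambda>. cmat (Q l) *v v)" unfolding one cmat_sum matrix_vector_sum_left ..
  finally have vs: "v = (\<Sum>l\<in>\<Lambda>. cmat (Q l) *v v)" .
  have "\<exists>l\<in>\<Lambda>. cmat (Q l) *v v \<noteq> 0"
  proof (rule ccontr)
   assume "\<not> ?thesis"
   then have "(\<Sum>l\<in>\<Lambda>. cmat (Q l) *v v) = 0" by (intro sum.neutral) blast
   then show False using vs v(1) by argo
  qed
  then obtain l where l: "l \<in> \<Lambda>" "cmat (Q l) *v v \<noteq> 0" by blast
  have "cmat (Q l) *v (cmat A *v v) = cmat (Q l ** A) *v v" by (simp add: cmat_mult matrix_vector_mul_assoc)
  also have "\<dots> = of_real l *s (cmat (Q l) *v v)" by (simp add: AQ[OF l(1)] cmat_scale)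
  finally have "of_real l *s (cmat (Q l) *v v) = cmat (Q l) *v (cmat A *v v)" by (rule sym)
  also have "\<dots> = z *s (cmat (Q l) *v v)" unfolding v(2) by (rule mv_scale)
  finally have "of_real l *s (cmat (Q l) *v v) = z *s (cmat (Q l) *v v)" .
  then have "of_real l = z" using l(2) vector_mul_rcancel by blast
  then show "z \<in> complex_of_real ` \<Lambda>" using l(1) by blast
 next
  fix z assume "z \<in> complex_of_real ` \<Lambda>"
  then obtain l where l: "l \<in> \<Lambda>" "z = of_real l" by blast
  have "cmat (Q l) \<noteq> 0" using Q0[OF l(1)] by (auto simp: map_matrix_def vec_eq_iff)
  then have "\<exists>w. cmat (Q l) *v w \<noteq> 0 *v w" using matrix_eq[of "cmat (Q l)" 0] by blast
  then obtain w where w: "cmat (Q l) *v w \<noteq> 0" by auto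
  have "cmat A *v (cmat (Q l) *v w) = cmat (A ** Q l) *v w" by (simp add: cmat_mult matrix_vector_mul_assoc)
  also have "\<dots> = z *s (cmat (Q l) *v w)" by (simp add: AQ[OF l(1)] cmat_scale l(2))
  finally show "z \<in> mat_spectrum A" unfolding mat_spectrum_def using w by blast
 qed
qed

subsection \<open>Kalman layers\<close>

lemma subspace_kalman_range: "subspace (kalman_range A B k)"
proof -
 let ?L = "\<lambda>v :: nat \<Rightarrow> real^'b. \<Sum>j\<le>k. (mat_pow A j ** B) *v v j"
 have 1: "0 = ?L (\<lambda>_. 0)" by simp
 have 2: "?L v + ?L w = ?L (\<lambda>j. v j + w j)" for v w by (simp add: matrix_vector_right_distrib sum.distrib)
 have 3: "c *\<^sub>R ?L v = ?L (\<lambda>j. c *\<^sub>R v j)" for c v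
  by (simp add: matrix_vector_mult_scaleR scaleR_sum_right)
 have "0 \<in> range ?L" by (rule range_eqI[where x="\<lambda>_. 0"], rule 1)
 moreover have "x + y \<in> range ?L" if xy: "x \<in> range ?L" "y \<in> range ?L" for x y
  proof -
  obtain v w where "x = ?L v" "y = ?L w" using xy by blast
  then have "x + y = ?L (\<lambda>j. v j + w j)" using 2[of v w] by simp
  then show ?thesis by (rule range_eqI[where f="?L"])
 qed
 moreover have "c *\<^sub>R x \<in> range ?L" if xx: "x \<in> range ?L" for c x
  proof -
  obtain v where "x = ?L v" using xx by blast
  then have "c *\<^sub>R x = ?L (\<lambda>j. c *\<^sub>R v j)" using 3[of c v] by simp
  then show ?thesis by (rule range_eqI[where f="?L"])
 qed
 ultimately show ?thesis unfolding subspace_def kalman_range_def by blast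
qed

lemma kalman_range_mono: "j \<le> k \<Longrightarrow> kalman_range A B j \<subseteq> kalman_range A B k"
proof
 fix x assume jk: "j \<le> k" and "x \<in> kalman_range A B j"
 then obtain v where v: "x = (\<Sum>i\<le>j. (mat_pow A i ** B) *v v i)" by (auto simp: kalman_range_def)
 have "(\<Sum>i\<le>k. (mat_pow A i ** B) *v (if i \<le> j then v i else 0)) = x"
  unfolding v by (rule sum.mono_neutral_cong_right) (use jk in auto)
 then show "x \<in> kalman_range A B k" by (auto simp: kalman_range_def)
qed

lemma kalman_range_power: "i \<le> k \<Longrightarrow> (mat_pow A i ** B) *v w \<in> kalman_range A B k"
proof -
 assume i: "i \<le> k"
 have "(\<Sum>j\<le>k. (mat_pow A j ** B) *v (if j = i then w else 0)) = (mat_pow A i ** B) *v w"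
  using i by (subst sum.remove[of _ i]) auto
 then show ?thesis unfolding kalman_range_def by (intro range_eqI[where x="\<lambda>j. if j = i then w else 0"]) simp
qed

lemma orth_proj_characterization:
 assumes V: "subspace V"
 shows "orth_proj V x \<in> V" "x - orth_proj V x \<in> V\<^sup>\<bottom>"
  "p \<in> V \<Longrightarrow> x - p \<in> V\<^sup>\<bottom> \<Longrightarrow> orth_proj V x = p"
proof -
 have uniq: "p = q" if "p \<in> V" "x - p \<in> V\<^sup>\<bottom>" "q \<in> V" "x - q \<in> V\<^sup>\<bottom>" for p q
 proof -
  have "(x - q) - (x - p) \<in> V\<^sup>\<bottom>" using that subspace_orthogonal_comp subspace_diff by blast
  moreover have "p - q \<in> V" using that V subspace_diff by blast
  ultimately have "orthogonal (p - q) (p - q)" by (auto simp: orthogonal_comp_def)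
  then show ?thesis by (simp add: orthogonal_self)
 qed
 have "\<exists>p. p \<in> V \<and> x - p \<in> V\<^sup>\<bottom>"
 proof -
  have "x \<in> V + V\<^sup>\<bottom>" using subspace_sum_orthogonal_comp[OF V] by simp
  then obtain p q where "p \<in> V" "q \<in> V\<^sup>\<bottom>" "x = p + q" by (auto elim: set_plus_elim)
  then show ?thesis by (intro exI[of _ p]) auto
 qed
 then have ex: "\<exists>!p. p \<in> V \<and> x - p \<in> V\<^sup>\<bottom>" using uniq by blast
 from theI'[OF this] show 1: "orth_proj V x \<in> V" and 2: "x - orth_proj V x \<in> V\<^sup>\<bottom>"
  by (auto simp: orth_proj_def)
 show "p \<in> V \<Longrightarrow> x - p \<in> V\<^sup>\<bottom> \<Longrightarrow> orth_proj V x = p" using uniq 1 2 by blast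
qed

lemma linear_orth_proj:
 assumes V: "subspace V" shows "linear (orth_proj V)"
proof (rule linearI)
 note c = orth_proj_characterization[OF V]
 note s = subspace_orthogonal_comp[of V]
 show "orth_proj V (x + y) = orth_proj V x + orth_proj V y" for x y
 proof (rule c(3))
  show "orth_proj V x + orth_proj V y \<in> V" using c(1) V subspace_add by blast
  show "x + y - (orth_proj V x + orth_proj V y) \<in> V\<^sup>\<bottom>"
   using subspace_add[OF s c(2)[of x] c(2)[of y]] by (simp add: algebra_simps)
 qed
 show "orth_proj V (r *\<^sub>R x) = r *\<^sub>R orth_proj V x" for r x
 proof (rule c(3))
  show "r *\<^sub>R orth_proj V x \<in> V" using c(1) V subspace_scale by blast
  show "r *\<^sub>R x - r *\<^sub>R orth_proj V x \<in> V\<^sup>\<bottom>"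
   using subspace_scale[OF s c(2)[of x], of r] by (simp add: algebra_simps)
 qed
qed

lemma transpose_sum: "transpose (\<Sum>i\<in>I. M i) = (\<Sum>i\<in>I. transpose (M i))"
 by (simp add: transpose_def vec_eq_iff)

lemma transpose_mat_pow: "transpose (mat_pow A r) = mat_pow (transpose A) r"
proof -
 have comm: "M ** mat_pow M r = mat_pow M r ** M" for M :: "'a^'n^'n" and r
  by (induction r) (simp_all add: matrix_mul_assoc)
 show ?thesis by (induction r) (simp_all add: transpose_mat matrix_transpose_mul comm)
qed

text \<open>The last two facts relate the layers to the observation. The layer \<open>j\<close> is orthogonal to the ranges of \<open>A\<^sup>r B\<close> for
\<open>r < j\<close>, so it is invisible to \<open>B\<^sup>T (A\<^sup>T)\<^sup>r\<close>. The layer \<open>k\<close> lies in the sum of the ranges of \<open>A\<^sup>i B\<close> for \<open>i \<le> k\<close>, so its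
symmetric projector can be recovered from the observations \<open>B\<^sup>T (A\<^sup>T)\<^sup>i z\<close>, \<open>i \<le> k\<close>.\<close>

lemma kalman_layer_projectors:
 fixes A :: "real^'n^'n" and B :: "real^'m^'n"
 assumes K: "kalman_index A B K"
 obtains P :: "nat \<Rightarrow> real^'n^'n" and X :: "nat \<Rightarrow> nat \<Rightarrow> real^'m^'n" where
  "\<And>k z. layer_proj A B k z = cmat (P k) *v z"
  "\<And>k. transpose (P k) = P k"
  "\<And>j k. P j ** P k = (if j = k then P k else 0)"
  "(\<Sum>k\<le>K. P k) = mat 1"
  "\<And>r j. r < j \<Longrightarrow> transpose B ** mat_pow (transpose A) r ** P j = 0"
  "\<And>k. P k = (\<Sum>i\<le>k. X k i ** (transpose B ** mat_pow (transpose A) i))"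
proof -
 let ?R = "kalman_range A B" and ?V = "kalman_layer A B"
 have V: "subspace (?V k)" for k
  unfolding kalman_layer_def by (intro subspace_inter subspace_kalman_range subspace_orthogonal_comp)
 note c = orth_proj_characterization[OF V]
 define P where "P k = matrix (orth_proj (?V k))" for k
 have P: "P k *v x = orth_proj (?V k) x" for k x
  unfolding P_def using linear_orth_proj[OF V] by (intro matrix_works) (simp add: scalar_mult_eq_scaleR[abs_def] linear_def)
 have VR: "?V k \<subseteq> ?R k" for k by (auto simp: kalman_layer_def)
 have fixV: "P k *v x = x" if "x \<in> ?V k" for k x
  unfolding P by (rule c(3)) (use that in \<open>auto simp: subspace_0 subspace_orthogonal_comp\<close>)
 have annV: "P k *v x = 0" if "x \<in> (?V k)\<^sup>\<bottom>" for k x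
  unfolding P by (rule c(3)) (use that V subspace_0 in auto)
 have VRo: "?V k \<subseteq> (?R j)\<^sup>\<bottom>" if "j < k" for j k
 proof -
  have "?V k \<subseteq> (?R (k - 1))\<^sup>\<bottom>" using that by (auto simp: kalman_layer_def)
  also have "\<dots> \<subseteq> (?R j)\<^sup>\<bottom>" by (rule orthogonal_comp_anti_mono[OF kalman_range_mono]) (use that in simp)
  finally show ?thesis .
 qed
 have RVo: "?R j \<subseteq> (?V k)\<^sup>\<bottom>" if "j < k" for j k
 proof
  fix x assume x: "x \<in> ?R j"
  have "orthogonal y x" if "y \<in> ?V k" for y
   using VRo[OF \<open>j < k\<close>] that x by (subst orthogonal_commute) (auto simp: orthogonal_comp_def)
  then show "x \<in> (?V k)\<^sup>\<bottom>" by (simp add: orthogonal_comp_def)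
 qed
 have VV: "?V j \<subseteq> (?V k)\<^sup>\<bottom>" if "j \<noteq> k" for j k
 proof (cases "j < k")
  case True then show ?thesis using VR RVo by blast
 next
  case False
  then have "k < j" using that by simp
  then have "?V j \<subseteq> (?R k)\<^sup>\<bottom>" by (rule VRo)
  also have "\<dots> \<subseteq> (?V k)\<^sup>\<bottom>" by (rule orthogonal_comp_anti_mono[OF VR])
  finally show ?thesis .
 qed
 have sym: "transpose (P k) = P k" for k
 proof -
  have "(P k *v x) \<bullet> y = x \<bullet> (P k *v y)" for x y
  proof -
   have "(P k *v x) \<bullet> (y - P k *v y) = 0" "(P k *v y) \<bullet> (x - P k *v x) = 0"
    using c(1)[of k] c(2)[of _ k] unfolding P by (auto simp: orthogonal_comp_def orthogonal_def)
   then show ?thesis by (simp add: inner_diff_right inner_commute)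
  qed
  then have "x \<bullet> (transpose (P k) *v y) = x \<bullet> (P k *v y)" for x y
   by (metis dot_lmul_matrix inner_commute transpose_matrix_vector)
  then have "transpose (P k) *v y = P k *v y" for y by (metis vector_eq_rdot inner_commute)
  then show ?thesis by (simp add: matrix_eq)
 qed
 have PP: "P j ** P k = (if j = k then P k else 0)" for j k
 proof -
  have "P j *v (P k *v x) = (if j = k then P k else 0) *v x" for x
  proof (cases "j = k")
   case True then show ?thesis using fixV[of "P k *v x" k] c(1)[of k x] by (simp add: P)
  next
   case False
   then have "P k *v x \<in> (?V j)\<^sup>\<bottom>" using VV[of k j] c(1)[of k x] by (auto simp: P)
   then show ?thesis using annV False by simp
  qed
  then show ?thesis by (subst matrix_eq) (simp add: matrix_vector_mul_assoc)
 qed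
 have recon: "(\<Sum>j\<le>k. P j *v x) = x" if "x \<in> ?R k" for k x
  using that
 proof (induction k arbitrary: x)
  case 0
  then have "x \<in> ?V 0" by (simp add: kalman_layer_def)
  then show ?case by (simp add: fixV)
 next
  case (Suc k)
  define y where "y = orth_proj (?R k) x"
  note cy = orth_proj_characterization[OF subspace_kalman_range[of A B k], where x=x, folded y_def]
  have y: "y \<in> ?R k" and xy: "x - y \<in> (?R k)\<^sup>\<bottom>" by (fact cy(1), fact cy(2))
  have "y \<in> ?R (Suc k)" using y kalman_range_mono[of k "Suc k"] by auto
  then have "x - y \<in> ?V (Suc k)"
   using xy Suc.prems subspace_diff[OF subspace_kalman_range] by (auto simp: kalman_layer_def)
  then have 1: "P (Suc k) *v (x - y) = x - y" by (rule fixV)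
  have 2: "P (Suc k) *v y = 0" by (rule annV) (use RVo[of k "Suc k"] y in auto)
  have 3: "P j *v (x - y) = 0" if "j \<le> k" for j
   by (rule annV) (use VV[of "Suc k" j] that \<open>x - y \<in> ?V (Suc k)\<close> in auto)
  have "(\<Sum>j\<le>Suc k. P j *v x) = (\<Sum>j\<le>Suc k. P j *v y + P j *v (x - y))"
   by (simp add: matrix_vector_mult_diff_distrib)
  also have "\<dots> = (\<Sum>j\<le>k. P j *v y) + (x - y)"
   by (simp add: 1 2 3 sum.distrib)
  finally show ?case using Suc.IH[OF y] by simp
 qed
 have top: "?R K = UNIV"
  using K subspace_kalman_range[of A B K] unfolding kalman_index_def
  by (metis DIM_cart DIM_real dim_eq_full mult.right_neutral span_eq_iff)
 have sum1: "(\<Sum>k\<le>K. P k) = mat 1"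
  by (subst matrix_eq) (simp add: matrix_vector_sum_left recon top)
 have F1: "transpose B ** mat_pow (transpose A) r ** P j = 0" if rj: "r < j" for r j
 proof -
  have "(transpose B ** mat_pow (transpose A) r) *v (P j *v x) = 0" for x
  proof -
   have e: "transpose B ** mat_pow (transpose A) r = transpose (mat_pow A r ** B)"
    by (simp add: matrix_transpose_mul transpose_mat_pow)
   have "w \<bullet> (transpose (mat_pow A r ** B) *v (P j *v x)) = 0" for w
   proof -
    have "(mat_pow A r ** B) *v w \<in> ?R r" by (rule kalman_range_power) simp
    moreover have "P j *v x \<in> (?R r)\<^sup>\<bottom>" using VRo[OF rj] c(1)[of j x] by (auto simp: P)
    ultimately have "((mat_pow A r ** B) *v w) \<bullet> (P j *v x) = 0"
     by (auto simp: orthogonal_comp_def orthogonal_def)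
    then show ?thesis by (metis dot_lmul_matrix inner_commute transpose_matrix_vector)
   qed
   then show ?thesis unfolding e by (metis inner_eq_zero_iff)
  qed
  then show ?thesis by (subst matrix_eq) (simp add: matrix_vector_mul_assoc[symmetric])
 qed
 have "\<exists>v. P k *v axis l 1 = (\<Sum>j\<le>k. (mat_pow A j ** B) *v v j)" for k l
  using c(1)[of k "axis l 1"] VR[of k] unfolding P kalman_range_def by blast
 then obtain v where v: "\<And>k l. P k *v axis l 1 = (\<Sum>j\<le>k. (mat_pow A j ** B) *v v k l j)" by metis
 define X where "X k j = (\<chi> l. v k l j)" for k j
 have F2: "P k = (\<Sum>i\<le>k. X k i ** (transpose B ** mat_pow (transpose A) i))" for k
 proof -
  have col: "transpose (X k j) *v axis l 1 = v k l j" for j l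
   by (simp add: matrix_vector_mult_basis column_def transpose_def X_def)
  have "P k = (\<Sum>j\<le>k. (mat_pow A j ** B) ** transpose (X k j))"
  proof (rule vec_eq_iff[THEN iffD2], rule, rule vec_eq_iff[THEN iffD2], rule)
   fix i l
   have "P k *v axis l 1 = (\<Sum>j\<le>k. (mat_pow A j ** B) ** transpose (X k j)) *v axis l 1"
    by (simp only: v matrix_vector_sum_left matrix_vector_mul_assoc[symmetric] col)
   then have "column l (P k) = column l (\<Sum>j\<le>k. (mat_pow A j ** B) ** transpose (X k j))"
    by (simp add: matrix_vector_mult_basis)
   then show "P k $ i $ l = (\<Sum>j\<le>k. (mat_pow A j ** B) ** transpose (X k j)) $ i $ l"
    by (simp add: column_def vec_eq_iff)
  qed
  then have "transpose (P k) = (\<Sum>j\<le>k. X k j ** (transpose B ** mat_pow (transpose A) j))"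
   by (simp add: transpose_sum matrix_transpose_mul transpose_mat_pow)
  then show ?thesis by (simp add: sym)
 qed
 have L: "layer_proj A B k z = cmat (P k) *v z" for k z
 proof -
  have "layer_proj A B k z $ i = (cmat (P k) *v z) $ i" for i
   unfolding layer_proj_def P[symmetric]
   by (simp add: cvec_def matrix_vector_mult_def map_matrix_def complex_eq_iff)
  then show ?thesis by (simp add: vec_eq_iff)
 qed
 show thesis by (rule that[OF L sym PP sum1 F1 F2])
qed

section \<open>The Kalman weights and the propagator\<close>

lemma complex_matrix_bounded:
 fixes M :: "complex^'n^'m"
 shows "\<exists>c\<ge>0. \<forall>z. norm (M *v z) \<le> c * norm z"
proof -
 have "bounded_linear (\<lambda>z. M *v z)"
  by (rule linear_conv_bounded_linear[THEN iffD1], rule linearI)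
   (simp_all add: matrix_vector_right_distrib mv_scaleR)
 then show ?thesis by (metis bounded_linear.nonneg_bounded mult.commute)
qed

lemma complex_matrix_measurable [measurable (raw)]:
 fixes M :: "complex^'n^'m"
 assumes "f \<in> borel_measurable N" shows "(\<lambda>x. M *v f x) \<in> borel_measurable N"
proof -
 have "bounded_linear (\<lambda>z. M *v z)"
  by (rule linear_conv_bounded_linear[THEN iffD1], rule linearI)
   (simp_all add: matrix_vector_right_distrib mv_scaleR)
 then show ?thesis
  using borel_measurable_continuous_on[OF linear_continuous_on assms] by blast
qed

lemma vec_scale_measurable [measurable (raw)]:
 fixes f :: "'a \<Rightarrow> complex^'n"
 assumes "c \<in> borel_measurable M" "f \<in> borel_measurable M"
 shows "(\<lambda>x. c x *s f x) \<in> borel_measurable M"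
 using assms by (auto simp: measurable_vec_iff intro!: borel_measurable_times)

lemma norm_vec_scale: "norm (c *s v) = norm c * norm (v :: complex^'n)"
proof -
 have "(norm (c *s v))\<^sup>2 = (norm c * norm v)\<^sup>2"
  by (simp add: norm_vec_sq norm_mult power_mult_distrib sum_distrib_left)
 then show ?thesis by simp
qed

lemma herm_self: "herm v v = of_real ((norm v)\<^sup>2)"
 unfolding herm_def norm_vec_sq of_real_sum complex_norm_square ..

lemma herm_cmat: "herm (cmat M *v v) w = herm v (cmat (transpose M) *v w)"
proof -
 have "herm (cmat M *v v) w = (\<Sum>i\<in>UNIV. \<Sum>j\<in>UNIV. of_real (M $ i $ j) * v $ j * cnj (w $ i))"
  by (simp add: herm_def matrix_vector_mult_def map_matrix_def sum_distrib_right)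
 also have "\<dots> = (\<Sum>j\<in>UNIV. \<Sum>i\<in>UNIV. of_real (M $ i $ j) * v $ j * cnj (w $ i))"
  by (rule sum.swap)
 also have "\<dots> = herm v (cmat (transpose M) *v w)"
  by (simp add: herm_def matrix_vector_mult_def map_matrix_def transpose_def sum_distrib_left mult_ac)
 finally show ?thesis .
qed

lemma herm_scale: "herm (c *s v) w = c * herm v w" "herm v (c *s w) = cnj c * herm v w"
 by (simp_all add: herm_def sum_distrib_left mult_ac)

lemma herm_add: "herm (u + v) w = herm u w + herm v w" "herm u (v + w) = herm u v + herm u w"
 by (simp_all add: herm_def distrib_right distrib_left sum.distrib)

lemma herm_zero [simp]: "herm 0 w = 0" "herm v 0 = 0"
 by (simp_all add: herm_def)

lemma herm_sum: "herm (\<Sum>i\<in>I. f i) w = (\<Sum>i\<in>I. herm (f i) w)" "herm w (\<Sum>i\<in>I. f i) = (\<Sum>i\<in>I. herm w (f i))"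
 by (induction I rule: infinite_finite_induct) (simp_all add: herm_add)

lemma norm_herm_le: "norm (herm v w) \<le> norm v * norm w"
proof -
 have "norm (herm v w) \<le> (\<Sum>i\<in>UNIV. norm (v $ i) * norm (w $ i))"
  unfolding herm_def by (rule order_trans[OF norm_sum]) (simp add: norm_mult)
 also have "\<dots> \<le> L2_set (\<lambda>i. norm (v $ i)) UNIV * L2_set (\<lambda>i. norm (w $ i)) UNIV"
  by (rule order_trans[OF _ L2_set_mult_ineq]) simp
 finally show ?thesis by (simp add: norm_vec_def)
qed

lemma scaleR_vec: "r *\<^sub>R (v :: complex^'n) = complex_of_real r *s v"
 by (rule vec_eq_iff[THEN iffD2], rule, simp only: vector_scaleR_component vector_smult_component, rule scaleR_conv_of_real)

lemma inner_herm: "v \<bullet> w = Re (herm v w)" for v w :: "complex^'n"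
 by (simp add: inner_vec_def herm_def inner_complex_def)

text \<open>All that the analysis uses of \<open>A\<close> and \<open>B\<close>: the spectral decomposition of \<open>A\<close> and the algebra of the layer
projectors \<open>P k\<close>.\<close>

locale kalman =
 fixes A :: "real^'n^'n" and B :: "real^'m^'n" and K :: nat
  and \<Lambda> :: "real set" and Q :: "real \<Rightarrow> real^'n^'n"
  and P :: "nat \<Rightarrow> real^'n^'n" and X :: "nat \<Rightarrow> nat \<Rightarrow> real^'m^'n"
 assumes fin: "finite \<Lambda>" and \<Lambda>_ne: "\<Lambda> \<noteq> {}"
  and pow: "\<And>r. mat_pow A r = (\<Sum>l\<in>\<Lambda>. l ^ r *\<^sub>R Q l)"
  and QQ: "\<And>l m. l \<in> \<Lambda> \<Longrightarrow> m \<in> \<Lambda> \<Longrightarrow> Q l ** Q m = (if l = m then Q l else 0)"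
  and layer: "\<And>k z. layer_proj A B k z = cmat (P k) *v z"
  and Psym: "\<And>k. transpose (P k) = P k"
  and PP: "\<And>j k. P j ** P k = (if j = k then P k else 0)"
  and Psum: "(\<Sum>k\<le>K. P k) = mat 1"
  and BAP: "\<And>r j. r < j \<Longrightarrow> transpose B ** mat_pow (transpose A) r ** P j = 0"
  and PX: "\<And>k. P k = (\<Sum>i\<le>k. X k i ** (transpose B ** mat_pow (transpose A) i))"
begin

definition pj :: "nat \<Rightarrow> complex^'n \<Rightarrow> complex^'n" where "pj k z = cmat (P k) *v z"

definition Bt :: "complex^'n \<Rightarrow> complex^'m" where "Bt z = cmat (transpose B) *v z"

definition Bc :: "complex^'m \<Rightarrow> complex^'n" where "Bc z = cmat B *v z"

definition Qt :: "real \<Rightarrow> complex^'n \<Rightarrow> complex^'n" where "Qt l z = cmat (transpose (Q l)) *v z"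

definition Qc :: "real \<Rightarrow> complex^'n \<Rightarrow> complex^'n" where "Qc l z = cmat (Q l) *v z"

text \<open>\<open>Ev \<theta> = exp (i \<theta> A\<^sup>T)\<close> is the adjoint of \<open>Es \<theta> = exp (- i \<theta> A)\<close>.\<close>

definition Ev :: "real \<Rightarrow> complex^'n \<Rightarrow> complex^'n" where
 "Ev \<theta> z = (\<Sum>l\<in>\<Lambda>. cis (\<theta> * l) *s Qt l z)"

definition Es :: "real \<Rightarrow> complex^'n \<Rightarrow> complex^'n" where
 "Es \<theta> z = (\<Sum>l\<in>\<Lambda>. cis (- (\<theta> * l)) *s Qc l z)"

text \<open>With \<open>\<mu> = min \<bar>\<xi>\<bar> 1\<close>, the squared norm of \<open>Dm \<mu> z\<close> is the weighted sum of the squared norms of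
 the layer components of \<open>z\<close>.\<close>

definition Dm :: "real \<Rightarrow> complex^'n \<Rightarrow> complex^'n" where
 "Dm \<mu> z = (\<Sum>k\<le>K. \<mu> ^ k *\<^sub>R pj k z)"

definition mu :: "real \<Rightarrow> real" where "mu \<xi> = min \<bar>\<xi>\<bar> 1"

lemmas opdefs = pj_def Bt_def Bc_def Qt_def Qc_def

lemma op_add: "pj k (z + w) = pj k z + pj k w" "Bt (z + w) = Bt z + Bt w" "Bc (c + d) = Bc c + Bc d"
  "Qt l (z + w) = Qt l z + Qt l w" "Qc l (z + w) = Qc l z + Qc l w"
 by (simp_all add: opdefs matrix_vector_right_distrib)

lemma op_scale: "pj k (c *s z) = c *s pj k z" "Bt (c *s z) = c *s Bt z" "Bc (c *s w) = c *s Bc w"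
  "Qt l (c *s z) = c *s Qt l z" "Qc l (c *s z) = c *s Qc l z"
 by (simp_all add: opdefs mv_scale)

lemma op_scaleR: "pj k (r *\<^sub>R z) = r *\<^sub>R pj k z" "Bt (r *\<^sub>R z) = r *\<^sub>R Bt z" "Bc (r *\<^sub>R w) = r *\<^sub>R Bc w"
  "Qt l (r *\<^sub>R z) = r *\<^sub>R Qt l z" "Qc l (r *\<^sub>R z) = r *\<^sub>R Qc l z"
 by (simp_all add: opdefs mv_scaleR)

lemma op_zero [simp]: "pj k 0 = 0" "Bt 0 = 0" "Bc 0 = 0" "Qt l 0 = 0" "Qc l 0 = 0"
 by (simp_all add: opdefs)

lemma op_sum: "pj k (\<Sum>i\<in>I. f i) = (\<Sum>i\<in>I. pj k (f i))" "Bt (\<Sum>i\<in>I. f i) = (\<Sum>i\<in>I. Bt (f i))"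
 "Bc (\<Sum>i\<in>I. g i) = (\<Sum>i\<in>I. Bc (g i))" "Qt l (\<Sum>i\<in>I. f i) = (\<Sum>i\<in>I. Qt l (f i))" "Qc l (\<Sum>i\<in>I. f i) = (\<Sum>i\<in>I. Qc l (f i))"
 by (simp_all add: opdefs matrix_vector_sum_right)

lemma op_measurable [measurable (raw)]:
 "f \<in> borel_measurable M \<Longrightarrow> (\<lambda>x. pj k (f x)) \<in> borel_measurable M"
 "f \<in> borel_measurable M \<Longrightarrow> (\<lambda>x. Bt (f x)) \<in> borel_measurable M"
 "g \<in> borel_measurable M \<Longrightarrow> (\<lambda>x. Bc (g x)) \<in> borel_measurable M"
 "f \<in> borel_measurable M \<Longrightarrow> (\<lambda>x. Qt l (f x)) \<in> borel_measurable M"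
 "f \<in> borel_measurable M \<Longrightarrow> (\<lambda>x. Qc l (f x)) \<in> borel_measurable M"
 unfolding opdefs by (rule complex_matrix_measurable, assumption)+

lemma pj_pj: "pj j (pj k z) = (if j = k then pj k z else 0)"
 using PP[of j k] by (simp add: pj_def matrix_vector_mul_assoc cmat_mult[symmetric] cmat_zero)

lemma pj_sum: "(\<Sum>k\<le>K. pj k z) = z"
proof -
 have "(\<Sum>k\<le>K. pj k z) = cmat (\<Sum>k\<le>K. P k) *v z"
  by (simp add: pj_def cmat_sum matrix_vector_sum_left)
 then show ?thesis by (simp add: Psum cmat_one)
qed

lemma herm_pj: "herm (pj k z) w = herm z (pj k w)"
 unfolding pj_def herm_cmat Psym ..

lemma norm_sum_pj: "(norm (\<Sum>k\<le>K. a k *\<^sub>R pj k z))\<^sup>2 = (\<Sum>k\<le>K. (a k)\<^sup>2 * (norm (pj k z))\<^sup>2)"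
proof -
 let ?S = "\<Sum>k\<le>K. a k *\<^sub>R pj k z"
 have "herm ?S ?S = (\<Sum>k\<le>K. herm (a k *\<^sub>R pj k z) ?S)" by (rule herm_sum(1))
 also have "\<dots> = (\<Sum>k\<le>K. \<Sum>j\<le>K. herm (a k *\<^sub>R pj k z) (a j *\<^sub>R pj j z))"
  by (intro sum.cong refl herm_sum(2))
 also have "\<dots> = (\<Sum>k\<le>K. \<Sum>j\<le>K. of_real (a k * a j) * herm (pj k z) (pj j z))"
  by (intro sum.cong refl) (simp add: scaleR_vec herm_scale)
 also have "\<dots> = (\<Sum>k\<le>K. \<Sum>j\<le>K. if j = k then of_real ((a k)\<^sup>2 * (norm (pj k z))\<^sup>2) else 0)"
 proof (intro sum.cong refl)
  fix k j
  show "of_real (a k * a j) * herm (pj k z) (pj j z) = (if j = k then of_real ((a k)\<^sup>2 * (norm (pj k z))\<^sup>2) else 0)"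
  proof (cases "j = k")
   case True then show ?thesis by (simp add: herm_self power2_eq_square)
  next
   case False then show ?thesis by (simp add: herm_pj pj_pj)
  qed
 qed
 also have "\<dots> = of_real (\<Sum>k\<le>K. (a k)\<^sup>2 * (norm (pj k z))\<^sup>2)" by (simp add: sum.delta)
 finally show ?thesis unfolding herm_self by (simp only: of_real_eq_iff)
qed

lemma norm_Dm: "(norm (Dm \<mu> z))\<^sup>2 = (\<Sum>k\<le>K. \<mu> ^ (2 * k) * (norm (pj k z))\<^sup>2)"
 unfolding Dm_def norm_sum_pj by (simp add: power_mult[symmetric] mult.commute)

lemma Dm_one [simp]: "Dm 1 z = z" by (simp add: Dm_def pj_sum)

lemma pj_Dm: "k \<le> K \<Longrightarrow> pj k (Dm \<mu> z) = \<mu> ^ k *\<^sub>R pj k z"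
proof -
 assume k: "k \<le> K"
 have "pj k (Dm \<mu> z) = (\<Sum>j\<le>K. if j = k then \<mu> ^ k *\<^sub>R pj k z else 0)"
  unfolding Dm_def op_sum by (intro sum.cong refl) (auto simp: op_scaleR pj_pj)
 then show ?thesis using k by simp
qed

lemma Dm_Dm: "Dm \<mu> (Dm \<nu> z) = Dm (\<mu> * \<nu>) z"
 unfolding Dm_def[of \<mu>] Dm_def[of "\<mu> * \<nu>"] by (intro sum.cong refl) (simp add: pj_Dm power_mult_distrib)

lemma norm_pj_le: "k \<le> K \<Longrightarrow> norm (pj k z) \<le> norm z"
proof -
 assume k: "k \<le> K"
 have "(norm (pj k z))\<^sup>2 \<le> (norm (Dm 1 z))\<^sup>2"
  unfolding norm_Dm using k member_le_sum[of k "{..K}" "\<lambda>k. (norm (pj k z))\<^sup>2"] by simp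
 then show ?thesis by (simp only: Dm_one) (rule power2_le_imp_le, auto)
qed

lemma Dm_add: "Dm \<mu> (z + w) = Dm \<mu> z + Dm \<mu> w"
 by (simp add: Dm_def op_add scaleR_right_distrib sum.distrib)

lemma herm_Dm: "herm (Dm \<mu> z) w = herm z (Dm \<mu> w)"
 by (simp add: Dm_def herm_sum scaleR_vec herm_scale herm_pj)

lemma Dm_measurable [measurable (raw)]:
 assumes [measurable]: "a \<in> borel_measurable M" "f \<in> borel_measurable M"
 shows "(\<lambda>x. Dm (a x) (f x)) \<in> borel_measurable M"
 unfolding Dm_def by measurable

lemma mu_measurable [measurable]: "mu \<in> borel_measurable borel"
 unfolding mu_def[abs_def] by measurable

lemma mu_range: "0 \<le> mu \<xi>" "mu \<xi> \<le> 1" "\<xi> \<noteq> 0 \<Longrightarrow> mu \<xi> > 0" "mu (- \<xi>) = mu \<xi>"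
 by (auto simp: mu_def)

lemma weight_mu: "weight k \<xi> = mu \<xi> ^ (2 * k)"
proof (cases "\<bar>\<xi>\<bar> \<le> 1")
 case True
 then have "\<bar>\<xi>\<bar> ^ (2 * k) \<le> 1" by (intro power_le_one) auto
 then show ?thesis using True by (simp add: weight_def mu_def)
next
 case False
 then have "1 \<le> \<bar>\<xi>\<bar> ^ (2 * k)" by (intro one_le_power) auto
 then show ?thesis using False by (simp add: weight_def mu_def)
qed

subsection \<open>The propagator\<close>

lemma Qt_Qt: "l \<in> \<Lambda> \<Longrightarrow> m \<in> \<Lambda> \<Longrightarrow> Qt l (Qt m z) = (if l = m then Qt l z else 0)"
proof -
 assume "l \<in> \<Lambda>" "m \<in> \<Lambda>"
 then have "transpose (Q l) ** transpose (Q m) = (if l = m then transpose (Q l) else 0)"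
  using QQ[of m l] by (simp add: matrix_transpose_mul[symmetric]) (auto simp: transpose_def vec_eq_iff)
 then show ?thesis
  by (simp add: Qt_def matrix_vector_mul_assoc cmat_mult[symmetric] cmat_zero split: if_splits)
qed

lemma herm_Qc: "herm (Qc l z) w = herm z (Qt l w)"
 unfolding Qc_def Qt_def by (rule herm_cmat)

lemma herm_Es: "herm (Es \<theta> z) w = herm z (Ev \<theta> w)"
 by (simp add: Es_def Ev_def herm_sum herm_scale herm_Qc cis_cnj)

lemma herm_Bc: "herm (Bc u) w = herm u (Bt w)"
 unfolding Bc_def Bt_def by (rule herm_cmat)

lemma Ev_add: "Ev \<theta> (z + w) = Ev \<theta> z + Ev \<theta> w"
 by (simp add: Ev_def op_add vector_add_ldistrib sum.distrib)

lemma Es_add: "Es \<theta> (z + w) = Es \<theta> z + Es \<theta> w"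
 by (simp add: Es_def op_add vector_add_ldistrib sum.distrib)

lemma Es_scale: "Es \<theta> (c *s z) = c *s Es \<theta> z"
 by (simp add: Es_def op_scale vec_eq_iff sum_distrib_left mult_ac)

lemma E_zero [simp]: "Ev \<theta> 0 = 0" "Es \<theta> 0 = 0" by (simp_all add: Ev_def Es_def)

lemma Ev_sum: "Ev \<theta> (\<Sum>i\<in>I. f i) = (\<Sum>i\<in>I. Ev \<theta> (f i))"
 by (induction I rule: infinite_finite_induct) (simp_all add: Ev_add)

lemma E_measurable [measurable (raw)]:
 assumes [measurable]: "a \<in> borel_measurable M" "f \<in> borel_measurable M"
 shows "(\<lambda>x. Ev (a x) (f x)) \<in> borel_measurable M" "(\<lambda>x. Es (a x) (f x)) \<in> borel_measurable M"
 unfolding Ev_def Es_def by measurable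

lemma Q_powers: "(\<Sum>l\<in>\<Lambda>. of_real (l ^ r) *s Qt l z) = cmat (mat_pow (transpose A) r) *v z"
proof -
 have t: "transpose (l *\<^sub>R M) = l *\<^sub>R transpose M" for l and M :: "real^'n^'n"
  by (simp add: transpose_def vec_eq_iff)
 have "mat_pow (transpose A) r = (\<Sum>l\<in>\<Lambda>. l ^ r *\<^sub>R transpose (Q l))"
  unfolding transpose_mat_pow[symmetric] pow transpose_sum t ..
 then show ?thesis by (simp add: cmat_sum matrix_vector_sum_left cmat_scale Qt_def)
qed

lemma Qc_powers: "(\<Sum>l\<in>\<Lambda>. of_real (l ^ r) *s Qc l z) = cmat (mat_pow A r) *v z"
 by (simp add: pow cmat_sum matrix_vector_sum_left cmat_scale Qc_def)

lemma Ev_0 [simp]: "Ev 0 z = z"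
 using Q_powers[of 0 z] by (simp add: Ev_def cmat_one)

lemma Es_0 [simp]: "Es 0 z = z"
 using Qc_powers[of 0 z] by (simp add: Es_def cmat_one)

lemma Qt_Ev: "l \<in> \<Lambda> \<Longrightarrow> Qt l (Ev \<theta> z) = cis (\<theta> * l) *s Qt l z"
 by (simp add: Ev_def op_sum op_scale Qt_Qt fin if_distrib[of "\<lambda>x. _ *s x"] sum.delta cong: if_cong sum.cong)

lemma Ev_Ev: "Ev \<theta> (Ev \<phi> z) = Ev (\<theta> + \<phi>) z"
 unfolding Ev_def[of \<theta>] Ev_def[of "\<theta> + \<phi>"]
 by (intro sum.cong refl) (simp add: Qt_Ev vector_smult_assoc cis_mult distrib_right)

lemma Ev_bounded: "\<exists>C\<ge>0. \<forall>\<theta> z. norm (Ev \<theta> z) \<le> C * norm z"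
proof -
 have "\<forall>l. \<exists>c\<ge>0. \<forall>z. norm (Qt l z) \<le> c * norm z" unfolding Qt_def using complex_matrix_bounded by blast
 then obtain c where c: "\<And>l. c l \<ge> 0" "\<And>l z. norm (Qt l z) \<le> c l * norm z" by metis
 have "norm (Ev \<theta> z) \<le> (\<Sum>l\<in>\<Lambda>. c l) * norm z" for \<theta> z
  unfolding Ev_def sum_distrib_right
  by (rule order_trans[OF norm_sum]) (intro sum_mono, simp add: norm_vec_scale c)
 then show ?thesis using c(1) by (intro exI[of _ "\<Sum>l\<in>\<Lambda>. c l"]) (simp add: sum_nonneg)
qed

lemma Ev_taylor:
 "\<exists>C\<ge>0. \<forall>\<theta> z. norm (Ev \<theta> z - (\<Sum>r\<le>n. ((\<i> * of_real \<theta>) ^ r / fact r) *s (cmat (mat_pow (transpose A) r) *v z)))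
   \<le> C * \<bar>\<theta>\<bar> ^ Suc n * norm z"
proof -
 have "\<forall>l. \<exists>c\<ge>0. \<forall>z. norm (Qt l z) \<le> c * norm z" unfolding Qt_def using complex_matrix_bounded by blast
 then obtain c where c: "\<And>l. c l \<ge> 0" "\<And>l z. norm (Qt l z) \<le> c l * norm z" by metis
 define C where "C = (\<Sum>l\<in>\<Lambda>. \<bar>l\<bar> ^ Suc n * c l)"
 have "norm (Ev \<theta> z - (\<Sum>r\<le>n. ((\<i> * of_real \<theta>) ^ r / fact r) *s (cmat (mat_pow (transpose A) r) *v z))) \<le> C * \<bar>\<theta>\<bar> ^ Suc n * norm z" for \<theta> z
 proof -
  have "(\<Sum>r\<le>n. ((\<i> * of_real \<theta>) ^ r / fact r) *s (cmat (mat_pow (transpose A) r) *v z))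
    = (\<Sum>r\<le>n. \<Sum>l\<in>\<Lambda>. ((\<i> * of_real (\<theta> * l)) ^ r / fact r) *s Qt l z)"
   unfolding Q_powers[symmetric]
   by (simp add: vec_eq_iff sum_distrib_left power_mult_distrib mult_ac)
  also have "\<dots> = (\<Sum>l\<in>\<Lambda>. \<Sum>r\<le>n. ((\<i> * of_real (\<theta> * l)) ^ r / fact r) *s Qt l z)" by (rule sum.swap)
  also have "\<dots> = (\<Sum>l\<in>\<Lambda>. (\<Sum>r\<le>n. (\<i> * of_real (\<theta> * l)) ^ r / fact r) *s Qt l z)"
   by (simp add: vec_eq_iff sum_distrib_right)
  finally have "Ev \<theta> z - (\<Sum>r\<le>n. ((\<i> * of_real \<theta>) ^ r / fact r) *s (cmat (mat_pow (transpose A) r) *v z))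
    = (\<Sum>l\<in>\<Lambda>. (cis (\<theta> * l) - (\<Sum>r\<le>n. (\<i> * of_real (\<theta> * l)) ^ r / fact r)) *s Qt l z)"
   by (simp add: Ev_def sum_subtractf[symmetric] vector_sub_rdistrib)
  also have "norm \<dots> \<le> (\<Sum>l\<in>\<Lambda>. \<bar>\<theta> * l\<bar> ^ Suc n * (c l * norm z))"
  proof (rule order_trans[OF norm_sum], intro sum_mono, unfold norm_vec_scale, intro mult_mono c)
   fix l
   have "norm (cis (\<theta> * l) - (\<Sum>r\<le>n. (\<i> * of_real (\<theta> * l)) ^ r / fact r)) \<le> \<bar>\<theta> * l\<bar> ^ Suc n / fact (Suc n)"
    using iexp_approx1[of "\<theta> * l" n] by (simp add: cis_conv_exp)
   also have "\<dots> \<le> \<bar>\<theta> * l\<bar> ^ Suc n / 1" by (intro divide_left_mono) (auto simp: fact_ge_1 simp del: fact_Suc)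
   finally show "norm (cis (\<theta> * l) - (\<Sum>r\<le>n. (\<i> * of_real (\<theta> * l)) ^ r / fact r)) \<le> \<bar>\<theta> * l\<bar> ^ Suc n" by simp
  qed auto
  also have "\<dots> = C * \<bar>\<theta>\<bar> ^ Suc n * norm z"
   unfolding C_def sum_distrib_right by (intro sum.cong refl) (simp add: abs_mult power_mult_distrib mult_ac del: power_Suc)
  finally show ?thesis .
 qed
 moreover have "C \<ge> 0" unfolding C_def using c(1) by (intro sum_nonneg mult_nonneg_nonneg) auto
 ultimately show ?thesis by blast
qed

lemma Bt_pj: "0 < j \<Longrightarrow> Bt (pj j z) = 0"
 using BAP[of 0 j] by (simp add: Bt_def pj_def matrix_vector_mul_assoc cmat_mult[symmetric] cmat_zero)

lemma Bt_pow_pj: "r < j \<Longrightarrow> Bt (cmat (mat_pow (transpose A) r) *v pj j z) = 0"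
 using BAP[of r j] by (simp add: Bt_def pj_def matrix_vector_mul_assoc cmat_mult[symmetric] cmat_zero matrix_mul_assoc)

lemma mat_pow_add: "mat_pow M i ** mat_pow M r = mat_pow M (i + r)" for M :: "real^'n^'n"
 by (induction i) (simp_all add: matrix_mul_assoc[symmetric])

lemma pj_expand: "pj k z = (\<Sum>i\<le>k. cmat (X k i) *v Bt (cmat (mat_pow (transpose A) i) *v z))"
 unfolding pj_def by (subst PX) (simp add: cmat_sum matrix_vector_sum_left Bt_def cmat_mult matrix_vector_mul_assoc)

text \<open>Each application of \<open>A\<^sup>T\<close> lowers the layer by at most one, since it takes \<open>j\<close> of them to make the layer \<open>j\<close> visible.\<close>

lemma pj_pow_pj: "k + r < j \<Longrightarrow> pj k (cmat (mat_pow (transpose A) r) *v pj j z) = 0"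
proof -
 assume kr: "k + r < j"
 have "Bt (cmat (mat_pow (transpose A) i) *v (cmat (mat_pow (transpose A) r) *v pj j z)) = 0" if "i \<le> k" for i
 proof -
  have "cmat (mat_pow (transpose A) i) *v (cmat (mat_pow (transpose A) r) *v pj j z) = cmat (mat_pow (transpose A) (i + r)) *v pj j z"
   by (simp add: matrix_vector_mul_assoc cmat_mult[symmetric] mat_pow_add)
  then show ?thesis using Bt_pow_pj[of "i + r" j z] kr that by simp
 qed
 then show ?thesis by (subst pj_expand) (simp add: sum.neutral)
qed

lemma Bt_bound: "\<exists>C\<ge>0. \<forall>\<mu> z. norm (Bt z) \<le> C * norm (Dm \<mu> z)"
proof -
 obtain c where c: "c \<ge> 0" "\<And>z. norm (Bt z) \<le> c * norm z"
  using complex_matrix_bounded[of "cmat (transpose B)"] unfolding Bt_def by blast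
 have "norm (Bt z) \<le> c * norm (Dm \<mu> z)" for \<mu> z
 proof -
  have "Bt z = Bt (\<Sum>k\<le>K. pj k z)" by (simp add: pj_sum)
  also have "\<dots> = (\<Sum>k\<le>K. if k = 0 then Bt (pj 0 z) else 0)" unfolding op_sum by (intro sum.cong) (auto simp: Bt_pj)
  also have "\<dots> = Bt (pj 0 z)" by simp
  also have "pj 0 z = pj 0 (Dm \<mu> z)" by (simp add: pj_Dm)
  finally show ?thesis using c norm_pj_le[of 0 "Dm \<mu> z"] by (metis le0 mult_left_mono order_trans)
 qed
 then show ?thesis using c by blast
qed

lemma pj_Ev_pj_bound:
 "\<exists>C\<ge>0. \<forall>\<theta> z. norm (pj k (Ev \<theta> (pj j z))) \<le> C * min 1 (\<bar>\<theta>\<bar> ^ (j - k)) * norm z"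
proof -
 obtain c where c: "c \<ge> 0" "\<And>z. norm (pj k z) \<le> c * norm z"
  using complex_matrix_bounded[of "cmat (P k)"] unfolding pj_def by blast
 obtain c' where c': "c' \<ge> 0" "\<And>z. norm (pj j z) \<le> c' * norm z"
  using complex_matrix_bounded[of "cmat (P j)"] unfolding pj_def by blast
 obtain e where e: "e \<ge> 0" "\<And>\<theta> z. norm (Ev \<theta> z) \<le> e * norm z" using Ev_bounded by blast
 have b1: "norm (pj k (Ev \<theta> (pj j z))) \<le> (c * e * c') * norm z" for \<theta> z
 proof -
  have "norm (pj k (Ev \<theta> (pj j z))) \<le> c * (e * (c' * norm z))"
   by (intro order_trans[OF c(2)] mult_left_mono order_trans[OF e(2)] c c' e)
  then show ?thesis by (simp add: mult_ac)
 qed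
 show ?thesis
 proof (cases "k < j")
  case False
  then show ?thesis using b1 c c' e by (intro exI[of _ "c * e * c'"]) auto
 next
  case True
  define n where "n = j - k - 1"
  have n: "Suc n = j - k" using True by (simp add: n_def)
  obtain C where C: "C \<ge> 0" "\<And>\<theta> z. norm (Ev \<theta> z - (\<Sum>r\<le>n. ((\<i> * of_real \<theta>) ^ r / fact r) *s (cmat (mat_pow (transpose A) r) *v z)))
   \<le> C * \<bar>\<theta>\<bar> ^ Suc n * norm z" using Ev_taylor by blast
  have b2: "norm (pj k (Ev \<theta> (pj j z))) \<le> (c * C * c') * \<bar>\<theta>\<bar> ^ (j - k) * norm z" for \<theta> z
  proof -
   let ?T = "\<Sum>r\<le>n. ((\<i> * of_real \<theta>) ^ r / fact r) *s (cmat (mat_pow (transpose A) r) *v pj j z)"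
   have "pj k ?T = 0" unfolding op_sum op_scale
    by (intro sum.neutral) (use True in \<open>auto simp: pj_pow_pj n_def\<close>)
   then have "pj k (Ev \<theta> (pj j z)) = pj k (Ev \<theta> (pj j z) - ?T)"
    unfolding pj_def by (simp add: matrix_vector_mult_diff_distrib)
   also have "norm \<dots> \<le> c * (C * \<bar>\<theta>\<bar> ^ Suc n * (c' * norm z))"
    by (intro order_trans[OF c(2)] mult_left_mono order_trans[OF C(2)] c C c' mult_nonneg_nonneg) auto
   finally show ?thesis by (simp add: n mult_ac)
  qed
  let ?M = "max (c * e * c') (c * C * c')"
  have "norm (pj k (Ev \<theta> (pj j z))) \<le> ?M * min 1 (\<bar>\<theta>\<bar> ^ (j - k)) * norm z" for \<theta> z
  proof -
   have M: "(c * e * c') * norm z \<le> ?M * norm z" "(c * C * c') * \<bar>\<theta>\<bar> ^ (j - k) * norm z \<le> ?M * \<bar>\<theta>\<bar> ^ (j - k) * norm z"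
    by (intro mult_right_mono; simp)+
   show ?thesis
    using order_trans[OF b1 M(1)] order_trans[OF b2 M(2)] by (simp add: min_def)
  qed
  then show ?thesis using c c' e by (intro exI[of _ ?M]) (auto simp: le_max_iff_disj)
 qed
qed

text \<open>Getting from the layer \<open>j\<close> down to the layer \<open>k\<close> takes \<open>j - k\<close> powers of \<open>A\<^sup>T\<close>, and each of them comes with a factor
\<open>s \<xi>\<close>. This compensates the smaller exponent of the weight on the lower layer.\<close>

lemma Dm_Ev_bound:
 "\<exists>C\<ge>0. \<forall>s \<xi> z. \<bar>s\<bar> \<le> T \<longrightarrow> norm (Dm (mu \<xi>) (Ev (s * \<xi>) z)) \<le> C * norm (Dm (mu \<xi>) z)"
proof -
 have "\<forall>k j. \<exists>C\<ge>0. \<forall>\<theta> z. norm (pj k (Ev \<theta> (pj j z))) \<le> C * min 1 (\<bar>\<theta>\<bar> ^ (j - k)) * norm z"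
  using pj_Ev_pj_bound by blast
 then obtain C where C: "\<And>k j. C k j \<ge> 0" "\<And>k j \<theta> z. norm (pj k (Ev \<theta> (pj j z))) \<le> C k j * min 1 (\<bar>\<theta>\<bar> ^ (j - k)) * norm z"
  by metis
 define M where "M = max 1 T ^ K"
 have M1: "M \<ge> 1" unfolding M_def by (intro one_le_power) simp
 have m: "mu \<xi> ^ k * min 1 (\<bar>s * \<xi>\<bar> ^ (j - k)) \<le> M * mu \<xi> ^ j" if s: "\<bar>s\<bar> \<le> T" and j: "j \<le> K" for s \<xi> k j
 proof (cases "k < j")
  case False
  have "mu \<xi> ^ k * min 1 (\<bar>s * \<xi>\<bar> ^ (j - k)) \<le> mu \<xi> ^ k * 1"
   using mu_range(1)[of \<xi>] by (intro mult_left_mono) auto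
  also have "\<dots> \<le> mu \<xi> ^ j" using False mu_range(1,2)[of \<xi>] by (simp add: power_decreasing)
  also have "\<dots> \<le> M * mu \<xi> ^ j" using M1 mu_range(1)[of \<xi>] mult_right_mono[of 1 M "mu \<xi> ^ j"] by simp
  finally show ?thesis .
 next
  case True
  have "min 1 (\<bar>s * \<xi>\<bar> ^ (j - k)) \<le> M * mu \<xi> ^ (j - k)"
  proof (cases "\<bar>\<xi>\<bar> \<le> 1")
   case True
   then have mu: "mu \<xi> = \<bar>\<xi>\<bar>" by (simp add: mu_def)
   have "\<bar>s\<bar> ^ (j - k) \<le> max 1 T ^ (j - k)" using s by (intro power_mono) auto
   also have "\<dots> \<le> M" unfolding M_def using j by (intro power_increasing) auto
   finally have "\<bar>s * \<xi>\<bar> ^ (j - k) \<le> M * \<bar>\<xi>\<bar> ^ (j - k)" by (simp add: abs_mult power_mult_distrib mult_right_mono)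
   then show ?thesis by (simp add: mu min_le_iff_disj)
  next
   case False
   then have mu: "mu \<xi> = 1" by (simp add: mu_def)
   show ?thesis using M1 by (simp add: mu min_le_iff_disj)
  qed
  then have "mu \<xi> ^ k * min 1 (\<bar>s * \<xi>\<bar> ^ (j - k)) \<le> mu \<xi> ^ k * (M * mu \<xi> ^ (j - k))"
   using mu_range(1)[of \<xi>] by (intro mult_left_mono) auto
  also have "\<dots> = M * mu \<xi> ^ j" using True by (simp add: power_add[symmetric] mult.left_commute)
  finally show ?thesis .
 qed
 define L where "L = (\<Sum>k\<le>K. \<Sum>j\<le>K. C k j * M)"
 have "norm (Dm (mu \<xi>) (Ev (s * \<xi>) z)) \<le> L * norm (Dm (mu \<xi>) z)" if s: "\<bar>s\<bar> \<le> T" for s \<xi> z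
 proof -
  have "Dm (mu \<xi>) (Ev (s * \<xi>) z) = Dm (mu \<xi>) (\<Sum>j\<le>K. Ev (s * \<xi>) (pj j z))"
   unfolding Ev_sum[symmetric] pj_sum ..
  also have "\<dots> = (\<Sum>k\<le>K. \<Sum>j\<le>K. mu \<xi> ^ k *\<^sub>R pj k (Ev (s * \<xi>) (pj j z)))"
   by (simp add: Dm_def op_sum scaleR_sum_right)
  also have "norm \<dots> \<le> (\<Sum>k\<le>K. \<Sum>j\<le>K. C k j * M * norm (Dm (mu \<xi>) z))"
  proof (intro order_trans[OF norm_sum] sum_mono)
   fix k j assume j: "j \<in> {..K}"
   have "norm (mu \<xi> ^ k *\<^sub>R pj k (Ev (s * \<xi>) (pj j z))) = mu \<xi> ^ k * norm (pj k (Ev (s * \<xi>) (pj j (pj j z))))"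
    using mu_range(1)[of \<xi>] by (simp add: pj_pj)
   also have "\<dots> \<le> mu \<xi> ^ k * (C k j * min 1 (\<bar>s * \<xi>\<bar> ^ (j - k)) * norm (pj j z))"
    using mu_range(1)[of \<xi>] by (intro mult_left_mono C) auto
   also have "\<dots> = C k j * (mu \<xi> ^ k * min 1 (\<bar>s * \<xi>\<bar> ^ (j - k))) * norm (pj j z)" by (simp add: mult_ac)
   also have "\<dots> \<le> C k j * (M * mu \<xi> ^ j) * norm (pj j z)"
    using j by (intro mult_right_mono mult_left_mono m s C) auto
   also have "\<dots> = C k j * M * norm (pj j (Dm (mu \<xi>) z))"
    using j mu_range(1)[of \<xi>] by (simp add: pj_Dm)
   also have "\<dots> \<le> C k j * M * norm (Dm (mu \<xi>) z)"
    using j M1 C(1)[of k j] by (intro mult_left_mono norm_pj_le) auto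
   finally show "norm (mu \<xi> ^ k *\<^sub>R pj k (Ev (s * \<xi>) (pj j z))) \<le> C k j * M * norm (Dm (mu \<xi>) z)" .
  qed
  finally show ?thesis by (simp add: L_def sum_distrib_right)
 qed
 moreover have "L \<ge> 0" unfolding L_def using C(1) M1 by (intro sum_nonneg mult_nonneg_nonneg) auto
 ultimately show ?thesis by blast
qed

end

section \<open>Observability of the Fourier modes\<close>

text \<open>Integrals over compact time windows, with values that need no integrability.\<close>

definition seg :: "real \<Rightarrow> real \<Rightarrow> (real \<Rightarrow> ennreal) \<Rightarrow> ennreal" where
 "seg a b f = (\<integral>\<^sup>+x. f x * indicator {a..b} x)"

definition nsq :: "'a::real_normed_vector \<Rightarrow> ennreal" where
 "nsq v = ennreal ((norm v)\<^sup>2)"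

lemma nsq_measurable [measurable (raw)]:
 "f \<in> borel_measurable M \<Longrightarrow> (\<lambda>x. nsq (f x :: 'a::euclidean_space)) \<in> borel_measurable M"
 unfolding nsq_def by measurable

lemma nsq_add_le: "nsq (a + b) \<le> 2 * nsq a + 2 * nsq b"
proof -
 have "nsq (a + b) \<le> ennreal (2 * (norm a)\<^sup>2 + 2 * (norm b)\<^sup>2)"
  unfolding nsq_def by (intro ennreal_leI norm_add_sq_le)
 then show ?thesis by (simp add: nsq_def ennreal_mult)
qed

lemma nsq_minus [simp]: "nsq (- a) = nsq a" by (simp add: nsq_def)

lemma nsq_diff_le: "nsq (a - b) \<le> 2 * nsq a + 2 * nsq b"
 using nsq_add_le[of a "- b"] by simp

lemma nsq_scaleR: "nsq (c *\<^sub>R v) = ennreal (c\<^sup>2) * nsq v"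
 by (simp add: nsq_def power_mult_distrib ennreal_mult)

lemma seg_mono: "(\<And>x. a \<le> x \<Longrightarrow> x \<le> b \<Longrightarrow> f x \<le> g x) \<Longrightarrow> seg a b f \<le> seg a b g"
 unfolding seg_def by (intro nn_integral_mono) (auto split: split_indicator)

lemma seg_subset: "a' \<le> a \<Longrightarrow> b \<le> b' \<Longrightarrow> seg a b f \<le> seg a' b' f"
 unfolding seg_def by (intro nn_integral_mono) (auto split: split_indicator)

lemma seg_add:
 "f \<in> borel_measurable borel \<Longrightarrow> g \<in> borel_measurable borel \<Longrightarrow> seg a b (\<lambda>x. f x + g x) = seg a b f + seg a b g"
 unfolding seg_def by (subst nn_integral_add[symmetric]) (auto simp: distrib_right)

lemma seg_cmult: "f \<in> borel_measurable borel \<Longrightarrow> seg a b (\<lambda>x. c * f x) = c * seg a b f"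
 unfolding seg_def by (subst nn_integral_cmult[symmetric]) (auto simp: mult.assoc)

lemma seg_const: "a \<le> b \<Longrightarrow> seg a b (\<lambda>x. c) = c * ennreal (b - a)"
 unfolding seg_def by (simp add: nn_integral_cmult_indicator)

lemma seg_affine:
 assumes c: "c > 0" and [measurable]: "f \<in> borel_measurable borel"
 shows "seg (t + c * a) (t + c * b) f = ennreal c * seg a b (\<lambda>x. f (t + c * x))"
proof -
 have "indicator {t + c * a..t + c * b} (t + c * x) = (indicator {a..b} x :: ennreal)" for x
  using c by (auto split: split_indicator)
 then show ?thesis
  unfolding seg_def using c by (subst nn_integral_real_affine[where c=c and t=t]) auto
qed

lemma seg_scale:
 assumes "c > 0" "f \<in> borel_measurable borel"
 shows "seg 0 (c * b) f = ennreal c * seg 0 b (\<lambda>x. f (c * x))"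
 using seg_affine[OF assms, of 0 0 b] by simp

text \<open>All norms of polynomials of bounded degree are equivalent. For \<open>P\<close> of degree \<open>K + 1\<close> the polynomial
\<open>2\<^bsup>K+1\<^esup> P(s/2) - P(s)\<close> has degree at most \<open>K\<close>, and its coefficients are at least as large as the lower ones of \<open>P\<close>.\<close>

lemma poly_coeff_bound:
 "\<exists>C>0. \<forall>p :: nat \<Rightarrow> 'a::euclidean_space.
   (\<Sum>k\<le>K. nsq (p k)) \<le> ennreal C * seg 0 1 (\<lambda>s. nsq (\<Sum>k\<le>K. s ^ k *\<^sub>R p k))"
proof (induction K)
 case 0
 show ?case by (intro exI[of _ 1]) (simp add: seg_const)
next
 case (Suc K)
 then obtain C where C: "C > 0" "\<And>p :: nat \<Rightarrow> 'a. (\<Sum>k\<le>K. nsq (p k)) \<le> ennreal C * seg 0 1 (\<lambda>s. nsq (\<Sum>k\<le>K. s ^ k *\<^sub>R p k))"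
  by blast
 define C1 where "C1 = C * (4 * 4 ^ Suc K + 2)"
 have C1: "C1 > 0" unfolding C1_def using C(1) by (intro mult_pos_pos add_pos_pos) auto
 \<comment> \<open>lower bound for the energy of \<open>s\<^bsup>K+1\<^esup>\<close> on \<open>(1/2, 1)\<close>\<close>
 define D where "D = (1 / 2) ^ (2 * Suc K) * (1 / 2 :: real)"
 have D: "D > 0" by (simp add: D_def)
 define C2 where "C2 = C1 + (2 + 2 * real (Suc K) * C1) / D"
 show ?case
 proof (intro exI[of _ C2] conjI allI)
  show "C2 > 0" using C1 D by (simp add: C2_def add_pos_nonneg)
  fix p :: "nat \<Rightarrow> 'a"
  define P where "P s = (\<Sum>k\<le>Suc K. s ^ k *\<^sub>R p k)" for s :: real
  have [measurable]: "P \<in> borel_measurable borel" unfolding P_def by measurable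
  define J where "J = seg 0 1 (\<lambda>s. nsq (P s))"
  have half: "seg 0 1 (\<lambda>s. nsq (P (s / 2))) \<le> 2 * J"
  proof -
   have "seg 0 ((1/2) * 1) (\<lambda>s. nsq (P s)) = ennreal (1/2) * seg 0 1 (\<lambda>x. nsq (P (1 / 2 * x)))"
    by (rule seg_scale) measurable
   then have "2 * seg 0 (1/2) (\<lambda>s. nsq (P s)) = 2 * ennreal (1/2) * seg 0 1 (\<lambda>x. nsq (P (1 / 2 * x)))"
    by (simp add: mult.assoc)
   also have "2 * ennreal (1/2) = 1"
    by (metis ennreal_1 ennreal_mult ennreal_numeral field_sum_of_halves mult.commute mult_2_right zero_le_divide_1_iff zero_le_numeral)
   finally have "seg 0 1 (\<lambda>x. nsq (P (x / 2))) = 2 * seg 0 (1/2) (\<lambda>s. nsq (P s))" by simp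
   also have "\<dots> \<le> 2 * J" unfolding J_def by (intro mult_left_mono seg_subset) auto
   finally show ?thesis .
  qed
  define q where "q k = (2 ^ (Suc K - k) - 1) *\<^sub>R p k" for k
  have E: "(\<Sum>k\<le>K. s ^ k *\<^sub>R q k) = 2 ^ Suc K *\<^sub>R P (s / 2) - P s" for s
  proof -
   have "2 ^ Suc K *\<^sub>R P (s / 2) - P s = (\<Sum>k\<le>Suc K. (2 ^ Suc K * (s / 2) ^ k - s ^ k) *\<^sub>R p k)"
    by (simp add: P_def scaleR_sum_right sum_subtractf[symmetric] scaleR_left_diff_distrib del: sum.atMost_Suc)
   also have "\<dots> = (\<Sum>k\<le>Suc K. (s ^ k * (2 ^ (Suc K - k) - 1)) *\<^sub>R p k)"
   proof (intro sum.cong refl)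
    fix k assume "k \<in> {..Suc K}"
    then have "2 ^ Suc K = (2::real) ^ (Suc K - k) * 2 ^ k" by (simp add: power_add[symmetric] del: power_Suc)
    then have "2 ^ Suc K * (s / 2) ^ k - s ^ k = s ^ k * (2 ^ (Suc K - k) - 1)"
     by (simp only:) (simp add: power_divide field_simps)
    then show "(2 ^ Suc K * (s / 2) ^ k - s ^ k) *\<^sub>R p k = (s ^ k * (2 ^ (Suc K - k) - 1)) *\<^sub>R p k" by simp
   qed
   also have "\<dots> = (\<Sum>k\<le>K. s ^ k *\<^sub>R q k)" by (simp add: q_def)
   finally show ?thesis by simp
  qed
  have pq: "nsq (p k) \<le> nsq (q k)" if "k \<le> K" for k
  proof -
   have "(2::real) ^ 1 \<le> 2 ^ (Suc K - k)" by (rule power_increasing) (use that in auto)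
   then have "1 * norm (p k) \<le> norm (q k)" unfolding q_def norm_scaleR by (intro mult_right_mono) auto
   then show ?thesis unfolding nsq_def by (intro ennreal_leI power_mono) auto
  qed
  have low: "(\<Sum>k\<le>K. nsq (p k)) \<le> ennreal C1 * J"
  proof -
   have "(\<Sum>k\<le>K. nsq (p k)) \<le> (\<Sum>k\<le>K. nsq (q k))" by (intro sum_mono pq) auto
   also have "\<dots> \<le> ennreal C * seg 0 1 (\<lambda>s. nsq (2 ^ Suc K *\<^sub>R P (s / 2) - P s))"
    using C(2)[of q] unfolding E .
   also have "seg 0 1 (\<lambda>s. nsq (2 ^ Suc K *\<^sub>R P (s / 2) - P s))
     \<le> seg 0 1 (\<lambda>s. 2 * (ennreal ((2 ^ Suc K)\<^sup>2) * nsq (P (s / 2))) + 2 * nsq (P s))"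
    unfolding nsq_scaleR[symmetric] by (intro seg_mono nsq_diff_le)
   also have "\<dots> = 2 * (ennreal ((2 ^ Suc K)\<^sup>2) * seg 0 1 (\<lambda>s. nsq (P (s / 2)))) + 2 * J"
    unfolding J_def by (subst seg_add) (simp_all add: seg_cmult)
   also have "\<dots> \<le> 2 * (ennreal ((2 ^ Suc K)\<^sup>2) * (2 * J)) + 2 * J"
    by (intro add_mono mult_left_mono half) auto
   also have "\<dots> = ennreal (4 * 4 ^ Suc K + 2) * J"
   proof -
    have "((2::real) ^ Suc K)\<^sup>2 = 4 ^ Suc K" by (simp add: power2_eq_square power_mult_distrib[symmetric])
    then have "ennreal (4 * 4 ^ Suc K + 2) = 4 * ennreal ((2 ^ Suc K)\<^sup>2) + 2"
     by (simp only:) (subst ennreal_plus, simp, simp, simp add: ennreal_mult)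
    moreover have "2 * (ennreal ((2 ^ Suc K)\<^sup>2) * (2 * J)) = (2 * 2) * (ennreal ((2 ^ Suc K)\<^sup>2) * J)"
     by (simp only: mult_ac)
    moreover have "(2 * 2 :: ennreal) = 4" by simp
    ultimately show ?thesis by (simp only: distrib_right mult.assoc)
   qed
   finally show ?thesis using C(1) by (simp add: C1_def ennreal_mult mult.assoc mult_left_mono)
  qed
  have high: "ennreal D * nsq (p (Suc K)) \<le> ennreal (2 + 2 * real (Suc K) * C1) * J"
  proof -
   have "ennreal D * nsq (p (Suc K)) = seg (1/2) 1 (\<lambda>s. ennreal ((1/2) ^ (2 * Suc K)) * nsq (p (Suc K)))"
   proof -
    have "seg (1/2) 1 (\<lambda>s. ennreal ((1/2) ^ (2 * Suc K)) * nsq (p (Suc K))) = ennreal ((1/2) ^ (2 * Suc K)) * nsq (p (Suc K)) * ennreal (1 - 1/2)"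
     by (rule seg_const) simp
    moreover have "ennreal D = ennreal ((1/2) ^ (2 * Suc K)) * ennreal (1 - 1/2)"
     unfolding D_def by (subst ennreal_mult[symmetric]) auto
    ultimately show ?thesis by (simp only: mult_ac)
   qed
   also have "\<dots> \<le> seg (1/2) 1 (\<lambda>s. nsq (s ^ Suc K *\<^sub>R p (Suc K)))"
    unfolding nsq_scaleR by (intro seg_mono mult_right_mono ennreal_leI)
     (auto simp: power_mult[symmetric] mult.commute intro!: power_mono simp del: power_Suc)
   also have "\<dots> \<le> seg 0 1 (\<lambda>s. nsq (s ^ Suc K *\<^sub>R p (Suc K)))" by (rule seg_subset) auto
   also have "\<dots> \<le> seg 0 1 (\<lambda>s. 2 * nsq (P s) + 2 * (of_nat (Suc K) * (\<Sum>k\<le>K. nsq (p k))))"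
   proof (rule seg_mono)
    fix s :: real assume s: "0 \<le> s" "s \<le> 1"
    have "s ^ Suc K *\<^sub>R p (Suc K) = P s - (\<Sum>k\<le>K. s ^ k *\<^sub>R p k)" by (simp add: P_def)
    also have "nsq \<dots> \<le> 2 * nsq (P s) + 2 * nsq (\<Sum>k\<le>K. s ^ k *\<^sub>R p k)" by (rule nsq_diff_le)
    also have "nsq (\<Sum>k\<le>K. s ^ k *\<^sub>R p k) \<le> of_nat (Suc K) * (\<Sum>k\<le>K. nsq (p k))"
    proof -
     have "norm (\<Sum>k\<le>K. s ^ k *\<^sub>R p k) \<le> (\<Sum>k\<le>K. norm (p k))"
      using s by (intro sum_norm_le) (simp add: mult_left_le_one_le power_le_one)
     then have "(norm (\<Sum>k\<le>K. s ^ k *\<^sub>R p k))\<^sup>2 \<le> (\<Sum>k\<le>K. norm (p k))\<^sup>2" by (rule power_mono) simp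
     also have "\<dots> \<le> (\<Sum>k\<le>K. (norm (p k))\<^sup>2) * real (card {..K})" by (rule sum_squared_le_sum_of_squares)
     finally have "(norm (\<Sum>k\<le>K. s ^ k *\<^sub>R p k))\<^sup>2 \<le> real (Suc K) * (\<Sum>k\<le>K. (norm (p k))\<^sup>2)" by (simp add: mult.commute)
     then have "nsq (\<Sum>k\<le>K. s ^ k *\<^sub>R p k) \<le> ennreal (real (Suc K) * (\<Sum>k\<le>K. (norm (p k))\<^sup>2))"
      unfolding nsq_def by (rule ennreal_leI)
     also have "\<dots> = of_nat (Suc K) * (\<Sum>k\<le>K. nsq (p k))"
      by (subst ennreal_mult) (auto simp: sum_nonneg nsq_def sum_ennreal ennreal_of_nat_eq_real_of_nat simp del: of_nat_Suc)
     finally show ?thesis .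
    qed
    finally show "nsq (s ^ Suc K *\<^sub>R p (Suc K)) \<le> 2 * nsq (P s) + 2 * (of_nat (Suc K) * (\<Sum>k\<le>K. nsq (p k)))"
     by (meson add_left_mono mult_left_mono order_trans zero_le)
   qed
   also have "\<dots> = 2 * J + 2 * (of_nat (Suc K) * (\<Sum>k\<le>K. nsq (p k)))"
    unfolding J_def by (subst seg_add) (simp_all add: seg_cmult seg_const)
   also have "\<dots> \<le> 2 * J + 2 * (of_nat (Suc K) * (ennreal C1 * J))"
    by (intro add_mono mult_left_mono low) auto
   also have "\<dots> = ennreal (2 + 2 * real (Suc K) * C1) * J"
   proof -
    have "ennreal (2 + 2 * real (Suc K) * C1) = 2 + 2 * of_nat (Suc K) * ennreal C1"
     using C1 by (subst ennreal_plus) (auto simp: ennreal_mult ennreal_of_nat_eq_real_of_nat simp del: of_nat_Suc)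
    then show ?thesis by (simp only: distrib_right mult.assoc)
   qed
   finally show ?thesis .
  qed
  have "nsq (p (Suc K)) = ennreal (1 / D) * (ennreal D * nsq (p (Suc K)))"
   using D by (simp add: mult.assoc[symmetric] ennreal_mult[symmetric])
  also have "\<dots> \<le> ennreal (1 / D) * (ennreal (2 + 2 * real (Suc K) * C1) * J)"
   by (intro mult_left_mono high) auto
  also have "\<dots> = ennreal ((2 + 2 * real (Suc K) * C1) / D) * J"
  proof -
   have "ennreal (1 / D) * ennreal (2 + 2 * real (Suc K) * C1) = ennreal (1 / D * (2 + 2 * real (Suc K) * C1))"
    using D C1 by (intro ennreal_mult[symmetric]) (auto intro!: add_nonneg_nonneg mult_nonneg_nonneg)
   then show ?thesis by (simp only: mult.assoc[symmetric] times_divide_eq_left mult_1_left)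
  qed
  finally have "(\<Sum>k\<le>Suc K. nsq (p k)) \<le> ennreal C1 * J + ennreal ((2 + 2 * real (Suc K) * C1) / D) * J"
   using low by (simp add: add_mono del: of_nat_Suc)
  also have "\<dots> = ennreal C2 * J"
   using C1 D by (simp add: C2_def ennreal_plus distrib_right del: of_nat_Suc)
  finally show "(\<Sum>k\<le>Suc K. nsq (p k)) \<le> ennreal C2 * seg 0 1 (\<lambda>s. nsq (\<Sum>k\<le>Suc K. s ^ k *\<^sub>R p k))"
   unfolding J_def P_def .
 qed
qed

context kalman
begin

lemma Dm_lower: "0 \<le> \<mu> \<Longrightarrow> \<mu> \<le> 1 \<Longrightarrow> \<mu> ^ K * norm z \<le> norm (Dm \<mu> z)"
proof -
 assume m: "0 \<le> \<mu>" "\<mu> \<le> 1"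
 have "(\<mu> ^ K * norm z)\<^sup>2 = \<mu> ^ (2 * K) * (norm (Dm 1 z))\<^sup>2" by (simp add: power_mult_distrib power_mult mult.commute)
 also have "\<dots> = (\<Sum>k\<le>K. \<mu> ^ (2 * K) * (norm (pj k z))\<^sup>2)" unfolding norm_Dm by (simp add: sum_distrib_left)
 also have "\<dots> \<le> (norm (Dm \<mu> z))\<^sup>2"
  unfolding norm_Dm using m by (intro sum_mono mult_right_mono power_decreasing) auto
 finally show ?thesis by (rule power2_le_imp_le) simp
qed

text \<open>The layer \<open>k\<close> is a combination of the \<open>B\<^sup>T (A\<^sup>T)\<^sup>r z\<close> with \<open>r \<le> k\<close>, and \<open>\<bar>\<tau>\<bar>\<^sup>k \<le> \<bar>\<tau>\<bar>\<^sup>r\<close>.\<close>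

lemma mode_coefficients:
 "\<exists>C>0. \<forall>\<tau> z. \<bar>\<tau>\<bar> \<le> 1 \<longrightarrow>
   nsq (Dm \<bar>\<tau>\<bar> z) \<le> ennreal C * (\<Sum>r\<le>K. nsq (((\<i> * of_real \<tau>) ^ r / fact r) *s Bt (cmat (mat_pow (transpose A) r) *v z)))"
proof -
 have "\<forall>k i. \<exists>c\<ge>0. \<forall>z. norm (cmat (X k i) *v z) \<le> c * norm z" using complex_matrix_bounded by blast
 then obtain c where c: "\<And>k i. c k i \<ge> 0" "\<And>k i z. norm (cmat (X k i) *v z) \<le> c k i * norm z" by metis
 define M where "M = (\<Sum>k\<le>K. \<Sum>i\<le>K. c k i * fact i) + 1"
 have M0: "M > 0" unfolding M_def using c(1) by (intro add_nonneg_pos sum_nonneg mult_nonneg_nonneg) auto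
 have cM: "c k i * fact i \<le> M" if "k \<le> K" "i \<le> K" for k i
 proof -
  have "c k i * fact i \<le> (\<Sum>i\<le>K. c k i * fact i)"
   by (rule member_le_sum) (use that c(1) in auto)
  also have "\<dots> \<le> (\<Sum>k\<le>K. \<Sum>i\<le>K. c k i * fact i)"
   by (rule member_le_sum[of k "{..K}" "\<lambda>k. \<Sum>i\<le>K. c k i * fact i"]) (use that c(1) in \<open>auto intro!: sum_nonneg\<close>)
  finally show ?thesis by (simp add: M_def)
 qed
 define C where "C = real (Suc K) * (M\<^sup>2 * real (Suc K))"
 have "nsq (Dm \<bar>\<tau>\<bar> z) \<le> ennreal C * (\<Sum>r\<le>K. nsq (((\<i> * of_real \<tau>) ^ r / fact r) *s Bt (cmat (mat_pow (transpose A) r) *v z)))"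
  if t: "\<bar>\<tau>\<bar> \<le> 1" for \<tau> z
 proof -
  define p where "p r = ((\<i> * of_real \<tau>) ^ r / fact r) *s Bt (cmat (mat_pow (transpose A) r) *v z)" for r
  define S where "S = (\<Sum>i\<le>K. norm (p i))"
  have np: "norm (p r) * fact r = \<bar>\<tau>\<bar> ^ r * norm (Bt (cmat (mat_pow (transpose A) r) *v z))" for r
   by (simp add: p_def norm_vec_scale norm_divide norm_power norm_mult)
  have k: "\<bar>\<tau>\<bar> ^ k * norm (pj k z) \<le> M * S" if k: "k \<le> K" for k
  proof -
   have "\<bar>\<tau>\<bar> ^ k * norm (pj k z) \<le> \<bar>\<tau>\<bar> ^ k * (\<Sum>i\<le>k. c k i * norm (Bt (cmat (mat_pow (transpose A) i) *v z)))"
    by (subst pj_expand) (intro mult_left_mono order_trans[OF norm_sum] sum_mono c, simp)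
   also have "\<dots> = (\<Sum>i\<le>k. c k i * (\<bar>\<tau>\<bar> ^ k * norm (Bt (cmat (mat_pow (transpose A) i) *v z))))"
    by (simp add: sum_distrib_left mult.left_commute)
   also have "\<dots> \<le> (\<Sum>i\<le>k. c k i * (\<bar>\<tau>\<bar> ^ i * norm (Bt (cmat (mat_pow (transpose A) i) *v z))))"
    using t c(1) by (intro sum_mono mult_left_mono mult_right_mono power_decreasing) auto
   also have "\<dots> = (\<Sum>i\<le>k. (c k i * fact i) * norm (p i))" unfolding np[symmetric] by (simp add: mult_ac)
   also have "\<dots> \<le> (\<Sum>i\<le>k. M * norm (p i))" using k by (intro sum_mono mult_right_mono cM) auto
   also have "\<dots> \<le> (\<Sum>i\<le>K. M * norm (p i))" using k M0 by (intro sum_mono2) auto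
   finally show ?thesis by (simp add: S_def sum_distrib_left)
  qed
  have "(norm (Dm \<bar>\<tau>\<bar> z))\<^sup>2 = (\<Sum>k\<le>K. (\<bar>\<tau>\<bar> ^ k * norm (pj k z))\<^sup>2)"
   unfolding norm_Dm by (simp add: power_mult_distrib power_mult[symmetric] mult.commute)
  also have "\<dots> \<le> (\<Sum>k\<le>K. (M * S)\<^sup>2)" using k by (intro sum_mono power_mono) auto
  also have "\<dots> = real (Suc K) * (M\<^sup>2 * S\<^sup>2)" by (simp add: power_mult_distrib)
  also have "S\<^sup>2 \<le> (\<Sum>i\<le>K. (norm (p i))\<^sup>2) * real (card {..K})"
   unfolding S_def by (rule sum_squared_le_sum_of_squares)
  finally have "(norm (Dm \<bar>\<tau>\<bar> z))\<^sup>2 \<le> real (Suc K) * (M\<^sup>2 * ((\<Sum>i\<le>K. (norm (p i))\<^sup>2) * real (card {..K})))"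
   by (simp add: mult_left_mono)
  also have "\<dots> = C * (\<Sum>i\<le>K. (norm (p i))\<^sup>2)" by (simp add: C_def mult_ac)
  finally show ?thesis
   unfolding nsq_def p_def[symmetric]
   by (subst sum_ennreal, simp, subst ennreal_mult[symmetric]) (auto simp: C_def sum_nonneg intro: ennreal_leI)
 qed
 moreover have "C > 0" using M0 by (simp add: C_def)
 ultimately show ?thesis by blast
qed

text \<open>The Taylor polynomial of the observation controls \<open>D z\<close>, where \<open>D\<close> stands for \<open>Dm \<bar>\<tau>\<bar>\<close>. On the window \<open>(0, \<delta>)\<close> its energy is at least of order
\<open>\<delta>\<^bsup>2K+1\<^esup>\<close>, while the remainder contributes the order \<open>\<delta>\<^bsup>2K+3\<^esup>\<close> of the same quantity, because
\<open>\<bar>\<tau>\<bar>\<^sup>K \<bar>z\<bar> \<le> \<bar>D z\<bar>\<close>.\<close>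

lemma mode_observability_low:
 "\<exists>c>0. \<forall>\<tau> z. \<bar>\<tau>\<bar> \<le> 1 \<longrightarrow>
   ennreal c * nsq (Dm \<bar>\<tau>\<bar> z) \<le> seg 0 1 (\<lambda>s. nsq (Bt (Ev (s * \<tau>) z)))"
proof -
 obtain C1 where C1: "C1 > 0" "\<And>p :: nat \<Rightarrow> complex^'m.
   (\<Sum>k\<le>K. nsq (p k)) \<le> ennreal C1 * seg 0 1 (\<lambda>s. nsq (\<Sum>k\<le>K. s ^ k *\<^sub>R p k))"
  using poly_coeff_bound by blast
 obtain b where b: "b \<ge> 0" "\<And>z. norm (Bt z) \<le> b * norm z"
  using complex_matrix_bounded[of "cmat (transpose B)"] unfolding Bt_def by blast
 obtain C2 where C2: "C2 \<ge> 0" "\<And>\<theta> z. norm (Ev \<theta> z - (\<Sum>r\<le>K. ((\<i> * of_real \<theta>) ^ r / fact r) *s (cmat (mat_pow (transpose A) r) *v z)))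
   \<le> C2 * \<bar>\<theta>\<bar> ^ Suc K * norm z" using Ev_taylor by blast
 obtain C3 where C3: "C3 > 0" "\<And>\<tau> z. \<bar>\<tau>\<bar> \<le> 1 \<Longrightarrow>
   nsq (Dm \<bar>\<tau>\<bar> z) \<le> ennreal C3 * (\<Sum>r\<le>K. nsq (((\<i> * of_real \<tau>) ^ r / fact r) *s Bt (cmat (mat_pow (transpose A) r) *v z)))"
  using mode_coefficients by blast
 define L where "L = b * C2"
 have L0: "L \<ge> 0" using b(1) C2(1) by (simp add: L_def)
 define a where "a = 1 / (C1 * C3)"
 have a0: "a > 0" using C1 C3 by (simp add: a_def)
 \<comment> \<open>so short that the Taylor remainder takes at most half of the main term\<close>
 define \<delta> where "\<delta> = min 1 (sqrt (a / (4 * (L\<^sup>2 + 1))))"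
 have d0: "\<delta> > 0" using a0 by (simp add: \<delta>_def add_nonneg_pos)
 have d1: "\<delta> \<le> 1" by (simp add: \<delta>_def)
 have d2: "2 * L\<^sup>2 * \<delta>\<^sup>2 \<le> a / 2"
 proof -
  have "\<delta> \<le> sqrt (a / (4 * (L\<^sup>2 + 1)))" by (simp add: \<delta>_def)
  then have "\<delta>\<^sup>2 \<le> (sqrt (a / (4 * (L\<^sup>2 + 1))))\<^sup>2" using d0 by (intro power_mono) auto
  also have "\<dots> = a / (4 * (L\<^sup>2 + 1))" using a0 by simp
  finally have "2 * L\<^sup>2 * \<delta>\<^sup>2 \<le> 2 * L\<^sup>2 * (a / (4 * (L\<^sup>2 + 1)))" by (intro mult_left_mono) auto
  also have "\<dots> \<le> 2 * (L\<^sup>2 + 1) * (a / (4 * (L\<^sup>2 + 1)))" using a0 by (intro mult_right_mono) auto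
  also have "\<dots> = a / 2"
  proof -
   have "L\<^sup>2 + 1 \<noteq> 0" by (metis add_nonneg_pos less_irrefl zero_le_power2 zero_less_one)
   then show ?thesis by (simp add: field_simps)
  qed
  finally show ?thesis .
 qed
 define c where "c = a / 4 * \<delta> ^ (2 * K + 1)"
 have "ennreal c * nsq (Dm \<bar>\<tau>\<bar> z) \<le> seg 0 1 (\<lambda>s. nsq (Bt (Ev (s * \<tau>) z)))" if t: "\<bar>\<tau>\<bar> \<le> 1" for \<tau> z
 proof -
  let ?N = "(norm (Dm \<bar>\<tau>\<bar> z))\<^sup>2"
  define p where "p r = ((\<i> * of_real \<tau>) ^ r / fact r) *s Bt (cmat (mat_pow (transpose A) r) *v z)" for r
  define f where "f s = Bt (Ev (s * \<tau>) z)" for s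
  define Pp where "Pp s = (\<Sum>r\<le>K. s ^ r *\<^sub>R p r)" for s :: real
  have [measurable]: "f \<in> borel_measurable borel" "Pp \<in> borel_measurable borel"
   unfolding f_def Pp_def by measurable
  have rem: "norm (Pp s - f s) \<le> L * s ^ Suc K * norm (Dm \<bar>\<tau>\<bar> z)" if s: "0 \<le> s" for s
  proof -
   have "Bt (\<Sum>r\<le>K. ((\<i> * of_real (s * \<tau>)) ^ r / fact r) *s (cmat (mat_pow (transpose A) r) *v z)) = Pp s"
    unfolding op_sum op_scale Pp_def p_def scaleR_vec
    by (intro sum.cong refl) (simp add: vector_smult_assoc power_mult_distrib mult_ac)
   then have "f s - Pp s = Bt (Ev (s * \<tau>) z - (\<Sum>r\<le>K. ((\<i> * of_real (s * \<tau>)) ^ r / fact r) *s (cmat (mat_pow (transpose A) r) *v z)))"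
    unfolding f_def Bt_def by (simp add: matrix_vector_mult_diff_distrib)
   also have "norm \<dots> \<le> b * (C2 * \<bar>s * \<tau>\<bar> ^ Suc K * norm z)"
    by (intro order_trans[OF b(2)] mult_left_mono C2 b(1))
   also have "\<dots> = L * s ^ Suc K * (\<bar>\<tau>\<bar> * (\<bar>\<tau>\<bar> ^ K * norm z))"
    using s by (simp add: L_def abs_mult power_mult_distrib)
   also have "\<dots> \<le> L * s ^ Suc K * (1 * norm (Dm \<bar>\<tau>\<bar> z))"
    using L0 s t by (intro mult_left_mono mult_mono Dm_lower) auto
   finally show ?thesis by (simp add: norm_minus_commute)
  qed
  have "ennreal a * nsq (Dm \<bar>\<tau>\<bar> z) \<le> ennreal a * (ennreal C3 * (\<Sum>r\<le>K. nsq (p r)))"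
   unfolding p_def by (intro mult_left_mono C3 t) auto
  also have "\<dots> \<le> ennreal a * (ennreal C3 * (ennreal ((1 / \<delta>) ^ (2 * K)) * (\<Sum>r\<le>K. nsq (\<delta> ^ r *\<^sub>R p r))))"
  proof -
   have "nsq (p r) \<le> ennreal ((1 / \<delta>) ^ (2 * K)) * nsq (\<delta> ^ r *\<^sub>R p r)" if "r \<le> K" for r
   proof -
    have "1 \<le> (1 / \<delta>) ^ (2 * K) * (\<delta> ^ r)\<^sup>2"
    proof -
     have "1 \<le> (1 / \<delta>) ^ (2 * (K - r))" using d0 d1 by (intro one_le_power) simp
     also have "\<dots> = (1 / \<delta>) ^ (2 * K) * (\<delta> ^ r)\<^sup>2"
     proof -
      have "(1 / \<delta>) ^ (2 * K) = (1 / \<delta>) ^ (2 * (K - r)) * (1 / \<delta>) ^ (2 * r)"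
       using that by (simp add: power_add[symmetric] mult_2 flip: distrib_left)
      moreover have "(1 / \<delta>) ^ (2 * r) * (\<delta> ^ r)\<^sup>2 = 1"
       using d0 by (simp add: power_divide power_mult[symmetric] mult.commute)
      ultimately show ?thesis by simp
     qed
     finally show ?thesis .
    qed
    then have "ennreal 1 * nsq (p r) \<le> ennreal ((1 / \<delta>) ^ (2 * K) * (\<delta> ^ r)\<^sup>2) * nsq (p r)"
     by (intro mult_right_mono ennreal_leI) auto
    then show ?thesis using d0 by (simp add: nsq_scaleR ennreal_mult mult.assoc)
   qed
   then show ?thesis unfolding sum_distrib_left by (intro mult_left_mono sum_mono) (auto simp: sum_distrib_left)
  qed
  also have "\<dots> \<le> ennreal a * (ennreal C3 * (ennreal ((1 / \<delta>) ^ (2 * K)) * (ennreal C1 * seg 0 1 (\<lambda>s. nsq (\<Sum>k\<le>K. s ^ k *\<^sub>R \<delta> ^ k *\<^sub>R p k)))))"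
   by (intro mult_left_mono C1) auto
  also have "\<dots> = ennreal ((1 / \<delta>) ^ (2 * K)) * seg 0 1 (\<lambda>s. nsq (Pp (\<delta> * s)))"
  proof -
   have "ennreal a * (ennreal C3 * ennreal C1) = 1" using C1 C3 by (simp add: a_def ennreal_mult[symmetric])
   moreover have "(\<Sum>k\<le>K. s ^ k *\<^sub>R \<delta> ^ k *\<^sub>R p k) = Pp (\<delta> * s)" for s
    by (simp add: Pp_def power_mult_distrib mult.commute)
   ultimately show ?thesis by (simp add: mult_ac) (metis (no_types, lifting) mult.assoc mult.commute mult_1)
  qed
  finally have "ennreal (\<delta> ^ (2 * K + 1)) * (ennreal a * nsq (Dm \<bar>\<tau>\<bar> z))
    \<le> ennreal (\<delta> ^ (2 * K + 1)) * (ennreal ((1 / \<delta>) ^ (2 * K)) * seg 0 1 (\<lambda>s. nsq (Pp (\<delta> * s))))"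
   by (intro mult_left_mono) auto
  also have "\<dots> = ennreal \<delta> * seg 0 1 (\<lambda>s. nsq (Pp (\<delta> * s)))"
  proof -
   have "\<delta> ^ (2 * K + 1) * (1 / \<delta>) ^ (2 * K) = \<delta>" using d0 by (simp add: power_divide)
   moreover have "ennreal (\<delta> ^ (2 * K + 1)) * ennreal ((1 / \<delta>) ^ (2 * K)) = ennreal (\<delta> ^ (2 * K + 1) * (1 / \<delta>) ^ (2 * K))"
    using d0 by (intro ennreal_mult[symmetric]) auto
   ultimately show ?thesis by (simp only: mult.assoc[symmetric])
  qed
  also have "\<dots> = seg 0 (\<delta> * 1) (\<lambda>s. nsq (Pp s))" using d0 by (intro seg_scale[symmetric]) measurable
  also have "\<dots> = seg 0 \<delta> (\<lambda>s. nsq (Pp s))" by simp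
  also have "\<dots> \<le> seg 0 \<delta> (\<lambda>s. 2 * nsq (f s) + 2 * ennreal (L\<^sup>2 * \<delta> ^ (2 * Suc K) * ?N))"
  proof (rule seg_mono)
   fix s assume s: "0 \<le> s" "s \<le> \<delta>"
   have "nsq (Pp s) = nsq (f s + (Pp s - f s))" by simp
   also have "\<dots> \<le> 2 * nsq (f s) + 2 * nsq (Pp s - f s)" by (rule nsq_add_le)
   also have "nsq (Pp s - f s) \<le> ennreal (L\<^sup>2 * \<delta> ^ (2 * Suc K) * ?N)"
   proof -
    have "norm (Pp s - f s) \<le> L * \<delta> ^ Suc K * norm (Dm \<bar>\<tau>\<bar> z)"
     by (rule order_trans[OF rem[OF s(1)]]) (use s L0 in \<open>intro mult_right_mono mult_left_mono power_mono; auto\<close>)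
    then have "(norm (Pp s - f s))\<^sup>2 \<le> (L * \<delta> ^ Suc K * norm (Dm \<bar>\<tau>\<bar> z))\<^sup>2" by (intro power_mono) auto
    also have "\<dots> = L\<^sup>2 * \<delta> ^ (2 * Suc K) * ?N" by (simp only: power_mult_distrib power_mult[symmetric] mult.commute[of 2])
    finally show ?thesis unfolding nsq_def by (rule ennreal_leI)
   qed
   finally show "nsq (Pp s) \<le> 2 * nsq (f s) + 2 * ennreal (L\<^sup>2 * \<delta> ^ (2 * Suc K) * ?N)"
    by (meson add_left_mono mult_left_mono order_trans zero_le)
  qed
  also have "\<dots> = 2 * seg 0 \<delta> (\<lambda>s. nsq (f s)) + 2 * ennreal (L\<^sup>2 * \<delta> ^ (2 * Suc K) * ?N) * ennreal \<delta>"
   using d0 by (subst seg_add) (simp_all add: seg_cmult seg_const mult.assoc)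
  also have "\<dots> \<le> 2 * seg 0 1 (\<lambda>s. nsq (f s)) + ennreal (a / 2 * \<delta> ^ (2 * K + 1) * ?N)"
  proof (intro add_mono mult_left_mono seg_subset d1 order_refl)
   have "2 * ennreal (L\<^sup>2 * \<delta> ^ (2 * Suc K) * ?N) * ennreal \<delta> = ennreal (2 * (L\<^sup>2 * \<delta> ^ (2 * Suc K) * ?N) * \<delta>)"
    using d0 by (simp add: ennreal_mult)
   also have "2 * (L\<^sup>2 * \<delta> ^ (2 * Suc K) * ?N) * \<delta> = (2 * L\<^sup>2 * \<delta>\<^sup>2) * (\<delta> ^ (2 * K + 1) * ?N)"
    by (simp add: power2_eq_square)
   also have "\<dots> \<le> (a / 2) * (\<delta> ^ (2 * K + 1) * ?N)" using d0 by (intro mult_right_mono d2) auto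
   finally show "2 * ennreal (L\<^sup>2 * \<delta> ^ (2 * Suc K) * ?N) * ennreal \<delta> \<le> ennreal (a / 2 * \<delta> ^ (2 * K + 1) * ?N)"
    by (simp add: ennreal_leI mult.assoc)
  qed auto
  finally have main: "ennreal (a * \<delta> ^ (2 * K + 1) * ?N) \<le> 2 * seg 0 1 (\<lambda>s. nsq (f s)) + ennreal (a / 2 * \<delta> ^ (2 * K + 1) * ?N)"
   using a0 d0 by (simp add: nsq_def ennreal_mult mult_ac)
  have "ennreal (c * ?N) \<le> seg 0 1 (\<lambda>s. nsq (f s))"
  proof (cases "seg 0 1 (\<lambda>s. nsq (f s))")
   case (real r)
   then have "2 * seg 0 1 (\<lambda>s. nsq (f s)) + ennreal (a / 2 * \<delta> ^ (2 * K + 1) * ?N) = ennreal (2 * r + a / 2 * \<delta> ^ (2 * K + 1) * ?N)"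
    using a0 d0 by (simp add: ennreal_mult)
   then have "a * \<delta> ^ (2 * K + 1) * ?N \<le> 2 * r + a / 2 * \<delta> ^ (2 * K + 1) * ?N"
    using main real a0 d0 by (simp add: ennreal_le_iff del: ennreal_plus)
   then have "c * ?N \<le> r" by (simp add: c_def)
   then show ?thesis using real by (simp add: ennreal_leI)
  qed simp
  then show ?thesis
   using a0 d0 by (simp add: f_def nsq_def c_def ennreal_mult[symmetric] del: power_Suc)
 qed
 moreover have "c > 0" using a0 d0 by (simp add: c_def)
 ultimately show ?thesis by blast
qed

lemma Ev_below: "\<exists>c>0. \<forall>\<theta> z. c * norm z \<le> norm (Ev \<theta> z)"
proof -
 obtain C where C: "C \<ge> 0" "\<And>\<theta> z. norm (Ev \<theta> z) \<le> C * norm z" using Ev_bounded by blast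
 have "norm z / (C + 1) \<le> norm (Ev \<theta> z)" for \<theta> z
 proof -
  have "norm z = norm (Ev (- \<theta>) (Ev \<theta> z))" by (simp add: Ev_Ev)
  also have "\<dots> \<le> C * norm (Ev \<theta> z)" by (rule C)
  also have "\<dots> \<le> (C + 1) * norm (Ev \<theta> z)" by (simp add: mult_right_mono)
  finally show ?thesis using C(1) by (simp add: divide_le_eq mult.commute add_nonneg_pos)
 qed
 then show ?thesis using C(1) by (intro exI[of _ "1 / (C + 1)"]) auto
qed

text \<open>During a window of length \<open>h = 1 / (2 \<bar>\<tau>\<bar>)\<close> the phase \<open>s \<tau>\<close> advances by one half. There the estimate for small
\<open>\<tau>\<close> applies to the solution at the beginning of the window, with weights bounded below. The bounds for all windows
that begin before the time \<open>1/2\<close> are averaged.\<close>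

lemma mode_observability_high:
 "\<exists>c>0. \<forall>\<tau> z. 1 \<le> \<bar>\<tau>\<bar> \<longrightarrow> ennreal c * nsq z \<le> seg 0 1 (\<lambda>s. nsq (Bt (Ev (s * \<tau>) z)))"
proof -
 obtain c where c: "c > 0" "\<And>\<tau> z. \<bar>\<tau>\<bar> \<le> 1 \<Longrightarrow>
   ennreal c * nsq (Dm \<bar>\<tau>\<bar> z) \<le> seg 0 1 (\<lambda>s. nsq (Bt (Ev (s * \<tau>) z)))" using mode_observability_low by blast
 obtain e where e: "e > 0" "\<And>\<theta> z. e * norm z \<le> norm (Ev \<theta> z)" using Ev_below by blast
 define c' where "c' = c * ((1/2) ^ K * e)\<^sup>2"
 have c'0: "c' > 0" using c e by (simp add: c'_def)
 have "ennreal (c' / 2) * nsq z \<le> seg 0 1 (\<lambda>s. nsq (Bt (Ev (s * \<tau>) z)))" if t: "1 \<le> \<bar>\<tau>\<bar>" for \<tau> z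
 proof -
  define f where "f s = nsq (Bt (Ev (s * \<tau>) z))" for s
  have [measurable]: "f \<in> borel_measurable borel" unfolding f_def by measurable
  define h where "h = 1 / (2 * \<bar>\<tau>\<bar>)"
  have h0: "h > 0" "h \<le> 1/2" using t by (auto simp: h_def field_simps)
  have h1: "h * \<tau> = sgn \<tau> / 2" using t by (simp add: h_def sgn_if)
  have 1: "ennreal h * (ennreal c' * nsq z) \<le> seg 0 h (\<lambda>r. f (s0 + r))" for s0
  proof -
   have "norm z * ((1/2) ^ K * e) \<le> norm (Dm (1/2) (Ev (s0 * \<tau>) z))"
   proof -
    have "(1/2) ^ K * (e * norm z) \<le> (1/2) ^ K * norm (Ev (s0 * \<tau>) z)" by (intro mult_left_mono e) auto
    also have "\<dots> \<le> norm (Dm (1/2) (Ev (s0 * \<tau>) z))" by (rule Dm_lower) auto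
    finally show ?thesis by (simp add: mult_ac)
   qed
   then have "((1/2) ^ K * e)\<^sup>2 * (norm z)\<^sup>2 \<le> (norm (Dm (1/2) (Ev (s0 * \<tau>) z)))\<^sup>2"
    using e(1) by (metis (no_types, lifting) less_eq_real_def mult.commute mult_nonneg_nonneg norm_ge_zero power_mono power_mult_distrib zero_le_divide_1_iff zero_le_numeral zero_le_power)
   then have "c' * (norm z)\<^sup>2 \<le> c * (norm (Dm (1/2) (Ev (s0 * \<tau>) z)))\<^sup>2"
    using c(1) by (simp add: c'_def mult.assoc)
   then have "ennreal c' * nsq z \<le> ennreal c * nsq (Dm (1/2) (Ev (s0 * \<tau>) z))"
    unfolding nsq_def using c(1) c'0 by (simp add: ennreal_mult[symmetric] ennreal_leI)
   also have "1/2 = \<bar>h * \<tau>\<bar>" using t unfolding h1 by (auto simp: sgn_if)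
   also have "ennreal c * nsq (Dm \<bar>h * \<tau>\<bar> (Ev (s0 * \<tau>) z)) \<le> seg 0 1 (\<lambda>s. nsq (Bt (Ev (s * (h * \<tau>)) (Ev (s0 * \<tau>) z))))"
    by (rule c(2)) (simp add: h1 sgn_if)
   also have "\<dots> = seg 0 1 (\<lambda>s. f (s0 + h * s))"
    by (simp add: f_def Ev_Ev algebra_simps)
   finally have "ennreal h * (ennreal c' * nsq z) \<le> ennreal h * seg 0 1 (\<lambda>s. f (s0 + h * s))"
    by (intro mult_left_mono) auto
   also have "\<dots> = seg 0 (h * 1) (\<lambda>r. f (s0 + r))"
    by (rule seg_scale[symmetric, OF h0(1)]) measurable
   finally show ?thesis by simp
  qed
  have "ennreal h * (ennreal (c' / 2) * nsq z) = seg 0 (1/2) (\<lambda>s0. ennreal h * (ennreal c' * nsq z))"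
  proof -
   have "ennreal (c' / 2) = ennreal c' * ennreal (1/2)" using c'0 by (subst ennreal_mult[symmetric]) auto
   moreover have "seg 0 (1/2) (\<lambda>s0. ennreal h * (ennreal c' * nsq z)) = ennreal h * (ennreal c' * nsq z) * ennreal (1/2 - 0)"
    by (rule seg_const) simp
   ultimately show ?thesis by (simp only: mult_ac diff_zero)
  qed
  also have "\<dots> \<le> seg 0 (1/2) (\<lambda>s0. seg 0 h (\<lambda>r. f (s0 + r)))" by (intro seg_mono 1)
  also have "\<dots> = (\<integral>\<^sup>+s0. \<integral>\<^sup>+r. f (s0 + r) * indicator {0..h} r * indicator {0..1/2} s0)"
   unfolding seg_def by (simp add: nn_integral_multc)
  also have "\<dots> = (\<integral>\<^sup>+r. \<integral>\<^sup>+s0. f (s0 + r) * indicator {0..h} r * indicator {0..1/2} s0)"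
   by (rule lborel_pair.Fubini') measurable
  also have "\<dots> = seg 0 h (\<lambda>r. seg 0 (1/2) (\<lambda>s0. f (s0 + r)))"
   unfolding seg_def
   by (rule nn_integral_cong, subst nn_integral_multc[symmetric], measurable) (simp add: mult_ac)
  also have "\<dots> \<le> seg 0 h (\<lambda>r. seg 0 1 f)"
  proof (rule seg_mono)
   fix r assume r: "0 \<le> r" "r \<le> h"
   have "seg 0 (1/2) (\<lambda>s0. f (s0 + r)) = seg (r + 1 * 0) (r + 1 * (1/2)) f"
    by (subst seg_affine) (simp_all add: add.commute)
   also have "\<dots> \<le> seg 0 1 f" by (rule seg_subset) (use r h0 in auto)
   finally show "seg 0 (1/2) (\<lambda>s0. f (s0 + r)) \<le> seg 0 1 f" .
  qed
  also have "\<dots> = ennreal h * seg 0 1 f" using h0 by (simp add: seg_const mult.commute)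
  finally have le: "ennreal h * (ennreal (c' / 2) * nsq z) \<le> ennreal h * seg 0 1 f" .
  have one: "ennreal (1 / h) * ennreal h = 1" using h0 by (simp add: ennreal_mult[symmetric])
  have "ennreal (c' / 2) * nsq z = ennreal (1 / h) * (ennreal h * (ennreal (c' / 2) * nsq z))"
   by (subst mult.assoc[symmetric]) (simp only: one mult_1_left)
  also have "\<dots> \<le> ennreal (1 / h) * (ennreal h * seg 0 1 f)" by (rule mult_left_mono[OF le]) simp
  also have "\<dots> = seg 0 1 f"
   by (subst mult.assoc[symmetric]) (simp only: one mult_1_left)
  finally have "ennreal (c' / 2) * nsq z \<le> seg 0 1 f" .
  then show ?thesis by (simp only: f_def[abs_def])
 qed
 then show ?thesis using c'0 by (intro exI[of _ "c' / 2"]) auto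
qed

text \<open>Scaling time by \<open>T\<close> replaces \<open>\<xi>\<close> by \<open>T \<xi>\<close>; comparing \<open>mu (T * \<xi>)\<close> with \<open>mu \<xi>\<close> costs \<open>min 1 T\<close> to the power \<open>2 K\<close>.\<close>

theorem mode_observability:
 "\<exists>c>0. \<forall>T>0. \<forall>\<xi> z. ennreal (c * min T (T ^ (2 * K + 1))) * nsq (Dm (mu \<xi>) z) \<le> seg 0 T (\<lambda>s. nsq (Bt (Ev (s * \<xi>) z)))"
proof -
 obtain c1 where c1: "c1 > 0" "\<And>\<tau> z. \<bar>\<tau>\<bar> \<le> 1 \<Longrightarrow>
   ennreal c1 * nsq (Dm \<bar>\<tau>\<bar> z) \<le> seg 0 1 (\<lambda>s. nsq (Bt (Ev (s * \<tau>) z)))" using mode_observability_low by blast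
 obtain c2 where c2: "c2 > 0" "\<And>\<tau> z. 1 \<le> \<bar>\<tau>\<bar> \<Longrightarrow>
   ennreal c2 * nsq z \<le> seg 0 1 (\<lambda>s. nsq (Bt (Ev (s * \<tau>) z)))" using mode_observability_high by blast
 define c where "c = min c1 c2"
 have c0: "c > 0" using c1 c2 by (simp add: c_def)
 have unit: "ennreal c * nsq (Dm (mu \<tau>) z) \<le> seg 0 1 (\<lambda>s. nsq (Bt (Ev (s * \<tau>) z)))" for \<tau> z
 proof (cases "\<bar>\<tau>\<bar> \<le> 1")
  case True
  then have "mu \<tau> = \<bar>\<tau>\<bar>" by (simp add: mu_def)
  then have "ennreal c * nsq (Dm (mu \<tau>) z) \<le> ennreal c1 * nsq (Dm \<bar>\<tau>\<bar> z)"
   by (simp only:) (intro mult_right_mono ennreal_leI, auto simp: c_def)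
  then show ?thesis using c1(2)[OF True] by (rule order_trans)
 next
  case False
  then have "mu \<tau> = 1" by (simp add: mu_def)
  then have "ennreal c * nsq (Dm (mu \<tau>) z) \<le> ennreal c2 * nsq z"
   by (simp only: Dm_one) (intro mult_right_mono ennreal_leI, auto simp: c_def)
  then show ?thesis using c2(2)[of \<tau> z] False by simp
 qed
 have "ennreal (c * min T (T ^ (2 * K + 1))) * nsq (Dm (mu \<xi>) z) \<le> seg 0 T (\<lambda>s. nsq (Bt (Ev (s * \<xi>) z)))"
  if T: "T > 0" for T \<xi> z
 proof -
  define m where "m = min 1 T"
  have m: "0 < m" "m \<le> 1" "m \<le> T" using T by (auto simp: m_def)
  have "min T (T ^ (2 * K + 1)) = T * m ^ (2 * K)"
  proof (cases "T \<le> 1")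
   case True
   then have "T ^ (2 * K) \<le> 1" using T by (intro power_le_one) auto
   then have "T * T ^ (2 * K) \<le> T * 1" using T by (intro mult_left_mono) auto
   then show ?thesis using True T by (simp add: m_def min_def)
  next
   case False
   then have "1 \<le> T ^ (2 * K)" by (intro one_le_power) auto
   then have "T * 1 \<le> T * T ^ (2 * K)" using T by (intro mult_left_mono) auto
   then show ?thesis using False by (simp add: m_def min_def)
  qed
  moreover have mm: "m * mu \<xi> \<le> mu (T * \<xi>)"
  proof -
   have "m * mu \<xi> \<le> T * \<bar>\<xi>\<bar>" using m by (intro mult_mono) (auto simp: mu_def)
   moreover have "m * mu \<xi> \<le> 1 * 1" using m mu_range[of \<xi>] by (intro mult_mono) auto
   ultimately show ?thesis using T by (simp add: mu_def[of "T * \<xi>"] abs_mult)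
  qed
  have "m ^ (2 * K) * (norm (Dm (mu \<xi>) z))\<^sup>2 \<le> (norm (Dm (mu (T * \<xi>)) z))\<^sup>2"
  proof -
   have "m ^ (2 * K) * (norm (Dm (mu \<xi>) z))\<^sup>2 = (\<Sum>k\<le>K. (m ^ (2 * K) * mu \<xi> ^ (2 * k)) * (norm (pj k z))\<^sup>2)"
    unfolding norm_Dm by (simp add: sum_distrib_left mult.assoc)
   also have "\<dots> \<le> (norm (Dm (mu (T * \<xi>)) z))\<^sup>2"
    unfolding norm_Dm
   proof (intro sum_mono mult_right_mono)
    fix k assume k: "k \<in> {..K}"
    have "m ^ (2 * K) * mu \<xi> ^ (2 * k) \<le> m ^ (2 * k) * mu \<xi> ^ (2 * k)"
     using k m mu_range(1)[of \<xi>] by (intro mult_right_mono power_decreasing) auto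
    also have "\<dots> = (m * mu \<xi>) ^ (2 * k)" by (simp add: power_mult_distrib)
    also have "\<dots> \<le> mu (T * \<xi>) ^ (2 * k)" using m mu_range(1)[of \<xi>] by (intro power_mono mm) auto
    finally show "m ^ (2 * K) * mu \<xi> ^ (2 * k) \<le> mu (T * \<xi>) ^ (2 * k)" .
   qed auto
   finally show ?thesis .
  qed
  ultimately have "c * min T (T ^ (2 * K + 1)) * (norm (Dm (mu \<xi>) z))\<^sup>2 \<le> T * (c * (norm (Dm (mu (T * \<xi>)) z))\<^sup>2)"
   using c0 T by (simp add: mult_ac mult_left_mono)
  then have "ennreal (c * min T (T ^ (2 * K + 1))) * nsq (Dm (mu \<xi>) z) \<le> ennreal T * (ennreal c * nsq (Dm (mu (T * \<xi>)) z))"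
   unfolding nsq_def using c0 T by (simp add: ennreal_mult[symmetric] ennreal_leI del: power_Suc)
  also have "\<dots> \<le> ennreal T * seg 0 1 (\<lambda>s. nsq (Bt (Ev (s * (T * \<xi>)) z)))" by (intro mult_left_mono unit) auto
  also have "\<dots> = seg 0 (T * 1) (\<lambda>s. nsq (Bt (Ev (s * \<xi>) z)))"
   by (subst seg_scale[OF T]) (simp_all add: mult_ac)
  finally show ?thesis by simp
 qed
 then show ?thesis using c0 by blast
qed

end

section \<open>Localized observability of superposed waves\<close>

lemma nsq_scale: "nsq (c *s v) = ennreal ((norm c)\<^sup>2) * nsq (v :: complex^'m)"
 by (simp add: nsq_def norm_vec_scale power_mult_distrib ennreal_mult)

lemma cis_minus_one_lower: "\<bar>\<theta>\<bar> \<le> 1 \<Longrightarrow> \<bar>\<theta>\<bar> / 2 \<le> norm (cis \<theta> - 1)"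
proof -
 assume t: "\<bar>\<theta>\<bar> \<le> 1"
 have "norm (cis \<theta> - (1 + \<i> * \<theta>)) \<le> \<bar>\<theta>\<bar>\<^sup>2 / 2"
  using iexp_approx1[of \<theta> 1] by (simp add: cis_conv_exp numeral_2_eq_2)
 moreover have "\<bar>\<theta>\<bar>\<^sup>2 \<le> \<bar>\<theta>\<bar>" using power_decreasing[of 1 2 "\<bar>\<theta>\<bar>"] t by simp
 moreover have "norm (\<i> * complex_of_real \<theta>) \<le> norm (cis \<theta> - 1) + norm (cis \<theta> - (1 + \<i> * \<theta>))"
  using norm_triangle_ineq4[of "cis \<theta> - 1" "cis \<theta> - (1 + \<i> * \<theta>)"] by simp
 ultimately show ?thesis by (simp add: norm_mult)
qed

lemma cis_minus_one_upper: "norm (cis \<theta> - 1) \<le> \<bar>\<theta>\<bar>" "norm (cis \<theta> - 1) \<le> 2"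
proof -
 show "norm (cis \<theta> - 1) \<le> \<bar>\<theta>\<bar>"
  using iexp_approx1[of \<theta> 0] by (simp add: cis_conv_exp)
 show "norm (cis \<theta> - 1) \<le> 2" using norm_triangle_ineq4[of "cis \<theta>" 1] by simp
qed

text \<open>The factor, integrated over shifts \<open>\<eta> < \<epsilon>\<close>, by which a difference along one wave changes the energy of another; \<open>x\<close> is the
frequency times the difference of the two speeds.\<close>

definition diff_mass :: "real \<Rightarrow> real \<Rightarrow> ennreal" where
 "diff_mass \<epsilon> x = seg 0 \<epsilon> (\<lambda>\<eta>. nsq (cis (- (\<eta> * x)) - 1))"

text \<open>If \<open>\<epsilon> \<bar>x\<bar> \<le> 1\<close>, the integrand is of order \<open>(\<eta> x)\<^sup>2\<close>. Otherwise the window contains pairs of shifts whose phases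
differ by one half, and the integrand cannot be small at both.\<close>

lemma diff_mass_lower:
 assumes e: "0 < \<epsilon>" "\<epsilon> \<le> E" and x: "x0 \<le> \<bar>x\<bar>" "0 < x0"
 shows "ennreal (min (x0\<^sup>2 / 32) (1 / (128 * E\<^sup>2)) * \<epsilon> ^ 3) \<le> diff_mass \<epsilon> x"
proof (cases "\<epsilon> * \<bar>x\<bar> \<le> 1")
 case True
 have "min (x0\<^sup>2 / 32) (1 / (128 * E\<^sup>2)) * \<epsilon> ^ 3 \<le> x0\<^sup>2 / 32 * \<epsilon> ^ 3"
  using e by (intro mult_right_mono) auto
 also have "\<dots> \<le> \<bar>x\<bar>\<^sup>2 / 32 * \<epsilon> ^ 3"
  using e x by (intro mult_right_mono divide_right_mono power_mono) auto
 also have "\<dots> = (\<epsilon> / 2 * \<bar>x\<bar> / 2)\<^sup>2 * (\<epsilon> - \<epsilon> / 2)" by (simp add: power2_eq_square power3_eq_cube)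
 finally have "ennreal (min (x0\<^sup>2 / 32) (1 / (128 * E\<^sup>2)) * \<epsilon> ^ 3) \<le> ennreal ((\<epsilon> / 2 * \<bar>x\<bar> / 2)\<^sup>2) * ennreal (\<epsilon> - \<epsilon> / 2)"
  using e by (simp add: ennreal_mult[symmetric] ennreal_leI)
 also have "\<dots> = seg (\<epsilon> / 2) \<epsilon> (\<lambda>\<eta>. ennreal ((\<epsilon> / 2 * \<bar>x\<bar> / 2)\<^sup>2))" using e by (intro seg_const[symmetric]) auto
 also have "\<dots> \<le> seg (\<epsilon> / 2) \<epsilon> (\<lambda>\<eta>. nsq (cis (- (\<eta> * x)) - 1))"
 proof (rule seg_mono)
  fix \<eta> assume h: "\<epsilon> / 2 \<le> \<eta>" "\<eta> \<le> \<epsilon>"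
  have "\<bar>- (\<eta> * x)\<bar> \<le> 1" using True h e by (simp add: abs_mult) (meson abs_ge_zero mult_right_mono order_trans)
  then have "\<bar>- (\<eta> * x)\<bar> / 2 \<le> norm (cis (- (\<eta> * x)) - 1)" by (rule cis_minus_one_lower)
  moreover have "\<epsilon> / 2 * \<bar>x\<bar> / 2 \<le> \<bar>- (\<eta> * x)\<bar> / 2"
  proof -
   have "\<epsilon> / 2 * \<bar>x\<bar> \<le> \<eta> * \<bar>x\<bar>" by (rule mult_right_mono[OF h(1)]) simp
   then show ?thesis using h e by (simp add: abs_mult)
  qed
  ultimately have "\<epsilon> / 2 * \<bar>x\<bar> / 2 \<le> norm (cis (- (\<eta> * x)) - 1)" by linarith
  then show "ennreal ((\<epsilon> / 2 * \<bar>x\<bar> / 2)\<^sup>2) \<le> nsq (cis (- (\<eta> * x)) - 1)"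
   unfolding nsq_def using e by (intro ennreal_leI power_mono) auto
 qed
 also have "\<dots> \<le> diff_mass \<epsilon> x" unfolding diff_mass_def by (rule seg_subset) (use e in auto)
 finally show ?thesis .
next
 case False
 define \<tau> where "\<tau> = 1 / (2 * \<bar>x\<bar>)"
 have x0: "\<bar>x\<bar> > 0" using x by linarith
 have t: "0 < \<tau>" "\<tau> \<le> \<epsilon> / 2" using False x0 e by (auto simp: \<tau>_def field_simps)
 define f where "f \<eta> = nsq (cis (- (\<eta> * x)) - 1)" for \<eta>
 have [measurable]: "f \<in> borel_measurable borel" unfolding f_def by measurable
 have pt: "ennreal (1/32) \<le> f \<eta> + f (\<tau> + \<eta>)" for \<eta>
 proof -
  let ?a = "cis (- (\<eta> * x)) - 1" and ?b = "cis (- ((\<tau> + \<eta>) * x)) - 1"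
  have "?b - ?a = cis (- (\<eta> * x)) * (cis (- (\<tau> * x)) - 1)"
   by (simp add: right_diff_distrib cis_mult algebra_simps)
  then have "norm (cis (- (\<tau> * x)) - 1) = norm (?b - ?a)" by (simp add: norm_mult)
  also have "\<dots> \<le> norm ?b + norm ?a" by (rule norm_triangle_ineq4)
  finally have "norm (cis (- (\<tau> * x)) - 1) \<le> norm ?b + norm ?a" .
  moreover have tx: "\<bar>- (\<tau> * x)\<bar> = 1/2" using x0 by (simp add: \<tau>_def abs_mult)
  then have "(1/2) / 2 \<le> norm (cis (- (\<tau> * x)) - 1)" using cis_minus_one_lower[of "- (\<tau> * x)"] by simp
  ultimately have "1/4 \<le> norm ?b + norm ?a" by simp
  then have "(1/4)\<^sup>2 \<le> (norm ?b + norm ?a)\<^sup>2" by (intro power_mono) auto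
  also have "\<dots> \<le> 2 * ((norm ?a)\<^sup>2 + (norm ?b)\<^sup>2)"
   using sum_squares_bound[of "norm ?b" "norm ?a"] by (simp add: power2_sum)
  finally have "1/32 \<le> (norm ?a)\<^sup>2 + (norm ?b)\<^sup>2" by (simp add: power2_eq_square)
  then show ?thesis by (simp add: f_def nsq_def ennreal_plus[symmetric] ennreal_leI del: ennreal_plus)
 qed
 have E: "E > 0" using e by linarith
 have e3: "\<epsilon> ^ 3 = \<epsilon> * \<epsilon>\<^sup>2" by (simp add: power3_eq_cube power2_eq_square)
 have "min (x0\<^sup>2 / 32) (1 / (128 * E\<^sup>2)) * \<epsilon> ^ 3 \<le> 1 / (128 * E\<^sup>2) * (\<epsilon> * \<epsilon>\<^sup>2)"
  unfolding e3 using e by (intro mult_right_mono) auto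
 also have "\<dots> \<le> 1 / (128 * E\<^sup>2) * (\<epsilon> * E\<^sup>2)" using e by (intro mult_left_mono power_mono) auto
 also have "\<dots> = \<epsilon> / 128" using E by simp
 finally have "ennreal (min (x0\<^sup>2 / 32) (1 / (128 * E\<^sup>2)) * \<epsilon> ^ 3) \<le> ennreal (\<epsilon> / 128)" by (rule ennreal_leI)
 also have "ennreal (\<epsilon> / 128) \<le> diff_mass \<epsilon> x"
 proof -
  have "ennreal (1/32) * ennreal (\<epsilon> / 2 - 0) = seg 0 (\<epsilon> / 2) (\<lambda>\<eta>. ennreal (1/32))"
   using e by (intro seg_const[symmetric]) simp
  also have "\<dots> \<le> seg 0 (\<epsilon> / 2) (\<lambda>\<eta>. f \<eta> + f (\<tau> + \<eta>))" by (intro seg_mono pt)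
  also have "\<dots> = seg 0 (\<epsilon> / 2) f + seg 0 (\<epsilon> / 2) (\<lambda>\<eta>. f (\<tau> + \<eta>))" by (rule seg_add) measurable
  also have "seg 0 (\<epsilon> / 2) (\<lambda>\<eta>. f (\<tau> + \<eta>)) = seg (\<tau> + 1 * 0) (\<tau> + 1 * (\<epsilon> / 2)) f"
   by (subst seg_affine) simp_all
  also have "seg 0 (\<epsilon> / 2) f + \<dots> \<le> seg 0 \<epsilon> f + seg 0 \<epsilon> f"
   using t e by (intro add_mono seg_subset) auto
  also have "\<dots> = 2 * diff_mass \<epsilon> x" by (simp add: diff_mass_def f_def[abs_def] mult_2)
  finally have le: "ennreal (\<epsilon> / 64) \<le> 2 * diff_mass \<epsilon> x" using e by (simp add: ennreal_mult[symmetric])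
  show ?thesis
  proof (cases "diff_mass \<epsilon> x")
   case (real r)
   then have "2 * diff_mass \<epsilon> x = ennreal (2 * r)" by (simp add: ennreal_mult)
   then have "\<epsilon> / 64 \<le> 2 * r" using le real e by (simp add: ennreal_le_iff)
   then show ?thesis using real by (simp add: ennreal_leI)
  qed simp
 qed
 finally show ?thesis .
qed

definition energy :: "real set \<Rightarrow> real \<Rightarrow> (real \<times> real \<Rightarrow> complex^'m) \<Rightarrow> ennreal" where
 "energy Om T w = (\<integral>\<^sup>+s. (\<integral>\<^sup>+x. nsq (w (s, x)) * indicator Om x) * indicator {0<..<T} s)"

text \<open>A superposition of waves that travel without change of shape; \<open>c l\<close> is the Fourier transform of the profile that
moves with speed \<open>l\<close>.\<close>

definition waves :: "real set \<Rightarrow> (real \<Rightarrow> real \<Rightarrow> complex^'m) \<Rightarrow> real \<Rightarrow> (real \<times> real \<Rightarrow> complex^'m) \<Rightarrow> bool" where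
 "waves S c T w \<longleftrightarrow> w \<in> borel_measurable borel \<and> (\<forall>l\<in>S. c l \<in> borel_measurable borel) \<and>
   (AE s in lborel. s \<in> {0<..<T} \<longrightarrow>
    is_fourier_L2 (\<lambda>x. w (s, x)) (\<lambda>\<xi>. \<Sum>l\<in>S. cis (- (s * \<xi> * l)) *s c l \<xi>))"

text \<open>Every point that travels with speed \<open>l\<close> spends at least the time \<open>\<rho>\<close> in \<open>Om\<close>.\<close>

definition sweeps :: "real set \<Rightarrow> real \<Rightarrow> real \<Rightarrow> real \<Rightarrow> bool" where
 "sweeps Om T l \<rho> \<longleftrightarrow> (\<forall>y. ennreal \<rho> \<le> (\<integral>\<^sup>+s. indicator Om (y + s * l) * indicator {0<..<T} s))"

lemma AE_lborel_nonempty: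
 assumes "AE s in lborel. s \<in> {a<..<b} \<longrightarrow> P s" and "a < (b::real)"
 obtains s where "a < s" "s < b" "P s"
proof -
 have "\<not> (AE s in lborel. s \<notin> {a<..<b})"
 proof
  assume "AE s in lborel. s \<notin> {a<..<b}"
  moreover have "{x. a < x \<and> x < b} = {a<..<b}" by auto
  ultimately have "emeasure lborel {a<..<b} = 0" using AE_iff_measurable[of "{a<..<b}" lborel "\<lambda>s. s \<notin> {a<..<b}"] by auto
  then show False using assms(2) by simp
 qed
 moreover have "AE s in lborel. s \<notin> {a<..<b}" if "\<And>s. a < s \<Longrightarrow> s < b \<Longrightarrow> \<not> P s"
  using assms(1) by eventually_elim (use that in auto)
 ultimately show thesis using that by blast
qed

text \<open>In coordinates moving with the wave, the energy is the integral of the squared profile against the time that its points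
spend in \<open>Om\<close>.\<close>

lemma single_wave_observability:
 assumes W: "waves {l} c T w" and Om[measurable]: "Om \<in> sets borel" and sw: "sweeps Om T l \<rho>"
 shows "ennreal \<rho> * (\<integral>\<^sup>+\<xi>. nsq (c l \<xi>)) \<le> ennreal (2 * pi) * energy Om T w"
proof (cases "T > 0")
 case False
 then have "{0<..<T} = {}" by simp
 then have "ennreal \<rho> = 0" using sw unfolding sweeps_def by simp
 then show ?thesis by simp
next
 case True
 have [measurable]: "w \<in> borel_measurable borel" "c l \<in> borel_measurable borel" using W by (auto simp: waves_def)
 have ft: "AE s in lborel. s \<in> {0<..<T} \<longrightarrow> is_fourier_L2 (\<lambda>x. w (s, x)) (\<lambda>\<xi>. cis (- (s * \<xi> * l)) *s c l \<xi>)"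
  using W by (simp add: waves_def)
 obtain s0 where "is_fourier_L2 (\<lambda>x. w (s0, x)) (\<lambda>\<xi>. cis (- (s0 * \<xi> * l)) *s c l \<xi>)"
  by (rule AE_lborel_nonempty[OF ft True])
 from FT_sqint(2)[OF this] have cs: "sqint (c l)"
  by (rule sqint_bound(1)[of _ _ 1]) (auto simp: norm_vec_scale)
 obtain W0 where W0: "is_fourier_L2 W0 (c l)" using FT_inverse_exists[OF cs] by blast
 have [measurable]: "W0 \<in> borel_measurable borel" using FT_sqint(1)[OF W0] by (simp add: sqint_def)
 have "ennreal \<rho> * (\<integral>\<^sup>+\<xi>. nsq (c l \<xi>)) = ennreal (2 * pi) * (\<integral>\<^sup>+y. nsq (W0 y) * ennreal \<rho>)"
 proof -
  have "(\<integral>\<^sup>+\<xi>. nsq (c l \<xi>)) = ennreal (2 * pi) * (\<integral>\<^sup>+y. nsq (W0 y))"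
   using FT_Plancherel[OF W0] by (simp only: L2_normsq_UNIV nsq_def)
  moreover have "(\<integral>\<^sup>+y. nsq (W0 y) * ennreal \<rho>) = (\<integral>\<^sup>+y. nsq (W0 y)) * ennreal \<rho>"
   by (rule nn_integral_multc) measurable
  ultimately show ?thesis by (simp only: mult_ac)
 qed
 also have "(\<integral>\<^sup>+y. nsq (W0 y) * ennreal \<rho>)
   \<le> (\<integral>\<^sup>+y. nsq (W0 y) * (\<integral>\<^sup>+s. indicator Om (y + s * l) * indicator {0<..<T} s))"
  using sw by (intro nn_integral_mono mult_left_mono) (auto simp: sweeps_def)
 also have "\<dots> = (\<integral>\<^sup>+y. \<integral>\<^sup>+s. nsq (W0 y) * (indicator Om (y + s * l) * indicator {0<..<T} s))"
  by (intro nn_integral_cong nn_integral_cmult[symmetric]) measurable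
 also have "\<dots> = (\<integral>\<^sup>+s. \<integral>\<^sup>+y. nsq (W0 y) * (indicator Om (y + s * l) * indicator {0<..<T} s))"
  by (rule lborel_pair.Fubini'[symmetric]) measurable
 also have "\<dots> = energy Om T w"
  unfolding energy_def
 proof (rule nn_integral_cong_AE, use ft in eventually_elim)
  fix s assume fs: "s \<in> {0<..<T} \<longrightarrow> is_fourier_L2 (\<lambda>x. w (s, x)) (\<lambda>\<xi>. cis (- (s * \<xi> * l)) *s c l \<xi>)"
  show "(\<integral>\<^sup>+y. nsq (W0 y) * (indicator Om (y + s * l) * indicator {0<..<T} s))
    = (\<integral>\<^sup>+x. nsq (w (s, x)) * indicator Om x) * indicator {0<..<T} s"
  proof (cases "s \<in> {0<..<T}")
   case True
   have "is_fourier_L2 (\<lambda>x. W0 (x + - (s * l))) (\<lambda>\<xi>. cis (- (s * l) * \<xi>) *s c l \<xi>)"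
    by (rule FT_translate[OF W0])
   moreover have "(\<lambda>\<xi>. cis (- (s * l) * \<xi>) *s c l \<xi>) = (\<lambda>\<xi>. cis (- (s * \<xi> * l)) *s c l \<xi>)"
    by (simp add: mult_ac)
   ultimately have ae: "AE x in lborel. w (s, x) = W0 (x + - (s * l))"
    using fs True FT_injective by metis
   have "(\<integral>\<^sup>+x. nsq (w (s, x)) * indicator Om x) = (\<integral>\<^sup>+x. nsq (W0 (x + - (s * l))) * indicator Om x)"
    by (rule nn_integral_cong_AE) (use ae in eventually_elim, simp)
   also have "\<dots> = (\<integral>\<^sup>+y. nsq (W0 y) * indicator Om (y + s * l))"
    by (subst nn_integral_real_affine[where c=1 and t="s * l"]) (auto simp: add.commute)
   finally show ?thesis using True by simp
  qed simp
 qed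
 finally show ?thesis by (simp add: mult_left_mono)
qed

text \<open>A shift by \<open>\<eta>\<close> in time and by \<open>\<eta> m\<close> in space leaves the wave of speed \<open>m\<close> unchanged.\<close>

lemma waves_difference:
 assumes W: "waves (insert m S) c T w" and m: "m \<notin> S" "finite S" and h: "0 \<le> \<eta>" "\<eta> \<le> \<epsilon>"
 shows "waves S (\<lambda>l \<xi>. (cis (- (\<eta> * (\<xi> * (l - m)))) - 1) *s c l \<xi>) (T - \<epsilon>) (\<lambda>z. w (fst z + \<eta>, snd z + \<eta> * m) - w z)"
 unfolding waves_def
proof (intro conjI ballI)
 have [measurable]: "w \<in> borel_measurable borel" using W by (simp add: waves_def)
 note [measurable] = borel_R2[OF this]
 show "(\<lambda>z. w (fst z + \<eta>, snd z + \<eta> * m) - w z) \<in> borel_measurable borel"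
  unfolding borel_prod[symmetric] by measurable
 show "(\<lambda>\<xi>. (cis (- (\<eta> * (\<xi> * (l - m)))) - 1) *s c l \<xi>) \<in> borel_measurable borel" if "l \<in> S" for l
 proof -
  have [measurable]: "c l \<in> borel_measurable borel" using W that by (auto simp: waves_def)
  show ?thesis by measurable
 qed
 have ft: "AE s in lborel. s \<in> {0<..<T} \<longrightarrow> is_fourier_L2 (\<lambda>x. w (s, x)) (\<lambda>\<xi>. \<Sum>l\<in>insert m S. cis (- (s * \<xi> * l)) *s c l \<xi>)"
  using W by (simp add: waves_def)
 have ft2: "AE s in lborel. \<eta> + 1 * s \<in> {0<..<T} \<longrightarrow> is_fourier_L2 (\<lambda>x. w (\<eta> + 1 * s, x)) (\<lambda>\<xi>. \<Sum>l\<in>insert m S. cis (- ((\<eta> + 1 * s) * \<xi> * l)) *s c l \<xi>)"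
  by (rule AE_lborel_affine[OF _ ft]) simp
 show "AE s in lborel. s \<in> {0<..<T - \<epsilon>} \<longrightarrow>
    is_fourier_L2 (\<lambda>x. w (fst (s, x) + \<eta>, snd (s, x) + \<eta> * m) - w (s, x))
     (\<lambda>\<xi>. \<Sum>l\<in>S. cis (- (s * \<xi> * l)) *s ((cis (- (\<eta> * (\<xi> * (l - m)))) - 1) *s c l \<xi>))"
  using ft ft2
 proof eventually_elim
  case (elim s)
  show ?case
  proof
   assume s: "s \<in> {0<..<T - \<epsilon>}"
   then have 1: "is_fourier_L2 (\<lambda>x. w (s, x)) (\<lambda>\<xi>. \<Sum>l\<in>insert m S. cis (- (s * \<xi> * l)) *s c l \<xi>)"
    and 2: "is_fourier_L2 (\<lambda>x. w (s + \<eta>, x)) (\<lambda>\<xi>. \<Sum>l\<in>insert m S. cis (- ((s + \<eta>) * \<xi> * l)) *s c l \<xi>)"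
    using elim h by (auto simp: add.commute)
   have "is_fourier_L2 (\<lambda>x. w (s + \<eta>, x + \<eta> * m) - w (s, x))
     (\<lambda>\<xi>. cis (\<eta> * m * \<xi>) *s (\<Sum>l\<in>insert m S. cis (- ((s + \<eta>) * \<xi> * l)) *s c l \<xi>) - (\<Sum>l\<in>insert m S. cis (- (s * \<xi> * l)) *s c l \<xi>))"
    by (rule FT_diff[OF FT_translate[OF 2] 1])
   moreover have "cis (\<eta> * m * \<xi>) *s (\<Sum>l\<in>insert m S. cis (- ((s + \<eta>) * \<xi> * l)) *s c l \<xi>) - (\<Sum>l\<in>insert m S. cis (- (s * \<xi> * l)) *s c l \<xi>)
    = (\<Sum>l\<in>S. cis (- (s * \<xi> * l)) *s ((cis (- (\<eta> * (\<xi> * (l - m)))) - 1) *s c l \<xi>))" for \<xi>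
   proof -
    have e: "cis (\<eta> * m * \<xi>) * cis (- ((s + \<eta>) * \<xi> * l)) = cis (- (s * \<xi> * l)) * cis (- (\<eta> * (\<xi> * (l - m))))" for l
     unfolding cis_mult by (simp add: algebra_simps)
    have "cis (\<eta> * m * \<xi>) *s (\<Sum>l\<in>insert m S. cis (- ((s + \<eta>) * \<xi> * l)) *s c l \<xi>) - (\<Sum>l\<in>insert m S. cis (- (s * \<xi> * l)) *s c l \<xi>)
     = (\<Sum>l\<in>insert m S. (cis (\<eta> * m * \<xi>) * cis (- ((s + \<eta>) * \<xi> * l)) - cis (- (s * \<xi> * l))) *s c l \<xi>)"
     by (simp add: vec_eq_iff sum_distrib_left sum_subtractf left_diff_distrib mult.assoc)
    also have "\<dots> = (\<Sum>l\<in>insert m S. cis (- (s * \<xi> * l)) *s ((cis (- (\<eta> * (\<xi> * (l - m)))) - 1) *s c l \<xi>))"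
     by (intro sum.cong refl) (simp add: e vector_smult_assoc right_diff_distrib)
    also have "\<dots> = (\<Sum>l\<in>S. cis (- (s * \<xi> * l)) *s ((cis (- (\<eta> * (\<xi> * (l - m)))) - 1) *s c l \<xi>))"
     using m by simp
    finally show ?thesis .
   qed
   ultimately show "is_fourier_L2 (\<lambda>x. w (fst (s, x) + \<eta>, snd (s, x) + \<eta> * m) - w (s, x))
     (\<lambda>\<xi>. \<Sum>l\<in>S. cis (- (s * \<xi> * l)) *s ((cis (- (\<eta> * (\<xi> * (l - m)))) - 1) *s c l \<xi>))" by simp
  qed
 qed
qed

lemma energy_difference:
 assumes [measurable]: "w \<in> borel_measurable borel" "Om \<in> sets borel" "Om' \<in> sets borel"
  and sub: "Om' \<subseteq> Om" "\<And>x. x \<in> Om' \<Longrightarrow> x + d \<in> Om" and h: "0 \<le> \<eta>" "\<eta> \<le> \<epsilon>"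
 shows "energy Om' (T - \<epsilon>) (\<lambda>z. w (fst z + \<eta>, snd z + d) - w z) \<le> 4 * energy Om T w"
proof -
 note [measurable] = borel_R2[OF assms(1)]
 define F where "F s = (\<integral>\<^sup>+x. nsq (w (s, x)) * indicator Om x)" for s
 have [measurable]: "F \<in> borel_measurable borel" unfolding F_def by measurable
 have E: "energy Om T w = (\<integral>\<^sup>+s. F s * indicator {0<..<T} s)" by (simp add: energy_def F_def)
 have "energy Om' (T - \<epsilon>) (\<lambda>z. w (fst z + \<eta>, snd z + d) - w z)
   \<le> (\<integral>\<^sup>+s. (2 * F (s + \<eta>) + 2 * F s) * indicator {0<..<T - \<epsilon>} s)"
  unfolding energy_def
 proof (intro nn_integral_mono mult_right_mono)
  fix s
  have "(\<integral>\<^sup>+x. nsq (w (fst (s, x) + \<eta>, snd (s, x) + d) - w (s, x)) * indicator Om' x)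
    \<le> (\<integral>\<^sup>+x. 2 * (nsq (w (s + \<eta>, x + d)) * indicator Om (x + d)) + 2 * (nsq (w (s, x)) * indicator Om x))"
  proof (rule nn_integral_mono)
   fix x
   show "nsq (w (fst (s, x) + \<eta>, snd (s, x) + d) - w (s, x)) * indicator Om' x
    \<le> 2 * (nsq (w (s + \<eta>, x + d)) * indicator Om (x + d)) + 2 * (nsq (w (s, x)) * indicator Om x)"
    using sub nsq_diff_le[of "w (s + \<eta>, x + d)" "w (s, x)"] by (cases "x \<in> Om'") auto
  qed
  also have "\<dots> = 2 * (\<integral>\<^sup>+x. nsq (w (s + \<eta>, x + d)) * indicator Om (x + d)) + 2 * F s"
   unfolding F_def by (subst nn_integral_add) (auto simp: nn_integral_cmult)
  also have "(\<integral>\<^sup>+x. nsq (w (s + \<eta>, x + d)) * indicator Om (x + d)) = F (s + \<eta>)"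
   unfolding F_def by (subst (2) nn_integral_real_affine[where c=1 and t=d]) (auto simp: add.commute)
  finally show "(\<integral>\<^sup>+x. nsq (w (fst (s, x) + \<eta>, snd (s, x) + d) - w (s, x)) * indicator Om' x) \<le> 2 * F (s + \<eta>) + 2 * F s" .
 qed simp
 also have "\<dots> \<le> (\<integral>\<^sup>+s. 2 * (F (s + \<eta>) * indicator {0<..<T} (s + \<eta>)) + 2 * (F s * indicator {0<..<T} s))"
  using h by (intro nn_integral_mono) (auto split: split_indicator simp: distrib_right)
 also have "\<dots> = 2 * (\<integral>\<^sup>+s. F (s + \<eta>) * indicator {0<..<T} (s + \<eta>)) + 2 * energy Om T w"
  unfolding E by (subst nn_integral_add) (auto simp: nn_integral_cmult)
 also have "(\<integral>\<^sup>+s. F (s + \<eta>) * indicator {0<..<T} (s + \<eta>)) = energy Om T w"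
  unfolding E by (subst (2) nn_integral_real_affine[where c=1 and t=\<eta>]) (auto simp: add.commute)
 also have "2 * energy Om T w + 2 * energy Om T w = 4 * energy Om T w"
  by (simp add: distrib_right[symmetric])
 finally show ?thesis .
qed

text \<open>Every step takes the difference along one of the waves in \<open>R\<close>. It shortens the time by \<open>\<epsilon>\<close> and passes to a smaller region,
whose shifts remain in the previous one. Integrating over the shift \<open>\<eta>\<close> replaces the factor on \<open>c l\<close> by its lower bound.\<close>

lemma wave_elimination:
 assumes "finite R" and "l \<notin> R" and e: "0 < \<epsilon>"
  and Om[measurable]: "\<And>j. Om j \<in> sets borel"
  and sub: "\<And>j. Om (Suc j) \<subseteq> Om j" "\<And>j x m \<eta>. x \<in> Om (Suc j) \<Longrightarrow> m \<in> R \<Longrightarrow> 0 \<le> \<eta> \<Longrightarrow> \<eta> \<le> \<epsilon> \<Longrightarrow> x + \<eta> * m \<in> Om j"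
  and W: "waves (insert l R) c T w" and sw: "sweeps (Om (j + card R)) (T - real (card R) * \<epsilon>) l \<rho>"
 shows "ennreal \<rho> * (\<integral>\<^sup>+\<xi>. (\<Prod>m\<in>R. diff_mass \<epsilon> (\<xi> * (l - m))) * nsq (c l \<xi>))
   \<le> (4 * ennreal \<epsilon>) ^ card R * (ennreal (2 * pi) * energy (Om j) T w)"
 using assms(1,2) sub(2) W sw
proof (induction R arbitrary: c T w j rule: finite_induct)
 case empty
 then show ?case using single_wave_observability[of l c T w "Om j" \<rho>] by simp
next
 case (insert m R)
 let ?g = "\<lambda>\<xi>. (\<Prod>m\<in>R. diff_mass \<epsilon> (\<xi> * (l - m)))"
 have cl[measurable]: "c l \<in> borel_measurable borel" and wm: "w \<in> borel_measurable borel"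
  using insert.prems(3) by (auto simp: waves_def)
 have [measurable]: "(\<lambda>\<xi>. diff_mass \<epsilon> (\<xi> * d)) \<in> borel_measurable borel" for d
  unfolding diff_mass_def seg_def by measurable
 have step: "ennreal \<rho> * (\<integral>\<^sup>+\<xi>. ?g \<xi> * nsq (c l \<xi>) * nsq (cis (- (\<eta> * (\<xi> * (l - m)))) - 1))
   \<le> (4 * ennreal \<epsilon>) ^ card R * (ennreal (2 * pi) * (4 * energy (Om j) T w))" if h: "0 \<le> \<eta>" "\<eta> \<le> \<epsilon>" for \<eta>
 proof -
  let ?c = "\<lambda>l \<xi>. (cis (- (\<eta> * (\<xi> * (l - m)))) - 1) *s c l \<xi>"
  let ?w = "\<lambda>z. w (fst z + \<eta>, snd z + \<eta> * m) - w z"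
  have "insert l (insert m R) = insert m (insert l R)" by auto
  then have "waves (insert l R) ?c (T - \<epsilon>) ?w"
   using insert.prems(1,3) insert.hyps by (intro waves_difference h) auto
  moreover have "sweeps (Om (Suc j + card R)) (T - \<epsilon> - real (card R) * \<epsilon>) l \<rho>"
   using insert.prems(4) insert.hyps by (simp add: algebra_simps)
  ultimately have "ennreal \<rho> * (\<integral>\<^sup>+\<xi>. ?g \<xi> * nsq (?c l \<xi>)) \<le> (4 * ennreal \<epsilon>) ^ card R * (ennreal (2 * pi) * energy (Om (Suc j)) (T - \<epsilon>) ?w)"
   using insert.prems(1,2) by (intro insert.IH) auto
  also have "\<dots> \<le> (4 * ennreal \<epsilon>) ^ card R * (ennreal (2 * pi) * (4 * energy (Om j) T w))"
  proof (intro mult_left_mono)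
   show "energy (Om (Suc j)) (T - \<epsilon>) ?w \<le> 4 * energy (Om j) T w"
    using insert.prems(2) h by (intro energy_difference wm Om sub(1)) auto
  qed auto
  also have "(\<integral>\<^sup>+\<xi>. ?g \<xi> * nsq (?c l \<xi>)) = (\<integral>\<^sup>+\<xi>. ?g \<xi> * nsq (c l \<xi>) * nsq (cis (- (\<eta> * (\<xi> * (l - m)))) - 1))"
  proof (rule nn_integral_cong)
   fix \<xi>
   show "?g \<xi> * nsq (?c l \<xi>) = ?g \<xi> * nsq (c l \<xi>) * nsq (cis (- (\<eta> * (\<xi> * (l - m)))) - 1)"
    unfolding nsq_scale nsq_def[of "cis (- (\<eta> * (\<xi> * (l - m)))) - 1"] by (simp only: mult_ac)
  qed
  finally show ?thesis .
 qed
 have "ennreal \<rho> * (\<integral>\<^sup>+\<xi>. (\<Prod>m\<in>insert m R. diff_mass \<epsilon> (\<xi> * (l - m))) * nsq (c l \<xi>))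
   = ennreal \<rho> * (\<integral>\<^sup>+\<xi>. ?g \<xi> * nsq (c l \<xi>) * diff_mass \<epsilon> (\<xi> * (l - m)))"
  using insert.hyps by (simp add: mult_ac)
 also have "\<dots> = ennreal \<rho> * (\<integral>\<^sup>+\<xi>. \<integral>\<^sup>+\<eta>. ?g \<xi> * nsq (c l \<xi>) * (nsq (cis (- (\<eta> * (\<xi> * (l - m)))) - 1) * indicator {0..\<epsilon>} \<eta>))"
  unfolding diff_mass_def[of _ "_ * (l - m)"] seg_def by (subst nn_integral_cmult) auto
 also have "\<dots> = ennreal \<rho> * (\<integral>\<^sup>+\<eta>. \<integral>\<^sup>+\<xi>. ?g \<xi> * nsq (c l \<xi>) * (nsq (cis (- (\<eta> * (\<xi> * (l - m)))) - 1) * indicator {0..\<epsilon>} \<eta>))"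
  by (subst lborel_pair.Fubini') measurable
 also have "\<dots> = seg 0 \<epsilon> (\<lambda>\<eta>. ennreal \<rho> * (\<integral>\<^sup>+\<xi>. ?g \<xi> * nsq (c l \<xi>) * nsq (cis (- (\<eta> * (\<xi> * (l - m)))) - 1)))"
  unfolding seg_def by (subst nn_integral_cmult[symmetric], measurable)
   (simp add: nn_integral_multc[symmetric] nn_integral_cmult[symmetric] mult_ac)
 also have "\<dots> \<le> seg 0 \<epsilon> (\<lambda>\<eta>. (4 * ennreal \<epsilon>) ^ card R * (ennreal (2 * pi) * (4 * energy (Om j) T w)))"
  by (intro seg_mono step)
 also have "\<dots> = (4 * ennreal \<epsilon>) ^ card R * (ennreal (2 * pi) * (4 * energy (Om j) T w)) * ennreal (\<epsilon> - 0)"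
  using e by (intro seg_const) simp
 also have "\<dots> = (4 * ennreal \<epsilon>) ^ card (insert m R) * (ennreal (2 * pi) * energy (Om j) T w)"
  using insert.hyps by (simp add: mult_ac)
 finally show ?case .
qed

subsection \<open>Low frequencies\<close>

definition thick :: "real set \<Rightarrow> real \<Rightarrow> real \<Rightarrow> bool" where
 "thick Om H r \<longleftrightarrow> (\<forall>x. ennreal r \<le> (\<integral>\<^sup>+h. indicator {0..H} h * indicator Om (x + h)))"

text \<open>Compare \<open>w(x)\<close> with \<open>w(x + h)\<close> and average over \<open>h\<close>: a share \<open>r\<close> of these translates lies in \<open>Om\<close>. The transform of the
difference is \<open>(exp (i h \<xi>) - 1) v(\<xi>)\<close>, where the factor is at most \<open>H L\<close> for \<open>\<bar>\<xi>\<bar> < L\<close>; the assumption on \<open>L\<close> lets the left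
side absorb this part.\<close>

lemma low_frequency_observability:
 assumes ft: "is_fourier_L2 w v" and th: "thick Om H r" and Om[measurable]: "Om \<in> sets borel"
  and pos: "0 < r" "0 < H" "0 < L" "4 * H ^ 3 * L\<^sup>2 \<le> r"
 shows "ennreal r * (\<integral>\<^sup>+\<xi>. nsq (v \<xi>))
   \<le> ennreal (8 * pi * H) * (\<integral>\<^sup>+x. nsq (w x) * indicator Om x)
    + ennreal (16 * H) * (\<integral>\<^sup>+\<xi>. nsq (v \<xi>) * indicator {\<xi>. L \<le> \<bar>\<xi>\<bar>} \<xi>)"
proof -
 have ws: "sqint w" and vs: "sqint v" using FT_sqint[OF ft] .
 note [measurable] = sqint_measurable[OF ws] sqint_measurable[OF vs]
 let ?Iv = "\<integral>\<^sup>+\<xi>. nsq (v \<xi>)" and ?Iw = "\<integral>\<^sup>+x. nsq (w x)"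
 let ?Ow = "\<integral>\<^sup>+x. nsq (w x) * indicator Om x"
 let ?hi = "\<integral>\<^sup>+\<xi>. nsq (v \<xi>) * indicator {\<xi>. L \<le> \<bar>\<xi>\<bar>} \<xi>"
 have vw: "?Iv = ennreal (2 * pi) * ?Iw" using FT_Plancherel[OF ft] by (simp only: L2_normsq_UNIV nsq_def)
 have diff: "ennreal (2 * pi) * (\<integral>\<^sup>+x. nsq (w (x + h) - w x)) \<le> ennreal ((H * L)\<^sup>2) * ?Iv + 4 * ?hi"
  if h: "0 \<le> h" "h \<le> H" for h
 proof -
  have "is_fourier_L2 (\<lambda>x. w (x + h) - w x) (\<lambda>\<xi>. cis (h * \<xi>) *s v \<xi> - v \<xi>)"
   by (intro FT_diff FT_translate ft)
  from FT_Plancherel[OF this]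
  have "ennreal (2 * pi) * (\<integral>\<^sup>+x. nsq (w (x + h) - w x)) = (\<integral>\<^sup>+\<xi>. nsq (cis (h * \<xi>) *s v \<xi> - v \<xi>))"
   by (simp only: L2_normsq_UNIV nsq_def)
  also have "\<dots> \<le> (\<integral>\<^sup>+\<xi>. ennreal ((H * L)\<^sup>2) * nsq (v \<xi>) + 4 * (nsq (v \<xi>) * indicator {\<xi>. L \<le> \<bar>\<xi>\<bar>} \<xi>))"
  proof (rule nn_integral_mono)
   fix \<xi>
   have "cis (h * \<xi>) *s v \<xi> - v \<xi> = (cis (h * \<xi>) - 1) *s v \<xi>" by (simp add: vec_eq_iff left_diff_distrib)
   then have eq: "nsq (cis (h * \<xi>) *s v \<xi> - v \<xi>) = ennreal ((norm (cis (h * \<xi>) - 1))\<^sup>2) * nsq (v \<xi>)"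
    by (simp only: nsq_scale)
   show "nsq (cis (h * \<xi>) *s v \<xi> - v \<xi>) \<le> ennreal ((H * L)\<^sup>2) * nsq (v \<xi>) + 4 * (nsq (v \<xi>) * indicator {\<xi>. L \<le> \<bar>\<xi>\<bar>} \<xi>)"
   proof (cases "L \<le> \<bar>\<xi>\<bar>")
    case True
    have "(norm (cis (h * \<xi>) - 1))\<^sup>2 \<le> 2\<^sup>2" by (intro power_mono cis_minus_one_upper) auto
    then have "ennreal ((norm (cis (h * \<xi>) - 1))\<^sup>2) * nsq (v \<xi>) \<le> 4 * nsq (v \<xi>)"
     by (intro mult_right_mono) (auto dest: ennreal_leI)
    then show ?thesis unfolding eq using True by (simp add: add_increasing)
   next
    case False
    have "norm (cis (h * \<xi>) - 1) \<le> \<bar>h * \<xi>\<bar>" by (rule cis_minus_one_upper)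
    also have "\<dots> \<le> H * L" using h False by (auto simp: abs_mult intro!: mult_mono)
    finally have "(norm (cis (h * \<xi>) - 1))\<^sup>2 \<le> (H * L)\<^sup>2" by (intro power_mono) auto
    then have "ennreal ((norm (cis (h * \<xi>) - 1))\<^sup>2) * nsq (v \<xi>) \<le> ennreal ((H * L)\<^sup>2) * nsq (v \<xi>)"
     by (intro mult_right_mono ennreal_leI) auto
    then show ?thesis unfolding eq using False by simp
   qed
  qed
  also have "\<dots> = ennreal ((H * L)\<^sup>2) * ?Iv + 4 * ?hi"
   by (subst nn_integral_add) (auto simp: nn_integral_cmult)
  finally show ?thesis .
 qed
 have avg: "ennreal r * ?Iw \<le> seg 0 H (\<lambda>h. 2 * ?Ow + 2 * (\<integral>\<^sup>+x. nsq (w (x + h) - w x)))"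
 proof -
  have "ennreal r * ?Iw = (\<integral>\<^sup>+x. nsq (w x) * ennreal r)" by (subst nn_integral_multc) (auto simp: mult.commute)
  also have "\<dots> \<le> (\<integral>\<^sup>+x. nsq (w x) * (\<integral>\<^sup>+h. indicator {0..H} h * indicator Om (x + h)))"
   using th by (intro nn_integral_mono mult_left_mono) (auto simp: thick_def)
  also have "\<dots> = (\<integral>\<^sup>+x. \<integral>\<^sup>+h. nsq (w x) * (indicator {0..H} h * indicator Om (x + h)))"
   by (intro nn_integral_cong nn_integral_cmult[symmetric]) measurable
  also have "\<dots> = (\<integral>\<^sup>+h. \<integral>\<^sup>+x. nsq (w x) * (indicator {0..H} h * indicator Om (x + h)))"
   by (rule lborel_pair.Fubini'[symmetric]) measurable
  also have "\<dots> \<le> seg 0 H (\<lambda>h. 2 * ?Ow + 2 * (\<integral>\<^sup>+x. nsq (w (x + h) - w x)))"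
   unfolding seg_def
  proof (rule nn_integral_mono)
   fix h
   have "(\<integral>\<^sup>+x. nsq (w x) * (indicator {0..H} h * indicator Om (x + h)))
    = (\<integral>\<^sup>+x. nsq (w x) * indicator Om (x + h)) * indicator {0..H} h"
    by (subst nn_integral_multc[symmetric]) (auto simp: mult_ac)
   also have "\<dots> \<le> (\<integral>\<^sup>+x. 2 * (nsq (w (x + h)) * indicator Om (x + h)) + 2 * nsq (w (x + h) - w x)) * indicator {0..H} h"
   proof (intro mult_right_mono nn_integral_mono)
    fix x
    show "nsq (w x) * indicator Om (x + h) \<le> 2 * (nsq (w (x + h)) * indicator Om (x + h)) + 2 * nsq (w (x + h) - w x)"
     using nsq_diff_le[of "w (x + h)" "w (x + h) - w x"] by (cases "x + h \<in> Om") auto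
   qed simp
   also have "(\<integral>\<^sup>+x. 2 * (nsq (w (x + h)) * indicator Om (x + h)) + 2 * nsq (w (x + h) - w x))
     = 2 * (\<integral>\<^sup>+x. nsq (w (x + h)) * indicator Om (x + h)) + 2 * (\<integral>\<^sup>+x. nsq (w (x + h) - w x))"
    by (subst nn_integral_add) (auto simp: nn_integral_cmult)
   also have "(\<integral>\<^sup>+x. nsq (w (x + h)) * indicator Om (x + h)) = ?Ow"
    by (subst (2) nn_integral_real_affine[where c=1 and t=h]) (auto simp: add.commute)
   finally show "(\<integral>\<^sup>+x. nsq (w x) * (indicator {0..H} h * indicator Om (x + h)))
    \<le> (2 * ?Ow + 2 * (\<integral>\<^sup>+x. nsq (w (x + h) - w x))) * indicator {0..H} h" .
  qed
  finally show ?thesis .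
 qed
 have "ennreal r * ?Iv = ennreal (2 * pi) * (ennreal r * ?Iw)" unfolding vw by (simp only: mult_ac)
 also have "\<dots> \<le> ennreal (2 * pi) * seg 0 H (\<lambda>h. 2 * ?Ow + 2 * (\<integral>\<^sup>+x. nsq (w (x + h) - w x)))"
  by (intro mult_left_mono avg) auto
 also have "\<dots> = seg 0 H (\<lambda>h. ennreal (2 * pi) * (2 * ?Ow + 2 * (\<integral>\<^sup>+x. nsq (w (x + h) - w x))))"
  by (rule seg_cmult[symmetric]) measurable
 also have "\<dots> \<le> seg 0 H (\<lambda>h. ennreal (4 * pi) * ?Ow + 2 * (ennreal ((H * L)\<^sup>2) * ?Iv + 4 * ?hi))"
 proof (rule seg_mono)
  fix h assume h: "0 \<le> h" "h \<le> H"
  have "ennreal (2 * pi) * (2 * ?Ow + 2 * (\<integral>\<^sup>+x. nsq (w (x + h) - w x)))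
   = (ennreal (2 * pi) * 2) * ?Ow + 2 * (ennreal (2 * pi) * (\<integral>\<^sup>+x. nsq (w (x + h) - w x)))"
   by (simp only: distrib_left mult_ac)
  also have "ennreal (2 * pi) * 2 = ennreal (4 * pi)"
   using ennreal_mult[of "2 * pi" 2] by simp
  also have "ennreal (4 * pi) * ?Ow + 2 * (ennreal (2 * pi) * (\<integral>\<^sup>+x. nsq (w (x + h) - w x)))
   \<le> ennreal (4 * pi) * ?Ow + 2 * (ennreal ((H * L)\<^sup>2) * ?Iv + 4 * ?hi)"
   by (intro add_mono mult_left_mono diff h) auto
  finally show "ennreal (2 * pi) * (2 * ?Ow + 2 * (\<integral>\<^sup>+x. nsq (w (x + h) - w x)))
   \<le> ennreal (4 * pi) * ?Ow + 2 * (ennreal ((H * L)\<^sup>2) * ?Iv + 4 * ?hi)" .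
 qed
 also have "\<dots> = (ennreal (4 * pi) * ?Ow + 2 * (ennreal ((H * L)\<^sup>2) * ?Iv + 4 * ?hi)) * ennreal (H - 0)"
  using pos by (intro seg_const) simp
 finally have main: "ennreal r * ?Iv \<le> (ennreal (4 * pi) * ?Ow + 2 * (ennreal ((H * L)\<^sup>2) * ?Iv + 4 * ?hi)) * ennreal (H - 0)" .
 have hle: "?hi \<le> ?Iv" by (intro nn_integral_mono) (auto split: split_indicator)
 have ole: "?Ow \<le> ?Iw" by (intro nn_integral_mono) (auto split: split_indicator)
 have vfin: "?Iv < \<infinity>" using vs by (simp add: sqint_iff_nn nsq_def)
 have wfin: "?Iw < \<infinity>" using ws by (simp add: sqint_iff_nn nsq_def)
 obtain iv where iv: "?Iv = ennreal iv" "iv \<ge> 0" using vfin by (cases ?Iv) auto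
 obtain hi where hi: "?hi = ennreal hi" "hi \<ge> 0" using vfin hle by (cases ?hi) (auto simp: top_unique)
 obtain ow where ow: "?Ow = ennreal ow" "ow \<ge> 0" using wfin ole by (cases ?Ow) (auto simp: top_unique)
 have "(ennreal (4 * pi) * ?Ow + 2 * (ennreal ((H * L)\<^sup>2) * ?Iv + 4 * ?hi)) * ennreal (H - 0)
   = ennreal ((4 * pi * ow + 2 * ((H * L)\<^sup>2 * iv + 4 * hi)) * H)"
  unfolding iv hi ow using iv(2) hi(2) ow(2) pos by (simp add: ennreal_mult ennreal_plus)
 moreover have "ennreal r * ?Iv = ennreal (r * iv)"
  unfolding iv(1) using pos(1) iv(2) by (intro ennreal_mult[symmetric]) auto
 ultimately have "ennreal (r * iv) \<le> ennreal ((4 * pi * ow + 2 * ((H * L)\<^sup>2 * iv + 4 * hi)) * H)"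
  using main by (simp only:)
 then have "r * iv \<le> (4 * pi * ow + 2 * ((H * L)\<^sup>2 * iv + 4 * hi)) * H"
  by (rule ennreal_le_iff[THEN iffD1, rotated]) (use iv(2) hi(2) ow(2) pos in auto)
 also have "\<dots> = 4 * pi * H * ow + (4 * H ^ 3 * L\<^sup>2) * iv / 2 + 8 * H * hi"
  by (simp add: power2_eq_square power3_eq_cube algebra_simps)
 also have "\<dots> \<le> 4 * pi * H * ow + r * iv / 2 + 8 * H * hi"
  using pos iv hi ow by (intro add_mono divide_right_mono mult_right_mono) auto
 finally have "r * iv \<le> 8 * pi * H * ow + 16 * H * hi" by simp
 then have "ennreal (r * iv) \<le> ennreal (8 * pi * H * ow + 16 * H * hi)" by (rule ennreal_leI)
 then show ?thesis
  unfolding iv hi ow using iv(2) hi(2) ow(2) pos by (simp add: ennreal_mult ennreal_plus)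
qed

subsection \<open>Geometry of the control region\<close>

text \<open>A decreasing family of regions: differences of waves in the smaller regions only involve points of the larger ones.\<close>

definition shrunk :: "(int \<Rightarrow> real) \<Rightarrow> (int \<Rightarrow> real) \<Rightarrow> real \<Rightarrow> real set" where
 "shrunk a b \<delta> = (\<Union>n. {a n + \<delta><..<b n - \<delta>})"

lemma shrunk_borel [measurable]: "shrunk a b \<delta> \<in> sets borel"
 unfolding shrunk_def by auto

lemma prod_mono_ennreal: "(\<And>i. i \<in> I \<Longrightarrow> f i \<le> g i) \<Longrightarrow> (\<Prod>i\<in>I. f i) \<le> (\<Prod>i\<in>I. g i :: ennreal)"
 by (induction I rule: infinite_finite_induct) (auto intro!: mult_mono)

lemma shrunk_shift: "x \<in> shrunk a b (\<delta> + \<sigma>) \<Longrightarrow> \<bar>d\<bar> \<le> \<sigma> \<Longrightarrow> x + d \<in> shrunk a b \<delta>"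
proof -
 assume "x \<in> shrunk a b (\<delta> + \<sigma>)" and d: "\<bar>d\<bar> \<le> \<sigma>"
 then obtain n where "a n + (\<delta> + \<sigma>) < x" "x < b n - (\<delta> + \<sigma>)" by (auto simp: shrunk_def)
 then have "x + d \<in> {a n + \<delta><..<b n - \<delta>}" using d by auto
 then show ?thesis by (auto simp: shrunk_def)
qed

locale gaps =
 fixes a b :: "int \<Rightarrow> real" and \<omega> :: "real set"
 assumes bg: "bounded_gap a b \<omega>"
begin

definition len :: real where "len = (INF n. b n - a n)"

lemma ab: "a n < b n" "b n < a (n + 1)" using bg by (auto simp: bounded_gap_def)

lemma len_pos: "len > 0" using bg by (simp add: bounded_gap_def len_def)

lemma len_le: "len \<le> b n - a n"
proof -
 have "bdd_below (range (\<lambda>n. b n - a n))"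
  by (rule bdd_belowI[of _ 0]) (auto intro: less_imp_le[OF ab(1)])
 then show ?thesis unfolding len_def by (rule cINF_lower) simp
qed

lemma gap_ge: "a (n + 1) - b n \<le> gap a b"
 unfolding gap_def by (rule cSUP_upper) (use bg in \<open>auto simp: bounded_gap_def\<close>)

lemma gap_pos: "gap a b > 0" using gap_ge[of 0] ab(2)[of 0] by linarith

lemma omega_shrunk: "\<omega> = shrunk a b 0" using bg by (simp add: bounded_gap_def shrunk_def)

lemma a_step: "a n + len \<le> a (n + 1)" using len_le[of n] ab(2)[of n] by linarith

lemma a_growth: "a m + real k * len \<le> a (m + int k)"
proof (induction k)
 case (Suc k)
 then show ?case using a_step[of "m + int k"] by (simp add: algebra_simps)
qed simp

lemma locate: "\<exists>n. a n \<le> x \<and> x < a (n + 1)"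
proof -
 obtain k :: nat where k: "\<bar>x - a 0\<bar> < real k * len" using ex_less_of_nat_mult[OF len_pos] by blast
 have lo: "a (- int k) \<le> x" using a_growth[of "- int k" k] k by simp
 have hi: "x < a (int k)" using a_growth[of 0 k] k by simp
 define S where "S = {n \<in> {- int k..int k}. a n \<le> x}"
 have S: "finite S" by (rule finite_subset[of _ "{- int k..int k}"]) (auto simp: S_def)
 have kS: "- int k \<in> S" using lo by (auto simp: S_def)
 define n where "n = Max S"
 have "n \<in> S" unfolding n_def using S kS by (intro Max_in) auto
 then have n: "a n \<le> x" "n \<le> int k" "- int k \<le> n" by (auto simp: S_def)
 have "n \<noteq> int k" using n hi by auto
 have "\<not> a (n + 1) \<le> x"
 proof
  assume "a (n + 1) \<le> x"
  then have "n + 1 \<in> S" using n \<open>n \<noteq> int k\<close> by (auto simp: S_def)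
  then have "n + 1 \<le> n" unfolding n_def using S by (intro Max_ge) auto
  then show False by simp
 qed
 then show ?thesis using n by auto
qed

text \<open>If the interval at the start of the window does not offer the length \<open>r\<close> any more, the window still reaches that far into
the next interval.\<close>

lemma coverage:
 assumes r: "0 < r" "r \<le> len - 2 * \<delta>" and d: "0 \<le> \<delta>" and L: "gap a b + 2 * \<delta> + r \<le> L"
 shows "ennreal r \<le> (\<integral>\<^sup>+u. indicator {0<..<L} u * indicator (shrunk a b \<delta>) (y + u))"
proof -
 obtain n where n: "a n \<le> y - \<delta>" "y - \<delta> < a (n + 1)" using locate by blast
 have Lr: "r \<le> L" using L d gap_pos by linarith
 have g: "a (n + 1) - b n \<le> gap a b" by (rule gap_ge)
 have mem: "y + u \<in> shrunk a b \<delta>" if "a j + \<delta> < y + u" "y + u < b j - \<delta>" for u j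
  using that by (auto simp: shrunk_def)
 show ?thesis
 proof (cases "y \<le> b n - \<delta> - r")
  case True
  have "ennreal r = (\<integral>\<^sup>+u. indicator {0<..<r} u)" using r by simp
  also have "\<dots> \<le> (\<integral>\<^sup>+u. indicator {0<..<L} u * indicator (shrunk a b \<delta>) (y + u))"
  proof (rule nn_integral_mono)
   fix u
   show "indicator {0<..<r} u \<le> (indicator {0<..<L} u * indicator (shrunk a b \<delta>) (y + u) :: ennreal)"
    using True n Lr mem[of n u] by (auto split: split_indicator)
  qed
  finally show ?thesis .
 next
  case False
  define q where "q = max 0 (b n - \<delta> - y)"
  define p where "p = a (n + 1) + \<delta> - y"
  have q: "0 \<le> q" "q < r" using False r by (auto simp: q_def)
  have p: "0 < p" using n by (simp add: p_def)
  have qp: "q \<le> p" using ab(2)[of n] d p by (auto simp: q_def p_def)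
  have pL: "p + (r - q) \<le> L" using g L by (auto simp: q_def p_def)
  have "ennreal r = ennreal q + ennreal (r - q)" using q by (simp add: ennreal_plus[symmetric] del: ennreal_plus)
  also have "\<dots> = (\<integral>\<^sup>+u. indicator {0<..<q} u) + (\<integral>\<^sup>+u. indicator {p<..<p + (r - q)} u)"
   using q by simp
  also have "\<dots> = (\<integral>\<^sup>+u. indicator {0<..<q} u + indicator {p<..<p + (r - q)} u)"
   by (rule nn_integral_add[symmetric]) auto
  also have "\<dots> \<le> (\<integral>\<^sup>+u. indicator {0<..<L} u * indicator (shrunk a b \<delta>) (y + u))"
  proof (rule nn_integral_mono)
   fix u
   have 1: "u < L \<and> y + u \<in> shrunk a b \<delta>" if u: "0 < u" "u < q"
   proof
    show "u < L" using u qp pL q by linarith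
    show "y + u \<in> shrunk a b \<delta>" using u n by (intro mem[of n]) (auto simp: q_def)
   qed
   have 2: "0 < u \<and> u < L \<and> y + u \<in> shrunk a b \<delta>" if u: "p < u" "u < p + (r - q)"
   proof (intro conjI)
    show "0 < u" "u < L" using u p pL by auto
    have "y + u < a (n + 1) + \<delta> + r" using u q by (simp add: p_def)
    also have "\<dots> \<le> b (n + 1) - \<delta>" using len_le[of "n + 1"] r by linarith
    finally show "y + u \<in> shrunk a b \<delta>" using u by (intro mem[of "n + 1"]) (auto simp: p_def)
   qed
   have dis: "\<not> (u < q \<and> p < u)" using qp by auto
   show "indicator {0<..<q} u + indicator {p<..<p + (r - q)} u \<le> (indicator {0<..<L} u * indicator (shrunk a b \<delta>) (y + u) :: ennreal)"
    using 1 2 dis by (auto split: split_indicator)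
  qed
  finally show ?thesis .
 qed
qed

lemma thick_omega: "thick \<omega> (gap a b + len) len"
 unfolding thick_def
proof
 fix x
 have "ennreal len \<le> (\<integral>\<^sup>+u. indicator {0<..<gap a b + len} u * indicator (shrunk a b 0) (x + u))"
  by (rule coverage) (use len_pos in auto)
 also have "\<dots> \<le> (\<integral>\<^sup>+h. indicator {0..gap a b + len} h * indicator \<omega> (x + h))"
  unfolding omega_shrunk by (intro nn_integral_mono) (auto split: split_indicator)
 finally show "ennreal len \<le> (\<integral>\<^sup>+h. indicator {0..gap a b + len} h * indicator \<omega> (x + h))" .
qed

lemma sweeps_shrunk:
 assumes r: "0 < r" "r \<le> len - 2 * \<delta>" and d: "0 \<le> \<delta>" and L: "gap a b + 2 * \<delta> + r \<le> \<bar>l\<bar> * T" and l: "l \<noteq> 0"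
 shows "sweeps (shrunk a b \<delta>) T l (r / \<bar>l\<bar>)"
 unfolding sweeps_def
proof
 fix y
 define X where "X = (\<integral>\<^sup>+s. indicator (shrunk a b \<delta>) (y + s * l) * indicator {0<..<T} s :: ennreal)"
 have "ennreal r \<le> ennreal \<bar>l\<bar> * X"
 proof (cases "l > 0")
  case True
  have "ennreal r \<le> (\<integral>\<^sup>+u. indicator {0<..<\<bar>l\<bar> * T} u * indicator (shrunk a b \<delta>) (y + u))"
   by (rule coverage[OF r d L])
  also have "\<dots> = ennreal \<bar>l\<bar> * (\<integral>\<^sup>+s. indicator {0<..<\<bar>l\<bar> * T} (0 + l * s) * indicator (shrunk a b \<delta>) (y + (0 + l * s)))"
   by (rule nn_integral_real_affine) (use l in auto)
  also have "(\<integral>\<^sup>+s. indicator {0<..<\<bar>l\<bar> * T} (0 + l * s) * indicator (shrunk a b \<delta>) (y + (0 + l * s))) = X"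
   unfolding X_def using True
   by (intro nn_integral_cong) (auto simp: mult.commute zero_less_mult_iff split: split_indicator)
  finally show ?thesis .
 next
  case False
  have "ennreal r \<le> (\<integral>\<^sup>+u. indicator {0<..<\<bar>l\<bar> * T} u * indicator (shrunk a b \<delta>) (y + l * T + u))"
   by (rule coverage[OF r d L])
  also have "\<dots> = ennreal \<bar>l\<bar> * (\<integral>\<^sup>+s. indicator {0<..<\<bar>l\<bar> * T} (- l * T + l * s) * indicator (shrunk a b \<delta>) (y + l * T + (- l * T + l * s)))"
   by (rule nn_integral_real_affine) (use l in auto)
  also have "(\<integral>\<^sup>+s. indicator {0<..<\<bar>l\<bar> * T} (- l * T + l * s) * indicator (shrunk a b \<delta>) (y + l * T + (- l * T + l * s))) = X"
   unfolding X_def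
  proof (rule nn_integral_cong)
   fix s
   have "- l * T + l * s = \<bar>l\<bar> * (T - s)" using False by (simp add: algebra_simps)
   then have "- l * T + l * s \<in> {0<..<\<bar>l\<bar> * T} \<longleftrightarrow> s \<in> {0<..<T}"
    using l by (auto simp: zero_less_mult_iff)
   then show "indicator {0<..<\<bar>l\<bar> * T} (- l * T + l * s) * indicator (shrunk a b \<delta>) (y + l * T + (- l * T + l * s))
    = (indicator (shrunk a b \<delta>) (y + s * l) * indicator {0<..<T} s :: ennreal)"
    by (auto simp: mult.commute split: split_indicator)
  qed
  finally show ?thesis .
 qed
 then have "ennreal (1 / \<bar>l\<bar>) * ennreal r \<le> ennreal (1 / \<bar>l\<bar>) * (ennreal \<bar>l\<bar> * X)" by (intro mult_left_mono) auto
 also have "\<dots> = (ennreal (1 / \<bar>l\<bar>) * ennreal \<bar>l\<bar>) * X" by (simp only: mult.assoc)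
 also have "ennreal (1 / \<bar>l\<bar>) * ennreal \<bar>l\<bar> = 1" using l by (simp add: ennreal_mult[symmetric])
 finally show "ennreal (r / \<bar>l\<bar>) \<le> (\<integral>\<^sup>+s. indicator (shrunk a b \<delta>) (y + s * l) * indicator {0<..<T} s)"
  unfolding X_def using r by (simp add: ennreal_mult[symmetric])
qed

text \<open>Frequencies above a fixed level \<open>L\<close> are observed by eliminating all waves but one, those below \<open>L\<close> at every single
time. The shifts \<open>\<epsilon>\<close> are a small multiple of \<open>t = T - gap a b / lam\<close>: after all eliminations even the slowest wave still has
time to cross the enlarged gaps of the shrunk region.\<close>

lemma localized_observability:
 fixes S :: "real set"
 assumes S: "finite S" "S \<noteq> {}" "0 \<notin> S" and lam: "lam = Min (abs ` S)" and T1: "T1 > gap a b / lam"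
 shows "\<exists>C>0. \<forall>T. gap a b / lam < T \<longrightarrow> T \<le> T1 \<longrightarrow> (\<forall>c (w :: real \<times> real \<Rightarrow> complex^'m). waves S c T w \<longrightarrow>
   (\<integral>\<^sup>+s. (\<integral>\<^sup>+\<xi>. nsq (\<Sum>l\<in>S. cis (- (s * \<xi> * l)) *s c l \<xi>)) * indicator {0<..<T} s)
    \<le> ennreal (C / (T - gap a b / lam) ^ (2 * card S - 1)) * energy \<omega> T w)"
proof -
 define Tg where "Tg = gap a b / lam"
 define t1 where "t1 = T1 - Tg"
 define k where "k = card S - 1"
 define M where "M = Max (abs ` S)"
 have lam_le: "lam \<le> \<bar>l\<bar>" if "l \<in> S" for l unfolding lam using S that by (intro Min_le) auto
 have M_ge: "\<bar>l\<bar> \<le> M" if "l \<in> S" for l unfolding M_def using S that by (intro Max_ge) auto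
 have lam_pos: "lam > 0"
 proof -
  have "lam \<in> abs ` S" unfolding lam using S by (intro Min_in) auto
  then show ?thesis using S(3) by auto
 qed
 obtain l0 where l0: "l0 \<in> S" using S by blast
 have M_pos: "M > 0" using lam_pos lam_le[OF l0] M_ge[OF l0] by linarith
 have Tg0: "Tg > 0" unfolding Tg_def using lam_pos gap_pos by simp
 have t1: "t1 > 0" using T1 by (simp add: t1_def Tg_def)
 have cardS: "card S = Suc k" using S by (simp add: k_def card_gt_0_iff)
 define H where "H = gap a b + len"
 have H: "H > 0" using gap_pos len_pos by (simp add: H_def)
 \<comment> \<open>the frequency below which the shift argument applies\<close>
 define L where "L = sqrt (len / (4 * H ^ 3))"
 have L: "L > 0" "4 * H ^ 3 * L\<^sup>2 \<le> len" using H len_pos by (auto simp: L_def)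
 \<comment> \<open>the smallest difference of speeds; the \<open>1\<close> covers the case of a single speed\<close>
 define d0 where "d0 = Min (insert 1 ((\<lambda>(l, m). \<bar>l - m\<bar>) ` {(l, m) \<in> S \<times> S. l \<noteq> m}))"
 have fS: "finite ((\<lambda>(l, m). \<bar>l - m\<bar>) ` {(l, m) \<in> S \<times> S. l \<noteq> m})"
  by (rule finite_imageI, rule finite_subset[of _ "S \<times> S"]) (use S in auto)
 have d0: "d0 > 0" unfolding d0_def using fS by (subst Min_gr_iff) auto
 have d0_le: "d0 \<le> \<bar>l - m\<bar>" if "l \<in> S" "m \<in> S" "l \<noteq> m" for l m
  unfolding d0_def using fS that by (intro Min_le) auto
 \<comment> \<open>the ratio of \<open>\<epsilon>\<close> to \<open>t\<close>: first bound for the time that is left, second one for the shrinking of the intervals\<close>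
 define \<kappa> where "\<kappa> = min (lam / (2 * (real k + 1) * (lam + 2 * M))) (len / (4 * (real k + 1) * M * t1))"
 have kap: "\<kappa> > 0" using lam_pos M_pos len_pos t1 by (simp add: \<kappa>_def)
 have kap1: "\<kappa> * real k * (lam + 2 * M) \<le> lam / 2"
 proof -
  have "\<kappa> * real k * (lam + 2 * M) \<le> \<kappa> * (real k + 1) * (lam + 2 * M)"
   using kap lam_pos M_pos by (intro mult_right_mono mult_left_mono) auto
  also have "\<dots> \<le> lam / (2 * (real k + 1) * (lam + 2 * M)) * (real k + 1) * (lam + 2 * M)"
   using lam_pos M_pos by (intro mult_right_mono) (auto simp: \<kappa>_def)
  also have "\<dots> = lam / 2"
  proof -
   have "lam / (2 * p * q) * p * q = lam / 2" if "p \<noteq> 0" "q \<noteq> 0" for p q :: real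
    using that by simp
   moreover have "real k + 1 \<noteq> 0" "lam + 2 * M \<noteq> 0" using lam_pos M_pos by linarith+
   ultimately show ?thesis by blast
  qed
  finally show ?thesis .
 qed
 have kap2: "2 * real k * M * \<kappa> * t1 \<le> len / 2"
 proof -
  have "2 * real k * M * \<kappa> * t1 \<le> 2 * (real k + 1) * M * \<kappa> * t1"
   using kap M_pos t1 by (intro mult_right_mono) auto
  also have "\<dots> \<le> 2 * (real k + 1) * M * (len / (4 * (real k + 1) * M * t1)) * t1"
   using M_pos t1 by (intro mult_right_mono mult_left_mono) (auto simp: \<kappa>_def)
  also have "\<dots> = len / 2"
  proof -
   have "real k + 1 \<noteq> 0" by linarith
   then show ?thesis using M_pos t1 by (simp add: divide_simps)
  qed
  finally show ?thesis .
 qed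
 \<comment> \<open>the length that the remaining wave covers inside the region is \<open>\<kappa>2 * t\<close>\<close>
 define \<kappa>2 where "\<kappa>2 = min (lam / 2) (len / (2 * t1))"
 have kap22: "\<kappa>2 > 0" using lam_pos len_pos t1 by (simp add: \<kappa>2_def)
 \<comment> \<open>the constant of \<open>diff_mass_lower\<close> at frequencies above \<open>L\<close>\<close>
 define \<kappa>3 where "\<kappa>3 = min ((L * d0)\<^sup>2 / 32) (1 / (128 * (\<kappa> * t1)\<^sup>2))"
 have kap3: "\<kappa>3 > 0" using L d0 kap t1 by (simp add: \<kappa>3_def)
 define D where "D = 4 ^ k * (2 * pi) * M / (\<kappa>2 * \<kappa>3 ^ k * \<kappa> ^ (2 * k))"
 have D: "D > 0" using M_pos kap kap22 kap3 by (simp add: D_def)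
 define C where "C = (8 * pi * H * t1 ^ (2 * k + 1) + 16 * H * T1 * (real (card S))\<^sup>2 * D) / len"
 have T10: "T1 > 0" using T1 Tg0 by (simp add: Tg_def)
 have C: "C > 0" unfolding C_def using H t1 D len_pos T10 by (intro divide_pos_pos add_pos_nonneg) auto
 show ?thesis
 proof (intro exI[of _ C] conjI C allI impI)
  fix T and c :: "real \<Rightarrow> real \<Rightarrow> complex^'m" and w
  assume T: "gap a b / lam < T" "T \<le> T1" and W: "waves S c T w"
  define t where "t = T - Tg"
  have t: "0 < t" "t \<le> t1" using T by (auto simp: t_def t1_def Tg_def)
  have lamT: "lam * T = gap a b + lam * t" using lam_pos by (simp add: t_def Tg_def field_simps)
  have [measurable]: "w \<in> borel_measurable borel" using W by (simp add: waves_def)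
  note [measurable] = borel_R2[OF this]
  have cm: "c l \<in> borel_measurable borel" if "l \<in> S" for l using W that by (simp add: waves_def)
  define v where "v s \<xi> = (\<Sum>l\<in>S. cis (- (s * \<xi> * l)) *s c l \<xi>)" for s \<xi>
  have vm: "(\<lambda>(s, \<xi>). v s \<xi>) \<in> borel_measurable (borel \<Otimes>\<^sub>M borel)"
   unfolding v_def split_def
  proof (rule borel_measurable_sum)
   fix l assume "l \<in> S"
   note [measurable] = cm[OF this]
   show "(\<lambda>x. cis (- (fst x * snd x * l)) *s c l (snd x)) \<in> borel_measurable (borel \<Otimes>\<^sub>M borel)" by measurable
  qed
  have [measurable]: "(\<lambda>x. v (f x) (g x)) \<in> borel_measurable N"
   if "f \<in> borel_measurable N" "g \<in> borel_measurable N" for f g and N :: "'z measure"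
   using measurable_compose[OF measurable_Pair[OF that] vm] by simp
  define hi where "hi = {\<xi>. L \<le> \<bar>\<xi>\<bar>}"
  have [measurable]: "hi \<in> sets borel" unfolding hi_def by measurable
  define \<epsilon> where "\<epsilon> = \<kappa> * t"
  have eps: "0 < \<epsilon>" "\<epsilon> \<le> \<kappa> * t1" using kap t by (auto simp: \<epsilon>_def)
  define \<sigma> where "\<sigma> = \<epsilon> * M"
  have sig: "\<sigma> > 0" using eps M_pos by (simp add: \<sigma>_def)
  define r where "r = \<kappa>2 * t"
  have r0: "r > 0" using kap22 t by (simp add: r_def)
  have rl: "r \<le> lam / 2 * t" unfolding r_def using t by (intro mult_right_mono) (auto simp: \<kappa>2_def)
  have rlen: "r \<le> len / 2"
  proof -
   have "r \<le> len / (2 * t1) * t" unfolding r_def using t by (intro mult_right_mono) (auto simp: \<kappa>2_def)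
   also have "\<dots> \<le> len / (2 * t1) * t1" using t t1 len_pos by (intro mult_left_mono) auto
   finally show ?thesis using t1 by simp
  qed
  have ks: "2 * (real k * \<sigma>) \<le> len / 2"
  proof -
   have "2 * (real k * \<sigma>) = 2 * real k * M * \<kappa> * t" by (simp add: \<sigma>_def \<epsilon>_def)
   also have "\<dots> \<le> 2 * real k * M * \<kappa> * t1" using t kap M_pos by (intro mult_left_mono) auto
   finally show ?thesis using kap2 by linarith
  qed
  have high: "(\<integral>\<^sup>+\<xi>. nsq (c l \<xi>) * indicator hi \<xi>) \<le> ennreal (D / t ^ (2 * k + 1)) * energy \<omega> T w" if l: "l \<in> S" for l
  proof -
   note [measurable] = cm[OF l]
   define R where "R = S - {l}"
   have R: "finite R" "l \<notin> R" "insert l R = S" "card R = k" using S l by (auto simp: R_def k_def)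
   have l0: "l \<noteq> 0" using l S by auto
   have len_ok: "gap a b + 2 * (real k * \<sigma>) + r \<le> \<bar>l\<bar> * (T - real k * \<epsilon>)"
   proof -
    have 1: "real k * \<epsilon> * (lam + 2 * M) \<le> lam / 2 * t"
    proof -
     have "real k * \<epsilon> * (lam + 2 * M) = (\<kappa> * real k * (lam + 2 * M)) * t" by (simp add: \<epsilon>_def)
     also have "\<dots> \<le> lam / 2 * t" using t by (intro mult_right_mono kap1) auto
     finally show ?thesis .
    qed
    have kl: "lam * (T - real k * \<epsilon>) = gap a b + lam * t - lam * (real k * \<epsilon>)" using lamT by (simp add: right_diff_distrib)
    have 2: "gap a b + 2 * (real k * \<sigma>) + r \<le> lam * (T - real k * \<epsilon>)"
     unfolding kl \<sigma>_def using 1 rl by (simp add: algebra_simps)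
    then have "0 < lam * (T - real k * \<epsilon>)" using gap_pos sig r0 by (smt (verit) mult_nonneg_nonneg of_nat_0_le_iff)
    then have "0 \<le> T - real k * \<epsilon>" using lam_pos by (simp add: zero_less_mult_iff)
    then have "lam * (T - real k * \<epsilon>) \<le> \<bar>l\<bar> * (T - real k * \<epsilon>)" by (intro mult_right_mono lam_le l)
    then show ?thesis using 2 by linarith
   qed
   have sw: "sweeps (shrunk a b (real (0 + card R) * \<sigma>)) (T - real (card R) * \<epsilon>) l (r / \<bar>l\<bar>)"
    unfolding R(4) using len_ok r0 rlen ks sig l0 by (intro sweeps_shrunk) auto
   have WR: "waves (insert l R) c T w" using W R(3) by simp
   have elim: "ennreal (r / \<bar>l\<bar>) * (\<integral>\<^sup>+\<xi>. (\<Prod>m\<in>R. diff_mass \<epsilon> (\<xi> * (l - m))) * nsq (c l \<xi>))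
    \<le> (4 * ennreal \<epsilon>) ^ card R * (ennreal (2 * pi) * energy (shrunk a b (real 0 * \<sigma>)) T w)"
   proof (rule wave_elimination[where Om="\<lambda>j. shrunk a b (real j * \<sigma>)", OF R(1,2) eps(1) _ _ _ WR sw])
    show "shrunk a b (real (Suc j) * \<sigma>) \<subseteq> shrunk a b (real j * \<sigma>)" for j
     using shrunk_shift[of _ a b "real j * \<sigma>" \<sigma> 0] sig by (auto simp: algebra_simps)
    show "x + \<eta> * m \<in> shrunk a b (real j * \<sigma>)"
     if x: "x \<in> shrunk a b (real (Suc j) * \<sigma>)" and m: "m \<in> R" and h: "0 \<le> \<eta>" "\<eta> \<le> \<epsilon>" for j x m \<eta>
    proof -
     have "\<bar>\<eta> * m\<bar> \<le> \<epsilon> * M" unfolding abs_mult using h m M_ge[of m] by (intro mult_mono) (auto simp: R_def)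
     then have "\<bar>\<eta> * m\<bar> \<le> \<sigma>" by (simp add: \<sigma>_def)
     then show ?thesis using shrunk_shift[of x a b "real j * \<sigma>" \<sigma> "\<eta> * m"] x by (simp add: algebra_simps)
    qed
   qed (rule shrunk_borel)
   define q where "q = \<kappa>3 * \<epsilon> ^ 3"
   have q: "q > 0" using kap3 eps by (simp add: q_def)
   define I where "I = (\<integral>\<^sup>+\<xi>. nsq (c l \<xi>) * indicator hi \<xi>)"
   have "ennreal (r / \<bar>l\<bar> * q ^ k) * I = ennreal (r / \<bar>l\<bar>) * (\<integral>\<^sup>+\<xi>. ennreal (q ^ k) * (nsq (c l \<xi>) * indicator hi \<xi>))"
   proof -
    have e: "ennreal (r / \<bar>l\<bar> * q ^ k) = ennreal (r / \<bar>l\<bar>) * ennreal (q ^ k)"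
     using r0 q by (intro ennreal_mult) auto
    have "(\<integral>\<^sup>+\<xi>. ennreal (q ^ k) * (nsq (c l \<xi>) * indicator hi \<xi>)) = ennreal (q ^ k) * I"
     unfolding I_def by (rule nn_integral_cmult) measurable
    then show ?thesis by (simp only: e mult.assoc)
   qed
   also have "\<dots> \<le> ennreal (r / \<bar>l\<bar>) * (\<integral>\<^sup>+\<xi>. (\<Prod>m\<in>R. diff_mass \<epsilon> (\<xi> * (l - m))) * nsq (c l \<xi>))"
   proof (intro mult_left_mono nn_integral_mono)
    fix \<xi>
    have "ennreal (q ^ k) \<le> (\<Prod>m\<in>R. diff_mass \<epsilon> (\<xi> * (l - m)))" if xi: "L \<le> \<bar>\<xi>\<bar>"
    proof -
     have "ennreal (q ^ k) = (\<Prod>m\<in>R. ennreal q)" using q R(4) by (simp add: ennreal_power)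
     also have "\<dots> \<le> (\<Prod>m\<in>R. diff_mass \<epsilon> (\<xi> * (l - m)))"
     proof (rule prod_mono_ennreal)
      fix m assume m: "m \<in> R"
      have "L * d0 \<le> \<bar>\<xi> * (l - m)\<bar>"
       unfolding abs_mult using xi d0_le[of l m] m l L d0 by (intro mult_mono) (auto simp: R_def)
      then show "ennreal q \<le> diff_mass \<epsilon> (\<xi> * (l - m))"
       unfolding q_def \<kappa>3_def using eps L d0 by (intro diff_mass_lower) auto
     qed
     finally show ?thesis .
    qed
    then show "ennreal (q ^ k) * (nsq (c l \<xi>) * indicator hi \<xi>) \<le> (\<Prod>m\<in>R. diff_mass \<epsilon> (\<xi> * (l - m))) * nsq (c l \<xi>)"
     by (cases "\<xi> \<in> hi") (auto simp: hi_def intro!: mult_right_mono)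
   qed auto
   also have "\<dots> \<le> (4 * ennreal \<epsilon>) ^ card R * (ennreal (2 * pi) * energy (shrunk a b (real 0 * \<sigma>)) T w)" by (rule elim)
   also have "\<dots> = ennreal ((4 * \<epsilon>) ^ k * (2 * pi)) * energy \<omega> T w"
   proof -
    have "4 * ennreal \<epsilon> = ennreal (4 * \<epsilon>)" using eps by (simp add: ennreal_mult)
    then have "(4 * ennreal \<epsilon>) ^ k = ennreal ((4 * \<epsilon>) ^ k)" using eps by (simp only: ennreal_power)
    moreover have "ennreal ((4 * \<epsilon>) ^ k * (2 * pi)) = ennreal ((4 * \<epsilon>) ^ k) * ennreal (2 * pi)"
     using eps by (intro ennreal_mult) auto
    ultimately show ?thesis by (simp only: R(4) omega_shrunk of_nat_0 mult_zero_left mult.assoc)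
   qed
   finally have le: "ennreal (r / \<bar>l\<bar> * q ^ k) * I \<le> ennreal ((4 * \<epsilon>) ^ k * (2 * pi)) * energy \<omega> T w" .
   define z where "z = r / \<bar>l\<bar> * q ^ k"
   have z: "z > 0" using r0 l0 q by (simp add: z_def)
   have "I = ennreal (1 / z) * (ennreal z * I)" using z by (simp add: mult.assoc[symmetric] ennreal_mult[symmetric])
   also have "\<dots> \<le> ennreal (1 / z) * (ennreal ((4 * \<epsilon>) ^ k * (2 * pi)) * energy \<omega> T w)"
    unfolding z_def by (intro mult_left_mono le) auto
   also have "\<dots> = ennreal ((4 * \<epsilon>) ^ k * (2 * pi) / z) * energy \<omega> T w"
    using z eps by (simp add: mult.assoc[symmetric] ennreal_mult[symmetric])
   also have "\<dots> \<le> ennreal (D / t ^ (2 * k + 1)) * energy \<omega> T w"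
   proof (intro mult_right_mono ennreal_leI)
    have "(4 * \<epsilon>) ^ k * (2 * pi) / z = 4 ^ k * (2 * pi) * \<bar>l\<bar> / (\<kappa>2 * \<kappa>3 ^ k * \<kappa> ^ (2 * k)) / t ^ (2 * k + 1)"
    proof -
     have "z = \<kappa>2 * t / \<bar>l\<bar> * (\<kappa>3 ^ k * (\<epsilon> ^ k * (\<kappa> * t) ^ (2 * k)))"
     proof -
      have "(\<epsilon> ^ 3) ^ k = \<epsilon> ^ (3 * k)" by (rule power_mult[symmetric])
      also have "\<dots> = \<epsilon> ^ (k + 2 * k)" by (rule arg_cong[where f="\<lambda>n. \<epsilon> ^ n"]) simp
      also have "\<dots> = \<epsilon> ^ k * \<epsilon> ^ (2 * k)" by (rule power_add)
      finally have "(\<epsilon> ^ 3) ^ k = \<epsilon> ^ k * (\<kappa> * t) ^ (2 * k)" by (simp only: \<epsilon>_def)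
      then show ?thesis unfolding z_def r_def q_def power_mult_distrib[of \<kappa>3] by simp
     qed
     also have "\<dots> = \<epsilon> ^ k * (\<kappa>2 * \<kappa>3 ^ k * \<kappa> ^ (2 * k)) * t ^ (2 * k + 1) / \<bar>l\<bar>"
      by (simp add: power_mult_distrib mult_ac)
     finally show ?thesis using eps by (simp add: power_mult_distrib)
    qed
    also have "\<dots> \<le> D / t ^ (2 * k + 1)"
     unfolding D_def using M_ge[OF l] kap kap22 kap3 t
     by (intro divide_right_mono mult_left_mono) auto
    finally show "(4 * \<epsilon>) ^ k * (2 * pi) / z \<le> D / t ^ (2 * k + 1)" .
   qed auto
   finally show ?thesis unfolding I_def .
  qed
  have vhi: "(\<integral>\<^sup>+\<xi>. nsq (v s \<xi>) * indicator hi \<xi>) \<le> ennreal ((real (card S))\<^sup>2 * D / t ^ (2 * k + 1)) * energy \<omega> T w" for s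
  proof -
   have "(\<integral>\<^sup>+\<xi>. nsq (v s \<xi>) * indicator hi \<xi>) \<le> (\<integral>\<^sup>+\<xi>. (\<Sum>l\<in>S. ennreal (real (card S)) * (nsq (c l \<xi>) * indicator hi \<xi>)))"
   proof (rule nn_integral_mono)
    fix \<xi>
    have "norm (v s \<xi>) \<le> (\<Sum>l\<in>S. norm (c l \<xi>))"
     unfolding v_def by (rule order_trans[OF norm_sum]) (simp add: norm_vec_scale)
    then have "(norm (v s \<xi>))\<^sup>2 \<le> (\<Sum>l\<in>S. norm (c l \<xi>))\<^sup>2" by (rule power_mono) simp
    also have "\<dots> \<le> (\<Sum>l\<in>S. (norm (c l \<xi>))\<^sup>2) * real (card S)" by (rule sum_squared_le_sum_of_squares)
    finally have "nsq (v s \<xi>) \<le> ennreal (real (card S) * (\<Sum>l\<in>S. (norm (c l \<xi>))\<^sup>2))"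
     unfolding nsq_def by (intro ennreal_leI) (simp add: mult.commute)
    also have "\<dots> = (\<Sum>l\<in>S. ennreal (real (card S)) * nsq (c l \<xi>))"
     unfolding nsq_def by (simp add: sum_nonneg ennreal_mult sum_ennreal[symmetric] sum_distrib_left del: sum_ennreal)
    finally show "nsq (v s \<xi>) * indicator hi \<xi> \<le> (\<Sum>l\<in>S. ennreal (real (card S)) * (nsq (c l \<xi>) * indicator hi \<xi>))"
     by (cases "\<xi> \<in> hi") auto
   qed
   also have "\<dots> = (\<Sum>l\<in>S. ennreal (real (card S)) * (\<integral>\<^sup>+\<xi>. nsq (c l \<xi>) * indicator hi \<xi>))"
    using cm by (subst nn_integral_sum) (auto intro!: sum.cong nn_integral_cmult)
   also have "\<dots> \<le> (\<Sum>l\<in>S. ennreal (real (card S)) * (ennreal (D / t ^ (2 * k + 1)) * energy \<omega> T w))"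
    by (intro sum_mono mult_left_mono high) auto
   also have "\<dots> = of_nat (card S) * (ennreal (real (card S)) * (ennreal (D / t ^ (2 * k + 1)) * energy \<omega> T w))"
    by simp
   also have "\<dots> = ennreal ((real (card S))\<^sup>2 * D / t ^ (2 * k + 1)) * energy \<omega> T w"
    using D t by (simp add: ennreal_of_nat_eq_real_of_nat mult.assoc[symmetric] ennreal_mult[symmetric] power2_eq_square)
   finally show ?thesis .
  qed
  have om[measurable]: "\<omega> \<in> sets borel" unfolding omega_shrunk by (rule shrunk_borel)
  have slice: "AE s in lborel. ennreal len * ((\<integral>\<^sup>+\<xi>. nsq (v s \<xi>)) * indicator {0<..<T} s)
    \<le> ennreal (8 * pi * H) * ((\<integral>\<^sup>+x. nsq (w (s, x)) * indicator \<omega> x) * indicator {0<..<T} s)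
     + ennreal (16 * H) * (ennreal ((real (card S))\<^sup>2 * D / t ^ (2 * k + 1)) * energy \<omega> T w) * indicator {0<..<T} s"
  proof -
   have "AE s in lborel. s \<in> {0<..<T} \<longrightarrow> is_fourier_L2 (\<lambda>x. w (s, x)) (v s)"
    using W unfolding waves_def v_def[abs_def] by blast
   then show ?thesis
   proof eventually_elim
    case (elim s)
    show ?case
    proof (cases "s \<in> {0<..<T}")
     case True
     then have ft: "is_fourier_L2 (\<lambda>x. w (s, x)) (v s)" using elim by blast
     from low_frequency_observability[OF this thick_omega om len_pos H[unfolded H_def] L(1) L(2)[unfolded H_def]]
     have "ennreal len * (\<integral>\<^sup>+\<xi>. nsq (v s \<xi>)) \<le> ennreal (8 * pi * H) * (\<integral>\<^sup>+x. nsq (w (s, x)) * indicator \<omega> x)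
       + ennreal (16 * H) * (\<integral>\<^sup>+\<xi>. nsq (v s \<xi>) * indicator hi \<xi>)"
      by (simp only: H_def hi_def)
     also have "\<dots> \<le> ennreal (8 * pi * H) * (\<integral>\<^sup>+x. nsq (w (s, x)) * indicator \<omega> x)
       + ennreal (16 * H) * (ennreal ((real (card S))\<^sup>2 * D / t ^ (2 * k + 1)) * energy \<omega> T w)"
      by (intro add_mono mult_left_mono vhi) auto
     finally show ?thesis using True by simp
    qed simp
   qed
  qed
  let ?IV = "\<integral>\<^sup>+s. (\<integral>\<^sup>+\<xi>. nsq (v s \<xi>)) * indicator {0<..<T} s"
  have "ennreal len * ?IV = (\<integral>\<^sup>+s. ennreal len * ((\<integral>\<^sup>+\<xi>. nsq (v s \<xi>)) * indicator {0<..<T} s))"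
   by (rule nn_integral_cmult[symmetric]) measurable
  also have "\<dots> \<le> (\<integral>\<^sup>+s. ennreal (8 * pi * H) * ((\<integral>\<^sup>+x. nsq (w (s, x)) * indicator \<omega> x) * indicator {0<..<T} s)
     + ennreal (16 * H) * (ennreal ((real (card S))\<^sup>2 * D / t ^ (2 * k + 1)) * energy \<omega> T w) * indicator {0<..<T} s)"
   by (rule nn_integral_mono_AE[OF slice])
  also have "\<dots> = ennreal (8 * pi * H) * energy \<omega> T w + ennreal (16 * H) * (ennreal ((real (card S))\<^sup>2 * D / t ^ (2 * k + 1)) * energy \<omega> T w) * ennreal T"
   unfolding energy_def using t Tg0 by (subst nn_integral_add) (auto simp: nn_integral_cmult nn_integral_cmult_indicator t_def)
  also have "\<dots> = ennreal (8 * pi * H + 16 * H * ((real (card S))\<^sup>2 * D / t ^ (2 * k + 1)) * T) * energy \<omega> T w"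
  proof -
   define X where "X = (real (card S))\<^sup>2 * D / t ^ (2 * k + 1)"
   have X: "X \<ge> 0" using D t by (simp add: X_def)
   have T0: "T \<ge> 0" using t Tg0 by (simp add: t_def)
   have "ennreal (8 * pi * H + 16 * H * X * T) = ennreal (8 * pi * H) + ennreal (16 * H * X * T)"
    using H X T0 by (intro ennreal_plus) auto
   also have "ennreal (16 * H * X * T) = ennreal (16 * H * X) * ennreal T"
    using H X T0 by (intro ennreal_mult) auto
   also have "ennreal (16 * H * X) = ennreal (16 * H) * ennreal X" using H X by (intro ennreal_mult) auto
   finally have e: "ennreal (8 * pi * H + 16 * H * X * T) = ennreal (8 * pi * H) + ennreal (16 * H) * ennreal X * ennreal T" .
   show ?thesis unfolding X_def[symmetric] e distrib_right by (simp only: mult_ac)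
  qed
  also have "\<dots> \<le> ennreal (len * (C / t ^ (2 * k + 1))) * energy \<omega> T w"
  proof (intro mult_right_mono ennreal_leI)
   have "8 * pi * H \<le> 8 * pi * H * t1 ^ (2 * k + 1) / t ^ (2 * k + 1)"
   proof -
    have "t ^ (2 * k + 1) \<le> t1 ^ (2 * k + 1)" using t by (intro power_mono) auto
    then have "8 * pi * H * t ^ (2 * k + 1) \<le> 8 * pi * H * t1 ^ (2 * k + 1)" using H by (intro mult_left_mono) auto
    moreover have "t ^ (2 * k + 1) > 0" using t by simp
    ultimately show ?thesis by (subst pos_le_divide_eq) auto
   qed
   moreover have "16 * H * ((real (card S))\<^sup>2 * D / t ^ (2 * k + 1)) * T \<le> 16 * H * ((real (card S))\<^sup>2 * D / t ^ (2 * k + 1)) * T1"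
    using H D t T by (intro mult_left_mono) auto
   moreover have "len * (C / t ^ (2 * k + 1)) = 8 * pi * H * t1 ^ (2 * k + 1) / t ^ (2 * k + 1) + 16 * H * ((real (card S))\<^sup>2 * D / t ^ (2 * k + 1)) * T1"
   proof -
    have c: "len * (x / len / y) = x / y" for x y using len_pos by simp
    show ?thesis unfolding C_def c by (simp add: add_divide_distrib mult_ac)
   qed
   ultimately show "8 * pi * H + 16 * H * ((real (card S))\<^sup>2 * D / t ^ (2 * k + 1)) * T \<le> len * (C / t ^ (2 * k + 1))" by linarith
  qed auto
  finally have fin: "ennreal len * ?IV \<le> ennreal (len * (C / t ^ (2 * k + 1))) * energy \<omega> T w" .
  have one: "ennreal (1 / len) * ennreal len = 1" using len_pos by (simp add: ennreal_mult[symmetric])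
  have "?IV = ennreal (1 / len) * (ennreal len * ?IV)" by (subst mult.assoc[symmetric]) (simp only: one mult_1_left)
  also have "\<dots> \<le> ennreal (1 / len) * (ennreal (len * (C / t ^ (2 * k + 1))) * energy \<omega> T w)" by (intro mult_left_mono fin) auto
  also have "\<dots> = ennreal (1 / len) * (ennreal len * (ennreal (C / t ^ (2 * k + 1)) * energy \<omega> T w))"
   using len_pos C t by (subst ennreal_mult) (auto simp: mult.assoc)
  also have "\<dots> = ennreal (C / t ^ (2 * k + 1)) * energy \<omega> T w" by (subst mult.assoc[symmetric]) (simp only: one mult_1_left)
  finally show "(\<integral>\<^sup>+s. (\<integral>\<^sup>+\<xi>. nsq (\<Sum>l\<in>S. cis (- (s * \<xi> * l)) *s c l \<xi>)) * indicator {0<..<T} s)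
    \<le> ennreal (C / (T - gap a b / lam) ^ (2 * card S - 1)) * energy \<omega> T w"
   unfolding v_def t_def Tg_def cardS by simp
 qed
qed

end

section \<open>The controlled system on the Fourier side\<close>

subsection \<open>Solving coercive equations in the space of square-integrable functions\<close>

lemma sqint_inner_integrable:
 assumes f: "sqint f" and g: "sqint g" shows "integrable lborel (\<lambda>x. f x \<bullet> g x)"
proof -
 note [measurable] = sqint_measurable[OF f] sqint_measurable[OF g]
 show ?thesis
  by (rule Bochner_Integration.integrable_bound[OF sqint_norm_mult_integrable[OF f g]])
   (auto simp: Cauchy_Schwarz_ineq2)
qed

lemma sqint_inner_le:
 assumes f: "sqint f" and g: "sqint g" shows "(LINT x. f x \<bullet> g x) \<le> l2norm f * l2norm g"
proof -
 have "(LINT x. f x \<bullet> g x) \<le> (LINT x. norm (f x) * norm (g x))"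
  by (intro integral_mono sqint_inner_integrable sqint_norm_mult_integrable f g norm_cauchy_schwarz)
 then show ?thesis using l2_Cauchy_Schwarz[OF f g] by linarith
qed

text \<open>The iteration \<open>h \<mapsto> h + \<tau> (e - M h)\<close> is a contraction for small \<open>\<tau>\<close>, by strong monotonicity and the Lipschitz bound.
The hypotheses speak of differences because the operators in question are linear only almost everywhere.\<close>

lemma coercive_solvable:
 fixes M :: "('a::euclidean_space \<Rightarrow> 'b::euclidean_space) \<Rightarrow> 'a \<Rightarrow> 'b"
 assumes sq: "\<And>h. sqint h \<Longrightarrow> sqint (M h)"
  and lip: "\<And>h k. sqint h \<Longrightarrow> sqint k \<Longrightarrow> l2norm (\<lambda>x. M h x - M k x) \<le> C * l2norm (\<lambda>x. h x - k x)"
  and coer: "\<And>h k. sqint h \<Longrightarrow> sqint k \<Longrightarrow> c * (l2norm (\<lambda>x. h x - k x))\<^sup>2 \<le> (LINT x. (M h x - M k x) \<bullet> (h x - k x))"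
  and c: "c > 0" and C: "C \<ge> 0" and e: "sqint e"
 shows "\<exists>h. sqint h \<and> (AE x in lborel. M h x = e x)"
proof -
 \<comment> \<open>enlarging the Lipschitz constant makes it positive and at least \<open>c\<close>\<close>
 define C' where "C' = C + c"
 have C': "C' > 0" "C \<le> C'" using c C by (auto simp: C'_def)
 \<comment> \<open>minimises the contraction factor \<open>1 - 2 \<tau> c + \<tau>\<^sup>2 C'\<^sup>2\<close> of the squared distance\<close>
 define \<tau> where "\<tau> = c / C'\<^sup>2"
 have tau: "\<tau> > 0" using c C' by (simp add: \<tau>_def)
 define q where "q = sqrt (1 - c\<^sup>2 / C'\<^sup>2)"
 have "c\<^sup>2 \<le> C'\<^sup>2" using c C by (intro power_mono) (auto simp: C'_def)
 then have q2: "q\<^sup>2 = 1 - c\<^sup>2 / C'\<^sup>2" using C' by (simp add: q_def)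
 have q: "0 \<le> q" "q < 1" using c C' \<open>c\<^sup>2 \<le> C'\<^sup>2\<close> by (auto simp: q_def)
 define S where "S h x = h x + \<tau> *\<^sub>R (e x - M h x)" for h x
 have Ssq: "sqint (S h)" if "sqint h" for h
  unfolding S_def[abs_def] by (intro sqint_add sqint_scaleR sqint_diff that e sq)
 have contr: "l2norm (\<lambda>x. S h x - S k x) \<le> q * l2norm (\<lambda>x. h x - k x)" if h: "sqint h" and k: "sqint k" for h k
 proof -
  let ?D = "\<lambda>x. h x - k x" and ?E = "\<lambda>x. M h x - M k x"
  have D: "sqint ?D" and E: "sqint ?E" by (intro sqint_diff h k sq)+
  have "(l2norm (\<lambda>x. S h x - S k x))\<^sup>2 = (LINT x. (norm (?D x))\<^sup>2 - 2 * \<tau> * (?E x \<bullet> ?D x) + \<tau>\<^sup>2 * (norm (?E x))\<^sup>2)"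
   unfolding l2norm_sq
  proof (rule Bochner_Integration.integral_cong[OF refl])
   fix x
   have "S h x - S k x = ?D x - \<tau> *\<^sub>R ?E x" by (simp add: S_def algebra_simps)
   then show "(norm (S h x - S k x))\<^sup>2 = (norm (?D x))\<^sup>2 - 2 * \<tau> * (?E x \<bullet> ?D x) + \<tau>\<^sup>2 * (norm (?E x))\<^sup>2"
    by (simp only: power2_norm_eq_inner) (simp add: inner_diff_left inner_diff_right inner_commute power2_eq_square algebra_simps)
  qed
  also have "\<dots> = (l2norm ?D)\<^sup>2 - 2 * \<tau> * (LINT x. ?E x \<bullet> ?D x) + \<tau>\<^sup>2 * (l2norm ?E)\<^sup>2"
   unfolding l2norm_sq using sqint_integrable[OF D] sqint_integrable[OF E] sqint_inner_integrable[OF E D] by simp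
  also have "\<dots> \<le> (l2norm ?D)\<^sup>2 - 2 * \<tau> * (c * (l2norm ?D)\<^sup>2) + \<tau>\<^sup>2 * (C'\<^sup>2 * (l2norm ?D)\<^sup>2)"
  proof -
   have "l2norm ?E \<le> C' * l2norm ?D" using lip[OF h k] mult_right_mono[OF C'(2) l2norm_nonneg[of ?D]] by linarith
   then have "(l2norm ?E)\<^sup>2 \<le> (C' * l2norm ?D)\<^sup>2" by (rule power_mono) simp
   then have "\<tau>\<^sup>2 * (l2norm ?E)\<^sup>2 \<le> \<tau>\<^sup>2 * (C'\<^sup>2 * (l2norm ?D)\<^sup>2)" unfolding power_mult_distrib by (intro mult_left_mono) auto
   moreover have "2 * \<tau> * (c * (l2norm ?D)\<^sup>2) \<le> 2 * \<tau> * (LINT x. ?E x \<bullet> ?D x)"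
    using coer[OF h k] tau by (intro mult_left_mono) auto
   ultimately show ?thesis by linarith
  qed
  also have "\<dots> = (1 - 2 * \<tau> * c + \<tau>\<^sup>2 * C'\<^sup>2) * (l2norm ?D)\<^sup>2" by (simp add: algebra_simps)
  also have "1 - 2 * \<tau> * c + \<tau>\<^sup>2 * C'\<^sup>2 = q\<^sup>2"
   unfolding q2 \<tau>_def using C' by (simp add: power2_eq_square field_simps)
  finally have "(l2norm (\<lambda>x. S h x - S k x))\<^sup>2 \<le> (q * l2norm ?D)\<^sup>2" by (simp add: power_mult_distrib)
  then show ?thesis by (rule power2_le_imp_le) (use q in simp)
 qed
 define h where "h n = (S ^^ n) (\<lambda>x. 0)" for n
 have hS: "h (Suc n) = S (h n)" for n by (simp add: h_def)
 have hs: "sqint (h n)" for n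
 proof (induction n)
  case 0 then show ?case by (simp add: h_def)
 next
  case (Suc n) then show ?case unfolding hS by (rule Ssq)
 qed
 define d where "d = l2norm (\<lambda>x. h 1 x - h 0 x)"
 have dn: "l2norm (\<lambda>x. h (Suc n) x - h n x) \<le> q ^ n * d" for n
 proof (induction n)
  case 0 then show ?case by (simp add: d_def)
 next
  case (Suc n)
  have "l2norm (\<lambda>x. h (Suc (Suc n)) x - h (Suc n) x) \<le> q * l2norm (\<lambda>x. h (Suc n) x - h n x)"
   unfolding hS[of "Suc n"] hS[of n] by (intro contr Ssq hs)
  also have "\<dots> \<le> q * (q ^ n * d)" by (intro mult_left_mono Suc q)
  finally show ?case by simp
 qed
 have tail: "l2norm (\<lambda>x. h (n + j) x - h n x) \<le> q ^ n * d / (1 - q)" for n j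
 proof -
  have "l2norm (\<lambda>x. h (n + j) x - h n x) \<le> (\<Sum>i<j. q ^ (n + i) * d)"
  proof (induction j)
   case 0 then show ?case by (simp add: l2norm_def)
  next
   case (Suc j)
   have "l2norm (\<lambda>x. h (n + Suc j) x - h n x) \<le> l2norm (\<lambda>x. h (Suc (n + j)) x - h (n + j) x) + l2norm (\<lambda>x. h (n + j) x - h n x)"
    using l2norm_triangle_diff[OF hs[of "Suc (n + j)"] hs[of "n + j"] hs[of n]] by simp
   then show ?case using dn[of "n + j"] Suc by simp
  qed
  also have "\<dots> = q ^ n * d * (\<Sum>i<j. q ^ i)" by (simp add: power_add sum_distrib_left mult_ac)
  also have "\<dots> \<le> q ^ n * d * (1 / (1 - q))"
  proof (intro mult_left_mono)
   have "(\<Sum>i<j. q ^ i) = (1 - q ^ j) / (1 - q)" using q by (simp add: sum_gp_strict)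
   also have "\<dots> \<le> 1 / (1 - q)" using q by (intro divide_right_mono) auto
   finally show "(\<Sum>i<j. q ^ i) \<le> 1 / (1 - q)" .
  qed (use q in \<open>simp add: d_def\<close>)
  finally show ?thesis by simp
 qed
 have "(\<lambda>n. q ^ n * d / (1 - q)) \<longlonglongrightarrow> 0 * d / (1 - q)"
  using q by (intro tendsto_intros LIMSEQ_power_zero) auto
 then have lim0: "(\<lambda>n. q ^ n * d / (1 - q)) \<longlonglongrightarrow> 0" by simp
 have "\<exists>g r. sqint g \<and> (\<lambda>n. l2norm (\<lambda>x. h n x - g x)) \<longlonglongrightarrow> 0 \<and> strict_mono r \<and> (AE x in lborel. (\<lambda>n. h (r n) x) \<longlonglongrightarrow> g x)"
 proof (rule l2_complete[OF hs])
  fix \<epsilon> :: real assume "\<epsilon> > 0"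
  then obtain N where N: "\<And>n. n \<ge> N \<Longrightarrow> norm (q ^ n * d / (1 - q)) < \<epsilon>" using LIMSEQ_D[OF lim0] by auto
  have "l2norm (\<lambda>x. h m x - h n x) < \<epsilon>" if mn: "N \<le> n" "n \<le> m" for m n
  proof -
   obtain j where "m = n + j" using mn(2) le_Suc_ex by blast
   then show ?thesis using tail[of n j] N[OF mn(1)] abs_ge_self[of "q ^ n * d / (1 - q)"]
    unfolding \<open>m = n + j\<close> real_norm_def by (meson le_less_trans)
  qed
  then show "\<exists>N. \<forall>m\<ge>N. \<forall>n\<ge>N. l2norm (\<lambda>x. h m x - h n x) < \<epsilon>"
   by (metis l2norm_diff_swap nle_le)
 qed
 then obtain g where g: "sqint g" "(\<lambda>n. l2norm (\<lambda>x. h n x - g x)) \<longlonglongrightarrow> 0" by blast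
 have "l2norm (\<lambda>x. S g x - g x) \<le> 0"
 proof (rule LIMSEQ_le_const)
  have "(\<lambda>n. q * l2norm (\<lambda>x. h n x - g x) + l2norm (\<lambda>x. h (Suc n) x - g x)) \<longlonglongrightarrow> q * 0 + 0"
   by (intro tendsto_intros g LIMSEQ_Suc[OF g(2)])
  then show "(\<lambda>n. q * l2norm (\<lambda>x. h n x - g x) + l2norm (\<lambda>x. h (Suc n) x - g x)) \<longlonglongrightarrow> 0" by simp
  have "l2norm (\<lambda>x. S g x - g x) \<le> q * l2norm (\<lambda>x. h n x - g x) + l2norm (\<lambda>x. h (Suc n) x - g x)" for n
  proof -
   have "l2norm (\<lambda>x. S g x - g x) \<le> l2norm (\<lambda>x. S g x - h (Suc n) x) + l2norm (\<lambda>x. h (Suc n) x - g x)"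
    by (intro l2norm_triangle_diff Ssq g hs)
   moreover have "l2norm (\<lambda>x. S g x - h (Suc n) x) \<le> q * l2norm (\<lambda>x. g x - h n x)"
    unfolding hS by (rule contr[OF g(1) hs])
   ultimately show ?thesis by (simp add: l2norm_diff_swap[of g])
  qed
  then show "\<exists>N. \<forall>n\<ge>N. l2norm (\<lambda>x. S g x - g x) \<le> q * l2norm (\<lambda>x. h n x - g x) + l2norm (\<lambda>x. h (Suc n) x - g x)"
   by blast
 qed
 then have "l2norm (\<lambda>x. S g x - g x) = 0" using l2norm_nonneg[of "\<lambda>x. S g x - g x"] by linarith
 then have "AE x in lborel. S g x - g x = 0" using l2norm_eq_0_iff[OF sqint_diff[OF Ssq[OF g(1)] g(1)]] by simp
 then have "AE x in lborel. M g x = e x" by eventually_elim (use tau in \<open>auto simp: S_def\<close>)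
 then show ?thesis using g(1) by blast
qed

subsection \<open>The input-to-state map\<close>

lemma norm_integral_le:
 fixes f :: "'a::euclidean_space \<Rightarrow> 'b::{banach, second_countable_topology}"
 assumes "integrable M g" and "\<And>x. norm (f x) \<le> g x"
 shows "norm (integral\<^sup>L M f) \<le> integral\<^sup>L M g"
proof (cases "integrable M f")
 case True then show ?thesis by (rule Bochner_Integration.integral_norm_bound_integral[OF _ assms(1)]) (rule assms(2))
next
 case False
 have "0 \<le> g x" for x using order_trans[OF norm_ge_zero assms(2)] .
 then show ?thesis using False by (simp add: not_integrable_integral_eq Bochner_Integration.integral_nonneg)
qed

lemma nn_integral_R2':
 assumes f: "f \<in> borel_measurable borel"
 shows "(\<integral>\<^sup>+z. f z \<partial>(lborel :: (real \<times> real) measure)) = (\<integral>\<^sup>+x. \<integral>\<^sup>+s. f (s, x))"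
proof -
 note [measurable] = borel_R2[OF f]
 show ?thesis unfolding nn_integral_R2[OF f] by (rule lborel_pair.Fubini'[symmetric]) measurable
qed

lemma sqint_section':
 fixes f :: "real \<times> real \<Rightarrow> 'b::euclidean_space"
 assumes f: "sqint f" shows "AE x in lborel. sqint (\<lambda>s. f (s, x))"
proof -
 note [measurable] = sqint_measurable[OF f] borel_R2[OF sqint_measurable[OF f]]
 have "(\<integral>\<^sup>+x. \<integral>\<^sup>+s. ennreal ((norm (f (s, x)))\<^sup>2)) < \<infinity>"
  using f nn_integral_R2'[of "\<lambda>z. ennreal ((norm (f z))\<^sup>2)"] by (simp add: sqint_iff_nn)
 moreover have "(\<lambda>x. \<integral>\<^sup>+s. ennreal ((norm (f (s, x)))\<^sup>2)) \<in> borel_measurable lborel" by measurable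
 ultimately have "AE x in lborel. (\<integral>\<^sup>+s. ennreal ((norm (f (s, x)))\<^sup>2)) \<noteq> \<infinity>"
  by (intro nn_integral_noteq_infinite) auto
 then show ?thesis
  by eventually_elim (auto simp: sqint_iff_nn less_top[symmetric])
qed

lemma emeasure_Ioo: "emeasure lborel {a<..<b} = ennreal (max 0 (b - a))"
 by (cases "a \<le> b") auto

definition partial_FT :: "(real \<times> real \<Rightarrow> complex^'k) \<Rightarrow> (real \<times> real \<Rightarrow> complex^'k) \<Rightarrow> bool" where
 "partial_FT u v \<longleftrightarrow> sqint u \<and> sqint v \<and> (AE s in lborel. is_fourier_L2 (\<lambda>x. u (s, x)) (\<lambda>\<xi>. v (s, \<xi>)))"

lemma partial_FT_exists: "sqint u \<Longrightarrow> \<exists>v. partial_FT u v"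
 using FT_partial unfolding partial_FT_def by blast

lemma partial_FT_inverse_exists: "sqint v \<Longrightarrow> \<exists>u. partial_FT u v"
 using FT_partial_inverse unfolding partial_FT_def by blast

lemma partial_FT_diff: "partial_FT u v \<Longrightarrow> partial_FT u' v' \<Longrightarrow> partial_FT (\<lambda>z. u z - u' z) (\<lambda>z. v z - v' z)"
 unfolding partial_FT_def by (auto intro: sqint_diff FT_diff elim!: eventually_elim2)

lemma partial_FT_l2norm:
 assumes "partial_FT u v" shows "l2norm v = sqrt (2 * pi) * l2norm u"
proof -
 have u: "sqint u" and v: "sqint v" and ft: "AE s in lborel. is_fourier_L2 (\<lambda>x. u (s, x)) (\<lambda>\<xi>. v (s, \<xi>))"
  using assms by (auto simp: partial_FT_def)
 note [measurable] = sqint_measurable[OF u] sqint_measurable[OF v] borel_R2[OF sqint_measurable[OF u]] borel_R2[OF sqint_measurable[OF v]]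
 have "ennreal ((l2norm v)\<^sup>2) = (\<integral>\<^sup>+s. \<integral>\<^sup>+\<xi>. ennreal ((norm (v (s, \<xi>)))\<^sup>2))"
  unfolding L2_normsq_eq_l2norm[OF v, symmetric] L2_normsq_UNIV by (rule nn_integral_R2) measurable
 also have "\<dots> = (\<integral>\<^sup>+s. ennreal (2 * pi) * (\<integral>\<^sup>+x. ennreal ((norm (u (s, x)))\<^sup>2)))"
  by (rule nn_integral_cong_AE) (use ft in eventually_elim, use FT_Plancherel in \<open>simp only: L2_normsq_UNIV\<close>)
 also have "\<dots> = ennreal (2 * pi) * (\<integral>\<^sup>+s. \<integral>\<^sup>+x. ennreal ((norm (u (s, x)))\<^sup>2))"
  by (rule nn_integral_cmult) measurable
 also have "(\<integral>\<^sup>+s. \<integral>\<^sup>+x. ennreal ((norm (u (s, x)))\<^sup>2)) = ennreal ((l2norm u)\<^sup>2)"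
  unfolding L2_normsq_eq_l2norm[OF u, symmetric] L2_normsq_UNIV by (rule nn_integral_R2[symmetric]) measurable
 finally have "ennreal ((l2norm v)\<^sup>2) = ennreal (2 * pi * (l2norm u)\<^sup>2)" by (simp add: ennreal_mult)
 then have "(l2norm v)\<^sup>2 = (sqrt (2 * pi) * l2norm u)\<^sup>2" by (simp add: power_mult_distrib)
 then show ?thesis by (subst (asm) power2_eq_iff_nonneg) auto
qed

lemma herm_integral_R2:
 fixes u w :: "real \<times> real \<Rightarrow> complex^'k"
 assumes u: "sqint u" and w: "sqint w"
 shows "integrable lborel (\<lambda>z. herm (u z) (w z))"
  "(LINT z. herm (u z) (w z)) = (LINT s. LINT x. herm (u (s, x)) (w (s, x)))"
  "(LINT z. herm (u z) (w z)) = (LINT x. LINT s. herm (u (s, x)) (w (s, x)))"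
proof -
 show i: "integrable lborel (\<lambda>z. herm (u z) (w z))"
 proof -
  note [measurable] = sqint_measurable[OF u] sqint_measurable[OF w]
  have [measurable]: "(\<lambda>z. herm (u z) (w z)) \<in> borel_measurable borel" unfolding herm_def by measurable
  show ?thesis
   by (rule Bochner_Integration.integrable_bound[OF sqint_norm_mult_integrable[OF u w]]) (auto simp: norm_herm_le)
 qed
 then have i2: "integrable (lborel \<Otimes>\<^sub>M lborel) (\<lambda>(s, x). herm (u (s, x)) (w (s, x)))"
  unfolding lborel_prod by (simp add: split_beta')
 have "(LINT z. herm (u z) (w z)) = integral\<^sup>L (lborel \<Otimes>\<^sub>M lborel) (\<lambda>(s, x). herm (u (s, x)) (w (s, x)))"
  unfolding lborel_prod by (simp add: split_beta')
 then show "(LINT z. herm (u z) (w z)) = (LINT s. LINT x. herm (u (s, x)) (w (s, x)))"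
  using lborel_pair.integral_fst[OF i2] by simp
 then show "(LINT z. herm (u z) (w z)) = (LINT x. LINT s. herm (u (s, x)) (w (s, x)))"
  using lborel_pair.Fubini_integral[OF i2] by simp
qed

lemma partial_FT_Parseval:
 assumes 1: "partial_FT u v" and 2: "partial_FT w z"
 shows "(LINT p. herm (v p) (z p)) = 2 * pi * (LINT p. herm (u p) (w p))"
proof -
 have s: "sqint u" "sqint v" "sqint w" "sqint z" using 1 2 by (auto simp: partial_FT_def)
 note [measurable] = borel_R2[OF sqint_measurable[OF s(1)]] borel_R2[OF sqint_measurable[OF s(2)]]
  borel_R2[OF sqint_measurable[OF s(3)]] borel_R2[OF sqint_measurable[OF s(4)]]
 have "(LINT p. herm (v p) (z p)) = (LINT s. LINT \<xi>. herm (v (s, \<xi>)) (z (s, \<xi>)))"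
  by (rule herm_integral_R2[OF s(2,4)])
 also have "\<dots> = (LINT s. 2 * pi * (LINT x. herm (u (s, x)) (w (s, x))))"
 proof (rule integral_cong_AE)
  show "AE s in lborel. (LINT \<xi>. herm (v (s, \<xi>)) (z (s, \<xi>))) = 2 * pi * (LINT x. herm (u (s, x)) (w (s, x)))"
  proof -
   have "AE s in lborel. is_fourier_L2 (\<lambda>x. u (s, x)) (\<lambda>\<xi>. v (s, \<xi>))" "AE s in lborel. is_fourier_L2 (\<lambda>x. w (s, x)) (\<lambda>\<xi>. z (s, \<xi>))"
    using 1 2 by (auto simp: partial_FT_def)
   then show ?thesis by eventually_elim (rule FT_Parseval)
  qed
 qed (unfold herm_def, measurable)
 also have "\<dots> = 2 * pi * (LINT p. herm (u p) (w p))"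
  unfolding herm_integral_R2(2)[OF s(1,3)] by simp
 finally show ?thesis .
qed

context kalman
begin

text \<open>Duhamel's formula: the Fourier transform of the state at time \<open>t\<close> that is reached from rest; \<open>v\<close> is the transform in \<open>x\<close> of
the control.\<close>

definition input_map :: "real \<Rightarrow> (real \<times> real \<Rightarrow> complex^'m) \<Rightarrow> real \<Rightarrow> complex^'n" where
 "input_map t v \<xi> = (LINT s. indicator {0<..<t} s *\<^sub>R Es ((t - s) * \<xi>) (Bc (v (s, \<xi>))))"

text \<open>The transform in \<open>x\<close> of \<open>B\<^sup>T q\<close> for the adjoint solution with final datum \<open>g\<close> at time \<open>t\<close>, extended by \<open>0\<close> to all times.\<close>

definition observe :: "real \<Rightarrow> (real \<Rightarrow> complex^'n) \<Rightarrow> real \<times> real \<Rightarrow> complex^'m" where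
 "observe t g z = indicator {0<..<t} (fst z) *\<^sub>R Bt (Ev ((t - fst z) * snd z) (g (snd z)))"

text \<open>The Fourier side of \<open>\<Y>\<^sub>K\<^sup>-\<close> and of \<open>\<Y>\<^sub>K\<^sup>+\<close>.\<close>

definition minus_sq :: "(real \<Rightarrow> complex^'n) \<Rightarrow> bool" where
 "minus_sq g \<longleftrightarrow> g \<in> borel_measurable borel \<and> sqint (\<lambda>\<xi>. Dm (mu \<xi>) (g \<xi>))"

definition plus_sq :: "(real \<Rightarrow> complex^'n) \<Rightarrow> bool" where
 "plus_sq y \<longleftrightarrow> y \<in> borel_measurable borel \<and> sqint (\<lambda>\<xi>. Dm (1 / mu \<xi>) (y \<xi>))"

lemma Dm_inverse: "\<xi> \<noteq> 0 \<Longrightarrow> Dm (mu \<xi>) (Dm (1 / mu \<xi>) z) = z" "\<xi> \<noteq> 0 \<Longrightarrow> Dm (1 / mu \<xi>) (Dm (mu \<xi>) z) = z"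
 using mu_range(3)[of \<xi>] by (simp_all add: Dm_Dm)

lemma AE_nonzero: "AE \<xi> in lborel. \<xi> \<noteq> (0::real)"
 by (rule AE_lborel_singleton)

lemma Bt_Ev_bound: "\<exists>C>0. \<forall>s \<xi> z. \<bar>s\<bar> \<le> T \<longrightarrow> norm (Bt (Ev (s * \<xi>) z)) \<le> C * norm (Dm (mu \<xi>) z)"
proof -
 obtain b where b: "b \<ge> 0" "\<And>\<mu> z. norm (Bt z) \<le> b * norm (Dm \<mu> z)" using Bt_bound by blast
 obtain C where C: "C \<ge> 0" "\<And>s \<xi> z. \<bar>s\<bar> \<le> T \<Longrightarrow> norm (Dm (mu \<xi>) (Ev (s * \<xi>) z)) \<le> C * norm (Dm (mu \<xi>) z)"
  using Dm_Ev_bound by blast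
 have "norm (Bt (Ev (s * \<xi>) z)) \<le> (b * C + 1) * norm (Dm (mu \<xi>) z)" if "\<bar>s\<bar> \<le> T" for s \<xi> z
 proof -
  have "norm (Bt (Ev (s * \<xi>) z)) \<le> b * (C * norm (Dm (mu \<xi>) z))"
   by (rule order_trans[OF b(2)[of _ "mu \<xi>"] mult_left_mono[OF C(2)[OF that] b(1)]])
  then show ?thesis by (simp add: distrib_right add_increasing2)
 qed
 then show ?thesis using b(1) C(1) by (intro exI[of _ "b * C + 1"]) (auto simp: add_nonneg_pos)
qed

lemma observe_measurable [measurable]:
 assumes [measurable]: "g \<in> borel_measurable borel"
 shows "observe t g \<in> borel_measurable borel" "observe t g \<in> borel_measurable (borel \<Otimes>\<^sub>M borel)"
proof -
 show 1: "observe t g \<in> borel_measurable (borel \<Otimes>\<^sub>M borel)" unfolding observe_def[abs_def] by measurable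
 then show "observe t g \<in> borel_measurable borel" by (simp add: borel_prod)
qed

lemma observe_bound:
 "\<exists>C>0. \<forall>g. minus_sq g \<longrightarrow> sqint (observe t g) \<and> l2norm (observe t g) \<le> C * l2norm (\<lambda>\<xi>. Dm (mu \<xi>) (g \<xi>))"
proof -
 obtain C where C: "C > 0" "\<And>s \<xi> z. \<bar>s\<bar> \<le> t \<Longrightarrow> norm (Bt (Ev (s * \<xi>) z)) \<le> C * norm (Dm (mu \<xi>) z)"
  using Bt_Ev_bound[of t] by blast
 define C' where "C' = C * sqrt \<bar>t\<bar> + 1"
 have C': "C' > 0" using C(1) by (simp add: C'_def add_nonneg_pos)
 have "sqint (observe t g) \<and> l2norm (observe t g) \<le> C' * l2norm (\<lambda>\<xi>. Dm (mu \<xi>) (g \<xi>))" if g: "minus_sq g" for g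
 proof -
  have [measurable]: "g \<in> borel_measurable borel" and gs: "sqint (\<lambda>\<xi>. Dm (mu \<xi>) (g \<xi>))" using g by (auto simp: minus_sq_def)
  let ?G = "l2norm (\<lambda>\<xi>. Dm (mu \<xi>) (g \<xi>))"
  have "(\<integral>\<^sup>+z. ennreal ((norm (observe t g z))\<^sup>2)) = (\<integral>\<^sup>+s. \<integral>\<^sup>+\<xi>. ennreal ((norm (observe t g (s, \<xi>)))\<^sup>2))"
   by (rule nn_integral_R2) measurable
  also have "\<dots> \<le> (\<integral>\<^sup>+s. ennreal (C\<^sup>2) * ennreal (?G\<^sup>2) * indicator {0<..<t} s)"
  proof (rule nn_integral_mono)
   fix s
   have "(\<integral>\<^sup>+\<xi>. ennreal ((norm (observe t g (s, \<xi>)))\<^sup>2)) \<le> (\<integral>\<^sup>+\<xi>. ennreal (C\<^sup>2) * indicator {0<..<t} s * ennreal ((norm (Dm (mu \<xi>) (g \<xi>)))\<^sup>2))"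
   proof (rule nn_integral_mono)
    fix \<xi>
    show "ennreal ((norm (observe t g (s, \<xi>)))\<^sup>2) \<le> ennreal (C\<^sup>2) * indicator {0<..<t} s * ennreal ((norm (Dm (mu \<xi>) (g \<xi>)))\<^sup>2)"
    proof (cases "s \<in> {0<..<t}")
     case True
     then have "norm (Bt (Ev ((t - s) * \<xi>) (g \<xi>))) \<le> C * norm (Dm (mu \<xi>) (g \<xi>))" by (intro C) auto
     then have "(norm (Bt (Ev ((t - s) * \<xi>) (g \<xi>))))\<^sup>2 \<le> C\<^sup>2 * (norm (Dm (mu \<xi>) (g \<xi>)))\<^sup>2"
      by (metis norm_ge_zero power_mono power_mult_distrib)
     then show ?thesis using True by (simp add: observe_def ennreal_mult[symmetric] ennreal_leI)
    qed (simp add: observe_def)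
   qed
   also have "\<dots> = ennreal (C\<^sup>2) * indicator {0<..<t} s * ennreal (?G\<^sup>2)"
    using L2_normsq_eq_l2norm[OF gs] by (subst nn_integral_cmult) (auto simp: L2_normsq_UNIV)
   finally show "(\<integral>\<^sup>+\<xi>. ennreal ((norm (observe t g (s, \<xi>)))\<^sup>2)) \<le> ennreal (C\<^sup>2) * ennreal (?G\<^sup>2) * indicator {0<..<t} s"
    by (simp add: mult_ac)
  qed
  also have "\<dots> \<le> ennreal (C\<^sup>2) * ennreal (?G\<^sup>2) * ennreal \<bar>t\<bar>"
   by (subst nn_integral_cmult_indicator) (auto intro!: mult_left_mono simp: emeasure_Ioo)
  also have "\<dots> = ennreal ((C * sqrt \<bar>t\<bar> * ?G)\<^sup>2)" by (simp add: ennreal_mult[symmetric] power_mult_distrib mult_ac)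
  finally have le: "(\<integral>\<^sup>+z. ennreal ((norm (observe t g z))\<^sup>2)) \<le> ennreal ((C * sqrt \<bar>t\<bar> * ?G)\<^sup>2)" .
  have s: "sqint (observe t g)"
   unfolding sqint_iff_nn using le by (auto simp: less_top[symmetric] top_unique)
  have "(l2norm (observe t g))\<^sup>2 \<le> (C * sqrt \<bar>t\<bar> * ?G)\<^sup>2"
   using le L2_normsq_eq_l2norm[OF s] by (simp add: L2_normsq_UNIV)
  then have "l2norm (observe t g) \<le> C * sqrt \<bar>t\<bar> * ?G" by (rule power2_le_imp_le) (use C in auto)
  also have "\<dots> \<le> C' * ?G" by (intro mult_right_mono) (auto simp: C'_def)
  finally show ?thesis using s by blast
 qed
 then show ?thesis using C' by blast
qed

lemma Es_bounded_linear: "bounded_linear (\<lambda>w. Es \<theta> (Bc w))"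
proof (rule linear_conv_bounded_linear[THEN iffD1], rule linearI)
 show "Es \<theta> (Bc (x + y)) = Es \<theta> (Bc x) + Es \<theta> (Bc y)" for x y by (simp add: op_add Es_add)
 show "Es \<theta> (Bc (r *\<^sub>R x)) = r *\<^sub>R Es \<theta> (Bc x)" for r x by (simp add: scaleR_vec op_scale Es_scale)
qed

lemma Es_Bc_bounded: "\<exists>C\<ge>0. \<forall>\<theta> w. norm (Es \<theta> (Bc w)) \<le> C * norm w"
proof -
 have "\<forall>l. \<exists>c\<ge>0. \<forall>z. norm (Qc l z) \<le> c * norm z" unfolding Qc_def using complex_matrix_bounded by blast
 then obtain c where c: "\<And>l. c l \<ge> 0" "\<And>l z. norm (Qc l z) \<le> c l * norm z" by metis
 obtain b where b: "b \<ge> 0" "\<And>w. norm (Bc w) \<le> b * norm w" unfolding Bc_def using complex_matrix_bounded by blast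
 have "norm (Es \<theta> (Bc w)) \<le> (\<Sum>l\<in>\<Lambda>. c l * b) * norm w" for \<theta> w
  unfolding Es_def sum_distrib_right
 proof (rule order_trans[OF norm_sum], intro sum_mono)
  fix l
  have "norm (Qc l (Bc w)) \<le> c l * (b * norm w)" by (intro order_trans[OF c(2)] mult_left_mono b c)
  then show "norm (cis (- (\<theta> * l)) *s Qc l (Bc w)) \<le> c l * b * norm w" by (simp add: norm_vec_scale mult.assoc)
 qed
 then show ?thesis using c(1) b(1) by (intro exI[of _ "\<Sum>l\<in>\<Lambda>. c l * b"]) (simp add: sum_nonneg)
qed

lemma input_integrable:
 assumes v: "sqint (\<lambda>s. v (s, \<xi>))"
 shows "integrable lborel (\<lambda>s. indicator {0<..<t} s *\<^sub>R Es ((t - s) * \<xi>) (Bc (v (s, \<xi>))))"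
  "integrable lborel (\<lambda>s. indicator {0<..<t} s *\<^sub>R v (s, \<xi>))"
proof -
 note [measurable] = sqint_measurable[OF v]
 have i: "sqint (\<lambda>s. indicator {0<..<t} s :: real)"
 proof -
  have "(norm (indicator {0<..<t} x :: real))\<^sup>2 = indicator {0<..<t} x" for x by (simp split: split_indicator)
  then show ?thesis unfolding sqint_def by (simp add: integrable_real_indicator emeasure_Ioo)
 qed
 note nm = sqint_norm_mult_integrable[OF i v]
 show "integrable lborel (\<lambda>s. indicator {0<..<t} s *\<^sub>R v (s, \<xi>))"
  by (rule Bochner_Integration.integrable_bound[OF nm]) auto
 obtain C where C: "C \<ge> 0" "\<And>\<theta> w. norm (Es \<theta> (Bc w)) \<le> C * norm w" using Es_Bc_bounded by blast
 have "integrable lborel (\<lambda>s. C * (norm (indicator {0<..<t} s :: real) * norm (v (s, \<xi>))))" using nm by simp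
 then show "integrable lborel (\<lambda>s. indicator {0<..<t} s *\<^sub>R Es ((t - s) * \<xi>) (Bc (v (s, \<xi>))))"
  by (rule Bochner_Integration.integrable_bound) (use C in \<open>auto split: split_indicator\<close>)
qed

lemma herm_bounded_linear: "bounded_linear (\<lambda>v. herm v w)"
proof (rule bounded_linear_intro[of _ "norm w"])
 show "herm (x + y) w = herm x w + herm y w" for x y by (rule herm_add)
 show "herm (r *\<^sub>R x) w = r *\<^sub>R herm x w" for r x by (simp add: scaleR_vec herm_scale scaleR_conv_of_real)
 show "norm (herm x w) \<le> norm x * norm w" for x by (rule norm_herm_le)
qed

lemma herm_input_map:
 assumes v: "sqint (\<lambda>s. v (s, \<xi>))"
 shows "herm (input_map t v \<xi>) z = (LINT s. herm (v (s, \<xi>)) (indicator {0<..<t} s *\<^sub>R Bt (Ev ((t - s) * \<xi>) z)))"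
proof -
 have "herm (input_map t v \<xi>) z = (LINT s. herm (indicator {0<..<t} s *\<^sub>R Es ((t - s) * \<xi>) (Bc (v (s, \<xi>)))) z)"
  unfolding input_map_def by (rule integral_bounded_linear[OF herm_bounded_linear input_integrable(1)[OF v], symmetric])
 also have "\<dots> = (LINT s. herm (v (s, \<xi>)) (indicator {0<..<t} s *\<^sub>R Bt (Ev ((t - s) * \<xi>) z)))"
  by (intro Bochner_Integration.integral_cong refl) (simp add: scaleR_vec herm_scale herm_Es herm_Bc)
 finally show ?thesis .
qed

lemma input_map_measurable [measurable]:
 assumes "v \<in> borel_measurable borel" shows "input_map t v \<in> borel_measurable borel"
proof -
 note [measurable] = borel_R2[OF assms]
 show ?thesis unfolding input_map_def[abs_def] by measurable
qed

text \<open>The weighted norm of the state is tested against the state itself; duality moves the weight to the observation, where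
\<open>Bt_Ev_bound\<close> applies.\<close>

lemma input_map_bound:
 "\<exists>C>0. \<forall>v. sqint v \<longrightarrow> sqint (\<lambda>\<xi>. Dm (1 / mu \<xi>) (input_map t v \<xi>)) \<and> l2norm (\<lambda>\<xi>. Dm (1 / mu \<xi>) (input_map t v \<xi>)) \<le> C * l2norm v"
proof -
 obtain C where C: "C > 0" "\<And>s \<xi> z. \<bar>s\<bar> \<le> t \<Longrightarrow> norm (Bt (Ev (s * \<xi>) z)) \<le> C * norm (Dm (mu \<xi>) z)"
  using Bt_Ev_bound[of t] by blast
 define C' where "C' = C * sqrt \<bar>t\<bar> + 1"
 have C': "C' > 0" using C(1) by (simp add: C'_def add_nonneg_pos)
 have "sqint (\<lambda>\<xi>. Dm (1 / mu \<xi>) (input_map t v \<xi>)) \<and> l2norm (\<lambda>\<xi>. Dm (1 / mu \<xi>) (input_map t v \<xi>)) \<le> C' * l2norm v"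
  if v: "sqint v" for v
 proof -
  note [measurable] = sqint_measurable[OF v] borel_R2[OF sqint_measurable[OF v]]
  let ?y = "\<lambda>\<xi>. Dm (1 / mu \<xi>) (input_map t v \<xi>)"
  have pt: "norm (?y \<xi>) \<le> C * (LINT s. norm (indicator {0<..<t} s *\<^sub>R v (s, \<xi>)))"
   if vs: "sqint (\<lambda>s. v (s, \<xi>))" and x: "\<xi> \<noteq> 0" for \<xi>
  proof -
   let ?I = "LINT s. norm (indicator {0<..<t} s *\<^sub>R v (s, \<xi>))"
   have "(norm (?y \<xi>))\<^sup>2 = norm (herm (?y \<xi>) (?y \<xi>))" by (simp only: herm_self norm_of_real abs_power2)
   also have "herm (?y \<xi>) (?y \<xi>) = herm (input_map t v \<xi>) (Dm (1 / mu \<xi>) (?y \<xi>))" by (rule herm_Dm)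
   also have "\<dots> = (LINT s. herm (v (s, \<xi>)) (indicator {0<..<t} s *\<^sub>R Bt (Ev ((t - s) * \<xi>) (Dm (1 / mu \<xi>) (?y \<xi>)))))"
    by (rule herm_input_map[OF vs])
   also have "norm \<dots> \<le> (LINT s. norm (indicator {0<..<t} s *\<^sub>R v (s, \<xi>)) * (C * norm (?y \<xi>)))"
   proof (rule norm_integral_le)
    show "integrable lborel (\<lambda>s. norm (indicator {0<..<t} s *\<^sub>R v (s, \<xi>)) * (C * norm (?y \<xi>)))"
     using input_integrable(2)[OF vs] by (intro integrable_mult_left integrable_norm) auto
    fix s
    show "norm (herm (v (s, \<xi>)) (indicator {0<..<t} s *\<^sub>R Bt (Ev ((t - s) * \<xi>) (Dm (1 / mu \<xi>) (?y \<xi>)))))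
     \<le> norm (indicator {0<..<t} s *\<^sub>R v (s, \<xi>)) * (C * norm (?y \<xi>))"
    proof (cases "s \<in> {0<..<t}")
     case True
     have "norm (Bt (Ev ((t - s) * \<xi>) (Dm (1 / mu \<xi>) (?y \<xi>)))) \<le> C * norm (Dm (mu \<xi>) (Dm (1 / mu \<xi>) (?y \<xi>)))"
      using True by (intro C) auto
     also have "Dm (mu \<xi>) (Dm (1 / mu \<xi>) (?y \<xi>)) = ?y \<xi>" by (rule Dm_inverse[OF x])
     finally have "norm (v (s, \<xi>)) * norm (Bt (Ev ((t - s) * \<xi>) (Dm (1 / mu \<xi>) (?y \<xi>)))) \<le> norm (v (s, \<xi>)) * (C * norm (?y \<xi>))"
      by (intro mult_left_mono) auto
     then show ?thesis using True order_trans[OF norm_herm_le] by simp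
    qed simp
   qed
   also have "\<dots> = ?I * (C * norm (?y \<xi>))" by simp
   finally have "norm (?y \<xi>) * norm (?y \<xi>) \<le> (C * ?I) * norm (?y \<xi>)" by (simp add: power2_eq_square mult_ac)
   moreover have "0 \<le> C * ?I" using C by (intro mult_nonneg_nonneg Bochner_Integration.integral_nonneg) auto
   ultimately show ?thesis by (cases "norm (?y \<xi>) = 0") auto
  qed
  have "(\<integral>\<^sup>+\<xi>. ennreal ((norm (?y \<xi>))\<^sup>2)) \<le> (\<integral>\<^sup>+\<xi>. ennreal (C\<^sup>2 * \<bar>t\<bar>) * (\<integral>\<^sup>+s. ennreal ((norm (v (s, \<xi>)))\<^sup>2)))"
  proof (rule nn_integral_mono_AE)
   show "AE \<xi> in lborel. ennreal ((norm (?y \<xi>))\<^sup>2) \<le> ennreal (C\<^sup>2 * \<bar>t\<bar>) * (\<integral>\<^sup>+s. ennreal ((norm (v (s, \<xi>)))\<^sup>2))"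
    using sqint_section'[OF v] AE_nonzero
   proof eventually_elim
    case (elim \<xi>)
    note [measurable] = sqint_measurable[OF elim(1)]
    let ?I = "LINT s. norm (indicator {0<..<t} s *\<^sub>R v (s, \<xi>))"
    have ind: "sqint (\<lambda>s. indicator {0<..<t} s :: real)" and indn: "l2norm (\<lambda>s. indicator {0<..<t} s :: real) \<le> sqrt \<bar>t\<bar>"
    proof -
     have e: "(norm (indicator {0<..<t} x :: real))\<^sup>2 = indicator {0<..<t} x" for x by (simp split: split_indicator)
     show "sqint (\<lambda>s. indicator {0<..<t} s :: real)"
      unfolding sqint_def e by (simp add: integrable_real_indicator emeasure_Ioo)
     show "l2norm (\<lambda>s. indicator {0<..<t} s :: real) \<le> sqrt \<bar>t\<bar>" unfolding l2norm_def e by (cases "t \<ge> 0") (auto simp: measure_def emeasure_Ioo ennreal_neg)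
    qed
    have "?I \<le> sqrt \<bar>t\<bar> * l2norm (\<lambda>s. v (s, \<xi>))"
    proof -
     have "?I = (LINT s. norm (indicator {0<..<t} s :: real) * norm (v (s, \<xi>)))" by simp
     also have "\<dots> \<le> l2norm (\<lambda>s. indicator {0<..<t} s :: real) * l2norm (\<lambda>s. v (s, \<xi>))"
      by (rule l2_Cauchy_Schwarz[OF ind elim(1)])
     also have "\<dots> \<le> sqrt \<bar>t\<bar> * l2norm (\<lambda>s. v (s, \<xi>))" by (intro mult_right_mono indn) auto
     finally show ?thesis .
    qed
    then have "norm (?y \<xi>) \<le> C * (sqrt \<bar>t\<bar> * l2norm (\<lambda>s. v (s, \<xi>)))"
     using pt[OF elim] C(1) by (meson less_imp_le mult_left_mono order_trans)
    then have "(norm (?y \<xi>))\<^sup>2 \<le> (C * (sqrt \<bar>t\<bar> * l2norm (\<lambda>s. v (s, \<xi>))))\<^sup>2" by (rule power_mono) simp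
    also have "\<dots> = C\<^sup>2 * \<bar>t\<bar> * (l2norm (\<lambda>s. v (s, \<xi>)))\<^sup>2" by (simp add: power_mult_distrib)
    finally show ?case
     using L2_normsq_eq_l2norm[OF elim(1)] by (simp add: L2_normsq_UNIV ennreal_mult[symmetric] ennreal_leI)
   qed
  qed
  also have "\<dots> = ennreal (C\<^sup>2 * \<bar>t\<bar>) * (\<integral>\<^sup>+\<xi>. \<integral>\<^sup>+s. ennreal ((norm (v (s, \<xi>)))\<^sup>2))"
   by (rule nn_integral_cmult) measurable
  also have "(\<integral>\<^sup>+\<xi>. \<integral>\<^sup>+s. ennreal ((norm (v (s, \<xi>)))\<^sup>2)) = ennreal ((l2norm v)\<^sup>2)"
   using nn_integral_R2'[of "\<lambda>z. ennreal ((norm (v z))\<^sup>2)"] L2_normsq_eq_l2norm[OF v] by (simp add: L2_normsq_UNIV)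
  also have "ennreal (C\<^sup>2 * \<bar>t\<bar>) * ennreal ((l2norm v)\<^sup>2) = ennreal ((C * sqrt \<bar>t\<bar> * l2norm v)\<^sup>2)"
   by (simp add: ennreal_mult[symmetric] power_mult_distrib)
  finally have le: "(\<integral>\<^sup>+\<xi>. ennreal ((norm (?y \<xi>))\<^sup>2)) \<le> ennreal ((C * sqrt \<bar>t\<bar> * l2norm v)\<^sup>2)" .
  have s: "sqint ?y"
   unfolding sqint_iff_nn using le by (auto simp: less_top[symmetric] top_unique)
  have "(l2norm ?y)\<^sup>2 \<le> (C * sqrt \<bar>t\<bar> * l2norm v)\<^sup>2"
   using le L2_normsq_eq_l2norm[OF s] by (simp add: L2_normsq_UNIV)
  then have "l2norm ?y \<le> C * sqrt \<bar>t\<bar> * l2norm v" by (rule power2_le_imp_le) (use C in auto)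
  also have "\<dots> \<le> C' * l2norm v" by (intro mult_right_mono) (auto simp: C'_def)
  finally show ?thesis using s by blast
 qed
 then show ?thesis using C' by blast
qed

lemma input_map_plus_sq: "sqint v \<Longrightarrow> plus_sq (input_map t v)"
 using input_map_bound[of t] by (auto simp: plus_sq_def sqint_measurable)

lemma input_map_diff:
 assumes u: "sqint u" and v: "sqint v"
 shows "AE \<xi> in lborel. input_map t (\<lambda>z. u z - v z) \<xi> = input_map t u \<xi> - input_map t v \<xi>"
 using sqint_section'[OF u] sqint_section'[OF v]
proof eventually_elim
 case (elim \<xi>)
 have sub: "Es \<theta> (Bc (x - y)) = Es \<theta> (Bc x) - Es \<theta> (Bc y)" for \<theta> x y
  by (rule linear_diff[OF bounded_linear.linear[OF Es_bounded_linear]])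
 show ?case
  unfolding input_map_def sub scaleR_right_diff_distrib
  using input_integrable(1)[OF elim(1), of t] input_integrable(1)[OF elim(2), of t] by simp
qed

lemma pairing_integrable:
 assumes y: "plus_sq y" and g: "minus_sq g"
 shows "integrable lborel (\<lambda>\<xi>. herm (y \<xi>) (g \<xi>))"
  "(LINT \<xi>. herm (y \<xi>) (g \<xi>)) = (LINT \<xi>. herm (Dm (1 / mu \<xi>) (y \<xi>)) (Dm (mu \<xi>) (g \<xi>)))"
proof -
 have [measurable]: "y \<in> borel_measurable borel" "g \<in> borel_measurable borel"
  and s: "sqint (\<lambda>\<xi>. Dm (1 / mu \<xi>) (y \<xi>))" "sqint (\<lambda>\<xi>. Dm (mu \<xi>) (g \<xi>))"
  using y g by (auto simp: plus_sq_def minus_sq_def)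
 have [measurable]: "(\<lambda>\<xi>. herm (y \<xi>) (g \<xi>)) \<in> borel_measurable borel"
   "(\<lambda>\<xi>. herm (Dm (1 / mu \<xi>) (y \<xi>)) (Dm (mu \<xi>) (g \<xi>))) \<in> borel_measurable borel"
  unfolding herm_def by measurable
 have ae: "AE \<xi> in lborel. herm (y \<xi>) (g \<xi>) = herm (Dm (1 / mu \<xi>) (y \<xi>)) (Dm (mu \<xi>) (g \<xi>))"
  using AE_nonzero by eventually_elim (simp add: herm_Dm Dm_inverse)
 show "(LINT \<xi>. herm (y \<xi>) (g \<xi>)) = (LINT \<xi>. herm (Dm (1 / mu \<xi>) (y \<xi>)) (Dm (mu \<xi>) (g \<xi>)))"
  by (rule integral_cong_AE[OF _ _ ae]) measurable
 show "integrable lborel (\<lambda>\<xi>. herm (y \<xi>) (g \<xi>))"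
  by (subst integrable_cong_AE[OF _ _ ae]) (auto intro: herm_integrable s)
qed

text \<open>On the Fourier side \<open>Es\<close> is the adjoint of \<open>Ev\<close>; Parseval's identity in \<open>x\<close> returns to \<open>u\<close> and \<open>w\<close>.\<close>

lemma input_map_duality:
 assumes uv: "partial_FT u v" and g: "minus_sq g" and wo: "partial_FT w (observe t g)"
 shows "(LINT \<xi>. herm (input_map t v \<xi>) (g \<xi>)) = 2 * pi * (LINT z. herm (u z) (w z))"
proof -
 have v: "sqint v" and o: "sqint (observe t g)" using uv wo by (auto simp: partial_FT_def)
 have [measurable]: "g \<in> borel_measurable borel" using g by (simp add: minus_sq_def)
 note [measurable] = sqint_measurable[OF v] borel_R2[OF sqint_measurable[OF v]]
 have "(LINT \<xi>. herm (input_map t v \<xi>) (g \<xi>)) = (LINT \<xi>. LINT s. herm (v (s, \<xi>)) (observe t g (s, \<xi>)))"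
 proof (rule integral_cong_AE)
  show "AE \<xi> in lborel. herm (input_map t v \<xi>) (g \<xi>) = (LINT s. herm (v (s, \<xi>)) (observe t g (s, \<xi>)))"
   using sqint_section'[OF v] by eventually_elim (simp add: herm_input_map observe_def)
 qed (unfold herm_def, measurable)
 also have "\<dots> = (LINT z. herm (v z) (observe t g z))"
  by (rule herm_integral_R2(3)[OF v o, symmetric])
 also have "\<dots> = 2 * pi * (LINT z. herm (u z) (w z))"
  by (rule partial_FT_Parseval[OF uv wo])
 finally show ?thesis .
qed

end

section \<open>Controls from observability\<close>

lemma sqint_reflect_snd:
 fixes v :: "real \<times> real \<Rightarrow> 'b::euclidean_space"
 assumes v: "sqint v" shows "sqint (\<lambda>z. v (fst z, - snd z))"
proof -
 note [measurable] = sqint_measurable[OF v] borel_R2[OF sqint_measurable[OF v]]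
 have m: "(\<lambda>z. v (fst z, - snd z)) \<in> borel_measurable (borel \<Otimes>\<^sub>M borel)" by measurable
 then have m': "(\<lambda>z. v (fst z, - snd z)) \<in> borel_measurable borel" by (simp add: borel_prod)
 note [measurable] = m m'
 have "(\<integral>\<^sup>+z. ennreal ((norm (v (fst z, - snd z)))\<^sup>2)) = (\<integral>\<^sup>+s. \<integral>\<^sup>+x. ennreal ((norm (v (s, - x)))\<^sup>2))"
  by (subst nn_integral_R2) auto
 also have "\<dots> = (\<integral>\<^sup>+s. \<integral>\<^sup>+x. ennreal ((norm (v (s, x)))\<^sup>2))"
 proof (rule nn_integral_cong)
  fix s
  have [measurable]: "(\<lambda>x. ennreal ((norm (v (s, x)))\<^sup>2)) \<in> borel_measurable borel" by measurable
  show "(\<integral>\<^sup>+x. ennreal ((norm (v (s, - x)))\<^sup>2)) = (\<integral>\<^sup>+x. ennreal ((norm (v (s, x)))\<^sup>2))"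
   by (subst (2) nn_integral_real_affine[where c="-1" and t=0]) auto
 qed
 also have "\<dots> = (\<integral>\<^sup>+z. ennreal ((norm (v z))\<^sup>2))" by (subst nn_integral_R2) auto
 also have "\<dots> < \<infinity>" using v by (simp add: sqint_iff_nn)
 finally show ?thesis using m' by (simp add: sqint_iff_nn)
qed

lemma norm_vcnj: "norm (vcnj v) = norm v"
 by (rule power2_eq_imp_eq) (simp_all add: norm_vec_sq)

lemma vcnj_bounded_linear: "bounded_linear vcnj"
 by (rule bounded_linear_intro[of _ 1]) (simp_all add: vec_eq_iff norm_vcnj)

lemma vcnj_scale: "vcnj (c *s v) = cnj c *s vcnj v" by (simp add: vec_eq_iff)

lemma vcnj_cmat: "vcnj (cmat M *v v) = cmat M *v vcnj v"
 by (simp add: vec_eq_iff matrix_vector_mult_def map_matrix_def)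

lemma vcnj_sum: "vcnj (\<Sum>i\<in>I. f i) = (\<Sum>i\<in>I. vcnj (f i))"
 by (simp add: vec_eq_iff)

lemma cvec_Re: "cvec (\<chi> i. Re (v $ i)) = (1 / 2) *s (v + vcnj v)"
 by (simp add: vec_eq_iff cvec_def complex_eq_iff)

lemma norm_cvec: "norm (cvec v) = norm v"
 by (rule power2_eq_imp_eq) (simp_all add: norm_vec_sq cvec_def)

lemma sqint_mult_indicator:
 assumes w: "sqint w" and [measurable]: "S \<in> sets borel"
 shows "sqint (\<lambda>z. indicator S z *\<^sub>R w z)" "l2norm (\<lambda>z. indicator S z *\<^sub>R w z) \<le> l2norm w"
proof -
 note [measurable] = sqint_measurable[OF w]
 have m: "(\<lambda>z. indicator S z *\<^sub>R w z) \<in> borel_measurable borel" by measurable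
 have le: "AE z in lborel. norm (indicator S z *\<^sub>R w z) \<le> 1 * norm (w z)" by (auto split: split_indicator)
 show "sqint (\<lambda>z. indicator S z *\<^sub>R w z)" by (rule sqint_bound(1)[OF w m le])
 show "l2norm (\<lambda>z. indicator S z *\<^sub>R w z) \<le> l2norm w" using sqint_bound(2)[OF w m le] by simp
qed

context kalman
begin

lemma Dm_diff: "Dm \<mu> (z - w) = Dm \<mu> z - Dm \<mu> w"
 using Dm_add[of \<mu> "z - w" w] by (simp add: algebra_simps)

lemma observe_diff: "observe t (\<lambda>\<xi>. g \<xi> - g' \<xi>) z = observe t g z - observe t g' z"
proof -
 have "Ev \<theta> (x - y) = Ev \<theta> x - Ev \<theta> y" for \<theta> x y using Ev_add[of \<theta> "x - y" y] by (simp add: algebra_simps)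
 moreover have "Bt (x - y) = Bt x - Bt y" for x y using op_add(2)[of "x - y" y] by (simp add: algebra_simps)
 ultimately show ?thesis by (simp add: observe_def scaleR_diff_right)
qed

lemma minus_sq_inverse_weight:
 assumes h: "sqint h"
 shows "minus_sq (\<lambda>\<xi>. Dm (1 / mu \<xi>) (h \<xi>))" "l2norm (\<lambda>\<xi>. Dm (mu \<xi>) (Dm (1 / mu \<xi>) (h \<xi>))) = l2norm h"
proof -
 note [measurable] = sqint_measurable[OF h]
 have ae: "AE \<xi> in lborel. h \<xi> = Dm (mu \<xi>) (Dm (1 / mu \<xi>) (h \<xi>))"
  using AE_nonzero by eventually_elim (simp add: Dm_inverse)
 show "minus_sq (\<lambda>\<xi>. Dm (1 / mu \<xi>) (h \<xi>))"
  unfolding minus_sq_def by (intro conjI sqint_cong_AE[OF h _ ae]) measurable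
 show "l2norm (\<lambda>\<xi>. Dm (mu \<xi>) (Dm (1 / mu \<xi>) (h \<xi>))) = l2norm h"
  by (rule l2norm_cong_AE[OF _ _ ae, symmetric]) measurable
qed

text \<open>Up to the factor of Parseval's identity, the quadratic form of the Gramian is the energy observed in \<open>S\<close>.\<close>

lemma gramian_energy:
 assumes D: "sqint D" and w: "partial_FT w (observe T (\<lambda>\<xi>. Dm (1 / mu \<xi>) (D \<xi>)))"
  and u: "partial_FT (\<lambda>z. indicator S z *\<^sub>R w z) v"
 shows "(LINT \<xi>. Dm (1 / mu \<xi>) (input_map T v \<xi>) \<bullet> D \<xi>) = 2 * pi * (l2norm (\<lambda>z. indicator S z *\<^sub>R w z))\<^sup>2"
proof -
 have v: "sqint v" using u by (simp add: partial_FT_def)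
 have s: "sqint (\<lambda>\<xi>. Dm (1 / mu \<xi>) (input_map T v \<xi>))" using input_map_plus_sq[OF v] by (simp add: plus_sq_def)
 have "(LINT \<xi>. Dm (1 / mu \<xi>) (input_map T v \<xi>) \<bullet> D \<xi>) = Re (LINT \<xi>. herm (Dm (1 / mu \<xi>) (input_map T v \<xi>)) (D \<xi>))"
  unfolding inner_herm by (rule integral_Re[OF herm_integrable[OF s D]])
 also have "(LINT \<xi>. herm (Dm (1 / mu \<xi>) (input_map T v \<xi>)) (D \<xi>)) = (LINT \<xi>. herm (input_map T v \<xi>) (Dm (1 / mu \<xi>) (D \<xi>)))"
  by (simp only: herm_Dm)
 also have "\<dots> = 2 * pi * (LINT z. herm (indicator S z *\<^sub>R w z) (w z))"
  by (rule input_map_duality[OF u minus_sq_inverse_weight(1)[OF D] w])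
 also have "(LINT z. herm (indicator S z *\<^sub>R w z) (w z)) = (LINT z. complex_of_real ((norm (indicator S z *\<^sub>R w z))\<^sup>2))"
  by (intro Bochner_Integration.integral_cong refl)
    (auto simp: scaleR_vec herm_scale herm_self split: split_indicator)
 also have "\<dots> = complex_of_real ((l2norm (\<lambda>z. indicator S z *\<^sub>R w z))\<^sup>2)"
  unfolding l2norm_sq by (rule integral_complex_of_real)
 finally show ?thesis by simp
qed

text \<open>The control is the observation, restricted to \<open>\<omega>\<close>, of an adjoint solution whose final datum is \<open>h\<close> divided by the
weights. Observability makes the map from \<open>h\<close> to the weighted final state strongly monotone. For the
cost, the energy of the control is \<open>(2 \<pi>)\<^sup>-\<^sup>1\<close> times the pairing of \<open>h\<close> with the target, and observability bounds \<open>h\<close> by that energy.\<close>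

lemma control_exists:
 assumes om[measurable]: "\<omega> \<in> sets borel" and c0: "c0 > 0"
  and obs: "\<And>h w. sqint h \<Longrightarrow> partial_FT w (observe T (\<lambda>\<xi>. Dm (1 / mu \<xi>) (h \<xi>))) \<Longrightarrow>
    c0 * (l2norm h)\<^sup>2 \<le> (l2norm (\<lambda>z. indicator ({0<..<T} \<times> \<omega>) z *\<^sub>R w z))\<^sup>2"
  and d: "plus_sq d"
 shows "\<exists>u v. partial_FT u v \<and> (\<forall>z. z \<notin> {0<..<T} \<times> \<omega> \<longrightarrow> u z = 0) \<and> (AE \<xi> in lborel. input_map T v \<xi> = d \<xi>) \<and>
   (l2norm u)\<^sup>2 \<le> (l2norm (\<lambda>\<xi>. Dm (1 / mu \<xi>) (d \<xi>)))\<^sup>2 / (4 * pi\<^sup>2 * c0)"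
proof -
 let ?S = "{0<..<T} \<times> \<omega>"
 have S: "?S \<in> sets borel" by (simp add: borel_Times)
 define a where "a h \<xi> = Dm (1 / mu \<xi>) (h \<xi>)" for h \<xi>
 have am: "minus_sq (a h)" "l2norm (\<lambda>\<xi>. Dm (mu \<xi>) (a h \<xi>)) = l2norm h" if "sqint h" for h
  using minus_sq_inverse_weight[OF that] by (simp_all add: a_def[abs_def])
 have ad: "observe T (a (\<lambda>\<xi>. h \<xi> - k \<xi>)) = (\<lambda>z. observe T (a h) z - observe T (a k) z)" for h k
  by (simp add: a_def[abs_def] Dm_diff observe_diff fun_eq_iff)
 obtain C1 where C1: "C1 > 0" "\<And>g. minus_sq g \<Longrightarrow> sqint (observe T g)" "\<And>g. minus_sq g \<Longrightarrow> l2norm (observe T g) \<le> C1 * l2norm (\<lambda>\<xi>. Dm (mu \<xi>) (g \<xi>))"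
  using observe_bound[of T] by blast
 obtain C2 where C2: "C2 > 0" "\<And>v. sqint v \<Longrightarrow> sqint (\<lambda>\<xi>. Dm (1 / mu \<xi>) (input_map T v \<xi>))"
   "\<And>v. sqint v \<Longrightarrow> l2norm (\<lambda>\<xi>. Dm (1 / mu \<xi>) (input_map T v \<xi>)) \<le> C2 * l2norm v"
  using input_map_bound[of T] by blast
 define w where "w h = (SOME w. partial_FT w (observe T (a h)))" for h
 have w: "partial_FT (w h) (observe T (a h))" if "sqint h" for h
  unfolding w_def by (rule someI_ex[OF partial_FT_inverse_exists[OF C1(2)[OF am(1)[OF that]]]])
 have ws: "sqint (w h)" if "sqint h" for h using w[OF that] by (simp add: partial_FT_def)
 define u where "u h z = indicator ?S z *\<^sub>R w h z" for h z
 have us: "sqint (u h)" if "sqint h" for h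
  unfolding u_def[abs_def] by (rule sqint_mult_indicator(1)[OF ws[OF that] S])
 define v where "v h = (SOME v. partial_FT (u h) v)" for h
 have v: "partial_FT (u h) (v h)" if "sqint h" for h
  unfolding v_def by (rule someI_ex[OF partial_FT_exists[OF us[OF that]]])
 have vs: "sqint (v h)" if "sqint h" for h using v[OF that] by (simp add: partial_FT_def)
 define M where "M h \<xi> = Dm (1 / mu \<xi>) (input_map T (v h) \<xi>)" for h \<xi>
 have Ms: "sqint (M h)" if "sqint h" for h
  unfolding M_def[abs_def] by (rule C2(2)[OF vs[OF that]])
 have wd: "partial_FT (\<lambda>z. w h z - w k z) (observe T (a (\<lambda>\<xi>. h \<xi> - k \<xi>)))" if "sqint h" "sqint k" for h k
  unfolding ad by (rule partial_FT_diff[OF w[OF that(1)] w[OF that(2)]])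
 have ud: "u h z - u k z = indicator ?S z *\<^sub>R (w h z - w k z)" for h k z by (simp add: u_def scaleR_diff_right)
 have vd: "partial_FT (\<lambda>z. indicator ?S z *\<^sub>R (w h z - w k z)) (\<lambda>z. v h z - v k z)" if "sqint h" "sqint k" for h k
  using partial_FT_diff[OF v[OF that(1)] v[OF that(2)]] by (simp only: ud)
 have Md: "AE \<xi> in lborel. Dm (1 / mu \<xi>) (input_map T (\<lambda>z. v h z - v k z) \<xi>) = M h \<xi> - M k \<xi>" if "sqint h" "sqint k" for h k
  using input_map_diff[OF vs[OF that(1)] vs[OF that(2)], of T] by eventually_elim (simp add: M_def Dm_diff)
 have Mm: "(\<lambda>\<xi>. M h \<xi> - M k \<xi>) \<in> borel_measurable borel"
   "(\<lambda>\<xi>. Dm (1 / mu \<xi>) (input_map T (\<lambda>z. v h z - v k z) \<xi>)) \<in> borel_measurable borel" if "sqint h" "sqint k" for h k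
  using sqint_diff[OF Ms[OF that(1)] Ms[OF that(2)]] C2(2)[OF sqint_diff[OF vs[OF that(1)] vs[OF that(2)]]]
  by (auto intro: sqint_measurable)
 have "\<exists>h. sqint h \<and> (AE \<xi> in lborel. M h \<xi> = Dm (1 / mu \<xi>) (d \<xi>))"
 proof (rule coercive_solvable[where M=M and C="C2 * C1" and c="2 * pi * c0"])
  fix h k :: "real \<Rightarrow> complex^'n" assume hk: "sqint h" "sqint k"
  note D = sqint_diff[OF hk]
  have "l2norm (\<lambda>\<xi>. M h \<xi> - M k \<xi>) = l2norm (\<lambda>\<xi>. Dm (1 / mu \<xi>) (input_map T (\<lambda>z. v h z - v k z) \<xi>))"
   by (rule l2norm_cong_AE[OF Mm[OF hk] AE_symmetric[OF Md[OF hk]]])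
  also have "\<dots> \<le> C2 * l2norm (\<lambda>z. v h z - v k z)" by (rule C2(3)[OF sqint_diff[OF vs[OF hk(1)] vs[OF hk(2)]]])
  also have "l2norm (\<lambda>z. v h z - v k z) = sqrt (2 * pi) * l2norm (\<lambda>z. indicator ?S z *\<^sub>R (w h z - w k z))"
   by (rule partial_FT_l2norm[OF vd[OF hk]])
  also have "\<dots> \<le> sqrt (2 * pi) * l2norm (\<lambda>z. w h z - w k z)"
   by (intro mult_left_mono sqint_mult_indicator(2)[OF _ S] sqint_diff ws hk) auto
  also have "\<dots> = l2norm (observe T (a (\<lambda>\<xi>. h \<xi> - k \<xi>)))" by (rule partial_FT_l2norm[OF wd[OF hk], symmetric])
  also have "\<dots> \<le> C1 * l2norm (\<lambda>\<xi>. h \<xi> - k \<xi>)"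
   using C1(3)[OF am(1)[OF D]] am(2)[OF D] by simp
  finally show "l2norm (\<lambda>\<xi>. M h \<xi> - M k \<xi>) \<le> C2 * C1 * l2norm (\<lambda>\<xi>. h \<xi> - k \<xi>)"
   using C2(1) by (simp add: mult.assoc)
  have "2 * pi * c0 * (l2norm (\<lambda>\<xi>. h \<xi> - k \<xi>))\<^sup>2 \<le> 2 * pi * (l2norm (\<lambda>z. indicator ?S z *\<^sub>R (w h z - w k z)))\<^sup>2"
   using obs[OF D wd[OF hk, unfolded a_def[abs_def]]] by simp
  also have "\<dots> = (LINT \<xi>. Dm (1 / mu \<xi>) (input_map T (\<lambda>z. v h z - v k z) \<xi>) \<bullet> (h \<xi> - k \<xi>))"
   by (rule gramian_energy[OF D wd[OF hk, unfolded a_def[abs_def]] vd[OF hk], symmetric])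
  also have "\<dots> = (LINT \<xi>. (M h \<xi> - M k \<xi>) \<bullet> (h \<xi> - k \<xi>))"
  proof (rule integral_cong_AE)
   show "(\<lambda>\<xi>. (M h \<xi> - M k \<xi>) \<bullet> (h \<xi> - k \<xi>)) \<in> borel_measurable lborel"
    "(\<lambda>\<xi>. Dm (1 / mu \<xi>) (input_map T (\<lambda>z. v h z - v k z) \<xi>) \<bullet> (h \<xi> - k \<xi>)) \<in> borel_measurable lborel"
    using borel_measurable_inner[OF Mm(1)[OF hk] sqint_measurable[OF D]] borel_measurable_inner[OF Mm(2)[OF hk] sqint_measurable[OF D]]
    by (simp_all only: measurable_lborel2)
   show "AE \<xi> in lborel. Dm (1 / mu \<xi>) (input_map T (\<lambda>z. v h z - v k z) \<xi>) \<bullet> (h \<xi> - k \<xi>) = (M h \<xi> - M k \<xi>) \<bullet> (h \<xi> - k \<xi>)"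
    using Md[OF hk] by eventually_elim simp
  qed
  finally show "2 * pi * c0 * (l2norm (\<lambda>\<xi>. h \<xi> - k \<xi>))\<^sup>2 \<le> (LINT \<xi>. (M h \<xi> - M k \<xi>) \<bullet> (h \<xi> - k \<xi>))" .
 next
  show "sqint (M h)" if "sqint h" for h by (rule Ms[OF that])
  show "0 < 2 * pi * c0" using c0 by simp
  show "0 \<le> C2 * C1" using C1(1) C2(1) by simp
  show "sqint (\<lambda>\<xi>. Dm (1 / mu \<xi>) (d \<xi>))" using d by (simp add: plus_sq_def)
 qed
 then obtain h where h: "sqint h" and Mh: "AE \<xi> in lborel. M h \<xi> = Dm (1 / mu \<xi>) (d \<xi>)" by blast
 define E where "E = l2norm (\<lambda>\<xi>. Dm (1 / mu \<xi>) (d \<xi>))"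
 have "AE \<xi> in lborel. input_map T (v h) \<xi> = d \<xi>"
  using Mh AE_nonzero by eventually_elim (metis M_def Dm_inverse(1))
 moreover have "(l2norm (u h))\<^sup>2 \<le> E\<^sup>2 / (4 * pi\<^sup>2 * c0)"
 proof -
  have U1: "c0 * (l2norm h)\<^sup>2 \<le> (l2norm (u h))\<^sup>2"
   using obs[OF h w[OF h, unfolded a_def[abs_def]]] by (simp add: u_def[abs_def])
  have "2 * pi * (l2norm (u h))\<^sup>2 = (LINT \<xi>. M h \<xi> \<bullet> h \<xi>)"
   using gramian_energy[OF h w[OF h, unfolded a_def[abs_def]] v[OF h, unfolded u_def[abs_def]]]
   by (simp add: u_def[abs_def] M_def[abs_def])
  also have "\<dots> \<le> l2norm (M h) * l2norm h" by (rule sqint_inner_le[OF Ms[OF h] h])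
  also have "l2norm (M h) = E" unfolding E_def
   using Ms[OF h] d by (intro l2norm_cong_AE Mh) (auto simp: plus_sq_def sqint_measurable)
  finally have U2: "2 * pi * (l2norm (u h))\<^sup>2 \<le> E * l2norm h" .
  have "(2 * pi * (l2norm (u h))\<^sup>2)\<^sup>2 \<le> (E * l2norm h)\<^sup>2" by (rule power_mono[OF U2]) simp
  then have "c0 * (2 * pi * (l2norm (u h))\<^sup>2)\<^sup>2 \<le> E\<^sup>2 * (c0 * (l2norm h)\<^sup>2)"
   using c0 by (simp add: power_mult_distrib mult.left_commute)
  also have "\<dots> \<le> E\<^sup>2 * (l2norm (u h))\<^sup>2" by (intro mult_left_mono U1) simp
  finally have "(4 * pi\<^sup>2 * c0 * (l2norm (u h))\<^sup>2) * (l2norm (u h))\<^sup>2 \<le> E\<^sup>2 * (l2norm (u h))\<^sup>2"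
   by (simp add: power2_eq_square mult_ac)
  then have "4 * pi\<^sup>2 * c0 * (l2norm (u h))\<^sup>2 \<le> E\<^sup>2"
   using c0 by (cases "l2norm (u h) = 0") (auto dest: mult_right_le_imp_le)
  then show ?thesis using c0 by (simp add: field_simps)
 qed
 ultimately show ?thesis unfolding E_def
  using v[OF h] by (intro exI[of _ "u h"] exI[of _ "v h"]) (auto simp: u_def)
qed

lemma Es_Bc_vcnj: "Es \<theta> (Bc (vcnj w)) = vcnj (Es (- \<theta>) (Bc w))"
 by (simp add: Es_def Bc_def Qc_def vcnj_sum vcnj_scale vcnj_cmat cis_cnj)

text \<open>The complex conjugate of a control reaches the reflected conjugate of the target. For a symmetric target both agree, so
the average of the two controls reaches it as well.\<close>

lemma real_control:
 assumes uv: "partial_FT u v" and z0: "\<And>z. z \<notin> S \<Longrightarrow> u z = 0"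
  and im: "AE \<xi> in lborel. input_map T v \<xi> = d \<xi>" and sym: "AE \<xi> in lborel. d (- \<xi>) = vcnj (d \<xi>)"
 shows "\<exists>u' :: real \<times> real \<Rightarrow> real^'m. \<exists>v'. partial_FT (\<lambda>z. cvec (u' z)) v' \<and> (\<forall>z. z \<notin> S \<longrightarrow> u' z = 0) \<and>
   (AE \<xi> in lborel. input_map T v' \<xi> = d \<xi>) \<and> sqint u' \<and> l2norm u' \<le> l2norm u"
proof -
 define u' where "u' z = (\<chi> i. Re (u z $ i))" for z
 define v1 where "v1 z = vcnj (v (fst z, - snd z))" for z
 define v' where "v' z = (1 / 2) *s (v z + v1 z)" for z
 have u: "sqint u" and v: "sqint v" using uv by (auto simp: partial_FT_def)
 note [measurable] = sqint_measurable[OF u]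
 have v1: "sqint v1"
 proof (rule sqint_bound(1)[OF sqint_reflect_snd[OF v]])
  show "v1 \<in> borel_measurable borel" unfolding v1_def[abs_def]
   using borel_measurable_continuous_on[OF linear_continuous_on[OF vcnj_bounded_linear] sqint_measurable[OF sqint_reflect_snd[OF v]]] .
  show "AE z in lborel. norm (v1 z) \<le> 1 * norm (v (fst z, - snd z))"
   by (simp add: v1_def norm_vcnj)
 qed
 have half: "(1 / 2) *s x = (1 / 2) *\<^sub>R (x :: complex^'k)" for x by (simp add: scaleR_vec)
 have v': "sqint v'" unfolding v'_def[abs_def] half by (intro sqint_scaleR sqint_add v v1)
 have cu: "cvec (u' z) = (1 / 2) *s (u z + vcnj (u z))" for z unfolding u'_def by (rule cvec_Re)
 have le: "norm (u' z) \<le> norm (u z)" for z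
  by (rule power2_le_imp_le) (auto simp: norm_vec_sq u'_def cmod_power2 intro!: sum_mono)
 have [measurable]: "u' \<in> borel_measurable borel" unfolding u'_def[abs_def] by (subst measurable_vec_iff) simp
 have le': "AE z in lborel. norm (u' z) \<le> 1 * norm (u z)" using le by simp
 have u's: "sqint u'" by (rule sqint_bound(1)[OF u _ le']) measurable
 have cu's: "sqint (\<lambda>z. cvec (u' z))"
 proof (rule sqint_bound(1)[OF u, where C=1])
  show "(\<lambda>z. cvec (u' z)) \<in> borel_measurable borel"
   unfolding cvec_def by (subst measurable_vec_iff) simp
 qed (simp add: norm_cvec le)
 have "AE s in lborel. is_fourier_L2 (\<lambda>x. u (s, x)) (\<lambda>\<xi>. v (s, \<xi>))" using uv by (simp add: partial_FT_def)
 then have "AE s in lborel. is_fourier_L2 (\<lambda>x. cvec (u' (s, x))) (\<lambda>\<xi>. v' (s, \<xi>))"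
 proof eventually_elim
  case (elim s)
  show ?case unfolding cu v'_def v1_def fst_conv snd_conv
   by (intro FT_cmult FT_add elim FT_conj)
 qed
 then have pf: "partial_FT (\<lambda>z. cvec (u' z)) v'" using cu's v' by (simp add: partial_FT_def)
 have "AE \<xi> in lborel. input_map T v (- \<xi>) = d (- \<xi>)"
  using AE_lborel_affine[OF _ im, of "-1" 0] by simp
 moreover have "AE \<xi> in lborel. sqint (\<lambda>s. v (s, - \<xi>))"
  using AE_lborel_affine[OF _ sqint_section'[OF v], of "-1" 0] by simp
 ultimately have "AE \<xi> in lborel. input_map T v' \<xi> = d \<xi>"
  using im sym sqint_section'[OF v] sqint_section'[OF v1]
 proof eventually_elim
  case (elim \<xi>)
  have lin: "Es \<theta> (Bc ((1 / 2) *s (x + y))) = (1 / 2) *s (Es \<theta> (Bc x) + Es \<theta> (Bc y))" for \<theta> x y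
   by (simp add: op_scale op_add Es_add Es_scale)
  note i = input_integrable(1)[OF elim(5), of T] input_integrable(1)[OF elim(6), of T]
  have "input_map T v' \<xi> = (LINT s. (1 / 2) *\<^sub>R (indicator {0<..<T} s *\<^sub>R Es ((T - s) * \<xi>) (Bc (v (s, \<xi>))) + indicator {0<..<T} s *\<^sub>R Es ((T - s) * \<xi>) (Bc (v1 (s, \<xi>)))))"
   unfolding input_map_def v'_def lin unfolding half by (intro Bochner_Integration.integral_cong refl) (simp add: scaleR_add_right)
  also have "\<dots> = (1 / 2) *\<^sub>R (input_map T v \<xi> + input_map T v1 \<xi>)"
   unfolding input_map_def using i by simp
  also have "input_map T v1 \<xi> = (LINT s. vcnj (indicator {0<..<T} s *\<^sub>R Es ((T - s) * (- \<xi>)) (Bc (v (s, - \<xi>)))))"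
   unfolding input_map_def
   by (intro Bochner_Integration.integral_cong refl) (simp add: v1_def Es_Bc_vcnj scaleR_vec vcnj_scale)
  also have "\<dots> = vcnj (input_map T v (- \<xi>))"
   unfolding input_map_def
   by (rule integral_bounded_linear[OF vcnj_bounded_linear]) (rule input_integrable(1)[where v=v, OF elim(2)])
  also have "\<dots> = d \<xi>" using elim(1,4) by (simp add: vec_eq_iff)
  finally show ?case using elim(3) by (simp add: scaleR_add_right[symmetric] flip: scaleR_2)
 qed
 moreover have "l2norm u' \<le> l2norm u" using sqint_bound(2)[OF u _ le'] by simp
 ultimately show ?thesis using pf u's z0
  by (intro exI[of _ u'] exI[of _ v']) (auto simp: u'_def vec_eq_iff)
qed

end

section \<open>The weighted spaces and the free dynamics\<close>

lemma schwartz_regular: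
 fixes q :: "real \<Rightarrow> complex^'n"
 assumes "schwartz q" shows "integrable lborel q" "sqint q"
proof -
 obtain D where D: "D 0 = q" "\<And>k x. (D k has_vector_derivative D (Suc k) x) (at x)"
   "\<And>j k. bounded (range (\<lambda>x. x ^ j *\<^sub>R D k x))"
  using assms unfolding schwartz_def by auto
 have "continuous_on UNIV q"
  using D(1) D(2)[of 0] by (auto intro!: continuous_at_imp_continuous_on has_vector_derivative_continuous)
 then have [measurable]: "q \<in> borel_measurable borel" by (rule borel_measurable_continuous_onI)
 obtain C0 where C0: "\<And>x. norm (q x) \<le> C0"
  using D(3)[of 0 0] by (auto simp: bounded_iff D(1))
 obtain C2 where C2: "\<And>x. x\<^sup>2 * norm (q x) \<le> C2"
  using D(3)[of 2 0] by (auto simp: bounded_iff D(1))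
 define C where "C = C0 + C2"
 have pos: "0 < 1 + x\<^sup>2" for x :: real by (simp add: add_pos_nonneg)
 have le: "norm (q x) \<le> C * inverse (1 + x\<^sup>2)" for x
  using C0[of x] C2[of x] pos[of x] by (simp add: C_def field_simps)
 have i: "integrable lborel (\<lambda>x::real. inverse (1 + x\<^sup>2))"
  using integrable_inverse_1_plus_square by (simp add: set_integrable_def einterval_def)
 have C: "0 \<le> C" using order_trans[OF norm_ge_zero C0[of 0]] C2[of 0] by (simp add: C_def)
 show "integrable lborel q"
  by (rule Bochner_Integration.integrable_bound[OF integrable_mult_right[OF i, of C]]) (use le C pos in \<open>auto simp: abs_mult less_imp_le\<close>)
 have "integrable lborel (\<lambda>x. (norm (q x))\<^sup>2)"
 proof (rule Bochner_Integration.integrable_bound[OF integrable_mult_right[OF i, of "C0 * C"]])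
  have "(norm (q x))\<^sup>2 \<le> C0 * (C * inverse (1 + x\<^sup>2))" for x
   unfolding power2_eq_square[of "norm (q x)"] using order_trans[OF norm_ge_zero C0] by (intro mult_mono C0 le) auto
  then show "AE x in lborel. norm ((norm (q x))\<^sup>2) \<le> norm (C0 * C * inverse (1 + x\<^sup>2))"
   by (auto intro: order_trans[OF _ abs_ge_self] simp: mult.assoc)
 qed simp
 then show "sqint q" by (simp add: sqint_def)
qed

lemma mat_pow_scaled:
 fixes A :: "real^'n^'n"
 shows "mat_pow (map_matrix (\<lambda>a. c * complex_of_real a) A) k $ i $ j = c ^ k * complex_of_real (mat_pow A k $ i $ j)"
proof (induction k arbitrary: i j)
 case 0 then show ?case by (simp add: mat_def)
next
 case (Suc k)
 have "mat_pow (map_matrix (\<lambda>a. c * complex_of_real a) A) (Suc k) $ i $ j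
   = (\<Sum>l\<in>UNIV. (c * of_real (A $ i $ l)) * (c ^ k * of_real (mat_pow A k $ l $ j)))"
  by (simp add: matrix_matrix_mult_def Suc.IH)
 also have "\<dots> = c ^ Suc k * complex_of_real (mat_pow A (Suc k) $ i $ j)"
  by (simp add: matrix_matrix_mult_def sum_distrib_left mult_ac)
 finally show ?case .
qed

lemma adjoint_mode_constant:
 fixes f :: "real \<Rightarrow> complex"
 assumes "\<And>s. s \<in> {0..t} \<Longrightarrow> (f has_vector_derivative (- \<i> * of_real a) * f s) (at s within {0..t})"
  and s: "s \<in> {0..t}"
 shows "f s = cis ((t - s) * a) * f t"
proof -
 have "\<exists>c. \<forall>s\<in>{0..t}. cis (s * a) * f s = c"
 proof (rule has_vector_derivative_zero_constant)
  fix r assume r: "r \<in> {0..t}"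
  have "((\<lambda>r. cis (r * a)) has_vector_derivative (a *\<^sub>R (\<i> * cis (r * a)))) (at r within {0..t})"
  proof -
   have "((\<lambda>z. exp (\<i> * (z * of_real a))) has_field_derivative exp (\<i> * (of_real r * of_real a)) * (\<i> * of_real a)) (at (of_real r))"
    by (auto intro!: derivative_eq_intros)
   from has_vector_derivative_real_field[OF this] show ?thesis
    by (simp add: cis_conv_exp scaleR_conv_of_real mult_ac)
  qed
  then have "((\<lambda>r. cis (r * a) * f r) has_vector_derivative cis (r * a) * ((- \<i> * of_real a) * f r) + (a *\<^sub>R (\<i> * cis (r * a))) * f r) (at r within {0..t})"
   by (rule has_vector_derivative_mult[OF _ assms(1)[OF r]])
  then show "((\<lambda>r. cis (r * a) * f r) has_vector_derivative 0) (at r within {0..t})"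
   by (simp add: scaleR_conv_of_real mult_ac)
 qed (simp, blast)
 then obtain c where c: "\<And>s. s \<in> {0..t} \<Longrightarrow> cis (s * a) * f s = c" by blast
 have e: "cis (s * a) * f s = cis (t * a) * f t" using c[OF s] c[of t] s by simp
 have "f s = cis (- (s * a)) * (cis (s * a) * f s)" by (simp add: mult.assoc[symmetric] cis_mult)
 also have "\<dots> = cis (- (s * a)) * cis (t * a) * f t" unfolding e by (rule mult.assoc[symmetric])
 also have "cis (- (s * a)) * cis (t * a) = cis ((t - s) * a)"
  unfolding cis_mult by (simp add: left_diff_distrib)
 finally show ?thesis .
qed

context kalman
begin

lemma weighted_minus_norm:
 assumes [measurable]: "g \<in> borel_measurable borel"
 shows "Yminus_normsq_hat A B K g = (\<integral>\<^sup>+\<xi>. ennreal ((norm (Dm (mu \<xi>) (g \<xi>)))\<^sup>2))"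
proof -
 have "Yminus_normsq_hat A B K g = (\<integral>\<^sup>+\<xi>. (\<Sum>k\<le>K. ennreal (mu \<xi> ^ (2 * k) * (norm (pj k (g \<xi>)))\<^sup>2)))"
  unfolding Yminus_normsq_hat_def layer weight_mu pj_def[symmetric] by (subst nn_integral_sum) auto
 also have "\<dots> = (\<integral>\<^sup>+\<xi>. ennreal ((norm (Dm (mu \<xi>) (g \<xi>)))\<^sup>2))"
  by (intro nn_integral_cong) (simp add: norm_Dm mu_range)
 finally show ?thesis .
qed

lemma weighted_plus_norm:
 assumes [measurable]: "fourier_L2 y \<in> borel_measurable borel"
 shows "Yplus_normsq A B K y = (\<integral>\<^sup>+\<xi>. ennreal ((norm (Dm (1 / mu \<xi>) (fourier_L2 y \<xi>)))\<^sup>2))"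
proof -
 have "Yplus_normsq A B K y = (\<integral>\<^sup>+\<xi>. (\<Sum>k\<le>K. ennreal ((norm (pj k (fourier_L2 y \<xi>)))\<^sup>2 / mu \<xi> ^ (2 * k))))"
  unfolding Yplus_normsq_def layer weight_mu pj_def[symmetric] by (subst nn_integral_sum) auto
 also have "\<dots> = (\<integral>\<^sup>+\<xi>. ennreal ((norm (Dm (1 / mu \<xi>) (fourier_L2 y \<xi>)))\<^sup>2))"
  by (intro nn_integral_cong) (simp add: norm_Dm mu_range power_one_over)
 finally show ?thesis .
qed

lemma norm_Dm_le: "0 \<le> \<mu> \<Longrightarrow> \<mu> \<le> 1 \<Longrightarrow> norm (Dm \<mu> z) \<le> norm z"
proof (rule power2_le_imp_le)
 assume m: "0 \<le> \<mu>" "\<mu> \<le> 1"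
 have "(norm (Dm \<mu> z))\<^sup>2 \<le> (norm (Dm 1 z))\<^sup>2"
  unfolding norm_Dm by (intro sum_mono mult_right_mono) (use m in \<open>auto intro: power_le_one\<close>)
 then show "(norm (Dm \<mu> z))\<^sup>2 \<le> (norm z)\<^sup>2" by simp
qed simp

lemma plus_sq_sqint:
 assumes "plus_sq y" shows "sqint y"
proof -
 have m: "y \<in> borel_measurable borel" and s: "sqint (\<lambda>\<xi>. Dm (1 / mu \<xi>) (y \<xi>))" using assms by (auto simp: plus_sq_def)
 have "AE \<xi> in lborel. norm (y \<xi>) \<le> 1 * norm (Dm (1 / mu \<xi>) (y \<xi>))"
  using AE_nonzero
 proof eventually_elim
  case (elim \<xi>)
  show ?case using norm_Dm_le[OF mu_range(1,2), of \<xi> "Dm (1 / mu \<xi>) (y \<xi>)"] by (simp only: Dm_inverse(1)[OF elim] mult_1)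
 qed
 then show ?thesis by (rule sqint_bound(1)[OF s m])
qed

lemma Yplus_normsq_FT:
 assumes ft: "is_fourier_L2 y yh"
 shows "Yplus_normsq A B K y = (\<integral>\<^sup>+\<xi>. ennreal ((norm (Dm (1 / mu \<xi>) (yh \<xi>)))\<^sup>2))"
proof -
 have f: "is_fourier_L2 y (fourier_L2 y)" by (rule FT_fourier_L2[OF FT_sqint(1)[OF ft]])
 have "AE \<xi> in lborel. fourier_L2 y \<xi> = yh \<xi>" by (rule FT_unique[OF f ft])
 then have ae: "AE \<xi> in lborel. ennreal ((norm (Dm (1 / mu \<xi>) (fourier_L2 y \<xi>)))\<^sup>2) = ennreal ((norm (Dm (1 / mu \<xi>) (yh \<xi>)))\<^sup>2)"
  by eventually_elim simp
 show ?thesis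
  unfolding weighted_plus_norm[OF sqint_measurable[OF FT_sqint(2)[OF f]]] by (rule nn_integral_cong_AE[OF ae])
qed

lemma Yplus_iff_plus_sq:
 assumes ft: "is_fourier_L2 y yh"
 shows "y \<in> Yplus A B K \<longleftrightarrow> plus_sq yh"
proof -
 have [measurable]: "yh \<in> borel_measurable borel" by (rule sqint_measurable[OF FT_sqint(2)[OF ft]])
 have "(\<lambda>\<xi>. Dm (1 / mu \<xi>) (yh \<xi>)) \<in> borel_measurable borel" by measurable
 then show ?thesis
  using FT_sqint(1)[OF ft] by (auto simp: Yplus_def Yplus_normsq_FT[OF ft] plus_sq_def sqint_iff_nn[of "\<lambda>\<xi>. Dm (1 / mu \<xi>) (yh \<xi>)"] sqint_iff_L2_on)
qed

text \<open>An element of the closure has finite distance from the transform of some Schwartz function, and the latter is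
square-integrable.\<close>

lemma Yminus_minus_sq:
 assumes g: "g \<in> Yminus_hat A B K" shows "minus_sq g"
proof -
 have [measurable]: "g \<in> borel_measurable borel" using g by (auto simp: Yminus_hat_def)
 obtain q where q: "\<And>j. schwartz (q j)" and lim: "(\<lambda>j. Yminus_normsq_hat A B K (\<lambda>\<xi>. fourier (q j) \<xi> - g \<xi>)) \<longlonglongrightarrow> 0"
  using g by (auto simp: Yminus_hat_def)
 obtain j where j: "Yminus_normsq_hat A B K (\<lambda>\<xi>. fourier (q j) \<xi> - g \<xi>) < 1"
  using eventually_happens[OF order_tendstoD(2)[OF lim, of 1]] by auto
 have f: "sqint (fourier (q j))"
  by (rule FT_sqint(2)[OF FT_fourier[OF schwartz_regular[OF q]]])
 note [measurable] = sqint_measurable[OF f]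
 have m: "(\<lambda>\<xi>. Dm (mu \<xi>) (fourier (q j) \<xi> - g \<xi>)) \<in> borel_measurable borel" by measurable
 have "(\<integral>\<^sup>+\<xi>. ennreal ((norm (Dm (mu \<xi>) (fourier (q j) \<xi> - g \<xi>)))\<^sup>2)) < 1"
  using j by (subst (asm) weighted_minus_norm) auto
 then have "(\<integral>\<^sup>+\<xi>. ennreal ((norm (Dm (mu \<xi>) (fourier (q j) \<xi> - g \<xi>)))\<^sup>2)) < \<infinity>"
  by (rule less_trans) simp
 with m have 1: "sqint (\<lambda>\<xi>. Dm (mu \<xi>) (fourier (q j) \<xi> - g \<xi>))" by (simp add: sqint_iff_nn)
 have 2: "sqint (\<lambda>\<xi>. Dm (mu \<xi>) (fourier (q j) \<xi>))"
  by (rule sqint_bound(1)[OF f, where C=1]) (auto simp: norm_Dm_le mu_range)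
 have "Dm (mu \<xi>) (g \<xi>) = Dm (mu \<xi>) (fourier (q j) \<xi>) - Dm (mu \<xi>) (fourier (q j) \<xi> - g \<xi>)" for \<xi>
  using Dm_add[of "mu \<xi>" "fourier (q j) \<xi> - g \<xi>" "g \<xi>"] by simp
 then show ?thesis using sqint_diff[OF 2 1] by (simp add: minus_sq_def)
qed

text \<open>Entrywise the exponential series is a combination of scalar exponential series over the spectrum.\<close>

lemma mat_exp_Es: "mat_exp (map_matrix (\<lambda>a. - \<i> * of_real (\<theta> * a)) A) *v z = Es \<theta> z"
proof -
 let ?c = "- \<i> * complex_of_real \<theta>"
 let ?M = "map_matrix (\<lambda>a. ?c * complex_of_real a) A"
 let ?E = "(\<chi> i j. \<Sum>l\<in>\<Lambda>. exp (?c * of_real l) * of_real (Q l $ i $ j)) :: complex^'n^'n"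
 have comp: "(mat_pow (map_matrix (\<lambda>a. c * complex_of_real a) A) k /\<^sub>R fact k) $ i $ j = (\<Sum>l\<in>\<Lambda>. ((c * of_real l) ^ k /\<^sub>R fact k) * of_real (Q l $ i $ j))" for c k i j
 proof -
  have "mat_pow A k $ i $ j = (\<Sum>l\<in>\<Lambda>. l ^ k * Q l $ i $ j)" unfolding pow by simp
  then show ?thesis
   unfolding vector_scaleR_component mat_pow_scaled
   by (simp add: sum_distrib_left scaleR_sum_right power_mult_distrib scaleR_conv_of_real[where 'a=complex] mult_ac)
 qed
 have "(\<lambda>k. mat_pow ?M k /\<^sub>R fact k) sums ?E"
  unfolding sums_def
 proof (intro vec_tendstoI)
  fix i j
  have "(\<lambda>k. \<Sum>l\<in>\<Lambda>. ((?c * of_real l) ^ k /\<^sub>R fact k) * of_real (Q l $ i $ j)) sums (\<Sum>l\<in>\<Lambda>. exp (?c * of_real l) * of_real (Q l $ i $ j))"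
   by (intro sums_sum sums_mult2 exp_converges)
  then have "(\<lambda>n. \<Sum>k<n. \<Sum>l\<in>\<Lambda>. ((?c * of_real l) ^ k /\<^sub>R fact k) * of_real (Q l $ i $ j)) \<longlonglongrightarrow> ?E $ i $ j"
   by (simp only: sums_def vec_lambda_beta)
  then show "(\<lambda>n. (\<Sum>k<n. mat_pow ?M k /\<^sub>R fact k) $ i $ j) \<longlonglongrightarrow> ?E $ i $ j"
   by (simp only: sum_component comp)
 qed
 then have e: "mat_exp ?M = ?E" unfolding mat_exp_def by (rule sums_unique[symmetric])
 have x: "exp (?c * of_real l) = cis (- (\<theta> * l))" for l by (simp add: cis_conv_exp mult.assoc)
 have "?E *v z = Es \<theta> z"
  unfolding Es_def Qc_def x vec_eq_iff
 proof
  fix i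
  have "((\<chi> i j. \<Sum>l\<in>\<Lambda>. cis (- (\<theta> * l)) * of_real (Q l $ i $ j)) *v z) $ i
    = (\<Sum>j\<in>UNIV. \<Sum>l\<in>\<Lambda>. cis (- (\<theta> * l)) * of_real (Q l $ i $ j) * z $ j)"
   by (simp add: matrix_vector_mult_def sum_distrib_right)
  also have "\<dots> = (\<Sum>l\<in>\<Lambda>. \<Sum>j\<in>UNIV. cis (- (\<theta> * l)) * of_real (Q l $ i $ j) * z $ j)" by (rule sum.swap)
  also have "\<dots> = (\<Sum>l\<in>\<Lambda>. cis (- (\<theta> * l)) *s (cmat (Q l) *v z)) $ i"
   by (simp add: matrix_vector_mult_def map_matrix_def sum_distrib_left mult.assoc)
  finally show "((\<chi> i j. \<Sum>l\<in>\<Lambda>. cis (- (\<theta> * l)) * of_real (Q l $ i $ j)) *v z) $ i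
    = (\<Sum>l\<in>\<Lambda>. cis (- (\<theta> * l)) *s (cmat (Q l) *v z)) $ i" .
 qed
 then show ?thesis using e by (simp add: mult.assoc)
qed

text \<open>The dual of \<open>Dm_Ev_bound\<close>.\<close>

lemma Es_weighted_bound:
 "\<exists>C\<ge>0. \<forall>\<xi> z. \<xi> \<noteq> 0 \<longrightarrow> norm (Dm (1 / mu \<xi>) (Es (t * \<xi>) z)) \<le> C * norm (Dm (1 / mu \<xi>) z)"
proof -
 obtain C where C: "C \<ge> 0" "\<And>s \<xi> z. \<bar>s\<bar> \<le> \<bar>t\<bar> \<Longrightarrow> norm (Dm (mu \<xi>) (Ev (s * \<xi>) z)) \<le> C * norm (Dm (mu \<xi>) z)"
  using Dm_Ev_bound by blast
 have "norm (Dm (1 / mu \<xi>) (Es (t * \<xi>) z)) \<le> C * norm (Dm (1 / mu \<xi>) z)" if x: "\<xi> \<noteq> 0" for \<xi> z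
 proof -
  let ?Y = "Dm (1 / mu \<xi>) (Es (t * \<xi>) z)"
  let ?V = "Ev (t * \<xi>) (Dm (1 / mu \<xi>) ?Y)"
  have "herm ?Y ?Y = herm z ?V" by (subst herm_Dm, subst herm_Es) (rule refl)
  also have "\<dots> = herm (Dm (mu \<xi>) (Dm (1 / mu \<xi>) z)) ?V" by (simp only: Dm_inverse(1)[OF x])
  also have "\<dots> = herm (Dm (1 / mu \<xi>) z) (Dm (mu \<xi>) ?V)" by (rule herm_Dm)
  finally have e: "herm ?Y ?Y = herm (Dm (1 / mu \<xi>) z) (Dm (mu \<xi>) ?V)" .
  have "(norm ?Y)\<^sup>2 = norm (herm ?Y ?Y)" by (simp only: herm_self norm_of_real abs_power2)
  also have "\<dots> \<le> norm (Dm (1 / mu \<xi>) z) * norm (Dm (mu \<xi>) ?V)" unfolding e by (rule norm_herm_le)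
  also have "\<dots> \<le> norm (Dm (1 / mu \<xi>) z) * (C * norm (Dm (mu \<xi>) (Dm (1 / mu \<xi>) ?Y)))"
   by (intro mult_left_mono C) auto
  also have "Dm (mu \<xi>) (Dm (1 / mu \<xi>) ?Y) = ?Y" by (rule Dm_inverse(1)[OF x])
  finally have "norm ?Y * norm ?Y \<le> (C * norm (Dm (1 / mu \<xi>) z)) * norm ?Y" by (simp add: power2_eq_square mult_ac)
  then show ?thesis using C(1) by (cases "norm ?Y = 0") auto
 qed
 then show ?thesis using C(1) by blast
qed

lemma plus_sq_Es:
 assumes y: "plus_sq y" shows "plus_sq (\<lambda>\<xi>. Es (t * \<xi>) (y \<xi>))"
proof -
 have [measurable]: "y \<in> borel_measurable borel" and s: "sqint (\<lambda>\<xi>. Dm (1 / mu \<xi>) (y \<xi>))" using y by (auto simp: plus_sq_def)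
 obtain C where C: "\<And>\<xi> z. \<xi> \<noteq> 0 \<Longrightarrow> norm (Dm (1 / mu \<xi>) (Es (t * \<xi>) z)) \<le> C * norm (Dm (1 / mu \<xi>) z)"
  using Es_weighted_bound by blast
 have "AE \<xi> in lborel. norm (Dm (1 / mu \<xi>) (Es (t * \<xi>) (y \<xi>))) \<le> C * norm (Dm (1 / mu \<xi>) (y \<xi>))"
  using AE_nonzero by eventually_elim (rule C)
 then have "sqint (\<lambda>\<xi>. Dm (1 / mu \<xi>) (Es (t * \<xi>) (y \<xi>)))"
  by (rule sqint_bound(1)[OF s, rotated]) measurable
 then show ?thesis by (simp add: plus_sq_def)
qed

lemma free_evolution_FT:
 assumes y: "plus_sq (fourier_L2 y0)"
 shows "is_fourier_L2 (free_evolution A T y0) (\<lambda>\<xi>. Es (T * \<xi>) (fourier_L2 y0 \<xi>))"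
 unfolding free_evolution_def mat_exp_Es
 by (rule someI_ex[OF FT_inverse_exists[OF plus_sq_sqint[OF plus_sq_Es[OF y]]]])

lemma Qt_transpose: "l \<in> \<Lambda> \<Longrightarrow> Qt l (cmat (transpose A) *v z) = complex_of_real l *s Qt l z"
proof -
 assume l: "l \<in> \<Lambda>"
 have "cmat (transpose A) *v z = (\<Sum>m\<in>\<Lambda>. of_real m *s Qt m z)" using Q_powers[of 1 z] by simp
 then have "Qt l (cmat (transpose A) *v z) = (\<Sum>m\<in>\<Lambda>. if l = m then of_real l *s Qt l z else 0)"
  by (simp only: op_sum op_scale) (intro sum.cong refl, simp add: Qt_Qt[OF l])
 then show ?thesis using l fin by simp
qed

text \<open>The spectral components satisfy scalar equations.\<close>

lemma adjoint_solution_unique: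
 assumes ad: "adjoint_solution_hat A t g qh" and s: "s \<in> {0..t}"
 shows "qh s \<xi> = Ev ((t - s) * \<xi>) (g \<xi>)"
proof -
 have qt: "qh t = g" using ad by (simp add: adjoint_solution_hat_def)
 have d: "((\<lambda>s. qh s \<xi>) has_vector_derivative (- \<i> * of_real \<xi>) *s (cmat (transpose A) *v qh r \<xi>)) (at r within {0..t})"
  if "r \<in> {0..t}" for r using ad that by (simp add: adjoint_solution_hat_def)
 have mode: "Qt l (qh s \<xi>) $ i = cis ((t - s) * (\<xi> * l)) * Qt l (g \<xi>) $ i" if l: "l \<in> \<Lambda>" for l i
 proof -
  have bl: "bounded_linear (\<lambda>z. Qt l z $ i)"
  proof -
   have "linear (\<lambda>z. Qt l z $ i)" by (rule linearI) (simp_all add: op_add op_scaleR)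
   then show ?thesis by (simp add: linear_conv_bounded_linear)
  qed
  have "Qt l (qh s \<xi>) $ i = cis ((t - s) * (\<xi> * l)) * Qt l (qh t \<xi>) $ i"
  proof (rule adjoint_mode_constant[OF _ s])
   fix r assume "r \<in> {0..t}"
   from bounded_linear.has_vector_derivative[OF bl d[OF this]]
   show "((\<lambda>s. Qt l (qh s \<xi>) $ i) has_vector_derivative - \<i> * complex_of_real (\<xi> * l) * Qt l (qh r \<xi>) $ i) (at r within {0..t})"
    by (simp only: op_scale Qt_transpose[OF l] vector_smult_component of_real_mult mult.assoc)
  qed
  then show ?thesis by (simp only: qt)
 qed
 have "qh s \<xi> = Ev 0 (qh s \<xi>)" by simp
 also have "\<dots> = (\<Sum>l\<in>\<Lambda>. Qt l (qh s \<xi>))" by (simp add: Ev_def)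
 also have "\<dots> = Ev ((t - s) * \<xi>) (g \<xi>)" unfolding Ev_def
  by (intro sum.cong refl) (simp add: vec_eq_iff mode mult.assoc)
 finally show ?thesis .
qed

end

section \<open>Observability inequalities\<close>

context kalman
begin

lemma seg_open: "(\<integral>\<^sup>+s. f s * indicator {a<..<b} s) = seg a b f"
proof -
 have "AE s in lborel. s \<noteq> a" "AE s in lborel. s \<noteq> b" by (rule AE_lborel_singleton)+
 then have "AE s in lborel. f s * indicator {a<..<b} s = f s * indicator {a..b} s"
  by eventually_elim (auto split: split_indicator)
 then show ?thesis unfolding seg_def by (rule nn_integral_cong_AE)
qed

lemma observe_mode:
 assumes [measurable]: "g \<in> borel_measurable borel"
 shows "(\<integral>\<^sup>+s. nsq (observe T g (s, \<xi>))) = seg 0 T (\<lambda>s. nsq (Bt (Ev (s * \<xi>) (g \<xi>))))"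
proof -
 have "(\<integral>\<^sup>+s. nsq (observe T g (s, \<xi>))) = (\<integral>\<^sup>+s. nsq (Bt (Ev ((T - s) * \<xi>) (g \<xi>))) * indicator {0<..<T} s)"
  by (intro nn_integral_cong) (auto simp: observe_def nsq_def split: split_indicator)
 also have "\<dots> = (\<integral>\<^sup>+s. nsq (Bt (Ev (s * \<xi>) (g \<xi>))) * indicator {0<..<T} s)"
  by (subst nn_integral_real_affine[where c="-1" and t=T]) (auto intro!: nn_integral_cong split: split_indicator)
 finally show ?thesis by (simp only: seg_open)
qed

lemma full_observability:
 "\<exists>c>0. \<forall>T>0. \<forall>g\<in>borel_measurable borel.
   ennreal (c * min T (T ^ (2 * K + 1))) * (\<integral>\<^sup>+\<xi>. nsq (Dm (mu \<xi>) (g \<xi>)))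
    \<le> (\<integral>\<^sup>+s. \<integral>\<^sup>+\<xi>. nsq (observe T g (s, \<xi>)))"
proof -
 obtain c where c: "c > 0" "\<And>T \<xi> z. T > 0 \<Longrightarrow> ennreal (c * min T (T ^ (2 * K + 1))) * nsq (Dm (mu \<xi>) z) \<le> seg 0 T (\<lambda>s. nsq (Bt (Ev (s * \<xi>) z)))"
  using mode_observability by blast
 have "ennreal (c * min T (T ^ (2 * K + 1))) * (\<integral>\<^sup>+\<xi>. nsq (Dm (mu \<xi>) (g \<xi>))) \<le> (\<integral>\<^sup>+s. \<integral>\<^sup>+\<xi>. nsq (observe T g (s, \<xi>)))"
  if T: "T > 0" and g[measurable]: "g \<in> borel_measurable borel" for T g
 proof -
  have m: "(\<lambda>z. nsq (observe T g z)) \<in> borel_measurable borel" by measurable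
  have "ennreal (c * min T (T ^ (2 * K + 1))) * (\<integral>\<^sup>+\<xi>. nsq (Dm (mu \<xi>) (g \<xi>)))
    = (\<integral>\<^sup>+\<xi>. ennreal (c * min T (T ^ (2 * K + 1))) * nsq (Dm (mu \<xi>) (g \<xi>)))"
   by (rule nn_integral_cmult[symmetric]) measurable
  also have "\<dots> \<le> (\<integral>\<^sup>+\<xi>. \<integral>\<^sup>+s. nsq (observe T g (s, \<xi>)))"
   unfolding observe_mode[OF g] by (intro nn_integral_mono c T)
  also have "\<dots> = (\<integral>\<^sup>+z. nsq (observe T g z))" by (rule nn_integral_R2'[OF m, symmetric])
  also have "\<dots> = (\<integral>\<^sup>+s. \<integral>\<^sup>+\<xi>. nsq (observe T g (s, \<xi>)))" by (rule nn_integral_R2[OF m])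
  finally show ?thesis .
 qed
 then show ?thesis using c(1) by blast
qed

text \<open>Links real norms on the plane with the iterated extended integrals of \<open>energy\<close>.\<close>

lemma l2norm_energy:
 assumes w: "sqint w" and [measurable]: "\<omega> \<in> sets borel"
 shows "ennreal ((l2norm (\<lambda>z. indicator ({0<..<T} \<times> \<omega>) z *\<^sub>R w z))\<^sup>2) = energy \<omega> T w"
proof -
 note [measurable] = sqint_measurable[OF w]
 have [measurable]: "{0<..<T} \<times> \<omega> \<in> sets borel" by (simp add: borel_Times)
 have m: "(\<lambda>z. indicator ({0<..<T} \<times> \<omega>) z *\<^sub>R w z) \<in> borel_measurable borel" by measurable
 have s: "sqint (\<lambda>z. indicator ({0<..<T} \<times> \<omega>) z *\<^sub>R w z)"
  by (rule sqint_bound(1)[OF w m, where C=1]) (auto split: split_indicator)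
 have "ennreal ((l2norm (\<lambda>z. indicator ({0<..<T} \<times> \<omega>) z *\<^sub>R w z))\<^sup>2) = (\<integral>\<^sup>+z. ennreal ((norm (indicator ({0<..<T} \<times> \<omega>) z *\<^sub>R w z))\<^sup>2))"
  using L2_normsq_eq_l2norm[OF s] by (simp add: L2_normsq_UNIV)
 also have "\<dots> = (\<integral>\<^sup>+s. \<integral>\<^sup>+x. ennreal ((norm (indicator ({0<..<T} \<times> \<omega>) (s, x) *\<^sub>R w (s, x)))\<^sup>2))"
  by (rule nn_integral_R2) measurable
 also have "\<dots> = energy \<omega> T w" unfolding energy_def nsq_def
 proof (rule nn_integral_cong)
  fix s
  show "(\<integral>\<^sup>+x. ennreal ((norm (indicator ({0<..<T} \<times> \<omega>) (s, x) *\<^sub>R w (s, x)))\<^sup>2))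
    = (\<integral>\<^sup>+x. ennreal ((norm (w (s, x)))\<^sup>2) * indicator \<omega> x) * indicator {0<..<T} s"
   by (cases "s \<in> {0<..<T}") (auto intro!: nn_integral_cong split: split_indicator)
 qed
 finally show ?thesis .
qed

lemma observability_constant:
 assumes h: "sqint h" and c: "0 \<le> c"
  and le: "ennreal c * (\<integral>\<^sup>+\<xi>. nsq (Dm (mu \<xi>) (Dm (1 / mu \<xi>) (h \<xi>)))) \<le> ennreal d * energy \<omega> T w"
  and w: "sqint w" and om: "\<omega> \<in> sets borel" and d: "0 < d"
 shows "c / d * (l2norm h)\<^sup>2 \<le> (l2norm (\<lambda>z. indicator ({0<..<T} \<times> \<omega>) z *\<^sub>R w z))\<^sup>2"
proof -
 note [measurable] = sqint_measurable[OF h]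
 have "AE \<xi> in lborel. nsq (Dm (mu \<xi>) (Dm (1 / mu \<xi>) (h \<xi>))) = ennreal ((norm (h \<xi>))\<^sup>2)"
  using AE_nonzero by eventually_elim (simp add: Dm_inverse nsq_def)
 then have "(\<integral>\<^sup>+\<xi>. nsq (Dm (mu \<xi>) (Dm (1 / mu \<xi>) (h \<xi>)))) = ennreal ((l2norm h)\<^sup>2)"
  using L2_normsq_eq_l2norm[OF h] by (simp add: L2_normsq_UNIV nn_integral_cong_AE)
 then have "ennreal (c * (l2norm h)\<^sup>2) \<le> ennreal (d * (l2norm (\<lambda>z. indicator ({0<..<T} \<times> \<omega>) z *\<^sub>R w z))\<^sup>2)"
  using le c d by (simp add: l2norm_energy[OF w om, symmetric] ennreal_mult)
 then have "c * (l2norm h)\<^sup>2 \<le> d * (l2norm (\<lambda>z. indicator ({0<..<T} \<times> \<omega>) z *\<^sub>R w z))\<^sup>2"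
  using d by simp
 then show ?thesis using d by (simp add: field_simps)
qed

lemma global_observability:
 "\<exists>c>0. \<forall>T>0. \<forall>h w. sqint h \<longrightarrow> partial_FT w (observe T (\<lambda>\<xi>. Dm (1 / mu \<xi>) (h \<xi>))) \<longrightarrow>
   c * min T (T ^ (2 * K + 1)) / (2 * pi) * (l2norm h)\<^sup>2 \<le> (l2norm (\<lambda>z. indicator ({0<..<T} \<times> UNIV) z *\<^sub>R w z))\<^sup>2"
proof -
 obtain c where c: "c > 0" "\<And>T g. T > 0 \<Longrightarrow> g \<in> borel_measurable borel \<Longrightarrow>
   ennreal (c * min T (T ^ (2 * K + 1))) * (\<integral>\<^sup>+\<xi>. nsq (Dm (mu \<xi>) (g \<xi>)))
    \<le> (\<integral>\<^sup>+s. \<integral>\<^sup>+\<xi>. nsq (observe T g (s, \<xi>)))"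
  using full_observability by blast
 have "c * min T (T ^ (2 * K + 1)) / (2 * pi) * (l2norm h)\<^sup>2 \<le> (l2norm (\<lambda>z. indicator ({0<..<T} \<times> UNIV) z *\<^sub>R w z))\<^sup>2"
  if T: "T > 0" and h: "sqint h" and w: "partial_FT w (observe T (\<lambda>\<xi>. Dm (1 / mu \<xi>) (h \<xi>)))" for T h w
 proof (rule observability_constant[OF h _ _ _ _])
  note [measurable] = sqint_measurable[OF h]
  let ?g = "\<lambda>\<xi>. Dm (1 / mu \<xi>) (h \<xi>)"
  have g: "?g \<in> borel_measurable borel" by measurable
  have ws: "sqint w" using w by (simp add: partial_FT_def)
  note [measurable] = sqint_measurable[OF ws] borel_R2[OF sqint_measurable[OF ws]]
  show "sqint w" by fact
  have "ennreal (c * min T (T ^ (2 * K + 1))) * (\<integral>\<^sup>+\<xi>. nsq (Dm (mu \<xi>) (?g \<xi>)))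
    \<le> (\<integral>\<^sup>+s. \<integral>\<^sup>+\<xi>. nsq (observe T ?g (s, \<xi>)))" by (rule c(2)[OF T g])
  also have "\<dots> = (\<integral>\<^sup>+s. ennreal (2 * pi) * ((\<integral>\<^sup>+x. nsq (w (s, x)) * indicator UNIV x) * indicator {0<..<T} s))"
  proof (rule nn_integral_cong_AE)
   have "AE s in lborel. is_fourier_L2 (\<lambda>x. w (s, x)) (\<lambda>\<xi>. observe T ?g (s, \<xi>))" using w by (simp add: partial_FT_def)
   then show "AE s in lborel. (\<integral>\<^sup>+\<xi>. nsq (observe T ?g (s, \<xi>))) = ennreal (2 * pi) * ((\<integral>\<^sup>+x. nsq (w (s, x)) * indicator UNIV x) * indicator {0<..<T} s)"
   proof eventually_elim
    case (elim s)
    show ?case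
    proof (cases "s \<in> {0<..<T}")
     case True then show ?thesis using FT_Plancherel[OF elim] by (simp add: L2_normsq_UNIV nsq_def)
    qed (simp add: observe_def nsq_def)
   qed
  qed
  also have "\<dots> = ennreal (2 * pi) * energy UNIV T w"
   unfolding energy_def by (rule nn_integral_cmult) measurable
  finally show "ennreal (c * min T (T ^ (2 * K + 1))) * (\<integral>\<^sup>+\<xi>. nsq (Dm (mu \<xi>) (?g \<xi>))) \<le> ennreal (2 * pi) * energy UNIV T w" .
 qed (use c T in auto)
 then show ?thesis using c(1) by blast
qed

text \<open>The observation is a superposition of waves whose speeds are the eigenvalues, and \<open>Tg > 0\<close> makes the single-frequency
constant uniform.\<close>

lemma local_observability:
 fixes a b :: "int \<Rightarrow> real"
 assumes bg: "bounded_gap a b \<omega>" and l0: "0 \<notin> \<Lambda>" and Tg: "Tg = gap a b / Min (abs ` \<Lambda>)" and T1: "T1 > Tg"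
 shows "\<exists>c>0. \<forall>T. Tg < T \<longrightarrow> T \<le> T1 \<longrightarrow> (\<forall>h w. sqint h \<longrightarrow> partial_FT w (observe T (\<lambda>\<xi>. Dm (1 / mu \<xi>) (h \<xi>))) \<longrightarrow>
   c * (T - Tg) ^ (2 * card \<Lambda> - 1) * (l2norm h)\<^sup>2 \<le> (l2norm (\<lambda>z. indicator ({0<..<T} \<times> \<omega>) z *\<^sub>R w z))\<^sup>2)"
proof -
 interpret gaps a b \<omega> by unfold_locales (rule bg)
 have om: "\<omega> \<in> sets borel" unfolding omega_shrunk by (rule shrunk_borel)
 let ?lam = "Min (abs ` \<Lambda>)"
 let ?e = "2 * card \<Lambda> - 1"
 have lam: "?lam > 0" using fin \<Lambda>_ne l0 by (subst Min_gr_iff) auto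
 have Tg0: "Tg > 0" unfolding Tg using gap_pos lam by simp
 obtain c where c: "c > 0" "\<And>T g. T > 0 \<Longrightarrow> g \<in> borel_measurable borel \<Longrightarrow>
   ennreal (c * min T (T ^ (2 * K + 1))) * (\<integral>\<^sup>+\<xi>. nsq (Dm (mu \<xi>) (g \<xi>)))
    \<le> (\<integral>\<^sup>+s. \<integral>\<^sup>+\<xi>. nsq (observe T g (s, \<xi>)))"
  using full_observability by blast
 obtain C where C: "C > 0" "\<And>T cc (w :: real \<times> real \<Rightarrow> complex^'m). Tg < T \<Longrightarrow> T \<le> T1 \<Longrightarrow> waves \<Lambda> cc T w \<Longrightarrow>
   (\<integral>\<^sup>+s. (\<integral>\<^sup>+\<xi>. nsq (\<Sum>l\<in>\<Lambda>. cis (- (s * \<xi> * l)) *s cc l \<xi>)) * indicator {0<..<T} s)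
    \<le> ennreal (C / (T - Tg) ^ ?e) * energy \<omega> T w"
  using localized_observability[OF fin \<Lambda>_ne l0 refl T1[unfolded Tg]] unfolding Tg by blast
 define c' where "c' = c * min Tg (Tg ^ (2 * K + 1))"
 have c': "c' > 0" using c(1) Tg0 by (simp add: c'_def)
 have "c' / C * (T - Tg) ^ ?e * (l2norm h)\<^sup>2 \<le> (l2norm (\<lambda>z. indicator ({0<..<T} \<times> \<omega>) z *\<^sub>R w z))\<^sup>2"
  if T: "Tg < T" "T \<le> T1" and h: "sqint h" and w: "partial_FT w (observe T (\<lambda>\<xi>. Dm (1 / mu \<xi>) (h \<xi>)))" for T h w
 proof -
  note [measurable] = sqint_measurable[OF h]
  define g where "g = (\<lambda>\<xi>. Dm (1 / mu \<xi>) (h \<xi>))"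
  have g[measurable]: "g \<in> borel_measurable borel" unfolding g_def by measurable
  have ws: "sqint w" using w by (simp add: partial_FT_def)
  have T0: "T > 0" using T Tg0 by simp
  let ?cc = "\<lambda>l \<xi>. cis (T * \<xi> * l) *s Bt (Qt l (g \<xi>))"
  have ob: "observe T g (s, \<xi>) = (\<Sum>l\<in>\<Lambda>. cis (- (s * \<xi> * l)) *s ?cc l \<xi>)" if "s \<in> {0<..<T}" for s \<xi>
   using that by (simp add: observe_def Ev_def op_sum op_scale vector_smult_assoc cis_mult algebra_simps)
  have "AE s in lborel. is_fourier_L2 (\<lambda>x. w (s, x)) (\<lambda>\<xi>. observe T g (s, \<xi>))" using w by (simp add: partial_FT_def g_def)
  then have W: "waves \<Lambda> ?cc T w" unfolding waves_def
   using sqint_measurable[OF ws] by (auto simp: ob elim!: eventually_mono)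
  have mn: "c' \<le> c * min T (T ^ (2 * K + 1))"
   unfolding c'_def using T Tg0 c(1) by (intro mult_left_mono min.mono power_mono) auto
  have "ennreal c' * (\<integral>\<^sup>+\<xi>. nsq (Dm (mu \<xi>) (g \<xi>))) \<le> ennreal (c * min T (T ^ (2 * K + 1))) * (\<integral>\<^sup>+\<xi>. nsq (Dm (mu \<xi>) (g \<xi>)))"
   by (intro mult_right_mono ennreal_leI mn) auto
  also have "\<dots> \<le> (\<integral>\<^sup>+s. \<integral>\<^sup>+\<xi>. nsq (observe T g (s, \<xi>)))" by (rule c(2)[OF T0 g])
  also have "\<dots> = (\<integral>\<^sup>+s. (\<integral>\<^sup>+\<xi>. nsq (\<Sum>l\<in>\<Lambda>. cis (- (s * \<xi> * l)) *s ?cc l \<xi>)) * indicator {0<..<T} s)"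
  proof (rule nn_integral_cong)
   fix s
   show "(\<integral>\<^sup>+\<xi>. nsq (observe T g (s, \<xi>))) = (\<integral>\<^sup>+\<xi>. nsq (\<Sum>l\<in>\<Lambda>. cis (- (s * \<xi> * l)) *s ?cc l \<xi>)) * indicator {0<..<T} s"
   proof (cases "s \<in> {0<..<T}")
    case True then show ?thesis by (simp only: ob[OF True] indicator_simps mult_1_right)
   qed (simp add: observe_def nsq_def)
  qed
  also have "\<dots> \<le> ennreal (C / (T - Tg) ^ ?e) * energy \<omega> T w" by (rule C(2)[OF T W])
  finally have "c' / (C / (T - Tg) ^ ?e) * (l2norm h)\<^sup>2 \<le> (l2norm (\<lambda>z. indicator ({0<..<T} \<times> \<omega>) z *\<^sub>R w z))\<^sup>2"
   using T C(1) by (intro observability_constant[OF h less_imp_le[OF c'] _ ws om]) (auto simp: g_def)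
  then show ?thesis by simp
 qed
 then show ?thesis using c' C(1) by (intro exI[of _ "c' / C"]) auto
qed

end

section \<open>Transposition solutions and exact controllability\<close>

lemma max_reciprocal:
 assumes "0 < a" "0 < (b :: real)" shows "max (1 / a) (1 / b) = 1 / min a b"
proof (cases "a \<le> b")
 case True
 then have "1 / b \<le> 1 / a" using assms by (simp add: frac_le)
 then show ?thesis using True by (simp add: max_absorb1 min_absorb1)
next
 case False
 then have "1 / a \<le> 1 / b" using assms by (simp add: frac_le)
 then show ?thesis using False by (simp add: max_absorb2 min_absorb2)
qed

lemma vcnj_cvec [simp]: "vcnj (cvec v) = cvec v"
 by (simp add: vec_eq_iff cvec_def)

lemma vcnj_vcnj [simp]: "vcnj (vcnj v) = v"
 by (simp add: vec_eq_iff)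

lemma fourier_real_symmetric:
 fixes f :: "real \<Rightarrow> real^'n"
 assumes "sqint (\<lambda>x. cvec (f x))"
 shows "AE \<xi> in lborel. fourier_L2 (\<lambda>x. cvec (f x)) (- \<xi>) = vcnj (fourier_L2 (\<lambda>x. cvec (f x)) \<xi>)"
proof -
 have ft: "is_fourier_L2 (\<lambda>x. cvec (f x)) (fourier_L2 (\<lambda>x. cvec (f x)))" by (rule FT_fourier_L2[OF assms])
 have "AE \<xi> in lborel. fourier_L2 (\<lambda>x. cvec (f x)) \<xi> = vcnj (fourier_L2 (\<lambda>x. cvec (f x)) (- \<xi>))"
  by (rule FT_unique[OF ft]) (use FT_conj[OF ft] in simp)
 then show ?thesis by eventually_elim (metis vcnj_vcnj)
qed

lemma sqint_L2_on:
 assumes u: "sqint u" and [measurable]: "S \<in> sets borel"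
 shows "u \<in> L2_on S" "L2_normsq S u \<le> ennreal ((l2norm u)\<^sup>2)"
proof -
 note [measurable] = sqint_measurable[OF u]
 have "L2_normsq S u \<le> L2_normsq UNIV u"
  unfolding L2_normsq_def by (intro nn_integral_mono) (auto split: split_indicator)
 then show 1: "L2_normsq S u \<le> ennreal ((l2norm u)\<^sup>2)" by (simp only: L2_normsq_eq_l2norm[OF u])
 have "L2_normsq S u < \<infinity>" by (rule le_less_trans[OF 1]) simp
 moreover have "set_borel_measurable lborel S u" unfolding set_borel_measurable_def by measurable
 ultimately show "u \<in> L2_on S" by (simp add: L2_on_def)
qed

context kalman
begin

lemma Es_vcnj: "Es \<theta> (vcnj z) = vcnj (Es (- \<theta>) z)"
 by (simp add: Es_def Qc_def vcnj_sum vcnj_scale vcnj_cmat cis_cnj)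

lemma plus_sq_add: "plus_sq y \<Longrightarrow> plus_sq z \<Longrightarrow> plus_sq (\<lambda>\<xi>. y \<xi> + z \<xi>)"
 by (auto simp: plus_sq_def Dm_add intro: sqint_add)

lemma plus_sq_diff: "plus_sq y \<Longrightarrow> plus_sq z \<Longrightarrow> plus_sq (\<lambda>\<xi>. y \<xi> - z \<xi>)"
 by (auto simp: plus_sq_def Dm_diff intro: sqint_diff)

text \<open>Vanishing outside the time interval at every point lets the pairing with a control be
restricted to that interval.\<close>

lemma adjoint_observation_exists:
 assumes g: "minus_sq g" and ad: "adjoint_solution_hat A t g qh"
 shows "\<exists>w. partial_FT w (observe t g) \<and> (\<forall>z. z \<notin> {0<..<t} \<times> UNIV \<longrightarrow> w z = 0) \<and> adjoint_observation B t qh w"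
proof -
 have "sqint (observe t g)" using observe_bound[of t] g by blast
 then obtain w0 where w0: "partial_FT w0 (observe t g)" using partial_FT_inverse_exists by blast
 define w where "w z = indicator ({0<..<t} \<times> UNIV) z *\<^sub>R w0 z" for z
 have S: "{0<..<t} \<times> (UNIV :: real set) \<in> sets borel" by (simp add: borel_Times)
 have ws: "sqint w" unfolding w_def[abs_def] by (rule sqint_mult_indicator(1)[OF _ S]) (use w0 in \<open>simp add: partial_FT_def\<close>)
 have ft0: "AE s in lborel. is_fourier_L2 (\<lambda>x. w0 (s, x)) (\<lambda>\<xi>. observe t g (s, \<xi>))" using w0 by (simp add: partial_FT_def)
 then have ft: "AE s in lborel. is_fourier_L2 (\<lambda>x. w (s, x)) (\<lambda>\<xi>. observe t g (s, \<xi>))"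
 proof eventually_elim
  case (elim s)
  show ?case
  proof (cases "s \<in> {0<..<t}")
   case False
   then show ?thesis using FT_cmult[OF elim, of 0] by (simp add: w_def observe_def)
  qed (use elim in \<open>simp add: w_def\<close>)
 qed
 have pf: "partial_FT w (observe t g)" using ws ft w0 by (simp add: partial_FT_def)
 have "AE s in lborel. s \<in> {0<..<t} \<longrightarrow> is_fourier_L2 (\<lambda>x. w (s, x)) (\<lambda>\<xi>. cmat (transpose B) *v qh s \<xi>)"
  using ft
 proof eventually_elim
  case (elim s)
  show ?case
  proof
   assume s: "s \<in> {0<..<t}"
   have "observe t g (s, \<xi>) = cmat (transpose B) *v qh s \<xi>" for \<xi>
    using s adjoint_solution_unique[OF ad, of s \<xi>] by (simp add: observe_def Bt_def)
   then show "is_fourier_L2 (\<lambda>x. w (s, x)) (\<lambda>\<xi>. cmat (transpose B) *v qh s \<xi>)" using elim by simp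
  qed
 qed
 then have "adjoint_observation B t qh w" using sqint_L2_on(1)[OF ws S] by (simp add: adjoint_observation_def)
 then show ?thesis using pf by (intro exI[of _ w]) (auto simp: w_def)
qed

text \<open>The state is defined by Duhamel's formula on the Fourier side at all times. In the pairing with \<open>g\<close> the free part turns
into the pairing of \<open>y0\<close> with the initial value of the adjoint solution, and the forced part is \<open>input_map_duality\<close>.\<close>

lemma steers_of_input_map:
 fixes u :: "real \<times> real \<Rightarrow> real^'m"
 assumes y0: "y0 \<in> Yplus A B K" and yd: "yd \<in> Yplus A B K"
  and uv: "partial_FT (\<lambda>z. cvec (u z)) v" and z0: "\<And>z. z \<notin> {0<..<T} \<times> \<omega> \<Longrightarrow> u z = 0"
  and im: "AE \<xi> in lborel. input_map T v \<xi> = fourier_L2 yd \<xi> - Es (T * \<xi>) (fourier_L2 y0 \<xi>)"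
 shows "steers A B K \<omega> T u y0 yd"
proof -
 have s0: "sqint y0" and sd: "sqint yd" using y0 yd by (auto simp: Yplus_def sqint_iff_L2_on)
 note f0 = FT_fourier_L2[OF s0] and fd = FT_fourier_L2[OF sd]
 have p0: "plus_sq (fourier_L2 y0)" using y0 Yplus_iff_plus_sq[OF f0] by simp
 have v: "sqint v" using uv by (simp add: partial_FT_def)
 define yh where "yh t \<xi> = Es (t * \<xi>) (fourier_L2 y0 \<xi>) + input_map t v \<xi>" for t \<xi>
 have yh: "plus_sq (yh t)" for t
  unfolding yh_def[abs_def] by (intro plus_sq_add plus_sq_Es p0 input_map_plus_sq v)
 define y where "y t = (SOME f. is_fourier_L2 f (yh t))" for t
 have y: "is_fourier_L2 (y t) (yh t)" for t
  unfolding y_def by (rule someI_ex[OF FT_inverse_exists[OF plus_sq_sqint[OF yh]]])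
 have "yh 0 = fourier_L2 y0" by (simp add: yh_def fun_eq_iff input_map_def)
 then have start: "AE x in lborel. y 0 x = y0 x" using FT_injective[OF _ f0] y[of 0] by simp
 have "AE \<xi> in lborel. fourier_L2 yd \<xi> = yh T \<xi>" using im by eventually_elim (simp add: yh_def)
 then have "is_fourier_L2 yd (yh T)"
  by (intro FT_cong_AE[OF fd sqint_measurable[OF sd] _ sqint_measurable[OF plus_sq_sqint[OF yh]]]) auto
 then have final: "AE x in lborel. y T x = yd x" by (rule FT_injective[OF y])
 have pair: "pairing (y t) g = pairing y0 (qh 0) + (LINT z:{0<..<t} \<times> \<omega>|lborel. (\<Sum>i\<in>UNIV. of_real (u z $ i) * cnj (w z $ i)))"
  if t: "0 \<le> t" "t \<le> T" and g: "minus_sq g" and ad: "adjoint_solution_hat A t g qh"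
   and w: "partial_FT w (observe t g)" "\<And>z. z \<notin> {0<..<t} \<times> UNIV \<Longrightarrow> w z = 0" for t g qh w
 proof -
  note [measurable] = sqint_measurable[OF plus_sq_sqint[OF yh]] sqint_measurable[OF FT_sqint(2)[OF FT_fourier_L2[OF FT_sqint(1)[OF y]]]]
  have [measurable]: "g \<in> borel_measurable borel" using g by (simp add: minus_sq_def)
  have q0: "qh 0 \<xi> = Ev (t * \<xi>) (g \<xi>)" for \<xi>
   using adjoint_solution_unique[OF ad, of 0 \<xi>] t by simp
  have ae: "AE \<xi> in lborel. fourier_L2 (y t) \<xi> = yh t \<xi>"
   by (rule FT_unique[OF FT_fourier_L2[OF FT_sqint(1)[OF y]] y])
  have "(LINT \<xi>. herm (fourier_L2 (y t) \<xi>) (g \<xi>)) = (LINT \<xi>. herm (yh t \<xi>) (g \<xi>))"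
  proof (rule integral_cong_AE)
   show "AE \<xi> in lborel. herm (fourier_L2 (y t) \<xi>) (g \<xi>) = herm (yh t \<xi>) (g \<xi>)" using ae by eventually_elim simp
  qed (unfold herm_def, measurable)
  also have "\<dots> = (LINT \<xi>. herm (Es (t * \<xi>) (fourier_L2 y0 \<xi>)) (g \<xi>)) + (LINT \<xi>. herm (input_map t v \<xi>) (g \<xi>))"
   unfolding yh_def herm_add
   by (rule Bochner_Integration.integral_add[OF pairing_integrable(1)[OF plus_sq_Es[OF p0] g] pairing_integrable(1)[OF input_map_plus_sq[OF v] g]])
  also have "(LINT \<xi>. herm (input_map t v \<xi>) (g \<xi>)) = 2 * pi * (LINT z. herm (cvec (u z)) (w z))"
   by (rule input_map_duality[OF uv g w(1)])
  also have "(LINT \<xi>. herm (Es (t * \<xi>) (fourier_L2 y0 \<xi>)) (g \<xi>)) = (LINT \<xi>. herm (fourier_L2 y0 \<xi>) (qh 0 \<xi>))"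
   by (simp only: herm_Es q0)
  finally have e: "(LINT \<xi>. herm (fourier_L2 (y t) \<xi>) (g \<xi>))
    = (LINT \<xi>. herm (fourier_L2 y0 \<xi>) (qh 0 \<xi>)) + 2 * pi * (LINT z. herm (cvec (u z)) (w z))" .
  have "(LINT z. herm (cvec (u z)) (w z)) = (LINT z:{0<..<t} \<times> \<omega>|lborel. (\<Sum>i\<in>UNIV. of_real (u z $ i) * cnj (w z $ i)))"
   unfolding set_lebesgue_integral_def
  proof (intro Bochner_Integration.integral_cong refl)
   fix z :: "real \<times> real"
   show "herm (cvec (u z)) (w z) = indicator ({0<..<t} \<times> \<omega>) z *\<^sub>R (\<Sum>i\<in>UNIV. complex_of_real (u z $ i) * cnj (w z $ i))"
   proof (cases "z \<in> {0<..<t} \<times> \<omega>")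
    case False
    then have "u z = 0 \<or> w z = 0" using z0[of z] w(2)[of z] by auto
    then show ?thesis using False by (auto simp: herm_def cvec_def)
   qed (simp add: herm_def cvec_def)
  qed
  with e show ?thesis
   unfolding pairing_def herm_def[symmetric] by (simp add: add_divide_distrib)
 qed
 have "transposition_solution A B K \<omega> T u y0 y"
  unfolding transposition_solution_def
 proof (intro conjI ballI allI impI start)
  fix t assume t: "t \<in> {0..T}"
  show "y t \<in> Yplus A B K" using Yplus_iff_plus_sq[OF y] yh by simp
  fix g qh assume gY: "g \<in> Yminus_hat A B K" and ad: "adjoint_solution_hat A t g qh"
  have g: "minus_sq g" by (rule Yminus_minus_sq[OF gY])
  obtain w where w: "partial_FT w (observe t g)" "\<And>z. z \<notin> {0<..<t} \<times> UNIV \<Longrightarrow> w z = 0" "adjoint_observation B t qh w"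
   using adjoint_observation_exists[OF g ad] by blast
  show "\<exists>w. adjoint_observation B t qh w \<and> pairing (y t) g = pairing y0 (qh 0) +
    (LINT z:{0<..<t} \<times> \<omega>|lborel. (\<Sum>i\<in>UNIV. of_real (u z $ i) * cnj (w z $ i)))"
   using w(3) pair[OF _ _ g ad w(1,2)] t by (intro exI[of _ w] conjI) auto
 qed
 then show ?thesis using final unfolding steers_def by blast
qed

lemma steering_cost:
 fixes y0 yd :: "real \<Rightarrow> real^'n"
 assumes om: "\<omega> \<in> sets borel" and c0: "c0 > 0"
  and obs: "\<And>h w. sqint h \<Longrightarrow> partial_FT w (observe T (\<lambda>\<xi>. Dm (1 / mu \<xi>) (h \<xi>))) \<Longrightarrow>
    c0 * (l2norm h)\<^sup>2 \<le> (l2norm (\<lambda>z. indicator ({0<..<T} \<times> \<omega>) z *\<^sub>R w z))\<^sup>2"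
  and y0: "(\<lambda>x. cvec (y0 x)) \<in> Yplus A B K" and yd: "(\<lambda>x. cvec (yd x)) \<in> Yplus A B K"
 shows "\<exists>u \<in> L2_on ({0<..<T} \<times> \<omega>). steers A B K \<omega> T u (\<lambda>x. cvec (y0 x)) (\<lambda>x. cvec (yd x)) \<and>
   L2_normsq ({0<..<T} \<times> \<omega>) u
    \<le> ennreal (1 / (4 * pi\<^sup>2 * c0)) * Yplus_normsq A B K (\<lambda>x. cvec (yd x) - free_evolution A T (\<lambda>x. cvec (y0 x)) x)"
proof -
 let ?y0 = "fourier_L2 (\<lambda>x. cvec (y0 x))" and ?yd = "fourier_L2 (\<lambda>x. cvec (yd x))"
 have s0: "sqint (\<lambda>x. cvec (y0 x))" and sd: "sqint (\<lambda>x. cvec (yd x))" using y0 yd by (auto simp: Yplus_def sqint_iff_L2_on)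
 note f0 = FT_fourier_L2[OF s0] and fd = FT_fourier_L2[OF sd]
 have p0: "plus_sq ?y0" and pd: "plus_sq ?yd" using y0 yd Yplus_iff_plus_sq[OF f0] Yplus_iff_plus_sq[OF fd] by auto
 define d where "d \<xi> = ?yd \<xi> - Es (T * \<xi>) (?y0 \<xi>)" for \<xi>
 have d: "plus_sq d" unfolding d_def[abs_def] by (intro plus_sq_diff pd plus_sq_Es p0)
 obtain u v where u: "partial_FT u v" "\<And>z. z \<notin> {0<..<T} \<times> \<omega> \<Longrightarrow> u z = 0" "AE \<xi> in lborel. input_map T v \<xi> = d \<xi>"
   "(l2norm u)\<^sup>2 \<le> (l2norm (\<lambda>\<xi>. Dm (1 / mu \<xi>) (d \<xi>)))\<^sup>2 / (4 * pi\<^sup>2 * c0)"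
  using control_exists[OF om c0 obs d] by blast
 have vd: "vcnj (a - b) = vcnj a - vcnj b" for a b :: "complex^'n" by (simp add: vec_eq_iff)
 have "AE \<xi> in lborel. d (- \<xi>) = vcnj (d \<xi>)"
  using fourier_real_symmetric[OF s0] fourier_real_symmetric[OF sd]
  by eventually_elim (simp add: d_def Es_vcnj vd)
 then obtain u' :: "real \<times> real \<Rightarrow> real^'m" and v' where u': "partial_FT (\<lambda>z. cvec (u' z)) v'" "\<And>z. z \<notin> {0<..<T} \<times> \<omega> \<Longrightarrow> u' z = 0"
   "AE \<xi> in lborel. input_map T v' \<xi> = d \<xi>" "sqint u'" "l2norm u' \<le> l2norm u"
  using real_control[OF u(1,2,3)] by blast
 have st: "steers A B K \<omega> T u' (\<lambda>x. cvec (y0 x)) (\<lambda>x. cvec (yd x))"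
  by (rule steers_of_input_map[OF y0 yd u'(1,2)]) (use u'(3) in \<open>simp_all add: d_def\<close>)
 have S: "{0<..<T} \<times> \<omega> \<in> sets borel" using om by (simp add: borel_Times)
 have "is_fourier_L2 (\<lambda>x. cvec (yd x) - free_evolution A T (\<lambda>x. cvec (y0 x)) x) d"
  unfolding d_def[abs_def] by (rule FT_diff[OF fd free_evolution_FT[OF p0]])
 then have cost: "Yplus_normsq A B K (\<lambda>x. cvec (yd x) - free_evolution A T (\<lambda>x. cvec (y0 x)) x)
   = ennreal ((l2norm (\<lambda>\<xi>. Dm (1 / mu \<xi>) (d \<xi>)))\<^sup>2)"
  using L2_normsq_eq_l2norm[of "\<lambda>\<xi>. Dm (1 / mu \<xi>) (d \<xi>)"] d by (simp add: Yplus_normsq_FT L2_normsq_UNIV plus_sq_def)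
 have "(l2norm u')\<^sup>2 \<le> (l2norm u)\<^sup>2" by (intro power_mono u'(5)) simp
 then have "(l2norm u')\<^sup>2 \<le> 1 / (4 * pi\<^sup>2 * c0) * (l2norm (\<lambda>\<xi>. Dm (1 / mu \<xi>) (d \<xi>)))\<^sup>2"
  using order_trans[OF _ u(4)] by simp
 then have "ennreal ((l2norm u')\<^sup>2) \<le> ennreal (1 / (4 * pi\<^sup>2 * c0) * (l2norm (\<lambda>\<xi>. Dm (1 / mu \<xi>) (d \<xi>)))\<^sup>2)" by (rule ennreal_leI)
 also have "\<dots> = ennreal (1 / (4 * pi\<^sup>2 * c0)) * ennreal ((l2norm (\<lambda>\<xi>. Dm (1 / mu \<xi>) (d \<xi>)))\<^sup>2)"
  using c0 by (intro ennreal_mult) auto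
 finally have "L2_normsq ({0<..<T} \<times> \<omega>) u' \<le> ennreal (1 / (4 * pi\<^sup>2 * c0)) * Yplus_normsq A B K (\<lambda>x. cvec (yd x) - free_evolution A T (\<lambda>x. cvec (y0 x)) x)"
  unfolding cost by (rule order_trans[OF sqint_L2_on(2)[OF u'(4) S]])
 then show ?thesis using st sqint_L2_on(1)[OF u'(4) S] by blast
qed

end

theorem corollary2p5:
  fixes A :: "real^'n^'n" and B :: "real^'m^'n" and K :: nat
  assumes "CARD('m) \<le> CARD('n)"
    and "diagonalizable_over_real A"
    and "kalman_index A B K"
  shows
    "(\<exists>C>0. \<forall>T>0. \<forall>y0 yd :: real \<Rightarrow> real^'n.
        (\<lambda>x. cvec (y0 x)) \<in> Yplus A B K \<longrightarrow> (\<lambda>x. cvec (yd x)) \<in> Yplus A B K \<longrightarrow>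
        (\<exists>u \<in> L2_on ({0<..<T} \<times> UNIV).
           steers A B K UNIV T u (\<lambda>x. cvec (y0 x)) (\<lambda>x. cvec (yd x)) \<and>
           L2_normsq ({0<..<T} \<times> UNIV) u
             \<le> ennreal (C * max (1 / T) (1 / T ^ (2 * K + 1))) *
                Yplus_normsq A B K (\<lambda>x. cvec (yd x) - free_evolution A T (\<lambda>x. cvec (y0 x)) x)))
     \<and>
     (\<forall>a b \<omega> T1.
        0 \<notin> mat_spectrum A \<longrightarrow> bounded_gap a b \<omega> \<longrightarrow> T1 > geometric_time A a b \<longrightarrow>
        (\<exists>C>0. \<forall>T\<in>{geometric_time A a b<..T1}. \<forall>y0 yd :: real \<Rightarrow> real^'n.
           (\<lambda>x. cvec (y0 x)) \<in> Yplus A B K \<longrightarrow> (\<lambda>x. cvec (yd x)) \<in> Yplus A B K \<longrightarrow>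
           (\<exists>u \<in> L2_on ({0<..<T} \<times> \<omega>).
              steers A B K \<omega> T u (\<lambda>x. cvec (y0 x)) (\<lambda>x. cvec (yd x)) \<and>
              L2_normsq ({0<..<T} \<times> \<omega>) u
                \<le> ennreal (C / (T - geometric_time A a b) ^ (2 * card (mat_spectrum A) - 1)) *
                   Yplus_normsq A B K (\<lambda>x. cvec (yd x) - free_evolution A T (\<lambda>x. cvec (y0 x)) x))))"
proof -
 obtain \<Lambda> :: "real set" and Q :: "real \<Rightarrow> real^'n^'n" where
  L: "finite \<Lambda>" "\<Lambda> \<noteq> {}" "\<And>r. mat_pow A r = (\<Sum>l\<in>\<Lambda>. l ^ r *\<^sub>R Q l)"
   "\<And>l m. l \<in> \<Lambda> \<Longrightarrow> m \<in> \<Lambda> \<Longrightarrow> Q l ** Q m = (if l = m then Q l else 0)" "\<And>l. l \<in> \<Lambda> \<Longrightarrow> Q l \<noteq> 0"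
  using diagonalizable_spectral_projectors[OF assms(2)] by blast
 obtain P :: "nat \<Rightarrow> real^'n^'n" and X :: "nat \<Rightarrow> nat \<Rightarrow> real^'m^'n" where
  P: "\<And>k z. layer_proj A B k z = cmat (P k) *v z" "\<And>k. transpose (P k) = P k"
   "\<And>j k. P j ** P k = (if j = k then P k else 0)" "(\<Sum>k\<le>K. P k) = mat 1"
   "\<And>r j. r < j \<Longrightarrow> transpose B ** mat_pow (transpose A) r ** P j = 0"
   "\<And>k. P k = (\<Sum>i\<le>k. X k i ** (transpose B ** mat_pow (transpose A) i))"
  using kalman_layer_projectors[OF assms(3)] by blast
 interpret kalman A B K \<Lambda> Q P X by unfold_locales (fact L P)+
 have spec: "mat_spectrum A = complex_of_real ` \<Lambda>" by (rule spectrum_from_projectors[OF L(1,3,4,5)])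
 show ?thesis
 proof (intro conjI allI impI)
  obtain c where c: "c > 0" "\<And>T h w. T > 0 \<Longrightarrow> sqint h \<Longrightarrow> partial_FT w (observe T (\<lambda>\<xi>. Dm (1 / mu \<xi>) (h \<xi>))) \<Longrightarrow>
    c * min T (T ^ (2 * K + 1)) / (2 * pi) * (l2norm h)\<^sup>2 \<le> (l2norm (\<lambda>z. indicator ({0<..<T} \<times> UNIV) z *\<^sub>R w z))\<^sup>2"
   using global_observability by blast
  have eq: "1 / (4 * pi\<^sup>2 * (c * min T (T ^ (2 * K + 1)) / (2 * pi))) = 1 / (2 * pi * c) * max (1 / T) (1 / T ^ (2 * K + 1))"
   if "T > 0" for T :: real
  proof -
   have "max (1 / T) (1 / T ^ (2 * K + 1)) = 1 / min T (T ^ (2 * K + 1))"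
    by (rule max_reciprocal) (use that in simp_all)
   moreover have "1 / (4 * pi\<^sup>2 * (c * m / (2 * pi))) = 1 / (2 * pi * c) * (1 / m)" for m
    by (simp add: power2_eq_square)
   ultimately show ?thesis by (simp only:)
  qed
  have res: "\<exists>u \<in> L2_on ({0<..<T} \<times> UNIV). steers A B K UNIV T u (\<lambda>x. cvec (y0 x)) (\<lambda>x. cvec (yd x)) \<and>
     L2_normsq ({0<..<T} \<times> UNIV) u \<le> ennreal (1 / (2 * pi * c) * max (1 / T) (1 / T ^ (2 * K + 1))) *
       Yplus_normsq A B K (\<lambda>x. cvec (yd x) - free_evolution A T (\<lambda>x. cvec (y0 x)) x)"
   if T: "T > 0" and y: "(\<lambda>x. cvec (y0 x)) \<in> Yplus A B K" "(\<lambda>x. cvec (yd x)) \<in> Yplus A B K" for T and y0 yd :: "real \<Rightarrow> real^'n"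
   unfolding eq[OF T, symmetric]
  proof (rule steering_cost[OF _ _ _ y])
   show "c * min T (T ^ (2 * K + 1)) / (2 * pi) * (l2norm h)\<^sup>2 \<le> (l2norm (\<lambda>z. indicator ({0<..<T} \<times> UNIV) z *\<^sub>R w z))\<^sup>2"
    if "sqint h" "partial_FT w (observe T (\<lambda>\<xi>. Dm (1 / mu \<xi>) (h \<xi>)))" for h w
    by (rule c(2)[OF T that])
  qed (use T c(1) in simp_all)
  show "\<exists>C>0. \<forall>T>0. \<forall>y0 yd :: real \<Rightarrow> real^'n.
    (\<lambda>x. cvec (y0 x)) \<in> Yplus A B K \<longrightarrow> (\<lambda>x. cvec (yd x)) \<in> Yplus A B K \<longrightarrow>
    (\<exists>u \<in> L2_on ({0<..<T} \<times> UNIV).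
      steers A B K UNIV T u (\<lambda>x. cvec (y0 x)) (\<lambda>x. cvec (yd x)) \<and>
      L2_normsq ({0<..<T} \<times> UNIV) u
       \<le> ennreal (C * max (1 / T) (1 / T ^ (2 * K + 1))) *
        Yplus_normsq A B K (\<lambda>x. cvec (yd x) - free_evolution A T (\<lambda>x. cvec (y0 x)) x))"
  proof (intro exI[of _ "1 / (2 * pi * c)"] conjI allI impI)
   show "0 < 1 / (2 * pi * c)" using c(1) by simp
  qed (rule res)
 next
  fix a b :: "int \<Rightarrow> real" and \<omega> :: "real set" and T1 :: real
  assume l0: "0 \<notin> mat_spectrum A" and bg: "bounded_gap a b \<omega>" and T1: "T1 > geometric_time A a b"
  interpret gaps a b \<omega> by unfold_locales (rule bg)
  have om: "\<omega> \<in> sets borel" unfolding omega_shrunk by (rule shrunk_borel)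
  have card: "card (mat_spectrum A) = card \<Lambda>" unfolding spec by (intro card_image) (simp add: inj_on_def)
  have Tg: "geometric_time A a b = gap a b / Min (abs ` \<Lambda>)"
   by (simp add: geometric_time_def spec image_image)
  have l0': "0 \<notin> \<Lambda>" using l0 by (force simp: spec)
  let ?Tg = "geometric_time A a b" and ?e = "2 * card (mat_spectrum A) - 1"
  obtain c where c: "c > 0" "\<And>T h w. ?Tg < T \<Longrightarrow> T \<le> T1 \<Longrightarrow> sqint h \<Longrightarrow> partial_FT w (observe T (\<lambda>\<xi>. Dm (1 / mu \<xi>) (h \<xi>))) \<Longrightarrow>
    c * (T - ?Tg) ^ ?e * (l2norm h)\<^sup>2 \<le> (l2norm (\<lambda>z. indicator ({0<..<T} \<times> \<omega>) z *\<^sub>R w z))\<^sup>2"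
   using local_observability[OF bg l0' Tg T1] unfolding card by blast
  have res: "\<exists>u \<in> L2_on ({0<..<T} \<times> \<omega>). steers A B K \<omega> T u (\<lambda>x. cvec (y0 x)) (\<lambda>x. cvec (yd x)) \<and>
     L2_normsq ({0<..<T} \<times> \<omega>) u \<le> ennreal (1 / (4 * pi\<^sup>2 * c) / (T - ?Tg) ^ ?e) *
       Yplus_normsq A B K (\<lambda>x. cvec (yd x) - free_evolution A T (\<lambda>x. cvec (y0 x)) x)"
   if T: "?Tg < T" "T \<le> T1" and y: "(\<lambda>x. cvec (y0 x)) \<in> Yplus A B K" "(\<lambda>x. cvec (yd x)) \<in> Yplus A B K" for T and y0 yd :: "real \<Rightarrow> real^'n"
  proof -
   have eq: "1 / (4 * pi\<^sup>2 * c) / (T - ?Tg) ^ ?e = 1 / (4 * pi\<^sup>2 * (c * (T - ?Tg) ^ ?e))" by (simp only: divide_divide_eq_left mult.assoc)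
   show ?thesis unfolding eq
   proof (rule steering_cost[OF om _ _ y])
    show "0 < c * (T - ?Tg) ^ ?e" using T(1) c(1) by simp
    show "c * (T - ?Tg) ^ ?e * (l2norm h)\<^sup>2 \<le> (l2norm (\<lambda>z. indicator ({0<..<T} \<times> \<omega>) z *\<^sub>R w z))\<^sup>2"
     if "sqint h" "partial_FT w (observe T (\<lambda>\<xi>. Dm (1 / mu \<xi>) (h \<xi>)))" for h w
     by (rule c(2)[OF T that])
   qed
  qed
  show "\<exists>C>0. \<forall>T\<in>{?Tg<..T1}. \<forall>y0 yd :: real \<Rightarrow> real^'n.
      (\<lambda>x. cvec (y0 x)) \<in> Yplus A B K \<longrightarrow> (\<lambda>x. cvec (yd x)) \<in> Yplus A B K \<longrightarrow>
      (\<exists>u \<in> L2_on ({0<..<T} \<times> \<omega>).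
       steers A B K \<omega> T u (\<lambda>x. cvec (y0 x)) (\<lambda>x. cvec (yd x)) \<and>
       L2_normsq ({0<..<T} \<times> \<omega>) u
        \<le> ennreal (C / (T - ?Tg) ^ ?e) *
          Yplus_normsq A B K (\<lambda>x. cvec (yd x) - free_evolution A T (\<lambda>x. cvec (y0 x)) x))"
  proof (intro exI[of _ "1 / (4 * pi\<^sup>2 * c)"] conjI ballI allI impI)
   show "0 < 1 / (4 * pi\<^sup>2 * c)" using c(1) by simp
  qed (rule res, auto)
 qed
qed

end
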